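(* Let $n\ge 2$, let $K$ be a number field, let $\alpha_1,\ldots,\alpha_n\in K$, and define \[ \Omega=\left\{(b_1,\ldots,b_n)\in\mathbb{Z}^n : b_1\alpha_1+\cdots+b_n\alpha_n=0\right\}^{\perp}, \] a subgroup of $\mathbb{Z}^n$ of rank $m$. Let $\epsilon>0$. Suppose $m\ge 2$, that $0=\alpha_0,\alpha_1,\ldots,\alpha_n$ are pairwise distinct, and that $(\alpha_i-\alpha_j)/(\alpha_k-\alpha_l)\notin\mathbb{Q}$ for all pairwise distinct $i,j,k,l\in\{0,\ldots,n\}$. Let $p$ be a prime, $v_0$ a place of $K$ extending the $p$-adic absolute value, and $e(v_0)$ the ramification index of $K/\mathbb{Q}$ at $v_0$. Suppose $(a_1,\ldots,a_n)\in\mathbb{Z}^n$ satisfies $|a_i-\alpha_i|_{v_0}<1$ for all $i\in\{1,\ldots,n\}$. Then, with $\zeta=e^{2\pi\sqrt{-1}/p}$, \[ \frac{1}{p-1}\sum_{t=1}^{p-1}\log\left|1+\zeta^{ta_1}+\cdots+\zeta^{ta_n}\right| = m(\Omega) + O\!\left(p^{-\frac{1}{4n[K:\mathbb{Q}]e(v_0)}+\epsilon}\right) \] as $p\to\infty$, where the implied constant depends only on $\alpha_1,\ldots,\alpha_n$ and $\epsilon$; in particular, the logarithm is well-defined for all large $p$.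
   Context: For a subgroup $\Lambda\subset\mathbb{Z}^n$, $\Lambda^\perp=\{a\in\mathbb{Z}^n:\langle a,\lambda\rangle=0 \text{ for all }\lambda\in\Lambda\}$ with $\langle\cdot,\cdot\rangle$ the standard scalar product. A place of $K$ extending the $p$-adic absolute value is an absolute value $|\cdot|_{v_0}$ on $K$ whose restriction to $\mathbb{Q}$ is the $p$-adic absolute value with $|p|_{v_0}=p^{-1}$. For a non-zero Laurent polynomial $P\in\mathbb{C}[X_1^{\pm1},\ldots,X_m^{\pm1}]$, $m(P)=\int_{[0,1]^m}\log|P(e^{2\pi\sqrt{-1}x_1},\ldots,e^{2\pi\sqrt{-1}x_m})|\,dx$ is its logarithmic Mahler measure. For a subgroup $\Omega\subset\mathbb{Z}^n$ of rank $m\ge1$, choose a matrix $A=(a_{ij})\in\mathbb{Z}^{m\times n}$ whose rows form a basis of $\Omega$, let $P_A=1+\sum_{j=1}^n X_1^{a_{1j}}\cdots X_m^{a_{mj}}$, and set $m(\Omega)=m(P_A)$ (this is independent of the choice of basis). *)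

theory Defs
  imports "HOL-Analysis.Analysis" "HOL-Computational_Algebra.Primes"
begin

text \<open>
  Vectors in \<open>\<int>\<^sup>n\<close> are functions on \<open>nat\<close> that vanish outside \<open>{1..n}\<close>, so that equality of
  vectors is equality of functions. A matrix with \<open>m\<close> rows is a family \<open>A 1, \<dots>, A m\<close> of such vectors.
\<close>

definition int_vecs :: "nat \<Rightarrow> (nat \<Rightarrow> int) set" where
  "int_vecs n = {b. \<forall>j. j \<notin> {1..n} \<longrightarrow> b j = 0}"

definition scalar_prod :: "nat \<Rightarrow> (nat \<Rightarrow> int) \<Rightarrow> (nat \<Rightarrow> int) \<Rightarrow> int" where
  "scalar_prod n a b = (\<Sum>j=1..n. a j * b j)"

definition perp :: "nat \<Rightarrow> (nat \<Rightarrow> int) set \<Rightarrow> (nat \<Rightarrow> int) set" where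
  "perp n L = {a \<in> int_vecs n. \<forall>l\<in>L. scalar_prod n a l = 0}"

definition int_comb :: "nat \<Rightarrow> (nat \<Rightarrow> nat \<Rightarrow> int) \<Rightarrow> (nat \<Rightarrow> int) \<Rightarrow> nat \<Rightarrow> int" where
  "int_comb m A c = (\<lambda>j. \<Sum>i=1..m. c i * A i j)"

definition lattice_basis :: "nat \<Rightarrow> (nat \<Rightarrow> nat \<Rightarrow> int) \<Rightarrow> (nat \<Rightarrow> int) set \<Rightarrow> bool" where
  "lattice_basis m A L \<longleftrightarrow>
     (\<forall>i\<in>{1..m}. A i \<in> L) \<and>
     L \<subseteq> int_comb m A ` int_vecs m \<and>
     (\<forall>c\<in>int_vecs m. int_comb m A c = (\<lambda>_. 0) \<longrightarrow> c = (\<lambda>_. 0))"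

text \<open>
  Every subgroup of \<open>\<int>\<^sup>n\<close> has a basis and all its bases have the same length, so
  \<open>LEAST\<close> only serves to name that length.
\<close>

definition lattice_rank :: "(nat \<Rightarrow> int) set \<Rightarrow> nat" where
  "lattice_rank L = (LEAST m. \<exists>A. lattice_basis m A L)"

text \<open>
  A Laurent polynomial in \<open>X\<^sub>1, \<dots>, X\<^sub>m\<close> is represented by the function it induces on
  points \<open>z\<close> with nonzero coordinates \<open>z 1, \<dots>, z m\<close>. The convention \<open>ln 0 = 0\<close> only
  concerns the zero set of the polynomial in the torus, a null set if the polynomial is nonzero.
\<close>

definition log_mahler :: "nat \<Rightarrow> ((nat \<Rightarrow> complex) \<Rightarrow> complex) \<Rightarrow> real" where
  "log_mahler m P =
     (LINT x : ({1..m} \<rightarrow>\<^sub>E {0..1}) | (\<Pi>\<^sub>M i\<in>{1..m}. lborel).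
        ln (cmod (P (\<lambda>i. exp (2 * of_real pi * \<i> * of_real (x i))))))"

definition matrix_laurent_poly ::
    "nat \<Rightarrow> nat \<Rightarrow> (nat \<Rightarrow> nat \<Rightarrow> int) \<Rightarrow> (nat \<Rightarrow> complex) \<Rightarrow> complex" where
  "matrix_laurent_poly m n A z = 1 + (\<Sum>j=1..n. \<Prod>i=1..m. z i powi A i j)"

text \<open>The value does not depend on the basis that is chosen.\<close>

definition lattice_mahler :: "nat \<Rightarrow> (nat \<Rightarrow> int) set \<Rightarrow> real" where
  "lattice_mahler n L =
     (let m = lattice_rank L; A = (SOME A. lattice_basis m A L)
      in log_mahler m (matrix_laurent_poly m n A))"

definition relation_lattice :: "nat \<Rightarrow> (nat \<Rightarrow> 'k::field_char_0) \<Rightarrow> (nat \<Rightarrow> int) set" where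
  "relation_lattice n \<alpha> = {b \<in> int_vecs n. (\<Sum>j=1..n. of_int (b j) * \<alpha> j) = 0}"

definition Omega :: "nat \<Rightarrow> (nat \<Rightarrow> 'k::field_char_0) \<Rightarrow> (nat \<Rightarrow> int) set" where
  "Omega n \<alpha> = perp n (relation_lattice n \<alpha>)"

text \<open>
  Number fields are subfields, of finite degree over the rationals, of an arbitrary ambient field
  of characteristic zero. The whole type is allowed, so this covers abstract number fields, and it
  permits quantifying over all number fields that contain given elements.
\<close>

definition rat_scale :: "rat \<Rightarrow> 'k::field_char_0 \<Rightarrow> 'k" where
  "rat_scale q x = of_rat q * x"

interpretation rat_vs: vector_space "rat_scale :: rat \<Rightarrow> 'k::field_char_0 \<Rightarrow> 'k"
  by unfold_locales (simp_all add: rat_scale_def algebra_simps of_rat_add of_rat_mult)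

definition number_field :: "'k::field_char_0 set \<Rightarrow> bool" where
  "number_field K \<longleftrightarrow>
     1 \<in> K \<and> (\<forall>x\<in>K. \<forall>y\<in>K. x - y \<in> K \<and> x * y \<in> K) \<and> (\<forall>x\<in>K. inverse x \<in> K) \<and>
     (\<exists>B. finite B \<and> rat_vs.span B = K)"

definition field_degree :: "'k::field_char_0 set \<Rightarrow> nat" where
  "field_degree K = rat_vs.dim K"

definition absolute_value_on :: "'k::field_char_0 set \<Rightarrow> ('k \<Rightarrow> real) \<Rightarrow> bool" where
  "absolute_value_on K v \<longleftrightarrow>
     (\<forall>x\<in>K. v x \<ge> 0 \<and> (v x = 0 \<longleftrightarrow> x = 0)) \<and>
     (\<forall>x\<in>K. \<forall>y\<in>K. v (x * y) = v x * v y \<and> v (x + y) \<le> v x + v y)"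

definition padic_abs :: "nat \<Rightarrow> rat \<Rightarrow> real" where
  "padic_abs p q =
     (if q = 0 then 0
      else case quotient_of q of (a, b) \<Rightarrow>
        real p powi (int (multiplicity (int p) b) - int (multiplicity (int p) a)))"

definition place_above :: "nat \<Rightarrow> 'k::field_char_0 set \<Rightarrow> ('k \<Rightarrow> real) \<Rightarrow> bool" where
  "place_above p K v \<longleftrightarrow>
     absolute_value_on K v \<and> (\<forall>q. v (of_rat q) = padic_abs p q)"

text \<open>
  The index of the value group \<open>v(\<rat>\<^sup>\<times>)\<close> in \<open>v(K\<^sup>\<times>)\<close>, computed as the number of cosets;
  it is finite for a place of a number field above a prime.
\<close>

definition ramification_index :: "'k::field_char_0 set \<Rightarrow> ('k \<Rightarrow> real) \<Rightarrow> nat" where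
  "ramification_index K v =
     card ((\<lambda>x. (\<lambda>y. v x * v y) ` (\<rat> - {0})) ` (K - {0}))"

definition root_sum :: "nat \<Rightarrow> nat \<Rightarrow> (nat \<Rightarrow> int) \<Rightarrow> nat \<Rightarrow> complex" where
  "root_sum n p a t =
     1 + (\<Sum>j=1..n. exp (2 * of_real pi * \<i> / of_nat p) powi (int t * a j))"

end

theory Submission
  imports
    Defs
    "HOL-Complex_Analysis.Complex_Analysis"
    "HOL-Probability.Probability"
    "HOL-Computational_Algebra.Computational_Algebra"
    "HOL-Computational_Algebra.Field_as_Ring"
    "Subresultants.Subresultant_Gcd"
    "HOL-Number_Theory.Cong"
    "HOL-Analysis.Kronecker_Approximation_Theorem"
begin

text \<open>
  Dirichlet's theorem replaces \<open>a\<close> by a multiple \<open>b\<close> modulo \<open>p\<close> with entries much smaller than \<open>p\<close>; this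
  permutes the summands. Up to a monomial the sum at \<open>t\<close> is then the value at a \<open>p\<close>-th root of unity of a sparse
  monic integer polynomial \<open>Q\<close> with exponents \<open>b\<^sub>j\<close>, of degree much smaller than \<open>p\<close>. The norm of a number in a
  fixed module shows that a linear form of size up to a small multiple of \<open>p powr (1 / D)\<close>, where \<open>D\<close> is the
  degree of the field generated by the \<open>\<alpha>\<^sub>j\<close>, vanishes at \<open>b\<close> if and only if it vanishes on \<open>\<Omega>\<close>.

  \<^item> The Mahler measure of \<open>Q\<close> is close to that of \<open>\<Omega>\<close>: the moments of \<open>\<bar>Q\<bar>\<^sup>2\<close> on the circle and of
    \<open>\<bar>P\<^sub>A\<bar>\<^sup>2\<close> on the torus agree up to a high order, and in the logarithmic series the later moments are negligible
    because a monic polynomial with \<open>k + 1\<close> terms has bounded moment of order \<open>- 1 / (2 k)\<close> on the circle.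

  \<^item> By Jensen's formula, the average over the \<open>p\<close>-th roots of unity differs from the Mahler measure of \<open>Q\<close> by a
    sum of \<open>ln \<bar>1 - z ^ p\<bar> - p ln\<^sup>+ \<bar>z\<bar>\<close> over the roots \<open>z\<close> of \<open>Q\<close>, which is split along the irreducible
    factors \<open>f\<close> of \<open>Q\<close>. If \<open>f\<close> does not divide the reciprocal polynomial of \<open>Q\<close>, the nonzero integer
    resultant of both keeps the roots of \<open>f\<close> away from the unit circle. All other factors together have small
    height: each vanishes, or has its inverse roots, at the common zeros of two sub-sums of \<open>Q\<close>, and by the
    hypothesis on the ratios \<open>(\<alpha>\<^sub>i - \<alpha>\<^sub>j) / (\<alpha>\<^sub>k - \<alpha>\<^sub>l)\<close> a resultant shows that there are few such zeros.
\<close>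

section \<open>Mean values of logarithmic derivatives\<close>

text \<open>The obstacle: a root z of Q may lie extremely close to a p-th root of unity, so a single
  term ln |1 - z^p| has no usable lower bound. Only integrality of a norm over all roots of a factor
  f gives one. The norm of z^p - 1 costs p times the height of f; the norm of the reciprocal
  polynomial costs O(d ln d) in total, d the degree of Q. The first price is affordable only if the
  factors concerned have total height tending to 0, and this is what the common zeros of sub-sums
  provide. The exponent: a moment of order -1/(2n) of |Q| is one of order -1/(4n) of |Q|^2, so
  cutting the logarithmic series at N costs N^(-1/(4n)), and N may be about p^(1/D). The other
  errors are no larger: the degree of Q contributes p^(-1/(n+1)) ln p and the factors of small
  height p^(-1/(D(n+1))). Uniformity in K: the module lies in the intersection of all number fields
  containing the \<alpha> j, so D and the constants come from \<alpha> alone, and D <=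
  [K:Q].\<close>

abbreviation circle_pt :: "real \<Rightarrow> complex" where
  "circle_pt x \<equiv> cis (2 * pi * x)"

abbreviation unit_interval :: "real measure" where
  "unit_interval \<equiv> restrict_space lborel {0..1}"

lemma prob_space_unit_interval: "prob_space unit_interval"
  by (intro prob_spaceI) (simp add: emeasure_restrict_space)

lemma space_unit_interval [simp]: "space unit_interval = {0..1}"
  by (simp add: space_restrict_space)

lemma measurable_unit_interval:
  "f \<in> borel_measurable borel \<Longrightarrow> f \<in> borel_measurable unit_interval"
  by (simp add: measurable_restrict_space1)

lemma inj_on_circle_pt: "inj_on circle_pt {0..<1}"
proof (rule inj_onI)
  fix x y :: real
  assume xy: "x \<in> {0..<1}" "y \<in> {0..<1}" and eq: "circle_pt x = circle_pt y"
  from eq have "exp (\<i> * of_real (2 * pi * x)) = exp (\<i> * of_real (2 * pi * y))"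
    by (simp add: cis_conv_exp)
  then obtain n :: int where "\<i> * of_real (2 * pi * x) = \<i> * of_real (2 * pi * y) + of_real (2 * of_int n * pi) * \<i>"
    unfolding exp_eq by auto
  then have "\<i> * of_real (2 * pi * x) = \<i> * of_real (2 * pi * y + 2 * of_int n * pi)"
    by (simp add: algebra_simps)
  then have "(of_real (2 * pi * x) :: complex) = of_real (2 * pi * y + 2 * of_int n * pi)"
    by (metis complex_i_not_zero mult_left_cancel)
  then have "2 * pi * x = 2 * pi * y + 2 * of_int n * pi"
    by (simp only: of_real_eq_iff)
  then have "2 * pi * x = 2 * pi * (y + of_int n)" by (simp add: algebra_simps)
  then have "x = y + of_int n" by simp
  with xy show "x = y" by auto
qed

lemma AE_circle_pt_notin:
  assumes "finite S"
  shows "AE x in unit_interval. circle_pt x \<notin> S"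
proof -
  have "finite (circle_pt -` S \<inter> {0..<1})"
    using assms inj_on_circle_pt by (rule finite_vimage_IntI)
  \<comment> \<open>\<open>circle_pt\<close> is injective only on [0,1); the endpoint 1, where it
    repeats its value at 0, is discarded separately.\<close>
  then have "insert 1 (circle_pt -` S \<inter> {0..<1}) \<in> null_sets lborel"
    by (intro finite_imp_null_set_lborel) auto
  then have "AE x in lborel. x \<notin> insert 1 (circle_pt -` S \<inter> {0..<1})"
    by (rule AE_not_in)
  then have "AE x in lborel. x \<in> {0..1} \<longrightarrow> circle_pt x \<notin> S"
    by eventually_elim force
  then show ?thesis
    by (subst AE_restrict_space_iff) auto
qed

lemma integrable_unit_interval_continuous:
  fixes f :: "real \<Rightarrow> 'a::euclidean_space"
  assumes "continuous_on {0..1} f"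
  shows "integrable unit_interval f"
    and "integral\<^sup>L unit_interval f = integral {0..1} f"
proof -
  have *: "set_integrable lborel {0..1} f"
    using assms by (intro borel_integrable_compact[unfolded set_integrable_def[symmetric]]) 
      (auto simp: set_integrable_def intro!: borel_integrable_compact)
  show "integrable unit_interval f"
    using * by (subst integrable_restrict_space) (auto simp: set_integrable_def)
  have "integral\<^sup>L unit_interval f = (LINT x:{0..1}|lborel. f x)"
    by (subst integral_restrict_space) (auto simp: set_lebesgue_integral_def)
  also have "\<dots> = integral {0..1} f"
    by (rule set_borel_integral_eq_integral(2)[OF *])
  finally show "integral\<^sup>L unit_interval f = integral {0..1} f" .
qed

lemma holomorphic_mean_value:
  assumes f: "f holomorphic_on ball 0 R" and r: "0 < r" "r < R"
  shows "integrable unit_interval (\<lambda>x. f (of_real r * circle_pt x))"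
    and "(LINT x|unit_interval. f (of_real r * circle_pt x)) = f 0"
proof -
  have fh: "f holomorphic_on cball 0 r"
    using f by (rule holomorphic_on_subset) (use r in auto)
  have cont: "continuous_on {0..1} (\<lambda>x. f (of_real r * circle_pt x))"
    by (rule continuous_on_compose2[OF holomorphic_on_imp_continuous_on[OF fh]])
       (use r in \<open>auto intro!: continuous_intros simp: norm_mult\<close>)
  show "integrable unit_interval (\<lambda>x. f (of_real r * circle_pt x))"
    by (rule integrable_unit_interval_continuous[OF cont])
  have "((\<lambda>u. f u / (u - 0)) has_contour_integral (2 * of_real pi * \<i> * f 0)) (circlepath 0 r)"
    by (rule Cauchy_integral_circlepath[OF holomorphic_on_imp_continuous_on[OF fh]])
       (use fh r in \<open>auto intro: holomorphic_on_subset\<close>)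
  then have "((\<lambda>x. f (circlepath 0 r x) / circlepath 0 r x * vector_derivative (circlepath 0 r) (at x within {0..1}))
      has_integral 2 * of_real pi * \<i> * f 0) {0..1}"
    by (simp add: has_contour_integral_def)
  then have "((\<lambda>x. 2 * of_real pi * \<i> * f (of_real r * circle_pt x)) has_integral 2 * of_real pi * \<i> * f 0) {0..1}"
  proof (rule has_integral_eq[rotated])
    fix x :: real assume x: "x \<in> {0..1}"
    have e: "exp (2 * of_real pi * \<i> * of_real x) = circle_pt x"
      by (simp add: cis_conv_exp mult_ac)
    show "f (circlepath 0 r x) / circlepath 0 r x * vector_derivative (circlepath 0 r) (at x within {0..1}) = 
       2 * of_real pi * \<i> * f (of_real r * circle_pt x)"
    proof -
      have "circlepath 0 r x = of_real r * circle_pt x" by (simp add: circlepath e)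
      moreover have "vector_derivative (circlepath 0 r) (at x within {0..1}) = 2 * of_real pi * \<i> * (of_real r * circle_pt x)"
        using x r vector_derivative_circlepath01[of x 0 r] by (simp only: e) (simp add: mult_ac)
      ultimately show ?thesis using r by (simp only:) (simp add: divide_simps)
    qed
  qed
  then have "((\<lambda>x. 1 / (2 * of_real pi * \<i>) * (2 * of_real pi * \<i> * f (of_real r * circle_pt x))) has_integral 
      1 / (2 * of_real pi * \<i>) * (2 * of_real pi * \<i> * f 0)) {0..1}"
    by (rule has_integral_mult_right)
  then have "((\<lambda>x. f (of_real r * circle_pt x)) has_integral f 0) {0..1}"
    by simp
  then have "integral {0..1} (\<lambda>x. f (of_real r * circle_pt x)) = f 0"
    by (rule integral_unique)
  with integrable_unit_interval_continuous(2)[OF cont]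
  show "(LINT x|unit_interval. f (of_real r * circle_pt x)) = f 0" by simp
qed

lemma sum_mset_ge_0:
  fixes f :: "'a \<Rightarrow> real"
  assumes "\<And>x. x \<in># M \<Longrightarrow> f x \<ge> 0"
  shows "(\<Sum>x\<in>#M. f x) \<ge> 0"
  using assms by (induction M) auto

text \<open>The square root of a number in the right half-plane has argument at most pi/4 in
  absolute value, so its real part controls its modulus. A half moment is thereby bounded by the
  mean of a harmonic function.\<close>

lemma Re_csqrt_ge:
  assumes "Re u \<ge> 0"
  shows "sqrt (cmod u) \<le> sqrt 2 * Re (csqrt u)"
proof -
  have "Re (csqrt u) = sqrt ((cmod u + Re u) / 2)" by simp
  also have "sqrt 2 * \<dots> = sqrt (cmod u + Re u)"
    by (simp add: real_sqrt_mult[symmetric])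
  finally show ?thesis using assms by simp
qed

lemma Re_cayley_nonneg:
  fixes v :: complex
  assumes "cmod v < 1"
  shows "Re ((1 + v) / (1 - v)) \<ge> 0"
proof -
  have "Re ((1 + v) / (1 - v)) = ((1 + Re v) * (1 - Re v) - Im v * Im v) / ((1 - Re v)\<^sup>2 + (Im v)\<^sup>2)"
    by (simp add: Re_divide power2_eq_square)
  moreover have "(1 + Re v) * (1 - Re v) - Im v * Im v = 1 - (cmod v)\<^sup>2"
    unfolding cmod_power2 by (simp add: power2_eq_square algebra_simps)
  moreover have "(cmod v)\<^sup>2 \<le> 1" using assms by (simp add: power_le_one)
  ultimately show ?thesis by simp
qed

text \<open>A normalised sum of Herglotz kernels, each of nonnegative real part on the unit disc
  when |u| <= 1. The summand 1 keeps the real part at least 1, away from the branch cut of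
  \<open>csqrt\<close>.\<close>

definition cayley_mean :: "nat \<Rightarrow> complex multiset \<Rightarrow> complex \<Rightarrow> complex" where
  "cayley_mean d W w = 1 + (\<Sum>u\<in>#W. (1 + w * u) / (1 - w * u)) / of_nat d"

text \<open>Kolmogorov's argument for functions of positive real part: the square root is
  holomorphic, so its mean over a circle is its value at 0, whose real part is at most sqrt 2. The
  other factor sqrt 2 of the bound comes from \<open>Re_csqrt_ge\<close>.\<close>

lemma cayley_mean_half_moment_inner:
  assumes W: "\<And>u. u \<in># W \<Longrightarrow> cmod u \<le> 1" and d: "size W \<le> d" "d > 0" and r: "0 < r" "r < 1"
  shows "(\<integral>\<^sup>+x. ennreal (sqrt (cmod (cayley_mean d W (of_real r * circle_pt x)))) \<partial>unit_interval) \<le> ennreal 2"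
proof -
  define f where "f = (\<lambda>w. csqrt (cayley_mean d W w))"
  have lt1: "cmod (w * u) < 1" if "u \<in># W" "cmod w < 1" for u w
    using W[OF that(1)] that(2)
    by (metis mult.commute mult_left_le norm_ge_zero norm_mult order_le_less_trans)
  have Re_ge: "Re (cayley_mean d W w) \<ge> 1" if w: "cmod w < 1" for w
  proof -
    have "0 \<le> (\<Sum>u\<in>#W. Re ((1 + w * u) / (1 - w * u)))"
      by (rule sum_mset_ge_0) (use Re_cayley_nonneg lt1 w in auto)
    also have "\<dots> = Re (\<Sum>u\<in>#W. (1 + w * u) / (1 - w * u))"
      by (induction W) auto
    finally show ?thesis using d by (simp add: cayley_mean_def Re_divide_of_nat)
  qed
  have holo: "(\<lambda>w. \<Sum>u\<in>#V. (1 + w * u) / (1 - w * u)) holomorphic_on ball 0 1"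
    if "\<And>u. u \<in># V \<Longrightarrow> u \<in># W" for V
    using that
  proof (induction V)
    case (add u V)
    then have "u \<in># W" by simp
    then have ne: "1 - w * u \<noteq> 0" if "w \<in> ball 0 1" for w
      using lt1[OF \<open>u \<in># W\<close>, of w] that by auto
    have "(\<lambda>w. \<Sum>u\<in>#V. (1 + w * u) / (1 - w * u)) holomorphic_on ball 0 1"
      by (rule add.IH) (use add.prems in simp)
    moreover have "(\<lambda>w. (1 + w * u) / (1 - w * u)) holomorphic_on ball 0 1"
      by (intro holomorphic_intros ne)
    ultimately show ?case by (simp add: holomorphic_on_add)
  qed simp
  have fh: "f holomorphic_on ball 0 1"
    unfolding f_def cayley_mean_def
  proof (rule holomorphic_on_csqrt')
    show "(\<lambda>w. 1 + (\<Sum>u\<in>#W. (1 + w * u) / (1 - w * u)) / of_nat d) holomorphic_on ball 0 1"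
      using d by (intro holomorphic_intros holo) auto
    fix w assume "w \<in> ball (0::complex) 1"
    then have "Re (cayley_mean d W w) \<ge> 1" using Re_ge by simp
    then show "1 + (\<Sum>u\<in>#W. (1 + w * u) / (1 - w * u)) / of_nat d \<notin> \<real>\<^sub>\<le>\<^sub>0"
      unfolding cayley_mean_def[symmetric] by (auto simp: complex_nonpos_Reals_iff)
  qed
  have f0: "Re (f 0) \<le> sqrt 2"
  proof -
    have "cayley_mean d W 0 = of_real (1 + real (size W) / real d)" by (simp add: cayley_mean_def)
    then have "Re (f 0) = sqrt (1 + real (size W) / real d)" unfolding f_def
      by (subst \<open>cayley_mean d W 0 = _\<close>, subst csqrt_of_real_nonneg) auto
    also have "\<dots> \<le> sqrt 2" using d by auto
    finally show ?thesis .
  qed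
  note mv = holomorphic_mean_value[OF fh r]
  have int: "integrable unit_interval (\<lambda>x. sqrt 2 * Re (f (of_real r * circle_pt x)))"
    using mv(1) by (intro integrable_mult_right integrable_Re)
  have "(\<integral>\<^sup>+x. ennreal (sqrt (cmod (cayley_mean d W (of_real r * circle_pt x)))) \<partial>unit_interval)
      \<le> (\<integral>\<^sup>+x. ennreal (sqrt 2 * Re (f (of_real r * circle_pt x))) \<partial>unit_interval)"
  proof (intro nn_integral_mono ennreal_leI)
    fix x
    have "Re (cayley_mean d W (of_real r * circle_pt x)) \<ge> 1"
      by (rule Re_ge) (use r in \<open>simp add: norm_mult\<close>)
    then show "sqrt (cmod (cayley_mean d W (of_real r * circle_pt x))) \<le> sqrt 2 * Re (f (of_real r * circle_pt x))"
      unfolding f_def by (intro Re_csqrt_ge) linarith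
  qed
  also have "\<dots> = ennreal (LINT x|unit_interval. sqrt 2 * Re (f (of_real r * circle_pt x)))"
    by (rule nn_integral_eq_integral[OF int]) (intro AE_I2 mult_nonneg_nonneg, simp, unfold f_def, rule Re_csqrt)
  also have "(LINT x|unit_interval. sqrt 2 * Re (f (of_real r * circle_pt x))) = sqrt 2 * Re (f 0)"
    using mv by (simp add: integral_Re)
  also have "\<dots> \<le> sqrt 2 * sqrt 2" using f0 by (intro mult_left_mono) auto
  also have "\<dots> = 2" by simp
  finally show ?thesis by (simp add: ennreal_leI)
qed

text \<open>Fatou's lemma on circles with radius tending to 1. The kernels have their poles at the
  inverses of the elements of W, and these meet the unit circle in finitely many points.\<close>

lemma cayley_mean_half_moment:
  assumes W: "\<And>u. u \<in># W \<Longrightarrow> cmod u \<le> 1" and d: "size W \<le> d" "d > 0"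
  shows "(\<integral>\<^sup>+x. ennreal (sqrt (cmod (cayley_mean d W (circle_pt x)))) \<partial>unit_interval) \<le> ennreal 2"
proof -
  define r where "r = (\<lambda>k. 1 - 1 / (real k + 2))"
  define F where "F = (\<lambda>k x. ennreal (sqrt (cmod (cayley_mean d W (of_real (r k) * circle_pt x)))))"
  have r: "0 < r k" "r k < 1" for k unfolding r_def by (auto simp: field_simps)
  have r_lim: "r \<longlonglongrightarrow> 1" unfolding r_def by real_asymp
  have meas: "(\<lambda>x. \<Sum>u\<in>#V. (1 + of_real c * circle_pt x * u) / (1 - of_real c * circle_pt x * u)) \<in> borel_measurable borel"
    for V and c :: real
  proof (induction V)
    case (add u V)
    have "circle_pt \<in> borel_measurable borel"
      by (intro borel_measurable_continuous_onI continuous_intros)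
    then show ?case using add by simp
  qed simp
  have "AE x in unit_interval. circle_pt x \<notin> (\<lambda>u. inverse u) ` set_mset W"
    by (rule AE_circle_pt_notin) auto
  then have lim: "AE x in unit_interval. ennreal (sqrt (cmod (cayley_mean d W (circle_pt x)))) = liminf (\<lambda>k. F k x)"
  proof eventually_elim
    case (elim x)
    have ne: "1 - circle_pt x * u \<noteq> 0" if "u \<in># W" for u
      using elim that by (metis eq_iff_diff_eq_0 image_eqI inverse_unique mult.commute)
    have "(\<lambda>k. \<Sum>u\<in>#V. (1 + of_real (r k) * circle_pt x * u) / (1 - of_real (r k) * circle_pt x * u))
        \<longlonglongrightarrow> (\<Sum>u\<in>#V. (1 + of_real 1 * circle_pt x * u) / (1 - of_real 1 * circle_pt x * u))"
      if "\<And>u. u \<in># V \<Longrightarrow> u \<in># W" for V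
      using that
    proof (induction V)
      case (add u V)
      have "(\<lambda>k. (1 + of_real (r k) * circle_pt x * u) / (1 - of_real (r k) * circle_pt x * u))
         \<longlonglongrightarrow> (1 + of_real 1 * circle_pt x * u) / (1 - of_real 1 * circle_pt x * u)"
        by (intro tendsto_intros r_lim) (use ne[of u] add.prems in auto)
      moreover note add.IH
      ultimately show ?case using add.prems by (simp add: tendsto_add)
    qed simp
    from this[of W] have "(\<lambda>k. F k x) \<longlonglongrightarrow> ennreal (sqrt (cmod (cayley_mean d W (circle_pt x))))"
      unfolding F_def cayley_mean_def using d by (intro tendsto_ennrealI tendsto_intros) auto
    then show ?case by (simp add: lim_imp_Liminf)
  qed
  have "(\<integral>\<^sup>+x. ennreal (sqrt (cmod (cayley_mean d W (circle_pt x)))) \<partial>unit_interval)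
      = (\<integral>\<^sup>+x. liminf (\<lambda>k. F k x) \<partial>unit_interval)"
    by (rule nn_integral_cong_AE[OF lim])
  also have "\<dots> \<le> liminf (\<lambda>k. \<integral>\<^sup>+x. F k x \<partial>unit_interval)"
  proof (rule nn_integral_liminf)
    fix k
    have "(\<lambda>x. cayley_mean d W (of_real (r k) * circle_pt x)) \<in> borel_measurable borel"
      unfolding cayley_mean_def using meas[where V = W and c = "r k"] by simp
    then show "F k \<in> borel_measurable unit_interval"
      unfolding F_def by (intro measurable_unit_interval) simp
  qed
  also have "\<dots> \<le> liminf (\<lambda>k. ennreal 2)"
    unfolding F_def by (intro Liminf_mono always_eventually allI cayley_mean_half_moment_inner W d r)
  finally show ?thesis by (simp add: Liminf_const)
qed

lemma poly_prod_mset_linear: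
  fixes z :: complex
  shows   "poly (\<Prod>u\<in>#M. [:-u, 1:]) z = (\<Prod>u\<in>#M. z - u)"
  by (induction M) (auto simp: algebra_simps)

lemma monic_decompose:
  fixes F :: "complex poly"
  assumes "lead_coeff F = 1"
  shows "F = (\<Prod>u\<in>#proots F. [:-u, 1:])"
  using complex_poly_decompose_multiset[of F] assms by simp

lemma poly_monic_eq_prod_roots:
  fixes F :: "complex poly"
  assumes "lead_coeff F = 1"
  shows "poly F z = (\<Prod>u\<in>#proots F. z - u)"
  using monic_decompose[OF assms] poly_prod_mset_linear by metis

lemma log_derivative_prod:
  fixes z :: complex
  assumes "\<And>u. u \<in># M \<Longrightarrow> z \<noteq> u"
  shows "poly (pderiv (\<Prod>u\<in>#M. [:-u, 1:])) z / poly (\<Prod>u\<in>#M. [:-u, 1:]) z = (\<Sum>u\<in>#M. 1 / (z - u))"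
  using assms
proof (induction M)
  case (add u M)
  let ?P = "\<Prod>u\<in>#M. [:-u, 1:]"
  have nz: "poly ?P z \<noteq> 0" unfolding poly_prod_mset_linear using add.prems by (auto simp: prod_mset_zero_iff)
  have "poly (pderiv (\<Prod>u\<in>#add_mset u M. [:-u, 1:])) z / poly (\<Prod>u\<in>#add_mset u M. [:-u, 1:]) z
     = ((z - u) * poly (pderiv ?P) z + poly ?P z) / ((z - u) * poly ?P z)"
    by (simp only: image_mset_add_mset prod_mset.add_mset pderiv_mult poly_add poly_mult)
       (simp add: pderiv_pCons algebra_simps)
  also have "\<dots> = poly (pderiv ?P) z / poly ?P z + 1 / (z - u)"
    using nz add.prems by (simp add: field_simps)
  finally show ?case using add by simp
qed simp

text \<open>For z on the unit circle, 2z / (z - u) is 1 plus the conjugate of the Herglotz kernel at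
  \<open>cnj u\<close> if |u| <= 1, and 1 minus the kernel at \<open>inverse u\<close> otherwise.
  The two families together have deg F members, so F' / (deg F * F) is bounded by 1 plus two Cayley
  means; hence 5 = 1 + 2 + 2, whatever the degree.\<close>

lemma log_derivative_half_moment:
  fixes F :: "complex poly"
  assumes monic: "lead_coeff F = 1" and d: "degree F > 0"
  shows "(\<integral>\<^sup>+x. ennreal (sqrt (cmod (poly (pderiv F) (circle_pt x) / (of_nat (degree F) * poly F (circle_pt x)))))
     \<partial>unit_interval) \<le> ennreal 5"
proof -
  define A where "A = filter_mset (\<lambda>u. cmod u \<le> 1) (proots F)"
  define B where "B = image_mset inverse (filter_mset (\<lambda>u. \<not> cmod u \<le> 1) (proots F))"
  define D where "D = degree F"
  have Dpos: "D > 0" using d by (simp add: D_def)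
  have F0: "F \<noteq> 0" using monic by auto
  have szAB: "size A + size B = D"
    unfolding A_def B_def D_def using multiset_partition[of "proots F" "\<lambda>u. cmod u \<le> 1"]
    by (metis size_image_mset size_proots_complex size_union)
  have measz: "(\<lambda>x. sqrt (cmod (cayley_mean D V (circle_pt x)))) \<in> borel_measurable unit_interval" for V
  proof -
    have "(\<lambda>x. \<Sum>u\<in>#V. (1 + circle_pt x * u) / (1 - circle_pt x * u)) \<in> borel_measurable borel"
    proof (induction V)
      case (add u V)
      have "circle_pt \<in> borel_measurable borel"
        by (intro borel_measurable_continuous_onI continuous_intros)
      then show ?case using add by simp
    qed simp
    then show ?thesis unfolding cayley_mean_def by (intro measurable_unit_interval) simp
  qed
  define A' where "A' = image_mset cnj A"
  have bdA: "(\<integral>\<^sup>+x. ennreal (sqrt (cmod (cayley_mean D A' (circle_pt x)))) \<partial>unit_interval) \<le> ennreal 2"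
    by (rule cayley_mean_half_moment) (use szAB Dpos in \<open>auto simp: A'_def A_def\<close>)
  have bdB: "(\<integral>\<^sup>+x. ennreal (sqrt (cmod (cayley_mean D B (circle_pt x)))) \<partial>unit_interval) \<le> ennreal 2"
    by (rule cayley_mean_half_moment) (use szAB Dpos in \<open>auto simp: B_def norm_inverse intro!: inverse_le_1_iff[THEN iffD2]\<close>)
  have "AE x in unit_interval. circle_pt x \<notin> {z. poly F z = 0}"
    by (rule AE_circle_pt_notin) (use F0 poly_roots_finite in auto)
  then have key: "AE x in unit_interval.
     ennreal (sqrt (cmod (poly (pderiv F) (circle_pt x) / (of_nat D * poly F (circle_pt x)))))
     \<le> 1 + ennreal (sqrt (cmod (cayley_mean D A' (circle_pt x)))) + ennreal (sqrt (cmod (cayley_mean D B (circle_pt x))))"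
  proof eventually_elim
    case (elim x)
    define z where "z = circle_pt x"
    have z1: "cmod z = 1" by (simp add: z_def)
    then have z0: "z \<noteq> 0" by auto
    have ne: "z \<noteq> u" if "u \<in># proots F" for u using elim that F0 by (auto simp: z_def)
    have cz: "cnj z = inverse z" using z1 by (simp add: z_def cis_cnj cis_inverse)
    have "poly (pderiv F) z / poly F z = (\<Sum>u\<in>#proots F. 1 / (z - u))"
      using log_derivative_prod[of "proots F" z] ne monic_decompose[OF monic] by metis
    then have "2 * z * (poly (pderiv F) z / poly F z) = (\<Sum>u\<in>#proots F. 2 * z / (z - u))"
      by (simp add: sum_mset_distrib_left multiset.map_comp comp_def)
    also have "\<dots> = (\<Sum>u\<in>#A. 2 * z / (z - u)) + (\<Sum>u\<in>#filter_mset (\<lambda>u. \<not> cmod u \<le> 1) (proots F). 2 * z / (z - u))"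
      unfolding A_def by (subst multiset_partition[of "proots F" "\<lambda>u. cmod u \<le> 1"]) (simp only: image_mset_union sum_mset.union)
    also have "(\<Sum>u\<in>#A. 2 * z / (z - u)) = (\<Sum>u\<in>#A. 1 + cnj ((1 + z * cnj u) / (1 - z * cnj u)))"
    proof (intro arg_cong[where f = sum_mset] image_mset_cong)
      fix u assume "u \<in># A"
      then have "z \<noteq> u" using ne by (simp add: A_def)
      then have "2 * z / (z - u) = 1 + (1 + inverse z * u) / (1 - inverse z * u)"
        using z0 by (simp add: field_simps)
      then show "2 * z / (z - u) = 1 + cnj ((1 + z * cnj u) / (1 - z * cnj u))"
        by (simp add: cz)
    qed
    also have "\<dots> = of_nat (size A) + cnj (\<Sum>u\<in>#A'. (1 + z * u) / (1 - z * u))"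
      unfolding A'_def by (induction A) auto
    also have "(\<Sum>u\<in>#filter_mset (\<lambda>u. \<not> cmod u \<le> 1) (proots F). 2 * z / (z - u)) = (\<Sum>u\<in>#B. 1 - (1 + z * u) / (1 - z * u))"
      unfolding B_def multiset.map_comp o_def
    proof (intro arg_cong[where f = sum_mset] image_mset_cong)
      fix u assume u: "u \<in># filter_mset (\<lambda>u. \<not> cmod u \<le> 1) (proots F)"
      then have "z \<noteq> u" "u \<noteq> 0" using ne by auto
      then show "2 * z / (z - u) = 1 - (1 + z * inverse u) / (1 - z * inverse u)"
        using z0 by (simp add: field_simps)
    qed
    also have "\<dots> = of_nat (size B) - (\<Sum>u\<in>#B. (1 + z * u) / (1 - z * u))"
      by (induction B) auto
    finally have "2 * z * (poly (pderiv F) z / poly F z) = of_nat (size A + size B) + 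
       cnj (\<Sum>u\<in>#A'. (1 + z * u) / (1 - z * u)) - (\<Sum>u\<in>#B. (1 + z * u) / (1 - z * u))"
      by simp
    then have "2 * z * (poly (pderiv F) z / poly F z) / of_nat D = 1 + 
       cnj (cayley_mean D A' z) - cayley_mean D B z"
      unfolding szAB cayley_mean_def using Dpos by (simp add: diff_divide_distrib add_divide_distrib)
    then have eq: "poly (pderiv F) z / (of_nat D * poly F z) = (1 + cnj (cayley_mean D A' z) - cayley_mean D B z) / (2 * z)"
      using z0 Dpos by (simp add: field_simps)
    have "cmod (poly (pderiv F) z / (of_nat D * poly F z)) = cmod (1 + cnj (cayley_mean D A' z) - cayley_mean D B z) / 2"
      unfolding eq by (simp add: norm_divide norm_mult z1)
    also have "\<dots> \<le> 1 + cmod (cayley_mean D A' z) + cmod (cayley_mean D B z)"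
    proof -
      have "cmod (1 + cnj (cayley_mean D A' z) - cayley_mean D B z) \<le> 1 + cmod (cayley_mean D A' z) + cmod (cayley_mean D B z)"
        using norm_triangle_ineq4[of "1 + cnj (cayley_mean D A' z)" "cayley_mean D B z"] norm_triangle_ineq[of 1 "cnj (cayley_mean D A' z)"]
        by simp
      moreover have "0 \<le> 1 + cmod (cayley_mean D A' z) + cmod (cayley_mean D B z)" by simp
      ultimately show ?thesis by linarith
    qed
    finally have "sqrt (cmod (poly (pderiv F) z / (of_nat D * poly F z))) \<le> sqrt (1 + cmod (cayley_mean D A' z) + cmod (cayley_mean D B z))"
      by simp
    also have "\<dots> \<le> 1 + sqrt (cmod (cayley_mean D A' z)) + sqrt (cmod (cayley_mean D B z))"
      using sqrt_add_le_add_sqrt[of "1 + cmod (cayley_mean D A' z)" "cmod (cayley_mean D B z)"]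
        sqrt_add_le_add_sqrt[of 1 "cmod (cayley_mean D A' z)"] by simp
    finally show ?case unfolding z_def
      by (simp flip: ennreal_plus ennreal_1 add: ennreal_leI)
  qed
  have "(\<integral>\<^sup>+x. ennreal (sqrt (cmod (poly (pderiv F) (circle_pt x) / (of_nat D * poly F (circle_pt x))))) \<partial>unit_interval)
     \<le> (\<integral>\<^sup>+x. 1 + ennreal (sqrt (cmod (cayley_mean D A' (circle_pt x)))) + ennreal (sqrt (cmod (cayley_mean D B (circle_pt x)))) \<partial>unit_interval)"
    by (rule nn_integral_mono_AE[OF key])
  also have "\<dots> = 1 + (\<integral>\<^sup>+x. ennreal (sqrt (cmod (cayley_mean D A' (circle_pt x)))) \<partial>unit_interval)
       + (\<integral>\<^sup>+x. ennreal (sqrt (cmod (cayley_mean D B (circle_pt x)))) \<partial>unit_interval)"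
    using measz by (simp add: nn_integral_add prob_space.emeasure_space_1[OF prob_space_unit_interval, simplified])
  also have "\<dots> \<le> 1 + ennreal 2 + ennreal 2" by (intro add_mono bdA bdB order_refl)
  also have "1 + ennreal 2 + ennreal 2 = ennreal (1 + 2 + 2)"
    by (subst ennreal_plus, simp, simp, subst ennreal_plus) auto
  finally show ?thesis by (simp add: D_def)
qed

section \<open>Negative moments of polynomials with few terms\<close>

text \<open>Only the leading coefficient is normalised: the degree and the other coefficients stay
  free, so that moment bounds depend on the number of terms alone.\<close>

definition fewnomial :: "nat \<Rightarrow> complex poly \<Rightarrow> bool" where
  "fewnomial k F \<longleftrightarrow> lead_coeff F = 1 \<and> card {i. coeff F i \<noteq> 0} \<le> Suc k"

lemma finite_support_poly: "finite {i. coeff F i \<noteq> 0}"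
  by (rule finite_subset[of _ "{..degree F}"]) (auto simp: le_degree)

lemma fewnomial_split:
  assumes "fewnomial (Suc k) F"
  obtains a G where "F = monom 1 a * G" "fewnomial (Suc k) G" "coeff G 0 \<noteq> 0"
proof -
  have F0: "F \<noteq> 0" using assms by (auto simp: fewnomial_def)
  define a where "a = order 0 F"
  obtain G where G: "F = [:0, 1:] ^ a * G" "\<not> [:0, 1:] dvd G"
    using order_decomp[OF F0, of 0] by (auto simp: a_def)
  have F_eq: "F = monom 1 a * G" using G(1) by (simp add: monom_altdef)
  have c0: "coeff G 0 \<noteq> 0" using G(2) by (metis poly_0_coeff_0 poly_eq_0_iff_dvd minus_zero)
  have coeffF: "coeff F i = (if i < a then 0 else coeff G (i - a))" for i
    unfolding F_eq by (simp add: coeff_monom_mult)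
  have "(\<lambda>i. i + a) ` {i. coeff G i \<noteq> 0} \<subseteq> {i. coeff F i \<noteq> 0}"
    by (auto simp: coeffF)
  from card_mono[OF finite_support_poly this]
  have "card {i. coeff G i \<noteq> 0} \<le> card {i. coeff F i \<noteq> 0}"
    by (simp add: card_image)
  moreover have "lead_coeff G = lead_coeff F" unfolding F_eq by (simp add: lead_coeff_mult degree_monom_eq)
  ultimately have "fewnomial (Suc k) G" using assms by (auto simp: fewnomial_def)
  then show ?thesis using that F_eq c0 by blast
qed

lemma fewnomial_pderiv:
  assumes G: "fewnomial (Suc k) G" "coeff G 0 \<noteq> 0" and d: "degree G > 0"
  shows "fewnomial k (Polynomial.smult (1 / of_nat (degree G)) (pderiv G))"
proof -
  have "lead_coeff (Polynomial.smult (1 / of_nat (degree G)) (pderiv G)) = 1"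
    using G d by (simp add: fewnomial_def degree_pderiv coeff_pderiv del: of_nat_Suc)
  moreover have "Suc ` {i. coeff (pderiv G) i \<noteq> 0} \<subseteq> {i. coeff G i \<noteq> 0} - {0}"
    by (auto simp: coeff_pderiv)
  from card_mono[OF finite_Diff[OF finite_support_poly] this]
  have "card {i. coeff (pderiv G) i \<noteq> 0} \<le> card ({i. coeff G i \<noteq> 0} - {0})"
    by (simp add: card_image)
  then have "card {i. coeff (pderiv G) i \<noteq> 0} \<le> Suc k"
    using G unfolding fewnomial_def by (auto simp: card_Diff_singleton_if)
  ultimately show ?thesis using d by (simp add: fewnomial_def)
qed

lemma fewnomial_0:
  assumes "fewnomial 0 F"
  shows "cmod (poly F (circle_pt x)) = 1"
proof -
  have "degree F \<in> {i. coeff F i \<noteq> 0}" using assms by (auto simp: fewnomial_def)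
  then have "{i. coeff F i \<noteq> 0} = {degree F}"
    using assms finite_support_poly[of F] unfolding fewnomial_def
    by (auto dest: card_le_Suc0_iff_eq[THEN iffD1, rotated])
  then have "coeff F i = 0" if "i \<noteq> degree F" for i using that by blast
  then have "F = monom 1 (degree F)"
    using assms by (intro poly_eqI) (auto simp: fewnomial_def)
  then have "poly F (circle_pt x) = circle_pt x ^ degree F" by (metis mult_1 poly_monom)
  then show ?thesis by (simp add: norm_power)
qed

lemma measurable_poly_circle [measurable]: "(\<lambda>x. poly F (circle_pt x)) \<in> borel_measurable unit_interval"
  by (intro measurable_unit_interval borel_measurable_continuous_onI continuous_intros)

lemma AE_poly_circle_nonzero:
  assumes "F \<noteq> 0"
  shows "AE x in unit_interval. poly F (circle_pt x) \<noteq> 0"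
  using AE_circle_pt_notin[of "{z. poly F z = 0}"] assms poly_roots_finite[of F] by simp

text \<open>The induction divides by the lowest monomial and differentiates, which removes a term; Young's
  inequality recombines the logarithmic derivative with the polynomial with fewer terms.\<close>

lemma fewnomial_negative_moment:
  "\<exists>C>0. \<forall>F. fewnomial (Suc k) F \<longrightarrow>
     (\<integral>\<^sup>+x. ennreal (cmod (poly F (circle_pt x)) powr (- 1 / (2 * real (Suc k)))) \<partial>unit_interval) \<le> ennreal C"
proof (induction k)
  case 0
  show ?case
  proof (intro exI[of _ 5] conjI allI impI)
    fix F assume "fewnomial (Suc 0) F"
    then obtain a G where G: "F = monom 1 a * G" "fewnomial (Suc 0) G" "coeff G 0 \<noteq> 0"
      by (rule fewnomial_split)
    have abs_eq: "cmod (poly F (circle_pt x)) = cmod (poly G (circle_pt x))" for x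
      by (simp add: G(1) poly_monom norm_mult norm_power)
    show "(\<integral>\<^sup>+x. ennreal (cmod (poly F (circle_pt x)) powr (- 1 / (2 * real (Suc 0)))) \<partial>unit_interval) \<le> ennreal 5"
    proof (cases "degree G = 0")
      case True
      then have "G = 1" using G(2) by (auto simp: fewnomial_def elim!: degree_eq_zeroE)
      then show ?thesis 
        by (simp add: abs_eq prob_space.emeasure_space_1[OF prob_space_unit_interval, simplified])
    next
      case False
      define D where "D = degree G"
      have f0: "fewnomial 0 (Polynomial.smult (1 / of_nat D) (pderiv G))"
        unfolding D_def by (rule fewnomial_pderiv) (use G False in auto)
      have pd: "cmod (poly (pderiv G) (circle_pt x)) / real D = 1" for x
        using fewnomial_0[OF f0, of x] by (simp only: poly_smult norm_mult norm_divide norm_one norm_of_nat) (simp only: times_divide_eq_left mult_1)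
      have eq: "cmod (poly F (circle_pt x)) powr (- 1 / (2 * real (Suc 0)))
         = sqrt (cmod (poly (pderiv G) (circle_pt x) / (of_nat D * poly G (circle_pt x))))" for x
      proof -
        have "cmod (poly (pderiv G) (circle_pt x) / (of_nat D * poly G (circle_pt x)))
            = (cmod (poly (pderiv G) (circle_pt x)) / real D) / cmod (poly G (circle_pt x))"
          by (simp add: norm_divide norm_mult)
        then have "sqrt (cmod (poly (pderiv G) (circle_pt x) / (of_nat D * poly G (circle_pt x))))
            = 1 / sqrt (cmod (poly G (circle_pt x)))"
          unfolding pd by (simp only: real_sqrt_divide real_sqrt_one)
        moreover have "cmod (poly F (circle_pt x)) powr (- (1 / 2)) = 1 / sqrt (cmod (poly G (circle_pt x)))"
          unfolding abs_eq powr_minus_divide by (simp only: powr_half_sqrt norm_ge_zero)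
        moreover have "- 1 / (2 * real (Suc 0)) = - (1 / 2)" by simp
        ultimately show ?thesis by (simp only:)
      qed
      have "(\<integral>\<^sup>+x. ennreal (sqrt (cmod (poly (pderiv G) (circle_pt x) / (of_nat (degree G) * poly G (circle_pt x)))))
         \<partial>unit_interval) \<le> ennreal 5"
        by (rule log_derivative_half_moment) (use G(2) False in \<open>auto simp: fewnomial_def\<close>)
      then show ?thesis unfolding eq D_def .
    qed
  qed simp
next
  case (Suc k)
  then obtain C where C: "C > 0" "\<And>F. fewnomial (Suc k) F \<Longrightarrow>
     (\<integral>\<^sup>+x. ennreal (cmod (poly F (circle_pt x)) powr (- 1 / (2 * real (Suc k)))) \<partial>unit_interval) \<le> ennreal C"
    by blast
  show ?case
  proof (intro exI[of _ "5 + C + 1"] conjI allI impI)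
    fix F assume "fewnomial (Suc (Suc k)) F"
    then obtain a G where G: "F = monom 1 a * G" "fewnomial (Suc (Suc k)) G" "coeff G 0 \<noteq> 0"
      by (rule fewnomial_split)
    have abs_eq: "cmod (poly F (circle_pt x)) = cmod (poly G (circle_pt x))" for x
      by (simp add: G(1) poly_monom norm_mult norm_power)
    show "(\<integral>\<^sup>+x. ennreal (cmod (poly F (circle_pt x)) powr (- 1 / (2 * real (Suc (Suc k))))) \<partial>unit_interval)
       \<le> ennreal (5 + C + 1)"
    proof (cases "degree G = 0")
      case True
      then have "G = 1" using G(2) by (auto simp: fewnomial_def elim!: degree_eq_zeroE)
      moreover have "ennreal 1 \<le> ennreal (5 + C + 1)" using C(1) by (intro ennreal_leI) simp
      ultimately show ?thesis
        by (simp add: abs_eq prob_space.emeasure_space_1[OF prob_space_unit_interval, simplified] del: ennreal_plus)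
    next
      case False
      define D where "D = degree G"
      define H where "H = Polynomial.smult (1 / of_nat D) (pderiv G)"
      have Dpos: "D > 0" using False by (simp add: D_def)
      have H: "fewnomial (Suc k) H"
        unfolding D_def H_def by (rule fewnomial_pderiv) (use G False in auto)
      have G0: "G \<noteq> 0" "H \<noteq> 0" using G(2) H by (auto simp: fewnomial_def)
      let ?q = "\<lambda>x. poly (pderiv G) (circle_pt x) / (of_nat D * poly G (circle_pt x))"
      let ?e = "- 1 / (2 * real (Suc k))"
      have key: "AE x in unit_interval. ennreal (cmod (poly F (circle_pt x)) powr (- 1 / (2 * real (Suc (Suc k)))))
         \<le> ennreal (sqrt (cmod (?q x))) + ennreal (cmod (poly H (circle_pt x)) powr ?e)"
        using AE_poly_circle_nonzero[OF G0(1)] AE_poly_circle_nonzero[OF G0(2)]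
      proof eventually_elim
        case (elim x)
        define u where "u = sqrt (cmod (?q x))"
        define v where "v = cmod (poly H (circle_pt x)) powr ?e"
        \<comment> \<open>The weight for which the powers of |H| cancel: the power s of u contains
          |H|^(s/2), and the power 1 - s of v is |H|^(-(1-s)/(2(k+1))) = |H|^(-s/2). What remains is
          |G|^(-s/2).\<close>
        define s where "s = 1 / real (Suc (Suc k))"
        have qH: "?q x = poly H (circle_pt x) / poly G (circle_pt x)"
          using Dpos by (simp add: H_def)
        have up: "u > 0" and vp: "v > 0" using elim by (simp_all add: u_def v_def qH)
        have s: "0 \<le> s" "0 \<le> 1 - s" "s + (1 - s) = 1" "s \<le> 1" by (auto simp: s_def)
        have "cmod (poly F (circle_pt x)) powr (- 1 / (2 * real (Suc (Suc k)))) = u powr s * v powr (1 - s)"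
        proof -
          define g h where "g = cmod (poly G (circle_pt x))" and "h = cmod (poly H (circle_pt x))"
          have gh: "g > 0" "h > 0" using elim by (auto simp: g_def h_def)
          have se: "(1 - s) * ?e = - s / 2" 
          proof -
            have *: "(a / b) * (- 1 / (2 * a)) = - (1 / b) / 2" if "a \<noteq> 0" for a b :: real
              using that by simp
            have "1 - s = real (Suc k) / real (Suc (Suc k))" by (simp add: s_def field_simps)
            then show ?thesis using *[of "real (Suc k)" "real (Suc (Suc k))"] by (simp add: s_def del: of_nat_Suc)
          qed
          have "ln u = (ln h - ln g) / 2"
            unfolding u_def qH norm_divide g_def[symmetric] h_def[symmetric] using gh by (simp add: ln_sqrt ln_div)
          moreover have "ln v = ?e * ln h"
            unfolding v_def h_def[symmetric] using gh by (simp only: ln_powr)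
          ultimately have "s * ln u + (1 - s) * ln v = s * ((ln h - ln g) / 2) + ((1 - s) * ?e) * ln h"
            by (simp only: mult.assoc)
          also have "\<dots> = - s / 2 * ln g" unfolding se by (simp add: field_simps)
          finally have "exp (s * ln u + (1 - s) * ln v) = exp (- s / 2 * ln g)" by (simp only:)
          then have "u powr s * v powr (1 - s) = g powr (- s / 2)"
            using up vp gh by (simp add: powr_def exp_add)
          also have "- s / 2 = - 1 / (2 * real (Suc (Suc k)))" by (simp add: s_def)
          finally show ?thesis by (simp add: abs_eq g_def)
        qed
        also have "\<dots> \<le> s * u + (1 - s) * v"
          using Youngs_inequality_0[OF s(1-3)] up vp by simp
        also have "\<dots> \<le> u + v"
          using up vp s by (intro add_mono mult_left_le_one_le) auto
        finally show ?case using up vp unfolding u_def v_def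
          by (simp flip: ennreal_plus add: ennreal_leI)
      qed
      have "(\<integral>\<^sup>+x. ennreal (cmod (poly F (circle_pt x)) powr (- 1 / (2 * real (Suc (Suc k))))) \<partial>unit_interval)
         \<le> (\<integral>\<^sup>+x. ennreal (sqrt (cmod (?q x))) + ennreal (cmod (poly H (circle_pt x)) powr ?e) \<partial>unit_interval)"
        by (rule nn_integral_mono_AE[OF key])
      also have "\<dots> = (\<integral>\<^sup>+x. ennreal (sqrt (cmod (?q x))) \<partial>unit_interval)
          + (\<integral>\<^sup>+x. ennreal (cmod (poly H (circle_pt x)) powr ?e) \<partial>unit_interval)"
        by (rule nn_integral_add) measurable
      also have "\<dots> \<le> ennreal 5 + ennreal C"
      proof (intro add_mono C(2) H)
        show "(\<integral>\<^sup>+x. ennreal (sqrt (cmod (?q x))) \<partial>unit_interval) \<le> ennreal 5"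
          unfolding D_def by (rule log_derivative_half_moment) (use G(2) False in \<open>auto simp: fewnomial_def\<close>)
      qed
      also have "ennreal 5 + ennreal C = ennreal (5 + C)" using C(1) by (subst ennreal_plus) auto
      also have "\<dots> \<le> ennreal (5 + C + 1)" by (intro ennreal_leI) simp
      finally show ?thesis .
    qed
  qed (use C(1) in simp)
qed

section \<open>Jensen's formula and logarithmic integrals\<close>

lemma jensen_inside:
  assumes c: "cmod c < 1"
  shows "integrable unit_interval (\<lambda>x. ln (cmod (1 - c * circle_pt x)))"
    and "(LINT x|unit_interval. ln (cmod (1 - c * circle_pt x))) = 0"
proof -
  define R where "R = 2 / (1 + cmod c)"
  have R: "1 < R" "R * cmod c < 1"
  proof -
    have "1 + cmod c > 0" by (simp add: add_pos_nonneg)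
    then show "1 < R" "R * cmod c < 1" using c unfolding R_def by (auto simp: pos_divide_less_eq pos_less_divide_eq)
  qed
  have Re_pos: "Re (1 - c * w) > 0" if "w \<in> ball 0 R" for w
  proof -
    have "cmod (c * w) \<le> cmod c * R" using that by (simp add: norm_mult mult_left_mono)
    then have "cmod (c * w) < 1" using R by (simp add: mult.commute)
    then show ?thesis using complex_Re_le_cmod[of "c * w"] by simp
  qed
  have holo: "(\<lambda>w. Ln (1 - c * w)) holomorphic_on ball 0 R"
    by (intro holomorphic_intros) (use Re_pos in \<open>force simp: complex_nonpos_Reals_iff\<close>)
  note mv = holomorphic_mean_value[OF holo, of 1]
  have eq: "ln (cmod (1 - c * circle_pt x)) = Re (Ln (1 - c * (of_real 1 * circle_pt x)))" for x
  proof -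
    have "Re (1 - c * circle_pt x) > 0" by (rule Re_pos) (use R in simp)
    then have "1 - c * circle_pt x \<noteq> 0" by (metis less_irrefl zero_complex.simps(1))
    then show ?thesis by simp
  qed
  show "integrable unit_interval (\<lambda>x. ln (cmod (1 - c * circle_pt x)))"
    unfolding eq using mv(1) R by (intro integrable_Re) auto
  show "(LINT x|unit_interval. ln (cmod (1 - c * circle_pt x))) = 0"
    unfolding eq using mv R by (subst integral_Re) auto
qed

lemma neg_ln_le_powr:
  fixes t :: real
  assumes "t > 0"
  shows "- ln t \<le> 2 / sqrt t"
proof -
  have "- ln t = 2 * ln (1 / sqrt t)" using assms by (simp add: ln_div ln_sqrt)
  also have "\<dots> \<le> 2 * (1 / sqrt t)" using assms ln_bound[of "1 / sqrt t"] by simp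
  finally show ?thesis by simp
qed

text \<open>Dominated convergence from \<open>jensen_inside\<close> at r c, r tending to 1. The
  majorant is a constant plus a multiple of the power -1/2 of |1 - c z| on the circle, integrable as
  the half moment of the logarithmic derivative of a linear polynomial.\<close>

lemma jensen_on_circle:
  assumes c: "cmod c = 1"
  shows "integrable unit_interval (\<lambda>x. ln (cmod (1 - c * circle_pt x)))"
    and "(LINT x|unit_interval. ln (cmod (1 - c * circle_pt x))) = 0"
proof -
  define r where "r = (\<lambda>k. 1 - 1 / (real k + 2))"
  have r: "0 < r k" "r k < 1" for k unfolding r_def by (auto simp: field_simps)
  have r_lim: "r \<longlonglongrightarrow> 1" unfolding r_def by real_asymp
  define g where "g = (\<lambda>x. cmod (1 - c * circle_pt x))"
  define w where "w = (\<lambda>x. 2 + 2 / sqrt (g x / 2))"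
  have g_alt: "g x = cmod (poly [:- cnj c, 1:] (circle_pt x))" for x
  proof -
    have "g x = cmod (cnj c) * cmod (1 - c * circle_pt x)" using c by (simp add: g_def)
    also have "\<dots> = cmod (cnj c * (1 - c * circle_pt x))" by (simp add: norm_mult)
    also have "cnj c * (1 - c * circle_pt x) = cnj c - circle_pt x"
      using c by (simp add: algebra_simps complex_norm_square[symmetric] flip: mult.assoc)
    finally show ?thesis by (simp add: norm_minus_commute)
  qed
  have meas_g [measurable]: "g \<in> borel_measurable unit_interval"
    unfolding g_def by (intro measurable_unit_interval borel_measurable_continuous_onI continuous_intros)
  have gpos: "AE x in unit_interval. g x > 0"
  proof -
    have "AE x in unit_interval. circle_pt x \<notin> {cnj c}" by (rule AE_circle_pt_notin) auto
    then show ?thesis by eventually_elim (simp add: g_alt)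
  qed
  have int_w: "integrable unit_interval w"
  proof -
    have "(\<integral>\<^sup>+x. ennreal (1 / sqrt (g x)) \<partial>unit_interval) \<le> ennreal 5"
      using log_derivative_half_moment[of "[:- cnj c, 1:]"]
      by (simp add: pderiv_pCons norm_divide real_sqrt_divide g_alt)
    then have "(\<integral>\<^sup>+x. ennreal (1 / sqrt (g x)) \<partial>unit_interval) < \<infinity>"
      by (rule order_le_less_trans) simp
    then have "integrable unit_interval (\<lambda>x. 1 / sqrt (g x))"
      by (rule integrableI_nonneg[rotated 2]) (measurable, simp add: g_def)
    then have "integrable unit_interval (\<lambda>x. 2 + 2 * sqrt 2 * (1 / sqrt (g x)))"
      by (intro Bochner_Integration.integrable_add integrable_mult_right)
         (auto intro!: finite_measure.integrable_const prob_space.finite_measure prob_space_unit_interval)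
    moreover have "w = (\<lambda>x. 2 + 2 * sqrt 2 * (1 / sqrt (g x)))"
      by (auto simp: w_def real_sqrt_divide)
    ultimately show ?thesis by simp
  qed
  define s where "s = (\<lambda>k x. ln (cmod (1 - of_real (r k) * c * circle_pt x)))"
  have s_int: "(LINT x|unit_interval. s k x) = 0" for k
    unfolding s_def using jensen_inside(2)[of "of_real (r k) * c"] r[of k] c by (simp add: norm_mult)
  have s_meas: "s k \<in> borel_measurable unit_interval" for k
    unfolding s_def using jensen_inside(1)[of "of_real (r k) * c"] r[of k] c by (simp add: norm_mult)
  have f_meas: "(\<lambda>x. ln (g x)) \<in> borel_measurable unit_interval" by measurable
  have lim: "AE x in unit_interval. (\<lambda>k. s k x) \<longlonglongrightarrow> ln (g x)"
    using gpos
  proof eventually_elim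
    case (elim x)
    have "(\<lambda>k. s k x) \<longlonglongrightarrow> ln (cmod (1 - of_real 1 * c * circle_pt x))"
      unfolding s_def by (intro tendsto_intros r_lim) (use elim in \<open>auto simp: g_def\<close>)
    then show ?case by (simp add: g_def)
  qed
  have bd: "AE x in unit_interval. norm (s k x) \<le> w x" for k
    using gpos
  proof eventually_elim
    case (elim x)
    define v where "v = c * circle_pt x"
    have v: "cmod v = 1" using c by (simp add: v_def norm_mult)
    define y where "y = cmod (1 - of_real (r k) * v)"
    have "g x = cmod ((1 - of_real (r k) * v) - of_real (1 - r k) * v)"
      by (simp add: g_def v_def algebra_simps)
    also have "\<dots> \<le> y + (1 - r k)"
      using norm_triangle_ineq4[of "1 - of_real (r k) * v" "of_real (1 - r k) * v"] v r[of k]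
      by (simp add: y_def norm_mult del: of_real_diff)
    finally have 1: "g x \<le> y + (1 - r k)" .
    have "1 - r k \<le> y"
      using norm_triangle_ineq2[of 1 "of_real (r k) * v"] v r[of k] by (simp add: y_def norm_mult)
    \<comment> \<open>Shrinking c by the factor r at most halves the distance to 1, because the
      displacement 1 - r is itself at most y.\<close>
    with 1 have y: "g x / 2 \<le> y" by simp
    then have ypos: "y > 0" using elim by simp
    have "y \<le> 2"
      using norm_triangle_ineq4[of 1 "of_real (r k) * v"] v r[of k] by (simp add: y_def norm_mult)
    then have "ln y \<le> 2" using ln_bound[OF ypos] by simp
    moreover have "- ln y \<le> 2 / sqrt (g x / 2)"
    proof -
      have "- ln y \<le> - ln (g x / 2)" using y elim by simp
      also have "\<dots> \<le> 2 / sqrt (g x / 2)" by (rule neg_ln_le_powr) (use elim in simp)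
      finally show ?thesis .
    qed
    moreover have "0 \<le> 2 / sqrt (g x / 2)" using elim by simp
    moreover have "s k x = ln y" by (simp add: s_def y_def v_def mult_ac)
    ultimately show ?case by (simp only: w_def real_norm_def; linarith)
  qed
  show "integrable unit_interval (\<lambda>x. ln (cmod (1 - c * circle_pt x)))"
    using integrable_dominated_convergence[OF f_meas s_meas int_w lim bd] by (simp add: g_def)
  have "(\<lambda>k. LINT x|unit_interval. s k x) \<longlonglongrightarrow> (LINT x|unit_interval. ln (g x))"
    by (rule integral_dominated_convergence[OF f_meas s_meas int_w lim bd])
  then have "(\<lambda>k::nat. 0) \<longlonglongrightarrow> (LINT x|unit_interval. ln (g x))" by (simp add: s_int)
  then show "(LINT x|unit_interval. ln (cmod (1 - c * circle_pt x))) = 0"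
    unfolding g_def by (simp add: LIMSEQ_const_iff)
qed

definition log_plus :: "complex \<Rightarrow> real" where
  "log_plus z = max 0 (ln (cmod z))"

lemma jensen_linear:
  "integrable unit_interval (\<lambda>x. ln (cmod (circle_pt x - u)))"
  "(LINT x|unit_interval. ln (cmod (circle_pt x - u))) = log_plus u"
proof -
  have "integrable unit_interval (\<lambda>x. ln (cmod (circle_pt x - u))) \<and>
     (LINT x|unit_interval. ln (cmod (circle_pt x - u))) = log_plus u"
  proof (cases "cmod u \<le> 1")
    case True
    have lp: "log_plus u = 0" using True by (cases "u = 0") (auto simp: log_plus_def)
    have eq: "cmod (circle_pt x - u) = cmod (1 - cnj u * circle_pt x)" for x
    proof -
      have "circle_pt x * cnj (circle_pt x) = 1" by (simp add: cis_cnj cis_mult)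
      have "cmod (circle_pt x - u) = cmod (cnj (circle_pt x) * (circle_pt x - u))"
        by (simp add: norm_mult)
      also have "cnj (circle_pt x) * (circle_pt x - u) = cnj (1 - cnj u * circle_pt x)"
        using \<open>circle_pt x * cnj (circle_pt x) = 1\<close> by (simp add: algebra_simps)
      finally show ?thesis by (simp only: complex_mod_cnj)
    qed
    show ?thesis unfolding eq lp using True jensen_inside[of "cnj u"] jensen_on_circle[of "cnj u"]
      by (cases "cmod u = 1") auto
  next
    case False
    then have u0: "u \<noteq> 0" by auto
    have "cmod (inverse u) < 1" using False by (simp add: norm_inverse inverse_less_1_iff)
    note J = jensen_inside[OF this]
    have eq: "ln (cmod (circle_pt x - u)) = ln (cmod u) + ln (cmod (1 - inverse u * circle_pt x))" for x
    proof -
      have "cmod (inverse u * circle_pt x) < 1" using \<open>cmod (inverse u) < 1\<close> by (simp add: norm_mult)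
      then have ne: "1 - inverse u * circle_pt x \<noteq> 0" by auto
      have "cmod (circle_pt x - u) = cmod (u * (1 - inverse u * circle_pt x))"
        using u0 by (simp add: right_diff_distrib norm_minus_commute flip: mult.assoc)
      then show ?thesis using u0 ne by (simp only: norm_mult ln_mult zero_less_norm_iff)
          (simp add: ln_mult_pos)
    qed
    have lp: "log_plus u = ln (cmod u)" using False by (simp add: log_plus_def)
    have ic: "integrable unit_interval (\<lambda>x. ln (cmod u))"
      by (auto intro!: finite_measure.integrable_const prob_space.finite_measure prob_space_unit_interval)
    have mc: "(LINT x|unit_interval. ln (cmod u)) = ln (cmod u)"
      using prob_space.prob_space[OF prob_space_unit_interval] by simp
    show ?thesis unfolding eq lp using J ic mc by (simp add: Bochner_Integration.integral_add)
  qed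
  then show "integrable unit_interval (\<lambda>x. ln (cmod (circle_pt x - u)))"
    "(LINT x|unit_interval. ln (cmod (circle_pt x - u))) = log_plus u" by auto
qed

lemma jensen_multiset:
  "integrable unit_interval (\<lambda>x. ln (cmod (\<Prod>u\<in>#M. circle_pt x - u))) \<and>
   (LINT x|unit_interval. ln (cmod (\<Prod>u\<in>#M. circle_pt x - u))) = (\<Sum>u\<in>#M. log_plus u)"
proof (induction M)
  case (add u M)
  have "AE x in unit_interval. circle_pt x \<notin> insert u (set_mset M)"
    by (rule AE_circle_pt_notin) auto
  then have AE: "AE x in unit_interval. ln (cmod (circle_pt x - u)) + ln (cmod (\<Prod>u\<in>#M. circle_pt x - u))
     = ln (cmod (\<Prod>u\<in>#add_mset u M. circle_pt x - u))"
    by eventually_elim (auto simp: norm_mult ln_mult prod_mset_zero_iff)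
  have meas: "(\<lambda>x. ln (cmod (\<Prod>u\<in>#add_mset u M. circle_pt x - u))) \<in> borel_measurable unit_interval"
  proof -
    have "(\<lambda>x. poly (\<Prod>u\<in>#add_mset u M. [:-u, 1:]) (circle_pt x)) \<in> borel_measurable borel"
      by (intro borel_measurable_continuous_onI continuous_intros)
    then have "(\<lambda>x. \<Prod>u\<in>#add_mset u M. circle_pt x - u) \<in> borel_measurable borel"
      unfolding poly_prod_mset_linear .
    then show ?thesis by (intro measurable_unit_interval) simp
  qed
  have sum: "integrable unit_interval (\<lambda>x. ln (cmod (circle_pt x - u)) + ln (cmod (\<Prod>u\<in>#M. circle_pt x - u)))"
    "(LINT x|unit_interval. ln (cmod (circle_pt x - u)) + ln (cmod (\<Prod>u\<in>#M. circle_pt x - u)))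
     = (\<Sum>u\<in>#add_mset u M. log_plus u)"
    using add.IH jensen_linear[of u] by (simp_all add: Bochner_Integration.integral_add)
  show ?case
    using integrable_cong_AE_imp[OF sum(1) meas] integral_cong_AE[OF borel_measurable_integrable[OF sum(1)] meas AE] sum(2) AE
    by (auto elim!: AE_mp)
qed simp

lemma jensen:
  fixes F :: "complex poly"
  assumes "lead_coeff F = 1"
  shows "integrable unit_interval (\<lambda>x. ln (cmod (poly F (circle_pt x))))"
    and "(LINT x|unit_interval. ln (cmod (poly F (circle_pt x)))) = (\<Sum>u\<in>#proots F. log_plus u)"
  using jensen_multiset[of "proots F"] unfolding poly_monic_eq_prod_roots[OF assms] by auto

text \<open>One step of a telescoping comparison of the sum of k^(-1-a) with the corresponding
  integral.\<close>

lemma powr_neg_increment: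
  fixes a :: real
  assumes a: "a > 0" and k: "k \<ge> (2::nat)"
  shows "real k powr (-1 - a) \<le> (real (k - 1) powr (- a) - real k powr (- a)) / a"
proof -
  define t where "t = 1 / real k"
  have t: "0 < t" "t < 1" using k by (auto simp: t_def)
  have k1: "real (k - 1) = real k * (1 - t)" using k by (simp add: t_def algebra_simps of_nat_diff)
  have "ln (1 - t) \<le> - t" using t ln_le_minus_one[of "1 - t"] by simp
  then have "a * t \<le> - a * ln (1 - t)" using a mult_left_mono[of t "- ln (1 - t)" a] by simp
  then have "1 + a * t \<le> exp (- a * ln (1 - t))"
    using exp_ge_add_one_self[of "a * t"] by (meson exp_le_cancel_iff order_trans)
  also have "\<dots> = (1 - t) powr (- a)" using t by (simp add: powr_def)
  finally have "1 + a * t \<le> (1 - t) powr (- a)" .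
  then have "real k powr (- a) * (1 + a * t) \<le> real k powr (- a) * (1 - t) powr (- a)"
    by (intro mult_left_mono) auto
  also have "\<dots> = real (k - 1) powr (- a)" unfolding k1 using t by (subst powr_mult) auto
  also have "real k powr (- a) * (1 + a * t) = real k powr (- a) + a * (real k powr (- a) * t)"
    by (simp add: algebra_simps)
  also have "real k powr (- a) * t = real k powr (-1 - a)"
    using k by (simp add: t_def powr_diff powr_minus divide_inverse mult.commute)
  finally show ?thesis using a by (simp add: field_simps)
qed

lemma powr_tail_sum:
  fixes a :: real
  assumes a: "a > 0" and N: "N \<ge> (1::nat)"
  shows "summable (\<lambda>j. real (Suc (j + N)) powr (-1 - a))"
    and "(\<Sum>j. real (Suc (j + N)) powr (-1 - a)) \<le> real N powr (- a) / a"
proof -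
  define f where "f = (\<lambda>j. - (real (N + j) powr (- a)) / a)"
  have "(\<lambda>j. real (N + j) powr (- a)) \<longlonglongrightarrow> 0"
    using a by real_asymp
  then have "f \<longlonglongrightarrow> - 0 / a" unfolding f_def by (intro tendsto_intros) (use a in auto)
  then have "f \<longlonglongrightarrow> 0" by simp
  from telescope_sums[OF this] have f_sums: "(\<lambda>j. f (Suc j) - f j) sums (0 - f 0)" .
  have le: "real (Suc (j + N)) powr (-1 - a) \<le> f (Suc j) - f j" for j
    using powr_neg_increment[OF a, of "Suc (j + N)"] N
    by (simp add: f_def diff_divide_distrib add_ac)
  show s: "summable (\<lambda>j. real (Suc (j + N)) powr (-1 - a))"
    by (rule summable_comparison_test'[OF sums_summable[OF f_sums], of 0]) (use le in auto)
  have "(\<Sum>j. real (Suc (j + N)) powr (-1 - a)) \<le> (\<Sum>j. f (Suc j) - f j)"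
    by (rule suminf_le[OF le s sums_summable[OF f_sums]])
  also have "\<dots> = real N powr (- a) / a" using sums_unique[OF f_sums] by (simp add: f_def)
  finally show "(\<Sum>j. real (Suc (j + N)) powr (-1 - a)) \<le> real N powr (- a) / a" .
qed

lemma ln_power_series:
  fixes y :: real
  assumes "0 < y" "y \<le> 1"
  shows "(\<lambda>k. (1 - y) ^ Suc k / real (Suc k)) sums (- ln y)"
proof -
  have s: "summable (\<lambda>k. (1 - y) ^ Suc k / real (Suc k))"
  proof (rule summable_comparison_test')
    show "summable (\<lambda>k. (1 - y) ^ k)" using assms by (intro summable_geometric) auto
    fix k :: nat assume "k \<ge> 0"
    have "(1 - y) ^ Suc k / real (Suc k) \<le> (1 - y) ^ Suc k / 1"
      using assms by (intro divide_left_mono) auto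
    also have "\<dots> \<le> (1 - y) ^ k" using assms by (auto intro: mult_left_le_one_le)
    finally show "norm ((1 - y) ^ Suc k / real (Suc k)) \<le> (1 - y) ^ k" using assms by simp
  qed
  have "ln y = (\<Sum>n. (-1) ^ n * (1 / real (n + 1)) * (y - 1) ^ Suc n)"
    using assms by (intro ln_series) auto
  also have "(\<lambda>n. (-1) ^ n * (1 / real (n + 1)) * (y - 1) ^ Suc n) = (\<lambda>k. - ((1 - y) ^ Suc k / real (Suc k)))"
  proof
    fix n
    have "(y - 1) ^ Suc n = (-1) ^ Suc n * (1 - y) ^ Suc n"
      by (metis minus_diff_eq power_minus mult_minus1)
    then show "(-1) ^ n * (1 / real (n + 1)) * (y - 1) ^ Suc n = - ((1 - y) ^ Suc n / real (Suc n))"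
      by (simp add: field_simps flip: power_mult_distrib)
  qed
  also have "(\<Sum>k. - ((1 - y) ^ Suc k / real (Suc k))) = - (\<Sum>k. (1 - y) ^ Suc k / real (Suc k))"
    by (rule suminf_minus[OF s])
  finally show ?thesis using s summable_sums by fastforce
qed

text \<open>Moments of \<open>1 - X\<close> control the integral of \<open>ln X\<close> through the logarithmic series, so no separate
  estimate near the zeros of \<open>X\<close> is needed.\<close>

lemma log_integral_moments:
  fixes X :: "'a \<Rightarrow> real"
  assumes M: "prob_space M" and meas [measurable]: "X \<in> borel_measurable M"
    and X: "\<And>x. x \<in> space M \<Longrightarrow> 0 \<le> X x \<and> X x \<le> 1"
    and a: "a > 0" and B: "B \<ge> 0"
    and bd: "\<And>k. k \<ge> 1 \<Longrightarrow> (LINT x|M. (1 - X x) ^ k) \<le> B * real k powr (- a)"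
    and N: "N \<ge> (1::nat)"
  shows "AE x in M. X x > 0" "integrable M (\<lambda>x. ln (X x))"
    "\<bar>(LINT x|M. ln (X x)) + (\<Sum>k=1..N. (LINT x|M. (1 - X x) ^ k) / real k)\<bar> \<le> B / a * real N powr (- a)"
proof -
  interpret prob_space M by (rule M)
  define e where "e = (\<lambda>k. (LINT x|M. (1 - X x) ^ k))"
  have pw: "0 \<le> (1 - X x) ^ k" "(1 - X x) ^ k \<le> 1" if "x \<in> space M" for x k
    using X[OF that] by (auto intro: power_le_one)
  have int: "integrable M (\<lambda>x. (1 - X x) ^ k)" for k
    by (rule integrable_const_bound[of _ 1]) (use pw in \<open>auto intro!: AE_I2\<close>)
  have e0: "0 \<le> e k" for k unfolding e_def by (rule integral_nonneg_AE) (use pw in \<open>auto intro!: AE_I2\<close>)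
  have e_le: "e (Suc k) / real (Suc k) \<le> B * real (Suc k) powr (-1 - a)" for k
  proof -
    have "e (Suc k) / real (Suc k) \<le> B * real (Suc k) powr (- a) / real (Suc k)"
      unfolding e_def by (intro divide_right_mono bd) auto
    also have "\<dots> = B * real (Suc k) powr (-1 - a)" by (simp add: powr_diff powr_minus divide_inverse mult_ac)
    finally show ?thesis .
  qed
  have sm: "summable (\<lambda>k. e (Suc k) / real (Suc k))"
  proof -
    have "summable (\<lambda>j. B * real (Suc (j + 1)) powr (-1 - a))"
      by (intro summable_mult powr_tail_sum a) auto
    then have "summable (\<lambda>j. e (Suc (j + 1)) / real (Suc (j + 1)))"
    proof (rule summable_comparison_test'[of _ 0])
      fix n :: nat
      show "norm (e (Suc (n + 1)) / real (Suc (n + 1))) \<le> B * real (Suc (n + 1)) powr (-1 - a)"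
        using e_le[of "n + 1"] e0[of "Suc (n + 1)"] by (simp only: real_norm_def abs_divide abs_of_nonneg of_nat_0_le_iff)
    qed
    then show ?thesis by (subst (asm) summable_iff_shift)
  qed
  define S where "S = (\<Sum>k. e (Suc k) / real (Suc k))"
  have S0: "S \<ge> 0" unfolding S_def by (intro suminf_nonneg sm) (simp add: e0)
  have nn: "(\<integral>\<^sup>+x. ennreal ((1 - X x) ^ Suc k / real (Suc k)) \<partial>M) = ennreal (e (Suc k) / real (Suc k))" for k
  proof -
    have "(\<integral>\<^sup>+x. ennreal ((1 - X x) ^ Suc k / real (Suc k)) \<partial>M) = ennreal (LINT x|M. (1 - X x) ^ Suc k / real (Suc k))"
      by (rule nn_integral_eq_integral) (use int pw in \<open>auto intro!: AE_I2 divide_nonneg_nonneg simp del: power_Suc\<close>)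
    then show ?thesis by (simp add: e_def del: power_Suc)
  qed
  \<comment> \<open>All terms are nonnegative, so sum and integral commute before anything is known
    about ln X. Finiteness of the result then excludes X = 0 almost everywhere, where the series is
    harmonic, and yields the integrability of ln X.\<close>
  have nnS: "(\<integral>\<^sup>+x. (\<Sum>k. ennreal ((1 - X x) ^ Suc k / real (Suc k))) \<partial>M) = ennreal S"
  proof -
    have "(\<integral>\<^sup>+x. (\<Sum>k. ennreal ((1 - X x) ^ Suc k / real (Suc k))) \<partial>M)
       = (\<Sum>k. \<integral>\<^sup>+x. ennreal ((1 - X x) ^ Suc k / real (Suc k)) \<partial>M)"
      by (rule nn_integral_suminf) measurable
    also have "\<dots> = (\<Sum>k. ennreal (e (Suc k) / real (Suc k)))" unfolding nn ..
    also have "\<dots> = ennreal S" unfolding S_def by (rule suminf_ennreal2[OF _ sm]) (simp add: e0)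
    finally show ?thesis .
  qed
  have fin: "AE x in M. (\<Sum>k. ennreal ((1 - X x) ^ Suc k / real (Suc k))) \<noteq> \<infinity>"
    by (rule nn_integral_noteq_infinite) (use nnS in auto)
  show pos: "AE x in M. X x > 0"
    using fin AE_space
  proof eventually_elim
    case (elim x)
    show ?case
    proof (rule ccontr)
      assume "\<not> X x > 0"
      then have "X x = 0" using X[OF elim(2)] by simp
      then have "(\<Sum>k. ennreal (1 / real (Suc k))) \<noteq> \<infinity>" using elim(1) by simp
      then have "summable (\<lambda>k. 1 / real (Suc k))" by (intro summable_suminf_not_top) auto
      then show False using not_summable_harmonic[where 'a = real]
        by (subst (asm) summable_Suc_iff) (simp add: inverse_eq_divide)
    qed
  qed
  have eqln: "AE x in M. (\<Sum>k. ennreal ((1 - X x) ^ Suc k / real (Suc k))) = ennreal (- ln (X x))"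
    using pos AE_space
  proof eventually_elim
    case (elim x)
    have s: "(\<lambda>k. (1 - X x) ^ Suc k / real (Suc k)) sums - ln (X x)"
      by (rule ln_power_series) (use elim X[OF elim(2)] in auto)
    have "(\<Sum>k. ennreal ((1 - X x) ^ Suc k / real (Suc k))) = ennreal (\<Sum>k. (1 - X x) ^ Suc k / real (Suc k))"
      by (rule suminf_ennreal2[OF _ sums_summable[OF s]]) (intro divide_nonneg_nonneg pw[OF elim(2)], simp)
    then show ?case using sums_unique[OF s] by (simp only:)
  qed
  have lnneg: "AE x in M. 0 \<le> - ln (X x)"
    using pos AE_space by eventually_elim (use X in auto)
  have nnln: "(\<integral>\<^sup>+x. ennreal (- ln (X x)) \<partial>M) = ennreal S"
    using nn_integral_cong_AE[OF eqln] nnS by simp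
  have int_ln: "integrable M (\<lambda>x. - ln (X x))"
    by (rule integrableI_nn_integral_finite[OF _ lnneg nnln]) measurable
  then show "integrable M (\<lambda>x. ln (X x))" by simp
  have "(LINT x|M. - ln (X x)) = S"
    using integral_eq_nn_integral[OF _ lnneg] nnln S0 by simp
  then have lnS: "(LINT x|M. ln (X x)) = - S" by simp
  have "S = (\<Sum>j. e (Suc (j + N)) / real (Suc (j + N))) + (\<Sum>k<N. e (Suc k) / real (Suc k))"
    unfolding S_def by (rule suminf_split_initial_segment[OF sm])
  moreover have "(\<Sum>k<N. e (Suc k) / real (Suc k)) = (\<Sum>k=1..N. e k / real k)"
    by (rule sum.reindex_bij_witness[of _ "\<lambda>k. k - 1" Suc]) auto
  moreover have tail0: "0 \<le> (\<Sum>j. e (Suc (j + N)) / real (Suc (j + N)))"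
    using sm by (intro suminf_nonneg) (auto simp: e0 summable_iff_shift[of "\<lambda>k. e (Suc k) / real (Suc k)" N, simplified])
  moreover have "(\<Sum>j. e (Suc (j + N)) / real (Suc (j + N))) \<le> B / a * real N powr (- a)"
  proof -
    have "(\<Sum>j. e (Suc (j + N)) / real (Suc (j + N))) \<le> (\<Sum>j. B * real (Suc (j + N)) powr (-1 - a))"
    proof (rule suminf_le)
      show "e (Suc (j + N)) / real (Suc (j + N)) \<le> B * real (Suc (j + N)) powr (-1 - a)" for j by (rule e_le)
      show "summable (\<lambda>j. e (Suc (j + N)) / real (Suc (j + N)))"
        using sm summable_iff_shift[of "\<lambda>k. e (Suc k) / real (Suc k)" N] by simp
      show "summable (\<lambda>j. B * real (Suc (j + N)) powr (-1 - a))"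
        by (intro summable_mult powr_tail_sum a N)
    qed
    also have "\<dots> = B * (\<Sum>j. real (Suc (j + N)) powr (-1 - a))"
      by (rule suminf_mult[OF powr_tail_sum(1)[OF a N]])
    also have "\<dots> \<le> B * (real N powr (- a) / a)" by (intro mult_left_mono powr_tail_sum a N B)
    finally show ?thesis by simp
  qed
  ultimately show "\<bar>(LINT x|M. ln (X x)) + (\<Sum>k=1..N. (LINT x|M. (1 - X x) ^ k) / real k)\<bar> \<le> B / a * real N powr (- a)"
    unfolding lnS by (simp add: e_def)
qed

section \<open>Integer polynomials and products over roots\<close>

abbreviation cpoly :: "int poly \<Rightarrow> complex poly" where
  "cpoly \<equiv> map_poly complex_of_int"

lemma common_root_resultant_0:
  fixes f g :: "complex poly"
  assumes "f \<noteq> 0 \<or> g \<noteq> 0" "poly f z = 0" "poly g z = 0"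
  shows "resultant f g = 0"
proof -
  have "[:-z, 1:] dvd gcd f g" using assms by (simp add: poly_eq_0_iff_dvd)
  moreover have "gcd f g \<noteq> 0" using assms by auto
  ultimately have "degree (gcd f g) \<ge> degree [:-z, 1:]" by (intro dvd_imp_degree_le) auto
  then show ?thesis by (simp add: resultant_0_gcd)
qed

lemma resultant_nonzero:
  fixes f g :: "complex poly"
  assumes "\<not> (\<exists>z. poly f z = 0 \<and> poly g z = 0)"
  shows "resultant f g \<noteq> 0"
proof
  assume "resultant f g = 0"
  then have "degree (gcd f g) \<noteq> 0" by (simp add: resultant_0_gcd)
  then obtain z where "poly (gcd f g) z = 0"
    using fundamental_theorem_of_algebra[of "gcd f g"] by (auto simp: constant_degree)
  then have "[:-z, 1:] dvd f" "[:-z, 1:] dvd g"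
    by (auto simp: poly_eq_0_iff_dvd intro: dvd_trans)
  then have "poly f z = 0" "poly g z = 0" by (simp_all add: poly_eq_0_iff_dvd)
  with assms show False by blast
qed

text \<open>A common root makes the integer resultant vanish, so the gcd over the integers has
  positive degree; being prime, f divides this gcd.\<close>

lemma prime_dvd_of_common_root:
  fixes f g :: "int poly"
  assumes f: "prime_elem f" and z: "poly (cpoly f) z = 0" "poly (cpoly g) z = 0"
  shows "f dvd g"
proof (cases "g = 0")
  case False
  have f0: "f \<noteq> 0" using f by auto
  have "complex_of_int (resultant f g) = resultant (cpoly f) (cpoly g)"
    by (rule of_int_hom.resultant_hom[symmetric])
  also have "\<dots> = 0" by (rule common_root_resultant_0[OF _ z]) (use f0 in auto)
  finally have "resultant f g = 0" by simp
  then have "degree (gcd f g) \<noteq> 0" by (simp add: resultant_0_gcd)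
  then have nu: "\<not> gcd f g dvd 1" by (metis is_unit_iff_degree not_is_unit_0 degree_1 dvd_imp_degree_le le_zero_eq one_neq_zero)
  obtain h where h: "f = gcd f g * h" by (meson dvdE gcd_dvd1)
  then have "f dvd gcd f g \<or> f dvd h" using f by (metis dvd_refl prime_elem_dvd_multD)
  then show ?thesis
  proof
    assume "f dvd h"
    then obtain k where "h = f * k" by auto
    then have "f * 1 = f * (gcd f g * k)" using h by (metis mult.left_commute mult_1_right)
    then have "gcd f g * k = 1" using f0 by (metis mult_left_cancel)
    then show ?thesis using nu by (metis dvd_triv_left)
  qed (metis dvd_trans gcd_dvd2)
qed simp

lemma prime_poly_distinct_roots:
  fixes f :: "int poly"
  assumes f: "prime_elem f" and deg: "degree f > 0" and z: "poly (cpoly f) z = 0"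
  shows "order z (cpoly f) = 1"
proof (rule ccontr)
  assume ne: "order z (cpoly f) \<noteq> 1"
  have f0: "cpoly f \<noteq> 0" using deg by auto
  have o0: "order z (cpoly f) \<noteq> 0" using z f0 by (simp add: order_root)
  have pd0: "pderiv (cpoly f) \<noteq> 0" using deg by (simp add: pderiv_eq_0_iff)
  have "order z (cpoly f) = Suc (order z (pderiv (cpoly f)))" by (rule order_pderiv[OF f0 z])
  then have "order z (pderiv (cpoly f)) \<noteq> 0" using ne by linarith
  then have "poly (pderiv (cpoly f)) z = 0" by (meson order_root)
  moreover have "pderiv (cpoly f) = cpoly (pderiv f)" by (simp add: of_int_hom.map_poly_pderiv)
  ultimately have z': "poly (cpoly (pderiv f)) z = 0" by simp
  have "f dvd pderiv f" by (rule prime_dvd_of_common_root[OF f z z'])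
  then show False using deg by simp
qed

text \<open>For monic f this is the resultant of f and g, that is, the norm of g(X) from the algebra
  of polynomials modulo f.\<close>

definition root_norm :: "int poly \<Rightarrow> int poly \<Rightarrow> complex" where
  "root_norm f g = (\<Prod>z\<in>#proots (cpoly f). poly (cpoly g) z)"

text \<open>M is the integer matrix of multiplication by g on the powers of X modulo f. The
  Vandermonde matrix V of the roots, invertible because they are distinct, conjugates M to the
  diagonal matrix D of the values of g; so the product of these values is det M.\<close>

lemma root_norm_integer:
  fixes f :: "int poly"
  assumes f: "prime_elem f" and deg: "degree f > 0" and monic: "lead_coeff f = 1"
  obtains k :: int where "root_norm f g = of_int k"
proof -
  define d where "d = degree f"
  have f0: "f \<noteq> 0" "cpoly f \<noteq> 0" using deg by auto
  obtain zs where zs: "mset zs = proots (cpoly f)" using ex_mset by blast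
  have len: "length zs = d"
    using size_proots_complex[of "cpoly f"] zs by (metis d_def size_mset of_int_hom.degree_map_poly_hom)
  have cnt: "count (mset zs) z \<le> 1" for z
    unfolding zs using prime_poly_distinct_roots[OF f deg, of z] f0
    by (cases "poly (cpoly f) z = 0") (auto simp: order_root)
  have dist: "distinct zs"
    unfolding distinct_count_atmost_1
    by (metis cnt antisym count_greater_eq_one_iff not_in_iff set_mset_mset)
  have root: "poly (cpoly f) (zs ! i) = 0" if "i < d" for i
  proof -
    have "zs ! i \<in># proots (cpoly f)" using that len zs by (metis nth_mem set_mset_mset)
    then show ?thesis using f0 by simp
  qed
  \<comment> \<open>As f is monic, pseudo-division is division with remainder over the
    integers.\<close>
  define r where "r = (\<lambda>k. snd (pseudo_divmod (monom 1 k * g) f))"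
  define q where "q = (\<lambda>k. fst (pseudo_divmod (monom 1 k * g) f))"
  have r: "monom 1 k * g = f * q k + r k" "r k = 0 \<or> degree (r k) < d" for k
    using pseudo_divmod[OF f0(1), of "monom 1 k * g" "q k" "r k"] monic
    by (auto simp: q_def r_def d_def)
  have reval: "(\<Sum>l<d. of_int (coeff (r k) l) * zs ! i ^ l) = zs ! i ^ k * poly (cpoly g) (zs ! i)" if "i < d" for i k
  proof -
    have "cpoly (monom 1 k * g) = cpoly (f * q k + r k)" using r(1)[of k] by simp
    then have "poly (cpoly (monom 1 k) * cpoly g) (zs ! i) = poly (cpoly f * cpoly (q k) + cpoly (r k)) (zs ! i)"
      by (simp add: hom_distribs)
    then have "zs ! i ^ k * poly (cpoly g) (zs ! i) = poly (cpoly (r k)) (zs ! i)"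
      using root[OF that] by (simp add: map_poly_monom poly_monom)
    also have "\<dots> = (\<Sum>l\<le>degree (cpoly (r k)). coeff (cpoly (r k)) l * zs ! i ^ l)" by (rule poly_altdef)
    also have "\<dots> = (\<Sum>l<d. coeff (cpoly (r k)) l * zs ! i ^ l)"
      using r(2)[of k] deg by (intro sum.mono_neutral_left) (auto simp: coeff_eq_0 d_def)
    finally show ?thesis by simp
  qed
  define M where "M = mat d d (\<lambda>(k, l). coeff (r k) l)"
  define V where "V = mat d d (\<lambda>(l, i). zs ! i ^ l)"
  define D where "D = mat d d (\<lambda>(i, j). if i = j then poly (cpoly g) (zs ! i) else 0)"
  have carrier: "map_mat complex_of_int M \<in> carrier_mat d d" "V \<in> carrier_mat d d" "D \<in> carrier_mat d d"
    by (auto simp: M_def V_def D_def)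
  have "map_mat complex_of_int M * V = V * D"
  proof (rule eq_matI)
    fix k i assume "k < dim_row (V * D)" "i < dim_col (V * D)"
    then have ki: "k < d" "i < d" by (auto simp: V_def D_def)
    have "(map_mat complex_of_int M * V) $$ (k, i) = (\<Sum>l = 0..<d. of_int (coeff (r k) l) * zs ! i ^ l)"
      using ki by (simp add: M_def V_def scalar_prod_def)
    also have "\<dots> = zs ! i ^ k * poly (cpoly g) (zs ! i)" using reval[OF ki(2)] by (simp add: atLeast0LessThan)
    also have "\<dots> = (\<Sum>l = 0..<d. zs ! l ^ k * (if l = i then poly (cpoly g) (zs ! l) else 0))"
      using ki by (simp add: if_distrib[of "\<lambda>x. _ * x"] sum.delta cong: if_cong)
    also have "\<dots> = (V * D) $$ (k, i)"
      using ki by (simp add: V_def D_def scalar_prod_def)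
    finally show "(map_mat complex_of_int M * V) $$ (k, i) = (V * D) $$ (k, i)" .
  qed (auto simp: M_def V_def D_def)
  then have "det (map_mat complex_of_int M) * det V = det V * det D"
    unfolding det_mult[OF carrier(1,2), symmetric] det_mult[OF carrier(2,3), symmetric] by simp
  moreover have "det V \<noteq> 0"
  proof
    assume "det V = 0"
    then have "det (transpose_mat V) = 0" using det_transpose[OF carrier(2)] by simp
    then obtain v where v: "v \<in> carrier_vec d" "v \<noteq> 0\<^sub>v d" "transpose_mat V *\<^sub>v v = 0\<^sub>v d"
      using det_0_iff_vec_prod_zero_field[of "transpose_mat V" d] carrier(2) by auto
    define P where "P = (\<Sum>l<d. monom (v $ l) l)"
    have P_coeff: "coeff P l = (if l < d then v $ l else 0)" for l
      by (simp add: P_def coeff_sum sum.delta)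
    have P0: "P \<noteq> 0"
    proof
      assume "P = 0"
      then have "v $ l = 0" if "l < d" for l using P_coeff[of l] that by simp
      then have "v = 0\<^sub>v d" using v(1) by (intro eq_vecI) auto
      with v(2) show False by simp
    qed
    have "poly P (zs ! i) = 0" if "i < d" for i
    proof -
      have "(transpose_mat V *\<^sub>v v) $ i = 0" using v(3) that by simp
      then have "(\<Sum>l = 0..<d. zs ! i ^ l * v $ l) = 0"
        using that v(1) carrier(2) by (simp add: scalar_prod_def V_def)
      then show ?thesis by (simp add: P_def poly_sum poly_monom atLeast0LessThan mult.commute)
    qed
    then have "set zs \<subseteq> {z. poly P z = 0}" by (auto simp: in_set_conv_nth len)
    moreover have "finite {z. poly P z = 0}" "card {z. poly P z = 0} \<le> degree P"
      using P0 by (auto intro: poly_roots_finite card_poly_roots_bound)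
    ultimately have "card (set zs) \<le> degree P" using card_mono order_trans by blast
    then have "d \<le> degree P" using dist len by (simp add: distinct_card)
    moreover have "degree P < d" using deg P0 P_coeff[of "degree P"] d_def by (auto split: if_splits)
    ultimately show False by simp
  qed
  ultimately have "det D = of_int (det M)" by (simp add: comm_ring_hom.hom_det[OF of_int_hom.comm_ring_hom_axioms])
  moreover have "det D = root_norm f g"
  proof -
    have "det D = prod_list (diag_mat D)"
      by (rule det_upper_triangular[OF _ carrier(3)]) (auto simp: D_def upper_triangular_def)
    also have "diag_mat D = map (\<lambda>z. poly (cpoly g) z) zs"
      by (rule nth_equalityI) (auto simp: diag_mat_def D_def len)
    also have "prod_list \<dots> = root_norm f g"
      unfolding root_norm_def zs[symmetric] by (simp only: mset_map[symmetric] prod_mset_prod_list)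
    finally show ?thesis .
  qed
  ultimately show ?thesis using that by metis
qed

lemma root_norm_ge_1:
  fixes f :: "int poly"
  assumes f: "prime_elem f" "degree f > 0" "lead_coeff f = 1"
    and nz: "\<And>z. poly (cpoly f) z = 0 \<Longrightarrow> poly (cpoly g) z \<noteq> 0"
  shows "cmod (root_norm f g) \<ge> 1"
proof -
  obtain k :: int where k: "root_norm f g = of_int k" using root_norm_integer[OF f] by blast
  have "cpoly f \<noteq> 0" using f by auto
  then have "root_norm f g \<noteq> 0" using nz by (auto simp: root_norm_def prod_mset_zero_iff)
  then have "k \<noteq> 0" using k by auto
  then show ?thesis using k by simp
qed

text \<open>P and Q are polynomials in y with polynomial coefficients in s. Expanding the Sylvester
  determinant bounds the degree in s of their resultant, which is nonzero because at x0 it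
  specialises to the resultant of two polynomials without common root. The leading coefficients may
  vanish at other points s, so there the specialised Sylvester matrix is shown directly to have a
  kernel vector.\<close>

lemma common_zero_count:
  fixes P Q :: "complex poly poly"
  assumes hP: "\<And>i. degree (coeff P i) \<le> h" and hQ: "\<And>i. degree (coeff Q i) \<le> h"
    and lP: "poly (lead_coeff P) x0 \<noteq> 0" and lQ: "poly (lead_coeff Q) x0 \<noteq> 0"
    and nc: "\<And>y. \<not> (poly (map_poly (\<lambda>c. poly c x0) P) y = 0 \<and> poly (map_poly (\<lambda>c. poly c x0) Q) y = 0)"
    and pos: "degree P + degree Q > 0"
  shows "finite {s. \<exists>y. y \<noteq> 0 \<and> poly (map_poly (\<lambda>c. poly c s) P) y = 0 \<and> poly (map_poly (\<lambda>c. poly c s) Q) y = 0}" (is "finite ?S")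
    and "card {s. \<exists>y. y \<noteq> 0 \<and> poly (map_poly (\<lambda>c. poly c s) P) y = 0 \<and> poly (map_poly (\<lambda>c. poly c s) Q) y = 0}
       \<le> (degree P + degree Q) * h"
proof -
  define N where "N = degree P + degree Q"
  define R where "R = resultant P Q"
  have entry: "degree (sylvester_mat P Q $$ (i, j)) \<le> h" if "i < N" "j < N" for i j
    using that hP hQ by (subst sylvester_index_mat) (auto simp: N_def)
  have "degree R \<le> N * h"
    unfolding R_def resultant_def det_def'[OF sylvester_carrier_mat]
  proof (rule degree_sum_le)
    show "finite {p. p permutes {0..<degree P + degree Q}}" by (simp add: finite_permutations)
    fix p assume p: "p \<in> {p. p permutes {0..<degree P + degree Q}}"
    then have pin: "p i < N" if "i < N" for i
      using that permutes_in_image[of p "{0..<N}" i] by (simp add: N_def)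
    have "degree (signof p * (\<Prod>i = 0..<degree P + degree Q. sylvester_mat P Q $$ (i, p i)))
       = degree (\<Prod>i = 0..<N. sylvester_mat P Q $$ (i, p i))"
      by (auto simp: sign_def N_def)
    also have "\<dots> \<le> (\<Sum>i = 0..<N. degree (sylvester_mat P Q $$ (i, p i)))"
      using degree_prod_sum_le[of "{0..<N}" "\<lambda>i. sylvester_mat P Q $$ (i, p i)"] by (simp add: o_def)
    also have "\<dots> \<le> (\<Sum>i = 0..<N. h)" by (intro sum_mono entry pin) auto
    finally show "degree (signof p * (\<Prod>i = 0..<degree P + degree Q. sylvester_mat P Q $$ (i, p i))) \<le> N * h"
      by simp
  qed
  moreover have R0: "R \<noteq> 0"
  proof
    assume "R = 0"
    then have "poly (resultant P Q) x0 = 0" by (simp add: R_def)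
    moreover have "resultant (map_poly (\<lambda>c. poly c x0) P) (map_poly (\<lambda>c. poly c x0) Q) = poly (resultant P Q) x0"
      by (rule comm_ring_hom.resultant_map_poly[OF poly_hom.comm_ring_hom_axioms]) (use lP lQ in \<open>auto intro: degree_map_poly\<close>)
    ultimately show False using resultant_nonzero nc by metis
  qed
  moreover have sub: "?S \<subseteq> {s. poly R s = 0}"
  proof safe
    fix s y
    assume y0: "y \<noteq> 0" and y: "poly (map_poly (\<lambda>c. poly c s) P) y = 0" "poly (map_poly (\<lambda>c. poly c s) Q) y = 0"
    define A where "A = map_mat (\<lambda>c. poly c s) (sylvester_mat P Q)"
    have A: "A \<in> carrier_mat N N" using sylvester_carrier_mat[of P Q] by (simp add: A_def N_def)
    \<comment> \<open>Powers N down to 1 rather than N - 1 down to 0: entry j then meets the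
      coefficient N - j of a shifted multiple of P or Q, and y nonzero makes the vector
      nonzero.\<close>
    define v where "v = vec N (\<lambda>j. y ^ (N - j))"
    interpret ph: map_poly_comm_ring_hom "\<lambda>c::complex poly. poly c s" ..
    have ev: "(\<Sum>j = 0..<N. poly (coeff (monom 1 (Suc l) * W) (N - j)) s * y ^ (N - j)) = 0"
      if W: "poly (map_poly (\<lambda>c. poly c s) W) y = 0" and deg: "Suc l + degree W \<le> N" for W l
    proof -
      let ?W = "monom 1 (Suc l) * W"
      let ?V = "map_poly (\<lambda>c. poly c s) ?W"
      have "degree ?W \<le> N" using deg degree_mult_le[of "monom 1 (Suc l)" W] by (simp add: degree_monom_eq)
      then have dV: "degree ?V \<le> N" using degree_map_poly_le le_trans by blast
      have "?V = map_poly (\<lambda>c. poly c s) (monom 1 (Suc l)) * map_poly (\<lambda>c. poly c s) W"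
        by (rule ph.hom_mult)
      then have "poly ?V y = 0" using W by simp
      moreover have "poly ?V y = (\<Sum>k\<le>degree ?V. coeff ?V k * y ^ k)" by (rule poly_altdef)
      moreover have "\<dots> = (\<Sum>k\<le>N. coeff ?V k * y ^ k)"
      proof (rule sum.mono_neutral_left)
        show "{..degree ?V} \<subseteq> {..N}" using dV by auto
        show "\<forall>i\<in>{..N} - {..degree ?V}. coeff ?V i * y ^ i = 0"
        proof
          fix i assume "i \<in> {..N} - {..degree ?V}"
          then have "coeff ?V i = 0" by (intro coeff_eq_0) simp
          then show "coeff ?V i * y ^ i = 0" by (simp only: mult_zero_left)
        qed
      qed simp
      moreover have "\<dots> = (\<Sum>k\<le>N. poly (coeff ?W k) s * y ^ k)" by (simp add: coeff_map_poly)
      moreover have "\<dots> = (\<Sum>k=Suc 0..N. poly (coeff ?W k) s * y ^ k)"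
        by (rule sum.mono_neutral_right) (auto simp: coeff_monom_mult)
      moreover have "\<dots> = (\<Sum>j = 0..<N. poly (coeff ?W (N - j)) s * y ^ (N - j))"
        by (rule sum.reindex_bij_witness[of _ "\<lambda>j. N - j" "\<lambda>k. N - k"]) auto
      ultimately show ?thesis by (simp only:)
    qed
    have "A *\<^sub>v v = 0\<^sub>v N"
    proof (rule eq_vecI)
      fix i assume "i < dim_vec (0\<^sub>v N :: complex vec)"
      then have i: "i < N" by simp
      have "(A *\<^sub>v v) $ i = (\<Sum>j = 0..<N. poly (sylvester_mat P Q $$ (i, j)) s * y ^ (N - j))"
        using i A by (simp add: scalar_prod_def A_def v_def N_def)
      also have "\<dots> = 0"
      proof (cases "i < degree Q")
        case True
        have "(\<Sum>j = 0..<N. poly (sylvester_mat P Q $$ (i, j)) s * y ^ (N - j))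
           = (\<Sum>j = 0..<N. poly (coeff (monom 1 (Suc (degree Q - i - 1)) * P) (N - j)) s * y ^ (N - j))"
        proof (intro sum.cong refl)
          fix j assume "j \<in> {0..<N}"
          then have j: "j < degree P + degree Q" by (simp add: N_def)
          have "Suc (degree Q - i - 1) = degree Q - i" using True by simp
          then show "poly (sylvester_mat P Q $$ (i, j)) s * y ^ (N - j)
            = poly (coeff (monom 1 (Suc (degree Q - i - 1)) * P) (N - j)) s * y ^ (N - j)"
            using sylvester_index_mat2[OF i[unfolded N_def] j] True by (simp only: N_def if_True)
        qed
        then show ?thesis using ev[OF y(1), of "degree Q - i - 1"] True by (simp add: N_def)
      next
        case False
        have "(\<Sum>j = 0..<N. poly (sylvester_mat P Q $$ (i, j)) s * y ^ (N - j))
           = (\<Sum>j = 0..<N. poly (coeff (monom 1 (Suc (N - i - 1)) * Q) (N - j)) s * y ^ (N - j))"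
        proof (intro sum.cong refl)
          fix j assume "j \<in> {0..<N}"
          then have j: "j < degree P + degree Q" by (simp add: N_def)
          have "Suc (N - i - 1) = N - i" using i by simp
          then show "poly (sylvester_mat P Q $$ (i, j)) s * y ^ (N - j)
            = poly (coeff (monom 1 (Suc (N - i - 1)) * Q) (N - j)) s * y ^ (N - j)"
            using sylvester_index_mat2[OF i[unfolded N_def] j] False by (simp only: N_def if_False)
        qed
        then show ?thesis using ev[OF y(2), of "N - i - 1"] False i by (simp add: N_def)
      qed
      finally show "(A *\<^sub>v v) $ i = 0\<^sub>v N $ i" using i by simp
    qed (use A in simp)
    moreover have "v \<noteq> 0\<^sub>v N"
    proof
      assume "v = 0\<^sub>v N"
      moreover have "v $ 0 \<noteq> 0" using pos y0 by (simp add: v_def N_def)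
      ultimately show False using pos by (simp add: N_def)
    qed
    ultimately have "det A = 0"
      using det_0_iff_vec_prod_zero_field[OF A] by (metis v_def vec_carrier)
    then show "poly R s = 0" unfolding R_def resultant_def A_def by (simp add: comm_ring_hom.hom_det[OF poly_hom.comm_ring_hom_axioms])
  qed
  ultimately have fin: "finite {s. poly R s = 0}" and sub: "?S \<subseteq> {s. poly R s = 0}" and dR: "degree R \<le> N * h"
    using poly_roots_finite by auto
  show "finite ?S" by (rule finite_subset[OF sub fin])
  have "card ?S \<le> card {s. poly R s = 0}" by (rule card_mono[OF fin sub])
  also have "\<dots> \<le> degree R" using R0 by (rule card_poly_roots_bound)
  also note dR
  finally show "card ?S \<le> (degree P + degree Q) * h" by (simp add: N_def)
qed

section \<open>Common zeros of sparse polynomials on a torus\<close>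

text \<open>Tropical principle: a largest term that exceeds every other one by a factor above N
  cannot be cancelled by at most N - 1 others. On the logarithmic scale the maximum is attained
  twice, up to ln N.\<close>

lemma vanishing_sum_max_twice:
  fixes a :: "nat \<Rightarrow> complex"
  assumes I: "finite I" "I \<noteq> {}" "card I \<le> N" and nz: "\<And>j. j \<in> I \<Longrightarrow> a j \<noteq> 0" and s: "(\<Sum>j\<in>I. a j) = 0"
  obtains i j where "i \<in> I" "j \<in> I" "i \<noteq> j" "\<And>k. k \<in> I \<Longrightarrow> cmod (a k) \<le> cmod (a i)"
    "ln (cmod (a i)) - ln (cmod (a j)) \<le> ln (real N)"
proof -
  obtain i where i: "i \<in> I" "\<And>k. k \<in> I \<Longrightarrow> cmod (a k) \<le> cmod (a i)"
  proof -
    have "Max ((\<lambda>k. cmod (a k)) ` I) \<in> (\<lambda>k. cmod (a k)) ` I" using I by (intro Max_in) auto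
    then obtain i where "i \<in> I" "Max ((\<lambda>k. cmod (a k)) ` I) = cmod (a i)" by auto
    moreover have "cmod (a k) \<le> Max ((\<lambda>k. cmod (a k)) ` I)" if "k \<in> I" for k
      using I that by (intro Max_ge) auto
    ultimately show ?thesis using that by metis
  qed
  have "\<exists>j\<in>I - {i}. cmod (a i) \<le> real N * cmod (a j)"
  proof (rule ccontr)
    assume "\<not> ?thesis"
    then have lt: "real N * cmod (a j) < cmod (a i)" if "j \<in> I - {i}" for j using that by force
    have N: "N > 0" using I by (metis card_gt_0_iff gr0I le_zero_eq)
    have "a i = - (\<Sum>j\<in>I - {i}. a j)" using s i(1) I(1) by (simp add: sum.remove[of I i] eq_neg_iff_add_eq_0)
    then have "real N * cmod (a i) = real N * cmod (\<Sum>j\<in>I - {i}. a j)" by simp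
    also have "\<dots> \<le> real N * (\<Sum>j\<in>I - {i}. cmod (a j))" by (intro mult_left_mono norm_sum) auto
    also have "\<dots> = (\<Sum>j\<in>I - {i}. real N * cmod (a j))" by (rule sum_distrib_left)
    also have "\<dots> \<le> (\<Sum>j\<in>I - {i}. cmod (a i))" by (intro sum_mono less_imp_le lt)
    also have "\<dots> = real (card I - 1) * cmod (a i)" using i(1) by simp
    also have "\<dots> < real N * cmod (a i)" using nz[OF i(1)] I N by (intro mult_strict_right_mono) auto
    finally show False by simp
  qed
  then obtain j where j: "j \<in> I" "j \<noteq> i" "cmod (a i) \<le> real N * cmod (a j)" by auto
  have N: "N > 0" using I by (metis card_gt_0_iff gr0I le_zero_eq)
  have "ln (cmod (a i)) \<le> ln (real N * cmod (a j))" using j nz i(1) N by (subst ln_le_cancel_iff) auto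
  also have "\<dots> = ln (real N) + ln (cmod (a j))" using nz[OF j(1)] N by (simp add: ln_mult)
  finally show ?thesis using that[OF i(1) j(1) j(2)[symmetric] i(2)] by simp
qed

text \<open>Eliminating \<tau> leaves T times an integer determinant, of absolute value at most 2 c
  M < T.\<close>

lemma two_linear_forms_small:
  fixes x1 y1 x2 y2 :: int and T \<tau> c M :: real
  assumes 1: "\<bar>T * x1 + \<tau> * y1\<bar> \<le> c" and 2: "\<bar>T * x2 + \<tau> * y2\<bar> \<le> c"
    and y: "\<bar>real_of_int y1\<bar> \<le> M" "\<bar>real_of_int y2\<bar> \<le> M" and T: "T > 2 * c * M" "T > 0"
  shows "x1 * y2 = x2 * y1"
proof (rule ccontr)
  assume "x1 * y2 \<noteq> x2 * y1"
  then have "\<bar>x1 * y2 - x2 * y1\<bar> \<ge> 1" by linarith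
  then have "1 \<le> real_of_int \<bar>x1 * y2 - x2 * y1\<bar>" by (simp only: of_int_1_le_iff)
  then have ge: "T \<le> T * \<bar>real_of_int (x1 * y2 - x2 * y1)\<bar>" using T(2) by simp
  have "T * real_of_int (x1 * y2 - x2 * y1) = (T * x1 + \<tau> * y1) * y2 - (T * x2 + \<tau> * y2) * y1"
    by (simp add: algebra_simps)
  then have "T * \<bar>real_of_int (x1 * y2 - x2 * y1)\<bar> = \<bar>(T * x1 + \<tau> * y1) * y2 - (T * x2 + \<tau> * y2) * y1\<bar>"
    using T(2) by (metis abs_mult abs_of_pos)
  also have "\<dots> \<le> \<bar>T * x1 + \<tau> * y1\<bar> * \<bar>real_of_int y2\<bar> + \<bar>T * x2 + \<tau> * y2\<bar> * \<bar>real_of_int y1\<bar>"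
    by (metis abs_mult abs_triangle_ineq4)
  also have "\<dots> \<le> c * M + c * M" using 1 2 y by (intro add_mono mult_mono) auto
  also have "c * M + c * M = 2 * c * M" by simp
  finally show False using ge T(1) by linarith
qed

lemma linear_form_small:
  fixes x1 :: int and T c :: real
  assumes "\<bar>T * x1\<bar> \<le> c" "T > c" "T > 0"
  shows "x1 = 0"
proof (rule ccontr)
  assume "x1 \<noteq> 0"
  then have "1 \<le> real_of_int \<bar>x1\<bar>" by linarith
  then have "T * 1 \<le> T * \<bar>real_of_int x1\<bar>" using assms(3) by (intro mult_left_mono) auto
  moreover have "\<bar>T * x1\<bar> = T * \<bar>real_of_int x1\<bar>" using assms(3) by (simp add: abs_mult)
  ultimately show False using assms by linarith
qed

lemma ln_norm_monomial:
  assumes "Y \<noteq> 0"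
  shows "ln (cmod (of_real (exp T) powi a * Y powi b)) = T * of_int a + ln (cmod Y) * of_int b"
proof -
  have "cmod (of_real (exp T) powi a * Y powi b) = exp T powi a * cmod Y powi b"
    by (simp add: norm_mult norm_power_int)
  also have "ln \<dots> = ln (exp T powi a) + ln (cmod Y powi b)"
    using assms by (subst ln_mult) auto
  also have "ln (exp T powi a) = T * of_int a" by (simp add: powr_real_of_int'[symmetric] ln_powr)
  also have "ln (cmod Y powi b) = ln (cmod Y) * of_int b"
    using assms by (simp add: powr_real_of_int'[symmetric] ln_powr)
  finally show ?thesis .
qed

text \<open>At \<open>X = exp T\<close> with \<open>T\<close> large the largest terms of a vanishing sum must have nearly equal size, which
  forces two differences of exponent vectors to be parallel.\<close>

lemma no_common_zero_disjoint:
  fixes x y :: "nat \<Rightarrow> int"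
  assumes I: "finite I" "I \<noteq> {}" "card I \<le> N" and J: "finite J" "J \<noteq> {}" "card J \<le> N" and disj: "I \<inter> J = {}"
    and nv: "\<And>i j. i \<in> I \<Longrightarrow> j \<in> I \<Longrightarrow> i \<noteq> j \<Longrightarrow> y i = y j \<Longrightarrow> x i \<noteq> x j"
    and par: "\<And>i j k l. i \<in> I \<Longrightarrow> j \<in> I \<Longrightarrow> i \<noteq> j \<Longrightarrow> k \<in> J \<Longrightarrow> l \<in> J \<Longrightarrow> k \<noteq> l
       \<Longrightarrow> (x i - x j) * (y k - y l) = (x k - x l) * (y i - y j) \<Longrightarrow> y i = y j"
    and yM: "\<And>i. i \<in> I \<union> J \<Longrightarrow> \<bar>y i\<bar> \<le> m"
  shows "\<exists>X0>0. \<forall>Y. Y \<noteq> 0 \<longrightarrow> \<not> ((\<Sum>j\<in>I. of_real X0 powi x j * Y powi y j) = 0 \<and>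
       (\<Sum>j\<in>J. of_real X0 powi x j * Y powi y j) = (0::complex))"
proof -
  define c where "c = ln (real N)"
  define M where "M = real_of_int (2 * m)"
  \<comment> \<open>Above 2 c M for \<open>two_linear_forms_small\<close> and above c for
    \<open>linear_form_small\<close>; M bounds the differences of the y i.\<close>
  define T where "T = 2 * c * M + c + 1"
  have N: "N > 0" using I by (metis card_gt_0_iff gr0I le_zero_eq)
  have c0: "c \<ge> 0" using N by (simp add: c_def)
  obtain i0 where "i0 \<in> I" using I by auto
  have M0: "M \<ge> 0" using yM[of i0] \<open>i0 \<in> I\<close> by (simp add: M_def)
  have T: "T > 2 * c * M" "T > c" "T > 0" using c0 M0 by (auto simp: T_def add_nonneg_pos)
  have yM2: "\<bar>real_of_int (y i - y j)\<bar> \<le> M" if "i \<in> I \<union> J" "j \<in> I \<union> J" for i j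
    using yM[OF that(1)] yM[OF that(2)] unfolding M_def by linarith
  show ?thesis
  proof (intro exI[of _ "exp T"] conjI allI impI notI)
    fix Y :: complex assume Y: "Y \<noteq> 0"
    assume *: "(\<Sum>j\<in>I. of_real (exp T) powi x j * Y powi y j) = 0 \<and> (\<Sum>j\<in>J. of_real (exp T) powi x j * Y powi y j) = 0"
    define \<tau> where "\<tau> = ln (cmod Y)"
    note lnm = ln_norm_monomial[OF Y, of T, folded \<tau>_def]
    obtain i j where ij: "i \<in> I" "j \<in> I" "i \<noteq> j"
      "\<And>k. k \<in> I \<Longrightarrow> cmod (of_real (exp T) powi x k * Y powi y k) \<le> cmod (of_real (exp T) powi x i * Y powi y i)"
      "ln (cmod (of_real (exp T) powi x i * Y powi y i)) - ln (cmod (of_real (exp T) powi x j * Y powi y j)) \<le> c"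
      using vanishing_sum_max_twice[OF I, of "\<lambda>j. of_real (exp T) powi x j * Y powi y j"] * Y
      unfolding c_def by (metis (no_types, lifting) exp_not_eq_zero mult_eq_0_iff of_real_eq_0_iff power_int_eq_0_iff)
    obtain k l where kl: "k \<in> J" "l \<in> J" "k \<noteq> l"
      "\<And>i. i \<in> J \<Longrightarrow> cmod (of_real (exp T) powi x i * Y powi y i) \<le> cmod (of_real (exp T) powi x k * Y powi y k)"
      "ln (cmod (of_real (exp T) powi x k * Y powi y k)) - ln (cmod (of_real (exp T) powi x l * Y powi y l)) \<le> c"
      using vanishing_sum_max_twice[OF J, of "\<lambda>j. of_real (exp T) powi x j * Y powi y j"] * Y
      unfolding c_def by (metis (no_types, lifting) exp_not_eq_zero mult_eq_0_iff of_real_eq_0_iff power_int_eq_0_iff)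
    have pos: "cmod (of_real (exp T) powi x j * Y powi y j) > 0" for j using Y by simp
    have d1: "\<bar>T * real_of_int (x i - x j) + \<tau> * real_of_int (y i - y j)\<bar> \<le> c"
      using ij(5) ij(4)[OF ij(2)] ln_le_cancel_iff[OF pos[of j] pos[of i]] unfolding lnm by (simp add: algebra_simps)
    have d2: "\<bar>T * real_of_int (x k - x l) + \<tau> * real_of_int (y k - y l)\<bar> \<le> c"
      using kl(5) kl(4)[OF kl(2)] ln_le_cancel_iff[OF pos[of l] pos[of k]] unfolding lnm by (simp add: algebra_simps)
    have "(x i - x j) * (y k - y l) = (x k - x l) * (y i - y j)"
      by (rule two_linear_forms_small[OF d1 d2 yM2 yM2 T(1,3)]) (use ij kl in auto)
    \<comment> \<open>With equal second exponents the unknown \<tau> drops out of the linear form,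
      so x i - x j must vanish as well.\<close>
    then have "y i = y j" using par ij(1-3) kl(1-3) by blast
    moreover from this have "x i - x j = 0" by (intro linear_form_small[OF _ T(2,3)]) (use d1 in simp)
    ultimately show False using nv[OF ij(1-3)] by simp
  qed simp
qed

text \<open>The second sum consists of the inverse terms, so its two largest terms are the two
  smallest ones of the first. If the four indices are distinct, \<open>par\<close> applies as for
  disjoint sums. If one is shared, maximum and minimum differ by at most 2 ln N on the logarithmic
  scale; then all terms have nearly equal size and the one pair of differences in
  \<open>par2\<close> gives the contradiction.\<close>

lemma no_common_zero_reciprocal:
  fixes x y :: "nat \<Rightarrow> int"
  assumes I: "finite I" "I \<noteq> {}" "card I \<le> N"
    and nv: "\<And>i j. i \<in> I \<Longrightarrow> j \<in> I \<Longrightarrow> i \<noteq> j \<Longrightarrow> y i = y j \<Longrightarrow> x i \<noteq> x j"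
    and par: "\<And>i j k l. i \<in> I \<Longrightarrow> j \<in> I \<Longrightarrow> k \<in> I \<Longrightarrow> l \<in> I \<Longrightarrow> distinct [i, j, k, l]
       \<Longrightarrow> (x i - x j) * (y k - y l) = (x k - x l) * (y i - y j) \<Longrightarrow> y i = y j"
    and par2: "i' \<in> I" "j' \<in> I" "i' \<noteq> j'" "k' \<in> I" "l' \<in> I"
       "(x i' - x j') * (y k' - y l') = (x k' - x l') * (y i' - y j') \<Longrightarrow> y i' = y j'"
    and yM: "\<And>i. i \<in> I \<Longrightarrow> \<bar>y i\<bar> \<le> m"
  shows "\<exists>X0>0. \<forall>Y. Y \<noteq> 0 \<longrightarrow> \<not> ((\<Sum>j\<in>I. of_real X0 powi x j * Y powi y j) = 0 \<and>
       (\<Sum>j\<in>I. of_real X0 powi (- x j) * Y powi (- y j)) = (0::complex))"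
proof -
  define c where "c = 2 * ln (real N)"
  define M where "M = real_of_int (2 * m)"
  define T where "T = 2 * c * M + c + 1"
  have N: "N > 0" using I by (metis card_gt_0_iff gr0I le_zero_eq)
  have c0: "c \<ge> 0" using N by (simp add: c_def)
  have M0: "M \<ge> 0" using yM[of i'] par2(1) by (simp add: M_def)
  have T: "T > 2 * c * M" "T > c" "T > 0" using c0 M0 by (auto simp: T_def add_nonneg_pos)
  have yM2: "\<bar>real_of_int (y i - y j)\<bar> \<le> M" if "i \<in> I" "j \<in> I" for i j
    using yM[OF that(1)] yM[OF that(2)] unfolding M_def by linarith
  show ?thesis
  proof (intro exI[of _ "exp T"] conjI allI impI notI)
    fix Y :: complex assume Y: "Y \<noteq> 0"
    assume *: "(\<Sum>j\<in>I. of_real (exp T) powi x j * Y powi y j) = 0 \<and> (\<Sum>j\<in>I. of_real (exp T) powi (- x j) * Y powi (- y j)) = 0"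
    define \<tau> where "\<tau> = ln (cmod Y)"
    define lv where "lv = (\<lambda>j. T * of_int (x j) + \<tau> * of_int (y j))"
    note lnm = ln_norm_monomial[OF Y, of T, folded \<tau>_def]
    have pos: "cmod (of_real (exp T) powi a * Y powi b) > 0" for a b using Y by simp
    obtain i j where ij: "i \<in> I" "j \<in> I" "i \<noteq> j"
      "\<And>k. k \<in> I \<Longrightarrow> cmod (of_real (exp T) powi x k * Y powi y k) \<le> cmod (of_real (exp T) powi x i * Y powi y i)"
      "ln (cmod (of_real (exp T) powi x i * Y powi y i)) - ln (cmod (of_real (exp T) powi x j * Y powi y j)) \<le> ln (real N)"
      using vanishing_sum_max_twice[OF I, of "\<lambda>j. of_real (exp T) powi x j * Y powi y j"] * Y
      by (metis (no_types, lifting) exp_not_eq_zero mult_eq_0_iff of_real_eq_0_iff power_int_eq_0_iff)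
    have i_max: "lv k \<le> lv i" if "k \<in> I" for k
      using ij(4)[OF that] ln_le_cancel_iff[OF pos[of "x k" "y k"] pos[of "x i" "y i"]] unfolding lnm lv_def by simp
    obtain k l where kl: "k \<in> I" "l \<in> I" "k \<noteq> l"
      "\<And>i. i \<in> I \<Longrightarrow> cmod (of_real (exp T) powi (- x i) * Y powi (- y i)) \<le> cmod (of_real (exp T) powi (- x k) * Y powi (- y k))"
      "ln (cmod (of_real (exp T) powi (- x k) * Y powi (- y k))) - ln (cmod (of_real (exp T) powi (- x l) * Y powi (- y l))) \<le> ln (real N)"
      using vanishing_sum_max_twice[OF I, of "\<lambda>j. of_real (exp T) powi (- x j) * Y powi (- y j)"] * Y
      by (metis (no_types, lifting) exp_not_eq_zero mult_eq_0_iff of_real_eq_0_iff power_int_eq_0_iff)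
    have k_min: "lv k \<le> lv i" if "i \<in> I" for i
      using kl(4)[OF that] ln_le_cancel_iff[OF pos[of "- x i" "- y i"] pos[of "- x k" "- y k"]] unfolding lnm lv_def by simp
    have ij': "lv i - lv j \<le> ln (real N)" using ij(5) unfolding lnm lv_def .
    have kl': "lv l - lv k \<le> ln (real N)" using kl(5) unfolding lnm lv_def by simp
    have contr: False if abc: "a \<in> I" "b \<in> I" "a \<noteq> b" "a' \<in> I" "b' \<in> I"
       and d: "\<bar>lv a - lv b\<bar> \<le> c" "\<bar>lv a' - lv b'\<bar> \<le> c"
       and p: "(x a - x b) * (y a' - y b') = (x a' - x b') * (y a - y b) \<Longrightarrow> y a = y b" for a b a' b'
    proof -
      have d1: "\<bar>T * real_of_int (x a - x b) + \<tau> * real_of_int (y a - y b)\<bar> \<le> c"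
        using d(1) by (simp add: lv_def algebra_simps)
      have d2: "\<bar>T * real_of_int (x a' - x b') + \<tau> * real_of_int (y a' - y b')\<bar> \<le> c"
        using d(2) by (simp add: lv_def algebra_simps)
      have "(x a - x b) * (y a' - y b') = (x a' - x b') * (y a - y b)"
        by (rule two_linear_forms_small[OF d1 d2 yM2 yM2 T(1,3)]) (use abc in auto)
      then have "y a = y b" by (rule p)
      moreover from this have "x a - x b = 0" by (intro linear_form_small[OF _ T(2,3)]) (use d1 in simp)
      ultimately show False using nv[OF abc(1-3)] by simp
    qed
    have lnN: "ln (real N) \<ge> 0" using N by simp
    show False
    proof (cases "distinct [i, j, k, l]")
      case True
      show False
      proof (rule contr[OF ij(1-3) kl(1,2)])
        show "\<bar>lv i - lv j\<bar> \<le> c" using ij' i_max[OF ij(2)] lnN by (simp add: c_def)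
        show "\<bar>lv k - lv l\<bar> \<le> c" using kl' k_min[OF kl(2)] lnN by (simp add: c_def)
        show "(x i - x j) * (y k - y l) = (x k - x l) * (y i - y j) \<Longrightarrow> y i = y j"
          using par[OF ij(1,2) kl(1,2) True] .
      qed
    next
      case False
      then have "i = k \<or> i = l \<or> j = k \<or> j = l" using ij(3) kl(3) by auto
      then have range: "lv i - lv k \<le> c" using ij' kl' i_max k_min kl(2) ij(2) lnN unfolding c_def by auto
      have close: "\<bar>lv a - lv b\<bar> \<le> c" if "a \<in> I" "b \<in> I" for a b
        using range i_max[OF that(1)] i_max[OF that(2)] k_min[OF that(1)] k_min[OF that(2)] by linarith
      show False by (rule contr[OF par2(1-5) close close par2(6)]) (use par2 in auto)
    qed
  qed simp
qed

text \<open>A point z = s^q of Z yields the common zero (X, Y) = (s, s powi D) of two Laurent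
  polynomials with small exponents. The resultant bounds the number of such s by (2 m + 2 m) * 2 h,
  and each z, being nonzero, has exactly q roots s; this gains the factor q.\<close>

lemma torus_zero_count:
  fixes x y x' y' :: "nat \<Rightarrow> int" and D :: int
  assumes I: "finite I" "I \<noteq> {}" and J: "finite J" "J \<noteq> {}"
    and hx: "\<And>j. j \<in> I \<Longrightarrow> \<bar>x j\<bar> \<le> int h" "\<And>j. j \<in> J \<Longrightarrow> \<bar>x' j\<bar> \<le> int h"
    and hy: "\<And>j. j \<in> I \<Longrightarrow> \<bar>y j\<bar> \<le> int m" "\<And>j. j \<in> J \<Longrightarrow> \<bar>y' j\<bar> \<le> int m"
    and m: "m \<ge> 1" and q: "q \<ge> 1"
    and Z: "\<And>s. s ^ q \<in> Z \<Longrightarrow> s \<noteq> 0 \<and> (\<Sum>j\<in>I. s powi (x j + D * y j)) = 0 \<and> (\<Sum>j\<in>J. s powi (x' j + D * y' j)) = (0::complex)"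
    and nc: "\<exists>X0>0. \<forall>Y. Y \<noteq> 0 \<longrightarrow> \<not> ((\<Sum>j\<in>I. of_real X0 powi x j * Y powi y j) = 0 \<and>
       (\<Sum>j\<in>J. of_real X0 powi x' j * Y powi y' j) = (0::complex))"
  shows "finite Z" "q * card Z \<le> 8 * m * h"
proof -
  define S where "S = {s. s ^ q \<in> Z}"
  obtain X0 :: real where X0: "X0 > 0" and nc: "\<And>Y. Y \<noteq> 0 \<Longrightarrow> \<not> ((\<Sum>j\<in>I. of_real X0 powi x j * Y powi y j) = 0 \<and>
       (\<Sum>j\<in>J. of_real X0 powi x' j * Y powi y' j) = (0::complex))" using nc by blast
  \<comment> \<open>Multiplication by a monomial clears the negative exponents. Shifting by the
    minimum of the y j also leaves a nonzero constant coefficient in Y, which excludes the common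
    zero Y = 0 at X0.\<close>
  define mk :: "nat set \<Rightarrow> (nat \<Rightarrow> int) \<Rightarrow> (nat \<Rightarrow> int) \<Rightarrow> complex poly poly" where
    "mk = (\<lambda>I x y. \<Sum>j\<in>I. monom (monom 1 (nat (x j + int h))) (nat (y j - Min (y ` I))))"
  have main: "(\<forall>i. degree (coeff (mk I x y) i) \<le> 2 * h) \<and> degree (mk I x y) \<le> 2 * m \<and>
     poly (lead_coeff (mk I x y)) (of_real X0) \<noteq> 0 \<and> poly (coeff (mk I x y) 0) (of_real X0) \<noteq> 0 \<and>
     (\<forall>s Y. s \<noteq> 0 \<longrightarrow> Y \<noteq> 0 \<longrightarrow> poly (map_poly (\<lambda>c. poly c s) (mk I x y)) Y = 
          s powi int h * Y powi (- Min (y ` I)) * (\<Sum>j\<in>I. s powi x j * Y powi y j))"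
    if I: "finite I" "I \<noteq> {}" and hx: "\<And>j. j \<in> I \<Longrightarrow> \<bar>x j\<bar> \<le> int h" and hy: "\<And>j. j \<in> I \<Longrightarrow> \<bar>y j\<bar> \<le> int m"
    for I and x y :: "nat \<Rightarrow> int"
  proof -
    define y0 where "y0 = Min (y ` I)"
    define k where "k = (\<lambda>j. nat (y j - y0))"
    have y0_in: "y0 \<in> y ` I" unfolding y0_def using I by (intro Min_in) auto
    have y0_le: "y0 \<le> y j" if "j \<in> I" for j unfolding y0_def using I that by (intro Min_le) auto
    have y0_ge: "- int m \<le> y0" using y0_in hy by force
    have coeff_mk: "coeff (mk I x y) i = (\<Sum>j\<in>{j \<in> I. k j = i}. monom 1 (nat (x j + int h)))" for i
      unfolding mk_def k_def y0_def coeff_sum using I(1) by (simp add: sum.inter_filter)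
    have dc: "degree (coeff (mk I x y) i) \<le> 2 * h" for i
      unfolding coeff_mk
    proof (rule degree_sum_le)
      fix j assume "j \<in> {j \<in> I. k j = i}"
      then show "degree (monom (1::complex) (nat (x j + int h))) \<le> 2 * h"
        using hx[of j] by (auto simp: degree_monom_eq)
    qed (use I in auto)
    \<comment> \<open>All terms have coefficient 1, so nothing cancels at a positive point; in
      particular the leading and the constant coefficient survive the specialisation.\<close>
    have pos: "poly (coeff (mk I x y) (k j)) (of_real X0) \<noteq> 0" if "j \<in> I" for j
    proof -
      have "poly (coeff (mk I x y) (k j)) (of_real X0) = of_real (\<Sum>i\<in>{i \<in> I. k i = k j}. X0 ^ nat (x i + int h))"
        unfolding coeff_mk poly_sum by (simp add: poly_monom)
      moreover have "(\<Sum>i\<in>{i \<in> I. k i = k j}. X0 ^ nat (x i + int h)) > 0"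
        using that I X0 by (intro sum_pos) auto
      ultimately show ?thesis by (metis less_irrefl of_real_eq_0_iff)
    qed
    define K where "K = Max (k ` I)"
    have K_in: "K \<in> k ` I" unfolding K_def using I by (intro Max_in) auto
    have degK: "degree (mk I x y) = K"
    proof (rule antisym)
      show "degree (mk I x y) \<le> K"
      proof (rule degree_le, intro allI impI)
        fix i assume "i > K"
        then have "{j \<in> I. k j = i} = {}" using I unfolding K_def by (auto simp: Max_less_iff)
        then show "coeff (mk I x y) i = 0" unfolding coeff_mk by (simp only: sum.empty)
      qed
      obtain j where j: "j \<in> I" "K = k j" using K_in by auto
      then have "coeff (mk I x y) K \<noteq> 0" using pos[of j] by (metis poly_0)
      then show "K \<le> degree (mk I x y)" by (rule le_degree)
    qed
    have "K \<le> 2 * m" using K_in hy y0_ge by (force simp: k_def)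
    moreover have "poly (lead_coeff (mk I x y)) (of_real X0) \<noteq> 0" using K_in pos unfolding degK by auto
    moreover have "poly (coeff (mk I x y) 0) (of_real X0) \<noteq> 0"
    proof -
      obtain j where "j \<in> I" "y0 = y j" using y0_in by auto
      then show ?thesis using pos[of j] by (simp add: k_def)
    qed
    moreover have "poly (map_poly (\<lambda>c. poly c s) (mk I x y)) Y = 
          s powi int h * Y powi (- y0) * (\<Sum>j\<in>I. s powi x j * Y powi y j)" if sY: "s \<noteq> 0" "Y \<noteq> 0" for s Y
    proof -
      interpret ph: map_poly_comm_ring_hom "\<lambda>c::complex poly. poly c s" ..
      have "map_poly (\<lambda>c. poly c s) (mk I x y) = (\<Sum>j\<in>I. monom (s ^ nat (x j + int h)) (k j))"
        unfolding mk_def ph.hom_sum k_def y0_def by (simp add: map_poly_monom poly_monom)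
      then have "poly (map_poly (\<lambda>c. poly c s) (mk I x y)) Y = (\<Sum>j\<in>I. s ^ nat (x j + int h) * Y ^ k j)"
        by (simp add: poly_sum poly_monom)
      also have "\<dots> = (\<Sum>j\<in>I. s powi int h * Y powi (- y0) * (s powi x j * Y powi y j))"
      proof (rule sum.cong[OF refl])
        fix j assume j: "j \<in> I"
        have "s ^ nat (x j + int h) = s powi (x j + int h)" using hx[OF j] by (simp add: power_int_def)
        also have "\<dots> = s powi x j * s powi int h" using sY by (simp add: power_int_add)
        moreover have "Y ^ k j = Y powi (y j - y0)" using y0_le[OF j] by (simp add: power_int_def k_def)
        moreover have "\<dots> = Y powi y j * Y powi (- y0)" using sY by (simp add: power_int_diff power_int_minus divide_inverse)
        ultimately show "s ^ nat (x j + int h) * Y ^ k j = s powi int h * Y powi (- y0) * (s powi x j * Y powi y j)"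
          by (simp only: mult_ac)
      qed
      finally show ?thesis by (simp only: sum_distrib_left)
    qed
    ultimately show ?thesis using dc degK unfolding y0_def by auto
  qed
  note P = main[of I x y, OF I hx(1) hy(1)] and Q = main[of J x' y', OF J hx(2) hy(2)]
  let ?P = "mk I x y" and ?Q = "mk J x' y'"
  have Pc: "degree (coeff ?P i) \<le> 2 * h" "poly (lead_coeff ?P) (of_real X0) \<noteq> 0" for i using P by simp_all
  have Qc: "degree (coeff ?Q i) \<le> 2 * h" "poly (lead_coeff ?Q) (of_real X0) \<noteq> 0" for i using Q by simp_all
  have rew: "s powi (a + D * b) = s powi a * (s powi D) powi b" if "s \<noteq> 0" for s :: complex and a b
    using that by (simp add: power_int_add power_int_mult)
  have S_zero: "s \<noteq> 0 \<and> poly (map_poly (\<lambda>c. poly c s) ?P) (s powi D) = 0 \<and> poly (map_poly (\<lambda>c. poly c s) ?Q) (s powi D) = 0"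
    if "s \<in> S" for s
  proof -
    have s: "s \<noteq> 0" "(\<Sum>j\<in>I. s powi (x j + D * y j)) = 0" "(\<Sum>j\<in>J. s powi (x' j + D * y' j)) = 0"
      using Z[of s] that unfolding S_def by auto
    then have "(\<Sum>j\<in>I. s powi x j * (s powi D) powi y j) = 0" "(\<Sum>j\<in>J. s powi x' j * (s powi D) powi y' j) = 0"
      using rew by simp_all
    moreover have "s powi D \<noteq> 0" using s by simp
    ultimately show ?thesis using P Q s(1) by simp
  qed
  have S: "finite S \<and> card S \<le> 8 * m * h"
  proof (cases "degree ?P + degree ?Q > 0")
    case True
    have ncx: "\<not> (poly (map_poly (\<lambda>c. poly c (of_real X0)) ?P) Y = 0 \<and> poly (map_poly (\<lambda>c. poly c (of_real X0)) ?Q) Y = 0)" for Y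
    proof (cases "Y = 0")
      case True
      then show ?thesis using P by (simp add: poly_0_coeff_0 coeff_map_poly)
    next
      case False
      have "poly (map_poly (\<lambda>c. poly c (of_real X0)) ?P) Y = of_real X0 powi int h * Y powi (- Min (y ` I)) * (\<Sum>j\<in>I. of_real X0 powi x j * Y powi y j)"
        using P False X0 by simp
      moreover have "poly (map_poly (\<lambda>c. poly c (of_real X0)) ?Q) Y = of_real X0 powi int h * Y powi (- Min (y' ` J)) * (\<Sum>j\<in>J. of_real X0 powi x' j * Y powi y' j)"
        using Q False X0 by simp
      ultimately show ?thesis using nc[OF False] False X0 by auto
    qed
    let ?T = "{s. \<exists>y. y \<noteq> 0 \<and> poly (map_poly (\<lambda>c. poly c s) ?P) y = 0 \<and> poly (map_poly (\<lambda>c. poly c s) ?Q) y = 0}"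
    have T: "finite ?T" "card ?T \<le> (degree ?P + degree ?Q) * (2 * h)"
      by (rule common_zero_count[OF Pc(1) Qc(1) Pc(2) Qc(2) ncx True])+
    have "S \<subseteq> ?T"
    proof
      fix s assume "s \<in> S"
      then show "s \<in> ?T" using S_zero[of s] by (intro CollectI exI[of _ "s powi D"]) auto
    qed
    then have "finite S" "card S \<le> card ?T" using T(1) by (auto intro: finite_subset card_mono)
    moreover have "(degree ?P + degree ?Q) * (2 * h) \<le> (2 * m + 2 * m) * (2 * h)"
      using P Q by (intro mult_right_mono add_mono) auto
    moreover have "(2 * m + 2 * m) * (2 * h) = 8 * m * h" by simp
    ultimately show ?thesis using T(2) by linarith
  next
    \<comment> \<open>Neither polynomial involves Y, and the points s are roots of the one
      coefficient c.\<close>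
    case False
    then have P0: "degree ?P = 0" by simp
    define c where "c = coeff ?P 0"
    have P_const: "?P = [:c:]" using P0 unfolding c_def by (metis degree_0_id)
    have c0: "c \<noteq> 0" using P unfolding c_def by auto
    have "S \<subseteq> {s. poly c s = 0}"
    proof
      fix s assume "s \<in> S"
      then have "poly (map_poly (\<lambda>c. poly c s) ?P) (s powi D) = 0" using S_zero by blast
      then show "s \<in> {s. poly c s = 0}" unfolding P_const using c0 by (cases "poly c s = 0") (simp_all add: map_poly_pCons)
    qed
    then have "finite S" "card S \<le> card {s. poly c s = 0}"
      using poly_roots_finite[OF c0] by (auto intro: finite_subset card_mono)
    moreover have "card {s. poly c s = 0} \<le> degree c" by (rule card_poly_roots_bound[OF c0])
    moreover have "degree c \<le> 2 * h" using P unfolding c_def by blast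
    moreover have "2 * h \<le> 8 * m * h" using m by (intro mult_right_mono) auto
    ultimately show ?thesis by linarith
  qed
  have Zim: "Z \<subseteq> (\<lambda>s. s ^ q) ` S"
  proof
    fix z assume z: "z \<in> Z"
    obtain s :: complex where "s ^ q = z" using exists_complex_root[of q z] q by auto
    then show "z \<in> (\<lambda>s. s ^ q) ` S" using z unfolding S_def by blast
  qed
  then show finZ: "finite Z" using S finite_subset[OF Zim] finite_imageI by blast
  have z0: "z \<noteq> 0" if zZ: "z \<in> Z" for z
  proof -
    obtain s where "s \<in> S" "z = s ^ q" using Zim zZ by blast
    moreover from this have "s \<noteq> 0" using S_zero by blast
    ultimately show ?thesis by (simp only: power_not_zero not_False_eq_True)
  qed
  have "S = (\<Union>z\<in>Z. {s. s ^ q = z})" unfolding S_def by auto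
  also have "card \<dots> = (\<Sum>z\<in>Z. card {s. s ^ q = z})"
  proof (rule card_UN_disjoint[OF finZ])
    show "\<forall>z\<in>Z. finite {s. s ^ q = z}" using q by (intro ballI finite_nth_roots) simp
  qed blast
  also have "\<dots> = (\<Sum>z\<in>Z. q)" by (intro sum.cong refl card_nth_roots) (use q z0 in auto)
  finally show "q * card Z \<le> 8 * m * h" using S by (simp add: mult.commute)
qed

section \<open>Logarithmic height and power defect\<close>

lemma consecutive_gap:
  fixes E :: "nat set"
  assumes "finite E" "card E = Suc (Suc k)"
  shows "\<exists>a\<in>E. \<exists>b\<in>E. a < b \<and> (\<forall>x\<in>E. x \<le> a \<or> b \<le> x) \<and> Max E - Min E \<le> Suc k * (b - a)"
  using assms
proof (induction k arbitrary: E)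
  case 0
  then obtain u v where uv: "E = {u, v}" "u \<noteq> v" by (auto simp: card_Suc_eq numeral_2_eq_2)
  show ?case
  proof (cases "u < v")
    case True
    then have "Max E = v" "Min E = u" using uv by auto
    then show ?thesis using True uv by (intro bexI[of _ u] bexI[of _ v]) auto
  next
    case False
    then have "v < u" using uv by simp
    then have "Max E = u" "Min E = v" using uv by auto
    then show ?thesis using \<open>v < u\<close> uv by (intro bexI[of _ v] bexI[of _ u]) auto
  qed
next
  case (Suc k)
  define M where "M = Max E"
  define E' where "E' = E - {M}"
  have ne: "E \<noteq> {}" using Suc.prems by auto
  have M: "M \<in> E" "\<And>x. x \<in> E \<Longrightarrow> x \<le> M" using ne Suc.prems by (auto simp: M_def)
  have E': "finite E'" "card E' = Suc (Suc k)" using Suc.prems M by (auto simp: E'_def)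
  then have ne': "E' \<noteq> {}" by auto
  define M' where "M' = Max E'"
  have M': "M' \<in> E'" "\<And>x. x \<in> E' \<Longrightarrow> x \<le> M'" using ne' E' by (auto simp: M'_def)
  have M'M: "M' < M" using M'(1) M unfolding E'_def by (metis DiffD1 DiffD2 insertI1 order_neq_le_trans)
  have min_eq: "Min E = Min E'"
  proof (rule Min_eqI)
    show "finite E" by (fact Suc.prems(1))
    show "Min E' \<in> E" using E' ne' Min_in[of E'] by (auto simp: E'_def)
    fix y assume "y \<in> E"
    then show "Min E' \<le> y"
    proof (cases "y = M")
      case True
      have "Min E' \<le> M'" using E' M'(1) by simp
      then show ?thesis using True M'M by simp
    next
      case False
      then show ?thesis using \<open>y \<in> E\<close> E' by (simp add: E'_def)
    qed
  qed
  obtain a b where ab: "a \<in> E'" "b \<in> E'" "a < b" "\<forall>x\<in>E'. x \<le> a \<or> b \<le> x" "M' - Min E' \<le> Suc k * (b - a)"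
    using Suc.IH[OF E'] unfolding M'_def by blast
  have mm: "Min E' \<le> M'" using E' M'(1) by simp
  have split: "M - Min E = (M - M') + (M' - Min E')" using M'M mm by (simp add: min_eq)
  show ?case
  proof (cases "M - M' \<le> b - a")
    case True
    have "M - Min E \<le> (b - a) + Suc k * (b - a)" using split True ab(5) by (simp only: add_mono)
    then have "M - Min E \<le> Suc (Suc k) * (b - a)" by (simp only: mult_Suc)
    moreover have "\<forall>x\<in>E. x \<le> a \<or> b \<le> x" using ab(2,4) M unfolding E'_def by auto
    moreover have "a \<in> E" "b \<in> E" using ab(1,2) by (simp_all add: E'_def)
    ultimately show ?thesis using ab(3) unfolding M_def[symmetric] by (intro bexI[of _ a] bexI[of _ b] conjI)
  next
    case False
    then have "Suc k * (b - a) \<le> Suc k * (M - M')" by (intro mult_left_mono) auto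
    then have "M' - Min E' \<le> Suc k * (M - M')" using ab(5) le_trans by blast
    then have "M - Min E \<le> (M - M') + Suc k * (M - M')" using split by (simp only: add_left_mono)
    then have "M - Min E \<le> Suc (Suc k) * (M - M')" by (simp only: mult_Suc)
    moreover have "\<forall>x\<in>E. x \<le> M' \<or> M \<le> x" using M' unfolding E'_def by auto
    moreover have "M' \<in> E" using M'(1) by (simp add: E'_def)
    ultimately show ?thesis using M(1) M'M unfolding M_def[symmetric] by (intro bexI[of _ M'] bexI[of _ M] conjI)
  qed
qed

lemma sum_mset_le_const:
  fixes g :: "'a \<Rightarrow> real"
  assumes "\<And>z. z \<in># M \<Longrightarrow> g z \<le> c"
  shows "(\<Sum>z\<in>#M. g z) \<le> real (size M) * c"
  using assms by (induction M) (auto simp: algebra_simps add_mono)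

lemma sum_mset_le_sum_mset:
  fixes g h :: "'a \<Rightarrow> real"
  assumes "\<And>z. z \<in># M \<Longrightarrow> g z \<le> h z"
  shows "(\<Sum>z\<in>#M. g z) \<le> (\<Sum>z\<in>#M. h z)"
  using assms by (induction M) (auto simp: add_mono)

lemma sum_mset_diff:
  fixes g h :: "'a \<Rightarrow> real"
  shows "(\<Sum>z\<in>#M. g z - h z) = (\<Sum>z\<in>#M. g z) - (\<Sum>z\<in>#M. h z)"
  by (induction M) auto

lemma ln_cmod_prod_mset:
  fixes g :: "'a \<Rightarrow> complex"
  assumes "\<And>z. z \<in># M \<Longrightarrow> g z \<noteq> 0"
  shows "ln (cmod (\<Prod>z\<in>#M. g z)) = (\<Sum>z\<in>#M. ln (cmod (g z)))"
  using assms by (induction M) (auto simp: norm_mult ln_mult prod_mset_zero_iff)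

text \<open>Hajos's lemma: once the lowest monomial is divided out, a differentiation removes the
  constant term and lowers the order at z by one.\<close>

lemma fewnomial_order_le:
  assumes "fewnomial k F" "z \<noteq> 0"
  shows "order z F \<le> k"
  using assms
proof (induction k arbitrary: F)
  case 0
  have "degree F \<in> {i. coeff F i \<noteq> 0}" using 0 by (auto simp: fewnomial_def)
  then have "{i. coeff F i \<noteq> 0} = {degree F}"
    using 0 finite_support_poly[of F] unfolding fewnomial_def
    by (auto dest: card_le_Suc0_iff_eq[THEN iffD1, rotated])
  then have "coeff F i = 0" if "i \<noteq> degree F" for i using that by blast
  then have "F = monom 1 (degree F)"
    using 0 by (intro poly_eqI) (auto simp: fewnomial_def)
  then have "poly F z \<noteq> 0" using 0(2) by (metis mult_1 poly_monom power_not_zero)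
  then show ?case by (simp add: order_root)
next
  case (Suc k)
  obtain a G where G: "F = monom 1 a * G" "fewnomial (Suc k) G" "coeff G 0 \<noteq> 0"
    using Suc.prems(1) by (rule fewnomial_split)
  have G0: "G \<noteq> 0" "F \<noteq> 0" using G Suc.prems by (auto simp: fewnomial_def)
  have "order z (monom 1 a) = 0" using Suc.prems(2) by (simp add: order_0I poly_monom)
  then have ord: "order z F = order z G" using G(1) G0 by (simp add: order_mult)
  show ?case
  proof (cases "poly G z = 0")
    case True
    have deg: "degree G > 0"
    proof (rule ccontr)
      assume "\<not> degree G > 0"
      then obtain c where "G = [:c:]" by (metis degree_eq_zeroE neq0_conv)
      then show False using True G0 by simp
    qed
    have "order z G = Suc (order z (pderiv G))" by (rule order_pderiv[OF G0(1) True])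
    also have "order z (pderiv G) = order z (Polynomial.smult (1 / of_nat (degree G)) (pderiv G))"
      using deg by (simp add: order_smult)
    also have "\<dots> \<le> k" by (rule Suc.IH[OF fewnomial_pderiv[OF G(2,3) deg] Suc.prems(2)])
    finally show ?thesis using ord by simp
  next
    case False
    then have "order z G = 0" by (rule order_0I)
    then show ?thesis using ord by simp
  qed
qed

lemma cmod_power_le_log_plus:
  assumes "z \<noteq> 0" "k \<le> d"
  shows "cmod z ^ k \<le> exp (real d * log_plus z)"
proof -
  have "cmod z ^ k = exp (real k * ln (cmod z))" using assms by (simp add: exp_of_nat_mult)
  also have "real k * ln (cmod z) \<le> real k * log_plus z" by (intro mult_left_mono) (auto simp: log_plus_def)
  also have "\<dots> \<le> real d * log_plus z" using assms by (intro mult_right_mono) (auto simp: log_plus_def)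
  finally show ?thesis by simp
qed

lemma log_plus_nonneg [simp]: "log_plus z \<ge> 0"
  by (simp add: log_plus_def)

text \<open>For monic f without p-th roots of unity among its roots, this is the sum of ln |f| over
  the p-th roots of unity minus p times the Mahler measure of f.\<close>

definition power_defect :: "nat \<Rightarrow> int poly \<Rightarrow> real" where
  "power_defect p f = (\<Sum>z\<in>#proots (cpoly f). ln (cmod (z ^ p - 1)) - real p * log_plus z)"

text \<open>For monic f this is the logarithmic Mahler measure, by Jensen's formula; it plays the
  role of a height and adds up over factors.\<close>

definition log_house :: "int poly \<Rightarrow> real" where
  "log_house f = (\<Sum>z\<in>#proots (cpoly f). log_plus z)"

lemma log_house_nonneg [simp]: "log_house f \<ge> 0"
  unfolding log_house_def by (rule sum_mset_ge_0) simp

lemma size_proots_cpoly [simp]: "size (proots (cpoly f)) = degree f"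
  by (simp add: size_proots_complex)

lemma power_defect_upper:
  assumes "\<And>z. poly (cpoly f) z = 0 \<Longrightarrow> z ^ p \<noteq> 1" "f \<noteq> 0"
  shows "power_defect p f \<le> real (degree f) * ln 2"
proof -
  have "power_defect p f \<le> real (size (proots (cpoly f))) * ln 2"
    unfolding power_defect_def
  proof (rule sum_mset_le_const)
    fix z assume "z \<in># proots (cpoly f)"
    then have z1: "z ^ p \<noteq> 1" using assms by auto
    have "cmod (z ^ p - 1) \<le> cmod (z ^ p) + 1" using norm_triangle_ineq4[of "z ^ p" 1] by simp
    also have "\<dots> \<le> 2 * exp (real p * log_plus z)"
    proof (cases "z = 0")
      case True
      then show ?thesis by (cases p) (auto simp: log_plus_def)
    next
      case False
      then have "cmod (z ^ p) \<le> exp (real p * log_plus z)"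
        using cmod_power_le_log_plus[OF False order_refl, of p] by (simp add: norm_power)
      moreover have "1 \<le> exp (real p * log_plus z)" by simp
      ultimately show ?thesis by linarith
    qed
    finally have "ln (cmod (z ^ p - 1)) \<le> ln (2 * exp (real p * log_plus z))" using z1 by simp
    then show "ln (cmod (z ^ p - 1)) - real p * log_plus z \<le> ln 2" by (simp add: ln_mult)
  qed
  then show ?thesis by simp
qed

text \<open>The product of z^p - 1 over the roots is a nonzero integer, so only the terms - p ln+
  |z| can make the sum negative. The factor p makes this useful only for factors of small total
  height.\<close>

lemma power_defect_lower_prime:
  assumes f: "prime_elem f" "degree f > 0" "lead_coeff f = 1"
    and z: "\<And>z. poly (cpoly f) z = 0 \<Longrightarrow> z ^ p \<noteq> 1"
  shows "power_defect p f \<ge> - real p * log_house f"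
proof -
  have f0: "cpoly f \<noteq> 0" using f by auto
  define g :: "int poly" where "g = monom 1 p - 1"
  have g: "poly (cpoly g) z = z ^ p - 1" for z
    unfolding g_def by (simp add: hom_distribs map_poly_monom poly_monom)
  have "1 \<le> cmod (root_norm f g)" by (rule root_norm_ge_1[OF f]) (use z in \<open>simp add: g\<close>)
  then have "0 \<le> ln (cmod (root_norm f g))" by simp
  also have "\<dots> = (\<Sum>z\<in>#proots (cpoly f). ln (cmod (z ^ p - 1)))"
    unfolding root_norm_def using z f0 by (subst ln_cmod_prod_mset) (auto simp: g)
  finally have "0 \<le> (\<Sum>z\<in>#proots (cpoly f). ln (cmod (z ^ p - 1)))" .
  moreover have "(\<Sum>z\<in>#proots (cpoly f). real p * log_plus z) = real p * log_house f"
    unfolding log_house_def by (rule sum_mset_distrib_left[symmetric])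
  ultimately show ?thesis unfolding power_defect_def sum_mset_diff by linarith
qed

section \<open>Sums over roots of unity of a sparse polynomial\<close>

text \<open>The number \<open>L\<close> bounds the coefficients of the excluded relations between differences of exponents. The last
  assumption supplies one independent pair in the case \<open>n = 2\<close>, where the one before it is void.\<close>

locale sparse_setup =
  fixes n d L :: nat and e :: "nat \<Rightarrow> nat"
  assumes n2: "n \<ge> 2" and inj: "inj_on e {0..n}" and e_le: "\<And>j. j \<in> {0..n} \<Longrightarrow> e j \<le> d"
    and e_max: "\<exists>j\<in>{0..n}. e j = d" and e_min: "\<exists>j\<in>{0..n}. e j = 0"
    and rel: "\<And>i j k l u v. i \<in> {0..n} \<Longrightarrow> j \<in> {0..n} \<Longrightarrow> k \<in> {0..n} \<Longrightarrow> l \<in> {0..n} \<Longrightarrow>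
      distinct [i, j, k, l] \<Longrightarrow> \<bar>u\<bar> \<le> int L \<Longrightarrow> \<bar>v\<bar> \<le> int L \<Longrightarrow>
      u * (int (e i) - int (e j)) = v * (int (e k) - int (e l)) \<Longrightarrow> u = 0 \<and> v = 0"
    and rel2: "\<exists>i\<in>{0..n}. \<exists>j\<in>{0..n}. \<exists>k\<in>{0..n}. \<exists>l\<in>{0..n}. i \<noteq> j \<and>
      (\<forall>u v. \<bar>u\<bar> \<le> int L \<longrightarrow> \<bar>v\<bar> \<le> int L \<longrightarrow>
        u * (int (e i) - int (e j)) = v * (int (e k) - int (e l)) \<longrightarrow> u = 0 \<and> v = 0)"
begin

definition block_poly :: "nat set \<Rightarrow> int poly" where
  "block_poly I = (\<Sum>j\<in>I. monom 1 (e j))"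

abbreviation Q :: "int poly" where "Q \<equiv> block_poly {0..n}"

lemma poly_block: "poly (cpoly (block_poly I)) z = (\<Sum>j\<in>I. z ^ e j)"
  unfolding block_poly_def by (simp add: of_int_poly_hom.hom_sum map_poly_monom poly_sum poly_monom)

lemma coeff_block: "I \<subseteq> {0..n} \<Longrightarrow> coeff (block_poly I) k = (if k \<in> e ` I then 1 else 0)"
proof -
  assume I: "I \<subseteq> {0..n}"
  have fin: "finite I" using I finite_subset by blast
  have "coeff (block_poly I) k = (\<Sum>j\<in>I. if e j = k then 1 else 0)"
    by (simp add: block_poly_def coeff_sum)
  also have "\<dots> = int (card {j \<in> I. e j = k})"
    using fin by (simp flip: sum.inter_filter)
  also have "\<dots> = (if k \<in> e ` I then 1 else 0)"
  proof (cases "k \<in> e ` I")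
    case True
    then obtain j where j: "j \<in> I" "e j = k" by auto
    then have "{j \<in> I. e j = k} = {j}" using inj I by (auto dest: inj_onD)
    then show ?thesis using True by simp
  next
    case False
    then have "{j \<in> I. e j = k} = {}" by auto
    then show ?thesis using False by (simp only: card.empty of_nat_0 if_False)
  qed
  finally show ?thesis .
qed

lemma coeff_Q: "coeff Q k = (if k \<in> e ` {0..n} then 1 else 0)"
  by (rule coeff_block) simp

lemma degree_Q: "degree Q = d"
proof (rule antisym)
  show "degree Q \<le> d" by (rule degree_le) (use e_le coeff_Q in force)
  show "d \<le> degree Q" by (rule le_degree) (use e_max coeff_Q in force)
qed

lemma lead_Q: "lead_coeff Q = 1"
  unfolding degree_Q using e_max coeff_Q by force

lemma coeff_Q_0: "coeff Q 0 = 1"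
  using e_min coeff_Q[of 0] by force

lemma Q_nz: "Q \<noteq> 0"
  using lead_Q by auto

lemma d_pos: "d > 0"
proof (rule ccontr)
  assume "\<not> d > 0"
  then have "e 0 = e 1" using e_le[of 0] e_le[of 1] n2 by simp
  then show False using inj n2 by (auto dest: inj_onD)
qed

lemma fewnomial_Q: "fewnomial n (cpoly Q)"
proof -
  have "{i. coeff (cpoly Q) i \<noteq> 0} = e ` {0..n}" using coeff_Q by auto
  then have "card {i. coeff (cpoly Q) i \<noteq> 0} \<le> Suc n" using card_image_le[of "{0..n}" e] by simp
  moreover have "lead_coeff (cpoly Q) = 1" using lead_Q by simp
  ultimately show ?thesis by (simp add: fewnomial_def)
qed

lemma poly_Q: "poly (cpoly Q) z = (\<Sum>j\<in>{0..n}. z ^ e j)"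
  by (rule poly_block)

lemma root_nz: "poly (cpoly Q) z = 0 \<Longrightarrow> z \<noteq> 0"
  using coeff_Q_0 by (auto simp: poly_0_coeff_0)

abbreviation factors :: "int poly multiset" where "factors \<equiv> prime_factorization Q"

text \<open>Elements of \<open>prime_factorization\<close> are normalised, which for integer
  polynomials fixes the sign of the leading coefficient. This is why the factors of the monic Q turn
  out monic and multiply exactly to Q.\<close>

lemma factor_lead_pos:
  assumes "f \<in># factors"
  shows "lead_coeff f > 0"
proof -
  have nf: "normalize f = f" and f0: "f \<noteq> 0" using assms by (auto dest: in_prime_factors_imp_prime)
  have "coeff (normalize f) (degree f) = lead_coeff f div sgn (lead_coeff f)"
    by (simp add: normalize_poly_eq_map_poly coeff_map_poly)
  then have eq: "lead_coeff f = lead_coeff f div sgn (lead_coeff f)" unfolding nf .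
  have "\<not> lead_coeff f < 0"
  proof
    assume "lead_coeff f < 0"
    then have "sgn (lead_coeff f) = -1" by simp
    then have "lead_coeff f = - lead_coeff f" using eq by simp
    then show False using \<open>lead_coeff f < 0\<close> by linarith
  qed
  moreover have "lead_coeff f \<noteq> 0" using f0 by simp
  ultimately show ?thesis by linarith
qed

lemma normalize_lead_pos:
  fixes f :: "int poly"
  assumes "lead_coeff f > 0"
  shows "normalize f = f"
  using assms by (simp add: normalize_poly_eq_map_poly map_poly_idI)

lemma prod_factors: "prod_mset factors = Q"
proof -
  have "lead_coeff (prod_mset M) > 0" if "\<And>f. f \<in># M \<Longrightarrow> lead_coeff f > 0" for M :: "int poly multiset"
    using that by (induction M) (auto simp: lead_coeff_mult)
  then have "normalize (prod_mset factors) = prod_mset factors"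
    using factor_lead_pos by (intro normalize_lead_pos) blast
  moreover have "normalize (prod_mset factors) = normalize Q" by (rule prod_mset_prime_factorization_weak) (rule Q_nz)
  moreover have "normalize Q = Q" using lead_Q by (intro normalize_lead_pos) simp
  ultimately show ?thesis by simp
qed

lemma factorD:
  assumes "f \<in># factors"
  shows "prime_elem f" "lead_coeff f = 1" "degree f > 0" "f dvd Q" "\<bar>coeff f 0\<bar> = 1"
proof -
  show pe: "prime_elem f" using assms by (auto dest: in_prime_factors_imp_prime)
  show dvd: "f dvd Q" using assms by (auto dest: in_prime_factors_imp_dvd)
  obtain g where g: "Q = f * g" using dvd by auto
  have "lead_coeff f * lead_coeff g = 1" using lead_Q unfolding g by (simp add: lead_coeff_mult)
  then have l: "lead_coeff f = 1 \<or> lead_coeff f = -1" by (metis dvd_triv_left zdvd1_eq abs_eq_iff' abs_1)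
  show l1: "lead_coeff f = 1" using l factor_lead_pos[OF assms] by linarith
  show "degree f > 0"
  proof (rule ccontr)
    assume "\<not> degree f > 0"
    then obtain c where "f = [:c:]" by (metis degree_eq_zeroE neq0_conv)
    then have "f = 1" using l1 by simp
    then show False using pe by simp
  qed
  have "coeff f 0 * coeff g 0 = 1" using coeff_Q_0 unfolding g by (simp add: coeff_mult_0)
  then show "\<bar>coeff f 0\<bar> = 1" by (metis dvd_triv_left zdvd1_eq)
qed

lemma factor_root: "f \<in># factors \<Longrightarrow> poly (cpoly f) z = 0 \<Longrightarrow> poly (cpoly Q) z = 0"
proof -
  assume f: "f \<in># factors" and z: "poly (cpoly f) z = 0"
  obtain g where "Q = f * g" using factorD(4)[OF f] by auto
  then have "cpoly Q = cpoly f * cpoly g" by (simp add: hom_distribs)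
  then show ?thesis using z by simp
qed

lemma proots_Q: "proots (cpoly Q) = (\<Sum>f\<in>#factors. proots (cpoly f))"
proof -
  have *: "proots (cpoly (prod_mset M)) = (\<Sum>f\<in>#M. proots (cpoly f))" if "0 \<notin># M" for M
    using that
  proof (induction M)
    case (add f M)
    then have "cpoly f \<noteq> 0" "cpoly (prod_mset M) \<noteq> 0" by (auto simp: prod_mset_zero_iff)
    then show ?case using add by (simp add: hom_distribs proots_mult)
  qed simp
  have "0 \<notin># factors" using factorD(1) by fastforce
  from *[OF this] show ?thesis unfolding prod_factors .
qed

lemma sum_over_factors:
  fixes g :: "complex \<Rightarrow> real"
  shows "(\<Sum>z\<in>#proots (cpoly Q). g z) = (\<Sum>f\<in>#factors. \<Sum>z\<in>#proots (cpoly f). g z)"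
proof -
  have "(\<Sum>z\<in>#(\<Sum>f\<in>#M. proots (cpoly f)). g z) = (\<Sum>f\<in>#M. \<Sum>z\<in>#proots (cpoly f). g z)" for M
    by (induction M) auto
  then show ?thesis unfolding proots_Q .
qed

lemma sum_degrees: "(\<Sum>f\<in>#factors. real (degree f)) = real d"
proof -
  have "size (\<Sum>f\<in>#factors. proots (cpoly f)) = d" unfolding proots_Q[symmetric] by (simp add: degree_Q)
  moreover have "real (size (\<Sum>f\<in>#M. proots (cpoly f))) = (\<Sum>f\<in>#M. real (degree f))" for M
    by (induction M) auto
  ultimately show ?thesis by metis
qed

lemma log_house_Q: "log_house Q \<le> ln (real n + 1)"
proof -
  have lc: "lead_coeff (cpoly Q) = 1" using lead_Q by simp
  have "log_house Q = (LINT x|unit_interval. ln (cmod (poly (cpoly Q) (circle_pt x))))"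
    unfolding log_house_def using jensen(2)[OF lc] by simp
  also have "\<dots> \<le> (LINT x|unit_interval. ln (real n + 1))"
  proof (rule integral_mono_AE)
    show "integrable unit_interval (\<lambda>x. ln (cmod (poly (cpoly Q) (circle_pt x))))" by (rule jensen(1)[OF lc])
    show "integrable unit_interval (\<lambda>x. ln (real n + 1))"
      by (auto intro!: finite_measure.integrable_const prob_space.finite_measure prob_space_unit_interval)
    have "AE x in unit_interval. poly (cpoly Q) (circle_pt x) \<noteq> 0"
      by (rule AE_poly_circle_nonzero) (use Q_nz in simp)
    then show "AE x in unit_interval. ln (cmod (poly (cpoly Q) (circle_pt x))) \<le> ln (real n + 1)"
    proof eventually_elim
      case (elim x)
      have "cmod (poly (cpoly Q) (circle_pt x)) \<le> (\<Sum>j\<in>{0..n}. cmod (circle_pt x ^ e j))"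
        unfolding poly_Q by (rule norm_sum)
      also have "\<dots> = real n + 1" by (simp add: norm_power)
      finally show ?case using elim by simp
    qed
  qed
  also have "\<dots> = ln (real n + 1)" using prob_space.prob_space[OF prob_space_unit_interval] by simp
  finally show ?thesis .
qed

lemma reflect_Q_eval: "z \<noteq> 0 \<Longrightarrow> poly (cpoly (reflect_poly Q)) z = z ^ d * poly (cpoly Q) (inverse z)"
proof -
  assume z: "z \<noteq> 0"
  have "cpoly (reflect_poly Q) = reflect_poly (cpoly Q)"
    by (rule poly_eqI) (simp add: coeff_reflect_poly)
  then show ?thesis using poly_reflect_poly_nz[OF z, of "cpoly Q"] by (simp add: degree_Q)
qed

text \<open>On the unit circle 1 / z is the conjugate of z, so a root of Q there is also a root of
  the reciprocal polynomial. In general, comparing Q at z and at the reflected point 1 / cnj z term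
  by term leaves the factor 1 - |z|^2.\<close>

lemma reflect_Q_bound:
  assumes z: "poly (cpoly Q) z = 0"
  shows "cmod (poly (cpoly (reflect_poly Q)) z) \<le> \<bar>1 - (cmod z)\<^sup>2\<bar> * ((real n + 1) * real d) * exp (2 * real d * log_plus z)"
proof -
  define w where "w = cnj z"
  have z0: "z \<noteq> 0" "w \<noteq> 0" using root_nz[OF z] by (auto simp: w_def)
  have cw: "cmod w = cmod z" by (simp add: w_def)
  have "cnj (poly (cpoly (reflect_poly Q)) z) = poly (cpoly (reflect_poly Q)) w"
    unfolding w_def by (simp add: poly_altdef)
  also have "\<dots> = w ^ d * (poly (cpoly Q) (inverse w) - poly (cpoly Q) z)"
    unfolding reflect_Q_eval[OF z0(2)] z by simp
  also have "\<dots> = (\<Sum>j\<in>{0..n}. w ^ (d - e j) * (1 - (z * w) ^ e j))"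
    unfolding poly_Q sum_subtractf[symmetric] sum_distrib_left
  proof (rule sum.cong[OF refl])
    fix j assume "j \<in> {0..n}"
    then have "w ^ d = w ^ (d - e j) * w ^ e j" using e_le[of j] by (simp flip: power_add)
    then show "w ^ d * (inverse w ^ e j - z ^ e j) = w ^ (d - e j) * (1 - (z * w) ^ e j)"
      using z0 by (simp add: algebra_simps power_mult_distrib power_inverse)
  qed
  also have "\<dots> = (1 - z * w) * (\<Sum>j\<in>{0..n}. \<Sum>l<e j. w ^ (d - e j) * (z * w) ^ l)"
    by (simp add: one_diff_power_eq sum_distrib_left mult_ac)
  finally have eq: "cnj (poly (cpoly (reflect_poly Q)) z) = (1 - z * w) * (\<Sum>j\<in>{0..n}. \<Sum>l<e j. w ^ (d - e j) * (z * w) ^ l)" .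
  have "cmod (\<Sum>j\<in>{0..n}. \<Sum>l<e j. w ^ (d - e j) * (z * w) ^ l) \<le> (\<Sum>j\<in>{0..n}. \<Sum>l<e j. exp (2 * real d * log_plus z))"
  proof (intro order_trans[OF norm_sum] sum_mono)
    fix j l assume j: "j \<in> {0..n}" and l: "l \<in> {..<e j}"
    have "cmod (w ^ (d - e j) * (z * w) ^ l) = cmod z ^ (d - e j + 2 * l)"
      by (simp add: norm_mult norm_power cw power_add power_mult power2_eq_square power_mult_distrib)
    also have "\<dots> \<le> exp (real (2 * d) * log_plus z)"
      by (rule cmod_power_le_log_plus[OF z0(1)]) (use e_le[OF j] l in auto)
    finally show "cmod (w ^ (d - e j) * (z * w) ^ l) \<le> exp (2 * real d * log_plus z)" by simp
  qed
  also have "\<dots> = (\<Sum>j\<in>{0..n}. real (e j)) * exp (2 * real d * log_plus z)"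
    by (simp add: sum_distrib_right)
  also have "\<dots> \<le> (\<Sum>j\<in>{0..n}. real d) * exp (2 * real d * log_plus z)"
    by (intro mult_right_mono sum_mono) (use e_le in auto)
  finally have b: "cmod (\<Sum>j\<in>{0..n}. \<Sum>l<e j. w ^ (d - e j) * (z * w) ^ l) \<le> (real n + 1) * real d * exp (2 * real d * log_plus z)"
    by (simp add: algebra_simps)
  have zw: "z * w = of_real ((cmod z)\<^sup>2)" by (simp only: w_def complex_norm_square)
  have "cmod (1 - z * w) = \<bar>1 - (cmod z)\<^sup>2\<bar>" unfolding zw by (metis norm_of_real of_real_1 of_real_diff)
  have "cmod (poly (cpoly (reflect_poly Q)) z) = \<bar>1 - (cmod z)\<^sup>2\<bar> * cmod (\<Sum>j\<in>{0..n}. \<Sum>l<e j. w ^ (d - e j) * (z * w) ^ l)"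
    unfolding \<open>cmod (1 - z * w) = _\<close>[symmetric] norm_mult[symmetric] eq[symmetric] by simp
  also have "\<dots> \<le> \<bar>1 - (cmod z)\<^sup>2\<bar> * ((real n + 1) * real d * exp (2 * real d * log_plus z))"
    by (intro mult_left_mono b) auto
  finally show ?thesis by (simp add: mult.assoc)
qed

text \<open>Once p ln+ |z| is removed, what matters is 1 - r^p with r the smaller of |z| and 1 /
  |z|, and this is at least 1 - r for every p >= 1. So the bound does not deteriorate with
  p.\<close>

lemma power_defect_point_lower:
  assumes "cmod z \<noteq> 1" "z \<noteq> 0" "p \<ge> 1"
  shows "ln (cmod (z ^ p - 1)) - real p * log_plus z \<ge> ln \<bar>1 - (cmod z)\<^sup>2\<bar> - ln 2 - 2 * log_plus z"
proof -
  have main: "ln (1 - r ^ p) \<ge> ln (1 - r\<^sup>2) - ln 2" if r: "0 < r" "r < 1" for r :: real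
  proof -
    have "1 - r\<^sup>2 = (1 - r) * (1 + r)" by (simp add: power2_eq_square algebra_simps)
    also have "\<dots> \<le> (1 - r) * 2" using r by (intro mult_left_mono) auto
    finally have "1 - r\<^sup>2 \<le> 2 * (1 - r)" by simp
    also have "r ^ p \<le> r ^ 1" using assms(3) r by (intro power_decreasing) auto
    then have "2 * (1 - r) \<le> 2 * (1 - r ^ p)" by simp
    finally have le: "1 - r\<^sup>2 \<le> 2 * (1 - r ^ p)" .
    have "0 < 1 - r\<^sup>2" "0 < 1 - r ^ p" using r assms(3) by (auto simp: power_less_one_iff)
    then have "ln (1 - r\<^sup>2) \<le> ln (2 * (1 - r ^ p))" using le by (subst ln_le_cancel_iff) auto
    also have "\<dots> = ln 2 + ln (1 - r ^ p)" using \<open>0 < 1 - r ^ p\<close> by (subst ln_mult) auto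
    finally show ?thesis by simp
  qed
  show ?thesis
  proof (cases "cmod z < 1")
    case True
    then have lp: "log_plus z = 0" using assms(2) by (simp add: log_plus_def)
    have p1: "cmod z ^ p < 1" using True assms(3) by (simp add: power_less_one_iff)
    have "1 - cmod z ^ p \<le> cmod (z ^ p - 1)"
      using norm_triangle_ineq2[of 1 "z ^ p"] by (simp add: norm_power norm_minus_commute)
    then have "ln (1 - cmod z ^ p) \<le> ln (cmod (z ^ p - 1))" using p1 by (subst ln_le_cancel_iff) auto
    moreover have "ln (1 - (cmod z)\<^sup>2) - ln 2 \<le> ln (1 - cmod z ^ p)" by (rule main) (use True assms(2) in auto)
    moreover have "\<bar>1 - (cmod z)\<^sup>2\<bar> = 1 - (cmod z)\<^sup>2" using True by (simp add: power_le_one)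
    ultimately show ?thesis using lp by simp
  next
    case False
    then have z1: "cmod z > 1" using assms(1) by simp
    then have lp: "log_plus z = ln (cmod z)" by (simp add: log_plus_def)
    define r where "r = 1 / cmod z"
    have "0 < cmod z" using z1 by linarith
    then have r: "0 < r" "r < 1" using z1 by (simp_all add: r_def divide_less_eq)
    have rp: "r ^ p < 1" using r assms(3) by (simp add: power_less_one_iff)
    have "cmod z ^ p \<noteq> 0" using \<open>0 < cmod z\<close> by simp
    then have "cmod z ^ p * (1 - r ^ p) = cmod z ^ p - 1" unfolding r_def power_one_over by (simp add: field_simps del: power_eq_0_iff norm_eq_zero)
    also have "\<dots> \<le> cmod (z ^ p - 1)" using norm_triangle_ineq2[of "z ^ p" 1] by (simp add: norm_power)
    finally have le: "cmod z ^ p * (1 - r ^ p) \<le> cmod (z ^ p - 1)" .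
    have pp: "0 < cmod z ^ p * (1 - r ^ p)"
      using zero_less_power[OF \<open>0 < cmod z\<close>, of p] rp by (intro mult_pos_pos) auto
    have "ln (cmod z ^ p * (1 - r ^ p)) \<le> ln (cmod (z ^ p - 1))"
      using ln_le_cancel_iff[OF pp order_less_le_trans[OF pp le]] le by blast
    moreover have "ln (cmod z ^ p * (1 - r ^ p)) = real p * ln (cmod z) + ln (1 - r ^ p)"
      using ln_mult_pos[of "cmod z ^ p" "1 - r ^ p"] zero_less_power[OF \<open>0 < cmod z\<close>, of p] rp \<open>0 < cmod z\<close>
      by (simp add: ln_realpow)
    moreover have "ln (1 - r\<^sup>2) - ln 2 \<le> ln (1 - r ^ p)" by (rule main) (use r in auto)
    moreover have "ln \<bar>1 - (cmod z)\<^sup>2\<bar> = ln (1 - r\<^sup>2) + 2 * ln (cmod z)"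
    proof -
      have "\<bar>1 - (cmod z)\<^sup>2\<bar> = (cmod z)\<^sup>2 - 1" using z1 by (simp add: one_less_power)
      also have "\<dots> = (1 - r\<^sup>2) * (cmod z)\<^sup>2" using \<open>0 < cmod z\<close> by (simp add: r_def field_simps)
      moreover have "1 - r\<^sup>2 > 0" using r by (simp add: power_less_one_iff)
      ultimately show ?thesis using \<open>0 < cmod z\<close> by (simp only: ln_mult_pos zero_less_power) (simp add: ln_realpow)
    qed
    ultimately show ?thesis using lp by simp
  qed
qed

text \<open>The prime f shares no root with the reciprocal polynomial, whose norm over the roots of
  f is therefore a nonzero integer. By \<open>reflect_Q_bound\<close> this bounds the product of the
  | 1 - |z|^2 | from below, at a price depending on d and not on p.\<close>

lemma power_defect_lower_coprime:
  assumes f: "f \<in># factors" and nd: "\<not> f dvd reflect_poly Q" and p: "p \<ge> 1"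
  shows "power_defect p f \<ge> - real (degree f) * ln (2 * ((real n + 1) * real d)) - (2 * real d + 2) * log_house f"
proof -
  note fD = factorD[OF f]
  have f0: "cpoly f \<noteq> 0" using fD by auto
  define c where "c = (real n + 1) * real d"
  have c: "c > 0" using d_pos by (simp add: c_def)
  have nz: "poly (cpoly (reflect_poly Q)) z \<noteq> 0" if "poly (cpoly f) z = 0" for z
    using nd prime_dvd_of_common_root[OF fD(1) that] by auto
  have z1: "cmod z \<noteq> 1" "z \<noteq> 0" if "poly (cpoly f) z = 0" for z
  proof -
    have q: "poly (cpoly Q) z = 0" using factor_root[OF f that] .
    show z0: "z \<noteq> 0" using root_nz[OF q] .
    show "cmod z \<noteq> 1"
    proof
      assume "cmod z = 1"
      then have "\<bar>1 - (cmod z)\<^sup>2\<bar> = 0" by simp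
      then show False using reflect_Q_bound[OF q] nz[OF that] by simp
    qed
  qed
  have "1 \<le> cmod (root_norm f (reflect_poly Q))" by (rule root_norm_ge_1[OF fD(1,3,2)]) (rule nz)
  then have "0 \<le> ln (cmod (root_norm f (reflect_poly Q)))" by simp
  also have "\<dots> = (\<Sum>z\<in>#proots (cpoly f). ln (cmod (poly (cpoly (reflect_poly Q)) z)))"
    unfolding root_norm_def by (rule ln_cmod_prod_mset) (use nz f0 in auto)
  also have "\<dots> \<le> (\<Sum>z\<in>#proots (cpoly f). ((ln (cmod (z ^ p - 1)) - real p * log_plus z) + ln (2 * c)) + (2 * real d + 2) * log_plus z)"
  proof (rule sum_mset_le_sum_mset)
    fix z assume "z \<in># proots (cpoly f)"
    then have z: "poly (cpoly f) z = 0" using f0 by simp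
    have q: "poly (cpoly Q) z = 0" using factor_root[OF f z] .
    have sq: "\<bar>1 - (cmod z)\<^sup>2\<bar> > 0" 
    proof -
      have "(cmod z)\<^sup>2 \<noteq> 1" using z1(1)[OF z] by (metis norm_ge_zero one_power2 power2_eq_imp_eq zero_le_one)
      then show ?thesis by simp
    qed
    have "ln (cmod (poly (cpoly (reflect_poly Q)) z)) \<le> ln (\<bar>1 - (cmod z)\<^sup>2\<bar> * c * exp (2 * real d * log_plus z))"
      using nz[OF z] reflect_Q_bound[OF q] sq c unfolding c_def[symmetric] by (subst ln_le_cancel_iff) auto
    also have "\<dots> = ln \<bar>1 - (cmod z)\<^sup>2\<bar> + ln c + 2 * real d * log_plus z"
      using sq c by (simp add: ln_mult)
    also have "ln \<bar>1 - (cmod z)\<^sup>2\<bar> \<le> (ln (cmod (z ^ p - 1)) - real p * log_plus z) + ln 2 + 2 * log_plus z"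
      using power_defect_point_lower[OF z1[OF z] p] by simp
    finally show "ln (cmod (poly (cpoly (reflect_poly Q)) z)) \<le> ((ln (cmod (z ^ p - 1)) - real p * log_plus z) + ln (2 * c)) + (2 * real d + 2) * log_plus z"
      using c by (simp add: ln_mult algebra_simps)
  qed
  also have "\<dots> = power_defect p f + real (degree f) * ln (2 * c) + (2 * real d + 2) * log_house f"
    unfolding power_defect_def log_house_def sum_mset.distrib sum_mset_distrib_left by simp
  finally show ?thesis by (simp add: c_def)
qed

end

context sparse_setup
begin

text \<open>If \<open>f\<close> divides a block but neither part of it at a gap, comparing the two parts at every root of
  \<open>f\<close> bounds its height by the inverse of the gap.\<close>

lemma log_house_le_spread:
  assumes f: "f \<in># factors" and I: "I \<subseteq> {0..n}" "I \<noteq> {}" and dvd: "f dvd block_poly I"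
    and min: "\<And>J. J \<subset> I \<Longrightarrow> J \<noteq> {} \<Longrightarrow> \<not> f dvd block_poly J"
  shows "log_house f * real (Max (e ` I) - Min (e ` I)) \<le> real n * ln (real n + 1) * real (degree f)"
    and "Max (e ` I) > Min (e ` I)"
proof -
  note fD = factorD[OF f]
  have f0: "cpoly f \<noteq> 0" using fD by auto
  have finI: "finite I" using I finite_subset by blast
  have injI: "inj_on e I" by (rule inj_on_subset[OF inj I(1)])
  have root: "z \<noteq> 0" "(\<Sum>j\<in>I. z ^ e j) = 0" if "poly (cpoly f) z = 0" for z
  proof -
    show "z \<noteq> 0" using root_nz[OF factor_root[OF f that]] .
    obtain g where "block_poly I = f * g" using dvd by auto
    then have "cpoly (block_poly I) = cpoly f * cpoly g" by (simp add: hom_distribs)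
    then have "poly (cpoly (block_poly I)) z = 0" using that by simp
    then show "(\<Sum>j\<in>I. z ^ e j) = 0" unfolding poly_block .
  qed
  have "\<not> constant (poly (cpoly f))" using fD by (simp add: constant_degree)
  then obtain z0 where z0: "poly (cpoly f) z0 = 0" using fundamental_theorem_of_algebra by blast
  have "card I \<noteq> 1"
  proof
    assume "card I = 1"
    then obtain j where "I = {j}" by (auto simp: card_1_singleton_iff)
    then show False using root[OF z0] by simp
  qed
  moreover have "card I \<noteq> 0" using finI I by simp
  ultimately have "card I \<ge> 2" by linarith
  then obtain k where k: "card I = Suc (Suc k)" by (metis add_2_eq_Suc le_Suc_ex)
  have "card I \<le> card {0..n}" using I by (intro card_mono) auto
  then have kn: "Suc k \<le> n" using k by simp
  obtain a b where ab: "a \<in> e ` I" "b \<in> e ` I" "a < b" "\<forall>x\<in>e ` I. x \<le> a \<or> b \<le> x"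
    "Max (e ` I) - Min (e ` I) \<le> Suc k * (b - a)"
  proof -
    have "finite (e ` I)" "card (e ` I) = Suc (Suc k)" using finI k by (auto simp: card_image[OF injI])
    from consecutive_gap[OF this] show ?thesis using that by blast
  qed
  have "a \<le> Max (e ` I)" "b \<le> Max (e ` I)" "Min (e ` I) \<le> a" using ab finI by auto
  then show "Max (e ` I) > Min (e ` I)" using ab(3) by linarith
  define I1 where "I1 = {j \<in> I. e j \<le> a}"
  define I2 where "I2 = {j \<in> I. b \<le> e j}"
  have part: "I1 \<union> I2 = I" "I1 \<inter> I2 = {}" using ab by (auto simp: I1_def I2_def)
  have fin12: "finite I1" "finite I2" using finI by (auto simp: I1_def I2_def)
  have I1_sub: "I1 \<subset> I" "I1 \<noteq> {}"
  proof -
    obtain jb where jb: "jb \<in> I" "e jb = b" using ab(2) by auto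
    then have "jb \<notin> I1" using ab(3) by (simp add: I1_def)
    then show "I1 \<subset> I" using jb by (auto simp: I1_def)
    show "I1 \<noteq> {}" using ab(1) by (auto simp: I1_def)
  qed
  have nd1: "\<not> f dvd block_poly I1" by (rule min[OF I1_sub])
  define m where "m = Min (e ` I)"
  have m_le: "m \<le> e j" if "j \<in> I" for j using finI that by (simp add: m_def)
  define R :: "int poly" where "R = (\<Sum>j\<in>I1. monom 1 (e j - m))"
  have R_eval: "poly (cpoly R) z = (\<Sum>j\<in>I1. z ^ (e j - m))" for z
    unfolding R_def by (simp add: of_int_poly_hom.hom_sum map_poly_monom poly_sum poly_monom)
  have "block_poly I1 = monom 1 m * R"
    unfolding block_poly_def R_def sum_distrib_left
    by (intro sum.cong refl) (use m_le part in \<open>auto simp: mult_monom\<close>)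
  then have ndR: "\<not> f dvd R" using nd1 by auto
  have nz: "poly (cpoly R) z \<noteq> 0" if "poly (cpoly f) z = 0" for z
    using ndR prime_dvd_of_common_root[OF fD(1) that] by blast
  have card12: "real (card I1) \<le> real n + 1" "real (card I2) \<le> real n + 1"
    using \<open>card I \<le> card {0..n}\<close> card_mono[OF finI, of I1] card_mono[OF finI, of I2] part by auto
  define lm where "lm = (\<lambda>z. max 0 (- ln (cmod z)))"
  have bound: "ln (cmod (poly (cpoly R) z)) \<le> ln (real n + 1) + real (a - m) * log_plus z - real (b - m) * lm z"
    if z: "poly (cpoly f) z = 0" for z
  proof (cases "cmod z \<ge> 1")
    case True
    have zp: "cmod z > 0" using True by linarith
    have "cmod (poly (cpoly R) z) \<le> (\<Sum>j\<in>I1. cmod z ^ (a - m))"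
      unfolding R_eval
    proof (intro order_trans[OF norm_sum] sum_mono)
      fix j assume "j \<in> I1"
      then show "cmod (z ^ (e j - m)) \<le> cmod z ^ (a - m)"
        unfolding norm_power using True by (intro power_increasing) (auto simp: I1_def)
    qed
    also have "\<dots> \<le> (real n + 1) * cmod z ^ (a - m)" using card12 by (simp add: mult_right_mono)
    finally have "ln (cmod (poly (cpoly R) z)) \<le> ln ((real n + 1) * cmod z ^ (a - m))"
      using nz[OF z] zp by (subst ln_le_cancel_iff) auto
    also have "\<dots> = ln (real n + 1) + real (a - m) * ln (cmod z)"
      using zp by (simp add: ln_mult ln_realpow)
    finally show ?thesis using True by (simp add: lm_def log_plus_def)
  next
    \<comment> \<open>Inside the disc the vanishing of the whole block replaces I1 by minus I2,
      whose exponents are at least b. The gain b - m here against the loss a - m outside leaves the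
      gap b - a.\<close>
    case False
    have zp: "cmod z > 0" using root(1)[OF z] by simp
    have "z ^ m * poly (cpoly R) z = (\<Sum>j\<in>I1. z ^ e j)"
      unfolding R_eval sum_distrib_left
      by (intro sum.cong refl) (use m_le part in \<open>auto simp flip: power_add\<close>)
    also have "\<dots> = - (\<Sum>j\<in>I2. z ^ e j)"
      using root(2)[OF z] part fin12 by (metis add_eq_0_iff2 sum.union_disjoint)
    finally have "cmod (z ^ m * poly (cpoly R) z) = cmod (\<Sum>j\<in>I2. z ^ e j)" by simp
    also have "\<dots> \<le> (\<Sum>j\<in>I2. cmod z ^ b)"
    proof (intro order_trans[OF norm_sum] sum_mono)
      fix j assume "j \<in> I2"
      then show "cmod (z ^ e j) \<le> cmod z ^ b"
        unfolding norm_power using False by (intro power_decreasing) (auto simp: I2_def)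
    qed
    also have "\<dots> \<le> (real n + 1) * cmod z ^ b" using card12 by (simp add: mult_right_mono)
    finally have "ln (cmod (z ^ m * poly (cpoly R) z)) \<le> ln ((real n + 1) * cmod z ^ b)"
      using nz[OF z] zp by (subst ln_le_cancel_iff) (auto simp: norm_mult norm_power)
    moreover have "ln (cmod (z ^ m * poly (cpoly R) z)) = real m * ln (cmod z) + ln (cmod (poly (cpoly R) z))"
      using nz[OF z] zp by (simp add: norm_mult norm_power ln_mult ln_realpow)
    moreover have "ln ((real n + 1) * cmod z ^ b) = ln (real n + 1) + real b * ln (cmod z)"
      using zp by (simp add: ln_mult ln_realpow)
    moreover have "lm z = - ln (cmod z)" "log_plus z = 0" using False zp by (simp_all add: lm_def log_plus_def)
    moreover have "real (b - m) = real b - real m" using ab m_def finI by (simp add: of_nat_diff)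
    ultimately show ?thesis by (simp add: algebra_simps)
  qed
  have "1 \<le> cmod (root_norm f R)" by (rule root_norm_ge_1[OF fD(1,3,2)]) (rule nz)
  then have "0 \<le> ln (cmod (root_norm f R))" by simp
  also have "\<dots> = (\<Sum>z\<in>#proots (cpoly f). ln (cmod (poly (cpoly R) z)))"
    unfolding root_norm_def by (rule ln_cmod_prod_mset) (use nz f0 in auto)
  also have "\<dots> \<le> (\<Sum>z\<in>#proots (cpoly f). (ln (real n + 1) + real (a - m) * log_plus z) - real (b - m) * lm z)"
    by (rule sum_mset_le_sum_mset) (use bound f0 in auto)
  also have "\<dots> = real (degree f) * ln (real n + 1) + real (a - m) * log_house f - real (b - m) * (\<Sum>z\<in>#proots (cpoly f). lm z)"
    unfolding log_house_def sum_mset_diff sum_mset.distrib sum_mset_distrib_left by simp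
  \<comment> \<open>The constant coefficient of f is 1 or -1, so the product of the roots has
    modulus 1 and the roots inside the disc balance those outside.\<close>
  also have "(\<Sum>z\<in>#proots (cpoly f). lm z) = log_house f"
  proof -
    have lcf: "lead_coeff (cpoly f) = 1" using fD by simp
    have "(\<Prod>z\<in>#proots (cpoly f). 0 - z) = poly (cpoly f) 0" using poly_monic_eq_prod_roots[OF lcf, of 0] by simp
    also have "cmod \<dots> = 1" using fD(5) by (simp add: poly_0_coeff_0)
    finally have "0 = ln (cmod (\<Prod>z\<in>#proots (cpoly f). 0 - z))" by simp
    also have "\<dots> = (\<Sum>z\<in>#proots (cpoly f). ln (cmod (0 - z)))"
      by (rule ln_cmod_prod_mset) (use root f0 in auto)
    also have "\<dots> = (\<Sum>z\<in>#proots (cpoly f). log_plus z - lm z)"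
      by (intro arg_cong[where f = sum_mset] image_mset_cong) (auto simp: log_plus_def lm_def max_def)
    finally show ?thesis unfolding log_house_def sum_mset_diff by simp
  qed
  finally have "0 \<le> real (degree f) * ln (real n + 1) - (real (b - m) - real (a - m)) * log_house f"
    by (simp add: algebra_simps)
  moreover have "real (b - m) - real (a - m) = real (b - a)"
    using ab finI by (simp add: m_def of_nat_diff)
  ultimately have gap: "real (b - a) * log_house f \<le> real (degree f) * ln (real n + 1)" by simp
  have "real (Max (e ` I) - Min (e ` I)) \<le> real (n * (b - a))"
    using ab(5) kn by (meson le_trans mult_le_mono1 of_nat_mono)
  then have "log_house f * real (Max (e ` I) - Min (e ` I)) \<le> log_house f * real (n * (b - a))"
    by (intro mult_left_mono) auto
  also have "\<dots> = real n * (real (b - a) * log_house f)" by simp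
  also have "\<dots> \<le> real n * (real (degree f) * ln (real n + 1))" by (intro mult_left_mono gap) auto
  finally show "log_house f * real (Max (e ` I) - Min (e ` I)) \<le> real n * ln (real n + 1) * real (degree f)"
    by (simp add: mult_ac)
qed

section \<open>Pairs of vanishing sub-sums and the number of their common zeros\<close>

definition reciprocal_pair :: "nat set \<Rightarrow> nat set \<Rightarrow> bool" where
  "reciprocal_pair I J \<longleftrightarrow> I = {0..n} \<and> J = {0..n}"

text \<open>Two situations in one notation. Disjoint I and J stand for two sub-sums vanishing at the
  same z; the pair of full index sets stands for Q vanishing at z and at 1 / z. Nonempty sets cannot
  be of both kinds.\<close>

definition common_zeros :: "nat set \<Rightarrow> nat set \<Rightarrow> complex set" where
  "common_zeros I J = {z. z \<noteq> 0 \<and> (\<Sum>j\<in>I. z ^ e j) = 0 \<and>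
     (if reciprocal_pair I J then (\<Sum>j\<in>J. inverse z ^ e j) = 0 else (\<Sum>j\<in>J. z ^ e j) = 0)}"

definition spread :: "nat set \<Rightarrow> nat" where
  "spread I = Max (e ` I) - Min (e ` I)"

text \<open>Take a minimal block I divisible by f. If it is proper, f also divides the complementary
  block, which contains a minimal block J disjoint from I; if it is everything, the reciprocal
  polynomial supplies the second equation. Minimality makes \<open>log_house_le_spread\<close>
  available for both blocks, hence for the larger spread.\<close>

lemma factor_pair:
  assumes f: "f \<in># factors" and rec: "f dvd reflect_poly Q"
  shows "\<exists>I J. I \<subseteq> {0..n} \<and> J \<subseteq> {0..n} \<and> I \<noteq> {} \<and> J \<noteq> {} \<and> (reciprocal_pair I J \<or> I \<inter> J = {}) \<and>
     max (spread I) (spread J) > 0 \<and>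
     (\<forall>z. poly (cpoly f) z = 0 \<longrightarrow> z \<in> common_zeros I J) \<and>
     log_house f * real (max (spread I) (spread J)) \<le> real n * ln (real n + 1) * real (degree f)"
proof -
  have minimal: "\<exists>I\<subseteq>U. I \<noteq> {} \<and> f dvd block_poly I \<and> (\<forall>J. J \<subset> I \<longrightarrow> J \<noteq> {} \<longrightarrow> \<not> f dvd block_poly J)"
    if "f dvd block_poly U" "U \<noteq> {}" "U \<subseteq> {0..n}" for U
    using that
  proof (induction "card U" arbitrary: U rule: less_induct)
    case less
    show ?case
    proof (cases "\<exists>J. J \<subset> U \<and> J \<noteq> {} \<and> f dvd block_poly J")
      case True
      then obtain J where J: "J \<subset> U" "J \<noteq> {}" "f dvd block_poly J" by blast
      have "finite U" using less.prems finite_subset by blast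
      then have "card J < card U" using J by (simp add: psubset_card_mono)
      moreover have "J \<subseteq> {0..n}" using J(1) less.prems(3) by auto
      ultimately obtain I where I: "I \<subseteq> J" "I \<noteq> {}" "f dvd block_poly I"
        "\<forall>K. K \<subset> I \<longrightarrow> K \<noteq> {} \<longrightarrow> \<not> f dvd block_poly K"
        using less.hyps[OF _ J(3,2)] by metis
      moreover have "I \<subseteq> U" using I(1) J(1) by auto
      ultimately show ?thesis by (intro exI[of _ I] conjI)
    next
      case False
      then show ?thesis using less.prems by (intro exI[of _ U] conjI) auto
    qed
  qed
  have ev: "z \<noteq> 0 \<and> (\<Sum>j\<in>I. z ^ e j) = 0" if dv: "f dvd block_poly I" and fz: "poly (cpoly f) z = 0" for I z
  proof -
    obtain g where "block_poly I = f * g" using dv by auto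
    then have "cpoly (block_poly I) = cpoly f * cpoly g" by (simp add: hom_distribs)
    then have "poly (cpoly (block_poly I)) z = 0" using fz by simp
    then show ?thesis unfolding poly_block using root_nz[OF factor_root[OF f fz]] by simp
  qed
  obtain I where I: "I \<subseteq> {0..n}" "I \<noteq> {}" "f dvd block_poly I" "\<And>J. J \<subset> I \<Longrightarrow> J \<noteq> {} \<Longrightarrow> \<not> f dvd block_poly J"
    using minimal[of "{0..n}"] factorD(4)[OF f] by auto
  note hI = log_house_le_spread[OF f I, folded spread_def]
  show ?thesis
  proof (cases "I = {0..n}")
    case True
    have "z \<in> common_zeros I I" if z: "poly (cpoly f) z = 0" for z
    proof -
      have zI: "z \<noteq> 0" "(\<Sum>j\<in>I. z ^ e j) = 0" using ev[OF I(3) z] by auto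
      obtain g where "reflect_poly Q = f * g" using rec by auto
      then have "cpoly (reflect_poly Q) = cpoly f * cpoly g" by (simp add: hom_distribs)
      then have "poly (cpoly (reflect_poly Q)) z = 0" using z by simp
      then have "(\<Sum>j\<in>{0..n}. inverse z ^ e j) = 0" using zI by (simp add: reflect_Q_eval poly_Q)
      then show ?thesis using zI True by (simp add: common_zeros_def reciprocal_pair_def)
    qed
    then show ?thesis using I hI True by (intro exI[of _ I]) (auto simp: reciprocal_pair_def spread_def)
  next
    case False
    define U where "U = {0..n} - I"
    have U: "U \<subseteq> {0..n}" "U \<noteq> {}" "I \<inter> U = {}" using False I by (auto simp: U_def)
    have "Q = block_poly I + block_poly U"
    proof -
      have "finite I" using I finite_subset by blast
      then have "block_poly (I \<union> U) = block_poly I + block_poly U"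
        unfolding block_poly_def using U by (intro sum.union_disjoint) (auto simp: U_def)
      moreover have "I \<union> U = {0..n}" using I by (auto simp: U_def)
      ultimately show ?thesis by simp
    qed
    then have dvdU: "f dvd block_poly U" using factorD(4)[OF f] I(3) by (metis dvd_add_right_iff)
    obtain J where J: "J \<subseteq> U" "J \<noteq> {}" "f dvd block_poly J" "\<And>K. K \<subset> J \<Longrightarrow> K \<noteq> {} \<Longrightarrow> \<not> f dvd block_poly K"
      using minimal[OF dvdU U(2,1)] by auto
    have JU: "J \<subseteq> {0..n}" using J U by auto
    note hJ = log_house_le_spread[OF f JU J(2-4), folded spread_def]
    have "\<not> reciprocal_pair I J" using False by (simp add: reciprocal_pair_def)
    then have cz: "\<forall>z. poly (cpoly f) z = 0 \<longrightarrow> z \<in> common_zeros I J"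
      using ev[OF I(3)] ev[OF J(3)] by (simp add: common_zeros_def)
    have lh: "log_house f * real (max (spread I) (spread J)) \<le> real n * ln (real n + 1) * real (degree f)"
      using hI(1) hJ(1) by (auto simp: max_def)
    have mx: "max (spread I) (spread J) > 0" using hI(2) by (simp add: spread_def)
    have "I \<inter> J = {}" using J(1) U(3) by blast
    then have or: "reciprocal_pair I J \<or> I \<inter> J = {}" by (rule disjI2)
    show ?thesis
      by (rule exI[of _ I], rule exI[of _ J]) (intro conjI I(1,2) JU J(2) or mx cz lh)
  qed
qed

text \<open>Dirichlet's theorem for the \<beta> j / s gives q and y j with q \<beta> j - s y j of
  size at most s / N. With z = t^q, X = t and Y = t^s both sums become Laurent polynomials in X and
  Y with exponents bounded by s / N and 2 q, so \<open>torus_zero_count\<close> bounds q times the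
  number of zeros by 16 q s / N. Parallel differences of exponents are excluded by the absence of
  relations with coefficients up to L, as L >= 4 N^(n+1).\<close>

lemma common_zeros_count:
  assumes I: "I \<subseteq> {0..n}" "I \<noteq> {}" and J: "J \<subseteq> {0..n}" "J \<noteq> {}"
    and IJ: "reciprocal_pair I J \<or> I \<inter> J = {}" and sp: "max (spread I) (spread J) > 0"
    and N: "N \<ge> 1" "4 * N ^ Suc n \<le> L"
  shows "finite (common_zeros I J)"
    "real (card (common_zeros I J)) * real N \<le> 16 * real (max (spread I) (spread J))"
proof -
  define s where "s = max (spread I) (spread J)"
  have fin: "finite I" "finite J" using I J finite_subset by blast+
  \<comment> \<open>Each block is measured from its own least exponent, so that \<beta> is bounded
    by the spread s and not merely by d.\<close>
  define bs where "bs = (\<lambda>j. if j \<in> I then Min (e ` I) else Min (e ` J))"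
  define \<beta> where "\<beta> = (\<lambda>j. int (e j) - int (bs j))"
  have \<beta>_s: "\<bar>\<beta> j\<bar> \<le> int s" if "j \<in> I \<union> J" for j
  proof -
    have *: "int (e j) - int (Min (e ` K)) \<ge> 0 \<and> int (e j) - int (Min (e ` K)) \<le> int (spread K)"
      if "j \<in> K" "finite K" for K
    proof -
      have "Min (e ` K) \<le> e j" "e j \<le> Max (e ` K)" using that by auto
      then show ?thesis unfolding spread_def by linarith
    qed
    show ?thesis
      using *[of I] *[of J] that fin unfolding \<beta>_def bs_def s_def by (auto split: if_splits)
  qed
  have s0: "s > 0" using sp by (simp add: s_def)
  obtain q :: int and y :: "nat \<Rightarrow> int" where q: "0 < q" "q \<le> int (N ^ Suc n)"
    and qy: "\<And>i. i < Suc n \<Longrightarrow> \<bar>of_int q * (real_of_int (\<beta> i) / real s) - of_int (y i)\<bar> < 1 / real N"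
    using Dirichlet_approx_simult[of N "Suc n" "\<lambda>i. real_of_int (\<beta> i) / real s"] N by auto
  define x where "x = (\<lambda>j. q * \<beta> j - int s * y j)"
  define h where "h = s div N"
  define m where "m = 2 * nat q"
  have jn: "j < Suc n" if "j \<in> I \<union> J" for j using that I J by auto
  have xh: "\<bar>x j\<bar> \<le> int h" if j: "j \<in> I \<union> J" for j
  proof -
    have "real s * \<bar>of_int q * (real_of_int (\<beta> j) / real s) - of_int (y j)\<bar> < real s * (1 / real N)"
      using qy[OF jn[OF j]] s0 by (intro mult_strict_left_mono) auto
    moreover have "real s * \<bar>of_int q * (real_of_int (\<beta> j) / real s) - of_int (y j)\<bar> = \<bar>real_of_int (x j)\<bar>"
    proof -
      have "real s * \<bar>of_int q * (real_of_int (\<beta> j) / real s) - of_int (y j)\<bar>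
          = \<bar>real s * (of_int q * (real_of_int (\<beta> j) / real s) - of_int (y j))\<bar>" by (simp add: abs_mult)
      also have "real s * (of_int q * (real_of_int (\<beta> j) / real s) - of_int (y j)) = real_of_int (x j)"
        using s0 by (simp add: x_def algebra_simps)
      finally show ?thesis .
    qed
    ultimately have "\<bar>real_of_int (x j)\<bar> * real N < real s" using N by (simp add: field_simps)
    then have "real_of_int (\<bar>x j\<bar> * int N) < real_of_int (int s)" by simp
    then have "\<bar>x j\<bar> * int N < int s" by (simp only: of_int_less_iff)
    then have "(\<bar>x j\<bar> * int N) div int N \<le> int s div int N" using N by (intro zdiv_mono1) auto
    then have "\<bar>x j\<bar> \<le> int s div int N" using N by simp
    then show ?thesis by (simp add: h_def zdiv_int)
  qed
  have ym: "\<bar>y j\<bar> \<le> int m" if j: "j \<in> I \<union> J" for j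
  proof -
    have "\<bar>real_of_int (\<beta> j)\<bar> \<le> real s" using \<beta>_s[OF j] by linarith
    then have "\<bar>real_of_int (\<beta> j) / real s\<bar> \<le> 1" using s0 by simp
    then have "\<bar>of_int q * (real_of_int (\<beta> j) / real s)\<bar> \<le> of_int q * 1"
      unfolding abs_mult using q by (intro mult_mono) auto
    moreover have "1 / real N \<le> 1" using N by simp
    moreover define w where "w = of_int q * (real_of_int (\<beta> j) / real s)"
    ultimately have "\<bar>w\<bar> \<le> of_int q" "\<bar>w - of_int (y j)\<bar> < 1" using qy[OF jn[OF j]] by auto
    then have "\<bar>real_of_int (y j)\<bar> < real_of_int q + 1" by linarith
    then have "\<bar>y j\<bar> \<le> q" by linarith
    then show ?thesis using q by (simp add: m_def)
  qed
  have mL: "2 * int m \<le> int L"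
  proof -
    have "2 * int m = 4 * q" using q by (simp add: m_def)
    also have "\<dots> \<le> 4 * int (N ^ Suc n)" using q by simp
    also have "\<dots> \<le> int L" using N(2) by (metis of_nat_le_iff of_nat_mult of_nat_numeral)
    finally show ?thesis .
  qed
  have yL: "\<bar>y i - y j\<bar> \<le> int L" if "i \<in> I \<union> J" "j \<in> I \<union> J" for i j
    using ym[OF that(1)] ym[OF that(2)] mL by linarith
  have diffI: "x i - x j = q * (int (e i) - int (e j)) - int s * (y i - y j)" if "i \<in> I" "j \<in> I" for i j
    using that by (simp add: x_def \<beta>_def bs_def algebra_simps)
  have diffJ: "x i - x j = q * (int (e i) - int (e j)) - int s * (y i - y j)" if "i \<in> J" "j \<in> J" "I \<inter> J = {}" for i j
  proof -
    have "i \<notin> I" "j \<notin> I" using that by auto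
    then show ?thesis by (simp add: x_def \<beta>_def bs_def algebra_simps)
  qed
  \<comment> \<open>In the cross product the terms with s cancel. What is left is q times a relation
    between differences of e whose coefficients are differences of y, hence at most L.\<close>
  have par_gen: "(y k - y l) * (int (e i) - int (e j)) = (y i - y j) * (int (e k) - int (e l))"
    if "x i - x j = q * (int (e i) - int (e j)) - int s * (y i - y j)"
       "x k - x l = q * (int (e k) - int (e l)) - int s * (y k - y l)"
       "(x i - x j) * (y k - y l) = (x k - x l) * (y i - y j)" for i j k l
  proof -
    have "q * ((y k - y l) * (int (e i) - int (e j))) = q * ((y i - y j) * (int (e k) - int (e l)))"
      using that(3) unfolding that(1,2) by (simp add: algebra_simps)
    then show ?thesis using q by simp
  qed
  have e_ne: "e i \<noteq> e j" if "i \<in> {0..n}" "j \<in> {0..n}" "i \<noteq> j" for i j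
    using inj that by (auto dest: inj_onD)
  have nv_gen: "x i \<noteq> x j" if "x i - x j = q * (int (e i) - int (e j)) - int s * (y i - y j)"
     "y i = y j" "i \<in> {0..n}" "j \<in> {0..n}" "i \<noteq> j" for i j
  proof -
    have "x i - x j = q * (int (e i) - int (e j))" using that(1,2) by simp
    moreover have "q * (int (e i) - int (e j)) \<noteq> 0" using e_ne[OF that(3-5)] q by simp
    ultimately have "x i - x j \<noteq> 0" by (simp only: not_False_eq_True)
    then show ?thesis by (simp only: right_minus_eq not_False_eq_True)
  qed
  have cardle: "card I \<le> Suc n" "card J \<le> Suc n"
    using I J card_mono[of "{0..n}" I] card_mono[of "{0..n}" J] by auto
  have powI: "t powi (x j + int s * y j) = (t ^ nat q) ^ e j * (t powi (- q * int (bs j)))" if "t \<noteq> 0" for t :: complex and j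
  proof -
    have 1: "x j + int s * y j = q * int (e j) + (- q * int (bs j))" by (simp add: x_def \<beta>_def algebra_simps)
    have 2: "t powi (q * int (e j)) = (t ^ nat q) ^ e j"
      using q by (simp add: power_int_def nat_mult_distrib power_mult flip: power_mult)
    have "t powi (q * int (e j) + (- q * int (bs j))) = t powi (q * int (e j)) * t powi (- q * int (bs j))"
      by (rule power_int_add) (use that in blast)
    then show ?thesis unfolding 1 2 .
  qed
  have m1: "m \<ge> 1" and q1: "nat q \<ge> 1" using q by (auto simp: m_def)
  have main: "finite (common_zeros I J) \<and> nat q * card (common_zeros I J) \<le> 8 * m * h"
  proof (cases "reciprocal_pair I J")
    case True
    then have IJ_all: "I = {0..n}" "J = {0..n}" by (auto simp: reciprocal_pair_def)
    obtain i' j' k' l' where r2: "i' \<in> {0..n}" "j' \<in> {0..n}" "k' \<in> {0..n}" "l' \<in> {0..n}" "i' \<noteq> j'"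
      "\<And>u v. \<bar>u\<bar> \<le> int L \<Longrightarrow> \<bar>v\<bar> \<le> int L \<Longrightarrow> u * (int (e i') - int (e j')) = v * (int (e k') - int (e l')) \<Longrightarrow> u = 0 \<and> v = 0"
      using rel2 by blast
    have r2I: "i' \<in> I" "j' \<in> I" "k' \<in> I" "l' \<in> I" using r2(1-4) IJ_all by simp_all
    have nvI: "x i \<noteq> x j" if "i \<in> I" "j \<in> I" "i \<noteq> j" "y i = y j" for i j
      using nv_gen[OF diffI] that I by blast
    have parI: "y i = y j" if a: "i \<in> I" "j \<in> I" "k \<in> I" "l \<in> I" "distinct [i, j, k, l]"
        "(x i - x j) * (y k - y l) = (x k - x l) * (y i - y j)" for i j k l
    proof -
      have "(y k - y l) * (int (e i) - int (e j)) = (y i - y j) * (int (e k) - int (e l))"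
        by (rule par_gen[OF diffI diffI a(6)]) (use a in auto)
      then have "y k - y l = 0 \<and> y i - y j = 0"
        by (intro rel[of i j k l]) (use a I yL in auto)
      then show "y i = y j" by simp
    qed
    have par2I: "y i' = y j'" if a: "(x i' - x j') * (y k' - y l') = (x k' - x l') * (y i' - y j')"
    proof -
      have "(y k' - y l') * (int (e i') - int (e j')) = (y i' - y j') * (int (e k') - int (e l'))"
        by (rule par_gen[OF diffI diffI a]) (use r2I in auto)
      then have "y k' - y l' = 0 \<and> y i' - y j' = 0"
        by (intro r2(6)) (use r2I yL in auto)
      then show "y i' = y j'" by simp
    qed
    have ymI: "\<bar>y i\<bar> \<le> int m" if "i \<in> I" for i using ym that by blast
    have nc: "\<exists>X0>0. \<forall>Y. Y \<noteq> 0 \<longrightarrow> \<not> ((\<Sum>j\<in>I. of_real X0 powi x j * Y powi y j) = 0 \<and>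
       (\<Sum>j\<in>I. of_real X0 powi (- x j) * Y powi (- y j)) = (0::complex))"
      by (rule no_common_zero_reciprocal[OF fin(1) I(2) cardle(1) nvI parI r2I(1,2) r2(5) r2I(3,4) par2I ymI])
    have zt: "t \<noteq> 0 \<and> (\<Sum>j\<in>I. t powi (x j + int s * y j)) = 0 \<and> (\<Sum>j\<in>I. t powi (- x j + int s * - y j)) = 0"
      if t: "t ^ nat q \<in> common_zeros I J" for t :: complex
    proof -
      have t0: "t \<noteq> 0" using q t by (auto simp: common_zeros_def power_0_left)
      have z: "(\<Sum>j\<in>I. (t ^ nat q) ^ e j) = 0" "(\<Sum>j\<in>I. inverse (t ^ nat q) ^ e j) = 0"
        using t True IJ_all by (auto simp: common_zeros_def)
      have bsI: "bs j = Min (e ` I)" if "j \<in> I" for j using that by (simp add: bs_def)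
      have "(\<Sum>j\<in>I. t powi (x j + int s * y j)) = (\<Sum>j\<in>I. (t ^ nat q) ^ e j * (t powi (- q * int (Min (e ` I)))))"
        by (intro sum.cong refl) (simp add: powI[OF t0] bsI)
      also have "\<dots> = 0" using z(1) by (simp flip: sum_distrib_right)
      finally have 1: "(\<Sum>j\<in>I. t powi (x j + int s * y j)) = 0" .
      have "(\<Sum>j\<in>I. t powi (- x j + int s * - y j)) = (\<Sum>j\<in>I. inverse (t ^ nat q) ^ e j * inverse (t powi (- q * int (Min (e ` I)))))"
      proof (intro sum.cong refl)
        fix j assume j: "j \<in> I"
        have "t powi (- x j + int s * - y j) = inverse (t powi (x j + int s * y j))"
          by (simp flip: power_int_minus)
        then show "t powi (- x j + int s * - y j) = inverse (t ^ nat q) ^ e j * inverse (t powi (- q * int (Min (e ` I))))"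
          unfolding powI[OF t0] bsI[OF j] by (simp add: power_inverse)
      qed
      also have "\<dots> = 0" using z(2) by (simp flip: sum_distrib_right)
      finally show "t \<noteq> 0 \<and> (\<Sum>j\<in>I. t powi (x j + int s * y j)) = 0 \<and> (\<Sum>j\<in>I. t powi (- x j + int s * - y j)) = 0"
        using t0 1 by simp
    qed
    have hx: "\<bar>x j\<bar> \<le> int h" "\<bar>- x j\<bar> \<le> int h" "\<bar>y j\<bar> \<le> int m" "\<bar>- y j\<bar> \<le> int m" if "j \<in> I" for j
      using xh ym that by simp_all
    show ?thesis
      using torus_zero_count[where x' = "\<lambda>j. - x j" and y' = "\<lambda>j. - y j", OF fin(1) I(2) fin(1) I(2) hx(1,2,3,4) m1 q1 zt nc] by blast
  next
    case False
    then have disj: "I \<inter> J = {}" using IJ by simp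
    have nvI: "x i \<noteq> x j" if "i \<in> I" "j \<in> I" "i \<noteq> j" "y i = y j" for i j
      using nv_gen[OF diffI] that I by blast
    have parI: "y i = y j" if a: "i \<in> I" "j \<in> I" "i \<noteq> j" "k \<in> J" "l \<in> J" "k \<noteq> l"
        "(x i - x j) * (y k - y l) = (x k - x l) * (y i - y j)" for i j k l
    proof -
      have "(y k - y l) * (int (e i) - int (e j)) = (y i - y j) * (int (e k) - int (e l))"
        by (rule par_gen[OF diffI diffJ a(7)]) (use a disj in auto)
      then have "y k - y l = 0 \<and> y i - y j = 0"
        by (intro rel[of i j k l]) (use a I J disj yL in auto)
      then show "y i = y j" by simp
    qed
    have nc: "\<exists>X0>0. \<forall>Y. Y \<noteq> 0 \<longrightarrow> \<not> ((\<Sum>j\<in>I. of_real X0 powi x j * Y powi y j) = 0 \<and>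
       (\<Sum>j\<in>J. of_real X0 powi x j * Y powi y j) = (0::complex))"
      by (rule no_common_zero_disjoint[OF fin(1) I(2) cardle(1) fin(2) J(2) cardle(2) disj nvI parI ym])
    have zt: "t \<noteq> 0 \<and> (\<Sum>j\<in>I. t powi (x j + int s * y j)) = 0 \<and> (\<Sum>j\<in>J. t powi (x j + int s * y j)) = 0"
      if t: "t ^ nat q \<in> common_zeros I J" for t :: complex
    proof -
      have t0: "t \<noteq> 0" using q t by (auto simp: common_zeros_def power_0_left)
      have z: "(\<Sum>j\<in>I. (t ^ nat q) ^ e j) = 0" "(\<Sum>j\<in>J. (t ^ nat q) ^ e j) = 0"
        using t False by (auto simp: common_zeros_def)
      have bsI: "bs j = Min (e ` I)" if "j \<in> I" for j using that by (simp add: bs_def)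
      have bsJ: "bs j = Min (e ` J)" if "j \<in> J" for j using that disj by (auto simp: bs_def)
      have "(\<Sum>j\<in>I. t powi (x j + int s * y j)) = (\<Sum>j\<in>I. (t ^ nat q) ^ e j * (t powi (- q * int (Min (e ` I)))))"
        by (intro sum.cong refl) (simp add: powI[OF t0] bsI)
      also have "\<dots> = 0" using z(1) by (simp flip: sum_distrib_right)
      finally have 1: "(\<Sum>j\<in>I. t powi (x j + int s * y j)) = 0" .
      have "(\<Sum>j\<in>J. t powi (x j + int s * y j)) = (\<Sum>j\<in>J. (t ^ nat q) ^ e j * (t powi (- q * int (Min (e ` J)))))"
        by (intro sum.cong refl) (simp add: powI[OF t0] bsJ)
      also have "\<dots> = 0" using z(2) by (simp flip: sum_distrib_right)
      finally show "t \<noteq> 0 \<and> (\<Sum>j\<in>I. t powi (x j + int s * y j)) = 0 \<and> (\<Sum>j\<in>J. t powi (x j + int s * y j)) = 0"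
        using t0 1 by simp
    qed
    have hxI: "\<bar>x j\<bar> \<le> int h" "\<bar>y j\<bar> \<le> int m" if "j \<in> I" for j using xh ym that by simp_all
    have hxJ: "\<bar>x j\<bar> \<le> int h" "\<bar>y j\<bar> \<le> int m" if "j \<in> J" for j using xh ym that by simp_all
    show ?thesis
      using torus_zero_count[OF fin(1) I(2) fin(2) J(2) hxI(1) hxJ(1) hxI(2) hxJ(2) m1 q1 zt nc] by blast
  qed
  then show "finite (common_zeros I J)" by simp
  have "nat q * card (common_zeros I J) \<le> nat q * (16 * h)" using main by (simp add: m_def)
  then have "card (common_zeros I J) \<le> 16 * h" using q by simp
  then have "card (common_zeros I J) * N \<le> 16 * h * N" by simp
  also have "\<dots> \<le> 16 * s" by (simp add: h_def mult.assoc)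
  finally have "real (card (common_zeros I J) * N) \<le> real (16 * s)" by (rule of_nat_mono)
  then show "real (card (common_zeros I J)) * real N \<le> 16 * real (max (spread I) (spread J))"
    unfolding s_def[symmetric] by simp
qed

end

section \<open>Roots of unity of prime order\<close>

lemma root_of_unity_coprime:
  fixes z :: complex
  assumes "z ^ m = 1" "z ^ p = 1" "coprime m p" "m > 0"
  shows "z = 1"
proof -
  obtain x y where xy: "m * x = p * y + gcd m p" using bezout_nat[of m p] assms(4) by auto
  have "1 = z ^ (m * x)" using assms(1) by (simp add: power_mult)
  also have "\<dots> = z ^ (p * y) * z ^ gcd m p" using xy by (simp add: power_add)
  also have "\<dots> = z" using assms(2,3) by (simp add: power_mult)
  finally show ?thesis by simp
qed

lemma inj_on_powers_prime:
  fixes z :: complex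
  assumes p: "prime p" and z: "z ^ p = 1" "z \<noteq> 1"
  shows "inj_on (\<lambda>k. z ^ k) {..<p}"
proof -
  have z0: "z \<noteq> 0" using z p by (auto simp: power_0_left prime_gt_0_nat split: if_splits)
  have *: "z ^ k \<noteq> z ^ l" if "k < l" "l < p" for k l
  proof
    assume eq: "z ^ k = z ^ l"
    have "z ^ l = z ^ k * z ^ (l - k)" using that by (simp flip: power_add)
    then have "z ^ (l - k) = 1" using eq z0 by simp
    moreover have "coprime (l - k) p"
      using p that by (metis coprime_commute diff_is_0_eq' less_imp_diff_less nat_dvd_not_less not_le prime_imp_coprime zero_less_diff)
    ultimately show False using root_of_unity_coprime[of z "l - k" p] z that by simp
  qed
  show ?thesis
    by (rule inj_onI) (metis * lessThan_iff linorder_neqE_nat)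
qed

lemma prod_root_of_unity_linear:
  fixes z :: complex
  assumes p: "prime p" and z: "z ^ p = 1" "z \<noteq> 1"
  shows "(\<Prod>k<p. [:- (z ^ k), 1:]) = monom 1 p - 1"
proof -
  define P where "P = (\<Prod>k<p. [:- (z ^ k), 1:])"
  define R where "R = monom 1 p - 1 - P"
  have p0: "p > 0" using p by (simp add: prime_gt_0_nat)
  have dP: "degree P = p" "lead_coeff P = 1"
    unfolding P_def by (subst degree_prod_sum_eq; simp) (simp add: lead_coeff_prod)
  have "coeff (monom 1 p - 1 :: complex poly) i = 0" if "i > p" for i using that p0 by (simp add: coeff_1)
  have cR: "coeff R i = 0" if "i \<ge> p" for i
  proof (cases "i = p")
    case True
    then show ?thesis using dP p0 by (simp add: R_def)
  next
    case False
    then show ?thesis using that dP p0 by (simp add: R_def coeff_eq_0)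
  qed
  have roots: "(\<lambda>k. z ^ k) ` {..<p} \<subseteq> {x. poly R x = 0}"
  proof safe
    fix k assume "k < p"
    then have "poly P (z ^ k) = 0" unfolding P_def poly_prod by (intro prod_zero) auto
    moreover have "(z ^ k) ^ p = 1" by (metis power_commutes power_mult mult.commute power_one z(1))
    ultimately show "poly R (z ^ k) = 0" by (simp add: R_def poly_monom)
  qed
  have "R = 0"
  proof (rule ccontr)
    assume R: "R \<noteq> 0"
    have "card ((\<lambda>k. z ^ k) ` {..<p}) \<le> card {x. poly R x = 0}"
      by (rule card_mono[OF poly_roots_finite[OF R] roots])
    also have "\<dots> \<le> degree R" by (rule card_poly_roots_bound[OF R])
    finally have "p \<le> degree R" using inj_on_powers_prime[OF p z] by (simp add: card_image)
    then show False using cR[of "degree R"] R by simp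
  qed
  then show ?thesis by (simp add: R_def P_def)
qed

text \<open>Dividing X^p - 1 by X - 1 identifies the product with 1 + X + ... + X^(p-1) at X =
  1.\<close>

lemma prod_one_minus_powers:
  fixes z :: complex
  assumes p: "prime p" and z: "z ^ p = 1" "z \<noteq> 1"
  shows "(\<Prod>k=1..<p. 1 - z ^ k) = of_nat p"
proof -
  define S where "S = (\<Sum>i<p. monom (1::complex) i)"
  have p0: "p > 0" using p by (simp add: prime_gt_0_nat)
  have "[:-1, 1:] * (\<Prod>k=1..<p. [:- (z ^ k), 1:]) = (\<Prod>k<p. [:- (z ^ k), 1:])"
  proof -
    have "{..<p} = insert 0 {1..<p}" using p0 by auto
    then show ?thesis by simp
  qed
  also have "\<dots> = monom 1 p - 1" by (rule prod_root_of_unity_linear[OF p z])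
  also have "\<dots> = [:-1, 1:] * S"
  proof -
    have "monom (1::complex) p - 1 = (monom 1 1) ^ p - 1" by (simp add: monom_power)
    also have "\<dots> = (monom 1 1 - 1) * (\<Sum>i<p. (monom 1 1) ^ i)" by (rule power_diff_1_eq)
    also have "monom (1::complex) 1 - 1 = [:-1, 1:]" by (intro poly_eqI) (simp add: coeff_pCons split: nat.split)
    finally show ?thesis by (simp add: S_def monom_power)
  qed
  finally have "(\<Prod>k=1..<p. [:- (z ^ k), 1:]) = S" by (simp only: mult_cancel_left) simp
  then have "poly (\<Prod>k=1..<p. [:- (z ^ k), 1:]) 1 = poly S 1" by simp
  then show ?thesis by (simp add: S_def poly_prod poly_sum poly_monom)
qed

lemma root_norm_mult: "root_norm f (g * h) = root_norm f g * root_norm f h"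
proof -
  have "(\<Prod>z\<in>#M. poly (cpoly (g * h)) z) = (\<Prod>z\<in>#M. poly (cpoly g) z) * (\<Prod>z\<in>#M. poly (cpoly h) z)" for M
    by (induction M) (simp_all add: hom_distribs)
  then show ?thesis unfolding root_norm_def .
qed

lemma root_norm_cong:
  assumes "\<And>z. z \<in># proots (cpoly f) \<Longrightarrow> poly (cpoly g) z = poly (cpoly h) z"
  shows "root_norm f g = root_norm f h"
  unfolding root_norm_def using assms by (intro arg_cong[where f = prod_mset] image_mset_cong)

lemma sum_mset_partition:
  fixes g :: "'a \<Rightarrow> real"
  assumes "finite K" "\<And>f. f \<in># M \<Longrightarrow> \<kappa> f \<in> K"
  shows "(\<Sum>f\<in>#M. g f) = (\<Sum>k\<in>K. \<Sum>f\<in>#filter_mset (\<lambda>f. \<kappa> f = k) M. g f)"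
  using assms(2)
proof (induction M)
  case (add a M)
  have "(\<Sum>k\<in>K. \<Sum>f\<in>#filter_mset (\<lambda>f. \<kappa> f = k) (add_mset a M). g f)
      = (\<Sum>k\<in>K. (if \<kappa> a = k then g a else 0) + (\<Sum>f\<in>#filter_mset (\<lambda>f. \<kappa> f = k) M. g f))"
    by (intro sum.cong refl) auto
  also have "\<dots> = g a + (\<Sum>k\<in>K. \<Sum>f\<in>#filter_mset (\<lambda>f. \<kappa> f = k) M. g f)"
    using add.prems assms(1) by (simp add: sum.distrib)
  finally show ?case using add by simp
qed simp

section \<open>From the factors of Q to the average over the roots of unity\<close>

context sparse_setup
begin

text \<open>Let f be a factor of Q vanishing at a p-th root of unity. The norms of 1 - z^k over the
  roots of f, for 0 < k < p, multiply to a power of p with exponent deg f, so p divides one of them.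
  As k is invertible modulo p, 1 - z is a multiple of 1 - z^k, so p divides the norm f(1) of 1 - z
  and hence Q(1) = n + 1, which is positive and smaller than p.\<close>

lemma no_root_of_unity:
  assumes p: "prime p" "p > n + 1" and Qz: "poly (cpoly Q) w = 0"
  shows "w ^ p \<noteq> 1"
proof
  assume wp: "w ^ p = 1"
  have "w \<in># proots (cpoly Q)" using Qz Q_nz by simp
  then obtain f where f: "f \<in># factors" and fw: "poly (cpoly f) w = 0"
    unfolding proots_Q using factorD(1) by fastforce
  note fD = factorD[OF f]
  have f0: "cpoly f \<noteq> 0" using fD by auto
  have Q1: "poly (cpoly Q) 1 = of_nat (n + 1)" unfolding poly_Q by simp
  define X :: "nat \<Rightarrow> int poly" where "X = (\<lambda>k. 1 - monom 1 k)"
  have Xe: "poly (cpoly (X k)) z = 1 - z ^ k" for k z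
    by (simp add: X_def hom_distribs map_poly_monom poly_monom)
  have "f dvd X p" by (rule prime_dvd_of_common_root[OF fD(1) fw]) (simp add: Xe wp)
  then obtain g where g: "X p = f * g" by auto
  have z: "z ^ p = 1" "z \<noteq> 1" if "z \<in># proots (cpoly f)" for z
  proof -
    have fz: "poly (cpoly f) z = 0" using that f0 by simp
    have "poly (cpoly (X p)) z = 0" unfolding g using fz by (simp add: hom_distribs)
    then show "z ^ p = 1" by (simp add: Xe)
    show "z \<noteq> 1"
    proof
      assume "z = 1"
      then have "of_nat (n + 1) = (0::complex)" using factor_root[OF f fz] Q1 by simp
      then show False by (metis Suc_eq_plus1 nat.simps(3) of_nat_eq_0_iff)
    qed
  qed
  have "\<forall>k. \<exists>N::int. root_norm f (X k) = of_int N"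
    using root_norm_integer[OF fD(1,3,2)] by blast
  then obtain N :: "nat \<Rightarrow> int" where N: "root_norm f (X k) = of_int (N k)" for k by metis
  have prodN: "(\<Prod>k=1..<p. N k) = int p ^ degree f"
  proof -
    have "complex_of_int (\<Prod>k=1..<p. N k) = (\<Prod>k=1..<p. \<Prod>z\<in>#proots (cpoly f). 1 - z ^ k)"
      by (simp add: N[symmetric] root_norm_def Xe)
    also have "\<dots> = (\<Prod>z\<in>#proots (cpoly f). \<Prod>k=1..<p. 1 - z ^ k)"
    proof -
      have "(\<Prod>k=1..<p. \<Prod>z\<in>#M. 1 - z ^ k) = (\<Prod>z\<in>#M. \<Prod>k=1..<p. 1 - z ^ k)" for M :: "complex multiset"
        by (induction M) (simp_all add: prod.distrib)
      then show ?thesis .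
    qed
    also have "\<dots> = (\<Prod>z\<in>#proots (cpoly f). of_nat p)"
      by (intro arg_cong[where f = prod_mset] image_mset_cong prod_one_minus_powers p(1) z)
    also have "\<dots> = complex_of_int (int p ^ degree f)" by simp
    finally show ?thesis by (simp only: of_int_eq_iff)
  qed
  have "int p dvd (\<Prod>k=1..<p. N k)" unfolding prodN using fD(3) by simp
  then obtain k where k: "k \<in> {1..<p}" "int p dvd N k"
    using p(1) by (subst (asm) prime_dvd_prod_iff) auto
  have "coprime k p" using k(1) p(1)
    by (metis atLeastLessThan_iff coprime_commute nat_dvd_not_less not_one_le_zero prime_imp_coprime zero_less_iff_neq_zero)
  then obtain k' where k': "[k * k' = 1] (mod p)" using coprime_iff_invertible_nat by (metis One_nat_def)
  \<comment> \<open>A geometric series in u^k with k' terms turns 1 - u^k into 1 - u^(k k') = 1 -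
    u.\<close>
  have "root_norm f (X 1) = root_norm f (X k * (\<Sum>i<k'. monom 1 (k * i)))"
  proof (rule root_norm_cong)
    fix u assume u: "u \<in># proots (cpoly f)"
    have "u ^ (k * k') = u ^ ((k * k') mod p)"
    proof -
      have "u ^ (k * k') = u ^ (p * ((k * k') div p) + (k * k') mod p)" by simp
      also have "\<dots> = (u ^ p) ^ ((k * k') div p) * u ^ ((k * k') mod p)" by (simp only: power_add power_mult)
      also have "\<dots> = u ^ ((k * k') mod p)" using z(1)[OF u] by simp
      finally show ?thesis .
    qed
    also have "(k * k') mod p = 1" using k' prime_gt_1_nat[OF p(1)] by (simp add: cong_def)
    finally have uk: "u ^ (k * k') = u" by simp
    have "poly (cpoly (X k * (\<Sum>i<k'. monom 1 (k * i)))) u = (1 - u ^ k) * (\<Sum>i<k'. (u ^ k) ^ i)"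
      by (simp add: hom_distribs Xe map_poly_monom poly_sum poly_monom power_mult)
    also have "\<dots> = 1 - (u ^ k) ^ k'" by (rule one_diff_power_eq[symmetric])
    also have "\<dots> = 1 - u" using uk by (simp add: power_mult)
    finally show "poly (cpoly (X 1)) u = poly (cpoly (X k * (\<Sum>i<k'. monom 1 (k * i)))) u" by (simp add: Xe)
  qed
  then have eq: "root_norm f (X 1) = root_norm f (X k) * root_norm f (\<Sum>i<k'. monom 1 (k * i))"
    by (simp only: root_norm_mult)
  obtain r :: int where r: "root_norm f (\<Sum>i<k'. monom 1 (k * i)) = of_int r"
    using root_norm_integer[OF fD(1,3,2)] by metis
  have "complex_of_int (N 1) = of_int (N k * r)" using eq unfolding N r by simp
  then have "N 1 = N k * r" by (simp only: of_int_eq_iff)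
  then have pN1: "int p dvd N 1" using k(2) by simp
  have lcf: "lead_coeff (cpoly f) = 1" using fD by simp
  have "complex_of_int (N 1) = (\<Prod>u\<in>#proots (cpoly f). 1 - u)" by (simp add: N[symmetric] root_norm_def Xe)
  also have "\<dots> = poly (cpoly f) 1" by (rule poly_monic_eq_prod_roots[OF lcf, symmetric])
  also have "\<dots> = of_int (poly f 1)" by (metis of_int_1 of_int_hom.poly_map_poly)
  finally have "N 1 = poly f 1" by (simp only: of_int_eq_iff)
  obtain h where h: "Q = f * h" using fD(4) by auto
  have "complex_of_int (poly Q 1) = of_nat (n + 1)" using Q1 by (metis of_int_1 of_int_hom.poly_map_poly)
  then have "poly Q 1 = int (n + 1)" by (metis of_int_eq_iff of_int_of_nat_eq)
  then have "int (n + 1) = poly f 1 * poly h 1" unfolding h by simp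
  then have "int p dvd int (n + 1)" using pN1 \<open>N 1 = poly f 1\<close> by (metis dvd_mult2)
  then have "p dvd n + 1" by (simp only: int_dvd_int_iff)
  then show False using p(2) by (auto dest: dvd_imp_le)
qed

text \<open>Exchange the product over the points with the product over the roots: for fixed w, the
  |\<zeta>^t - w| multiply to |w^p - 1|.\<close>

lemma root_of_unity_sum:
  assumes p: "prime p" "p > n + 1"
  shows "\<And>t. poly (cpoly Q) (circle_pt (real t / real p)) \<noteq> 0"
    "(\<Sum>t<p. ln (cmod (poly (cpoly Q) (circle_pt (real t / real p))))) - real p * log_house Q = power_defect p Q"
proof -
  define \<zeta> where "\<zeta> = circle_pt (1 / real p)"
  have p1: "p > 1" using p by (simp add: prime_gt_1_nat)
  have zt: "circle_pt (real t / real p) = \<zeta> ^ t" for t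
  proof -
    have "2 * pi * (real t / real p) = real t * (2 * pi * (1 / real p))" by simp
    then show ?thesis by (simp only: \<zeta>_def Complex.DeMoivre)
  qed
  have zp: "\<zeta> ^ p = 1"
  proof -
    have "real p * (2 * pi * (1 / real p)) = 2 * pi" using p1 by simp
    then show ?thesis unfolding \<zeta>_def Complex.DeMoivre by (simp only: cis_2pi)
  qed
  have z1: "\<zeta> \<noteq> 1"
  proof
    assume "\<zeta> = 1"
    then have "circle_pt (1 / real p) = circle_pt 0" by (simp add: \<zeta>_def)
    then have "1 / real p = 0" by (rule inj_onD[OF inj_on_circle_pt]) (use p1 in auto)
    then show False using p1 by simp
  qed
  have ztp: "(\<zeta> ^ t) ^ p = 1" for t by (metis mult.commute power_mult power_one zp)
  show nz: "poly (cpoly Q) (circle_pt (real t / real p)) \<noteq> 0" for t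
    using no_root_of_unity[OF p, of "\<zeta> ^ t"] ztp[of t] unfolding zt by blast
  have lc: "lead_coeff (cpoly Q) = 1" using lead_Q by simp
  have root: "w ^ p \<noteq> 1" if "w \<in># proots (cpoly Q)" for w using no_root_of_unity[OF p, of w] that Q_nz by simp
  have "(\<Sum>t<p. ln (cmod (poly (cpoly Q) (circle_pt (real t / real p))))) = (\<Sum>t<p. \<Sum>w\<in>#proots (cpoly Q). ln (cmod (\<zeta> ^ t - w)))"
  proof (rule sum.cong[OF refl])
    fix t
    show "ln (cmod (poly (cpoly Q) (circle_pt (real t / real p)))) = (\<Sum>w\<in>#proots (cpoly Q). ln (cmod (\<zeta> ^ t - w)))"
      unfolding zt poly_monic_eq_prod_roots[OF lc] by (rule ln_cmod_prod_mset) (use root ztp in force)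
  qed
  also have "\<dots> = (\<Sum>w\<in>#proots (cpoly Q). \<Sum>t<p. ln (cmod (\<zeta> ^ t - w)))"
  proof -
    have "(\<Sum>t<p. \<Sum>w\<in>#M. ln (cmod (\<zeta> ^ t - w))) = (\<Sum>w\<in>#M. \<Sum>t<p. ln (cmod (\<zeta> ^ t - w)))" for M
      by (induction M) (simp_all add: sum.distrib)
    then show ?thesis .
  qed
  also have "\<dots> = (\<Sum>w\<in>#proots (cpoly Q). ln (cmod (w ^ p - 1)))"
  proof (intro arg_cong[where f = sum_mset] image_mset_cong)
    fix w assume w: "w \<in># proots (cpoly Q)"
    have ne: "\<zeta> ^ t - w \<noteq> 0" for t using root[OF w] ztp[of t] by auto
    have "(\<Prod>t<p. w - \<zeta> ^ t) = poly (\<Prod>k<p. [:- (\<zeta> ^ k), 1:]) w" by (simp add: poly_prod)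
    also have "\<dots> = w ^ p - 1" unfolding prod_root_of_unity_linear[OF p(1) zp z1] by (simp add: poly_monom)
    finally have "cmod (w ^ p - 1) = cmod (\<Prod>t<p. w - \<zeta> ^ t)" by (simp only:)
    also have "\<dots> = (\<Prod>t<p. cmod (w - \<zeta> ^ t))" by (rule prod_norm[symmetric])
    also have "\<dots> = (\<Prod>t<p. cmod (\<zeta> ^ t - w))" by (simp add: norm_minus_commute)
    finally show "(\<Sum>t<p. ln (cmod (\<zeta> ^ t - w))) = ln (cmod (w ^ p - 1))"
      using ne by (simp add: ln_prod)
  qed
  finally show "(\<Sum>t<p. ln (cmod (poly (cpoly Q) (circle_pt (real t / real p))))) - real p * log_house Q = power_defect p Q"
    unfolding power_defect_def log_house_def sum_mset_diff sum_mset_distrib_left by simp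
qed

text \<open>A nonzero root of Q has multiplicity at most n, since Q has n + 1 terms; so counting
  distinct zeros is enough.\<close>

lemma sum_degrees_le_zeros:
  assumes M: "M \<subseteq># factors" and Z: "finite Z" "0 \<notin> Z" and roots: "\<And>f z. f \<in># M \<Longrightarrow> poly (cpoly f) z = 0 \<Longrightarrow> z \<in> Z"
  shows "(\<Sum>f\<in>#M. real (degree f)) \<le> real n * real (card Z)"
proof -
  define R where "R = (\<Sum>f\<in>#M. proots (cpoly f))"
  have sz: "real (size (\<Sum>f\<in>#K. proots (cpoly f))) = (\<Sum>f\<in>#K. real (degree f))" for K
    by (induction K) auto
  obtain K where K: "factors = M + K" using M by (auto simp: subset_mset.le_iff_add)
  have cnt: "count R z \<le> order z (cpoly Q)" for z
  proof -
    have "count (proots (cpoly Q)) z = count R z + count (\<Sum>f\<in>#K. proots (cpoly f)) z"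
      unfolding proots_Q K R_def by simp
    then show ?thesis using Q_nz by simp
  qed
  have sub: "set_mset R \<subseteq> Z"
  proof
    fix z assume "z \<in># R"
    then obtain f where f: "f \<in># M" "z \<in># proots (cpoly f)" unfolding R_def by auto
    have "f \<in># factors" using f(1) M by (auto dest: mset_subset_eqD)
    then have "cpoly f \<noteq> 0" using factorD(1) by auto
    then show "z \<in> Z" using roots[OF f(1)] f(2) by simp
  qed
  have "size R = (\<Sum>z\<in>Z. count R z)"
    unfolding size_multiset_overloaded_eq by (rule sum.mono_neutral_left[OF Z(1) sub]) (auto simp: not_in_iff)
  also have "\<dots> \<le> (\<Sum>z\<in>Z. n)"
  proof (rule sum_mono)
    fix z assume "z \<in> Z"
    then have "z \<noteq> 0" using Z(2) by auto
    then show "count R z \<le> n" using cnt[of z] fewnomial_order_le[OF fewnomial_Q] le_trans by blast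
  qed
  finally have "size R \<le> n * card Z" by (simp add: mult.commute)
  then have "real (size R) \<le> real n * real (card Z)" by (metis of_nat_le_iff of_nat_mult)
  then show ?thesis unfolding R_def sz .
qed

text \<open>4^(n+1) counts the pairs of subsets of {0..n}, 16 comes from
  \<open>common_zeros_count\<close>, n ln (n+1) from \<open>log_house_le_spread\<close>, and the
  second n from the multiplicity of the zeros.\<close>

definition pair_constant :: real where
  "pair_constant = 16 * real n ^ 2 * ln (real n + 1) * 4 ^ Suc n"

text \<open>Sort the factors by a pair (I, J) from \<open>factor_pair\<close>. For one pair with
  larger spread s, the heights add up to at most a constant times the total degree over s, and the
  total degree is at most a constant times s / N; the spread cancels.\<close>

lemma reciprocal_factors_log_house:
  assumes N: "N \<ge> 1" "4 * N ^ Suc n \<le> L"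
  shows "(\<Sum>f\<in>#filter_mset (\<lambda>f. f dvd reflect_poly Q) factors. log_house f) \<le> pair_constant / real N"
proof -
  define F where "F = filter_mset (\<lambda>f. f dvd reflect_poly Q) factors"
  define good where "good = (\<lambda>f (I, J). I \<subseteq> {0..n} \<and> J \<subseteq> {0..n} \<and> I \<noteq> {} \<and> J \<noteq> {} \<and> (reciprocal_pair I J \<or> I \<inter> J = {}) \<and>
     max (spread I) (spread J) > 0 \<and>
     (\<forall>z. poly (cpoly f) z = 0 \<longrightarrow> z \<in> common_zeros I J) \<and>
     log_house f * real (max (spread I) (spread J)) \<le> real n * ln (real n + 1) * real (degree f))"
  define \<kappa> where "\<kappa> = (\<lambda>f. SOME IJ. good f IJ)"
  have \<kappa>: "good f (\<kappa> f)" if f: "f \<in># F" for f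
  proof -
    have "\<exists>IJ. good f IJ" using factor_pair[of f] f unfolding F_def good_def by auto
    then show ?thesis unfolding \<kappa>_def by (rule someI_ex)
  qed
  define K where "K = Pow {0..n} \<times> Pow {0..n}"
  have finK: "finite K" by (simp add: K_def)
  have cardK: "real (card K) = 4 ^ Suc n"
    by (simp add: K_def card_cartesian_product card_Pow power_mult_distrib[symmetric])
  have "\<kappa> f \<in> K" if "f \<in># F" for f using \<kappa>[OF that] unfolding good_def K_def by (auto split: prod.splits)
  then have "(\<Sum>f\<in>#F. log_house f) = (\<Sum>k\<in>K. \<Sum>f\<in>#filter_mset (\<lambda>f. \<kappa> f = k) F. log_house f)"
    by (intro sum_mset_partition finK)
  also have "\<dots> \<le> (\<Sum>k\<in>K. 16 * real n ^ 2 * ln (real n + 1) / real N)"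
  proof (rule sum_mono)
    fix k assume "k \<in> K"
    obtain I J where k: "k = (I, J)" by (cases k)
    define M where "M = filter_mset (\<lambda>f. \<kappa> f = k) F"
    have gM: "good f (I, J)" if "f \<in># M" for f using \<kappa>[of f] that unfolding M_def k by auto
    show "(\<Sum>f\<in>#filter_mset (\<lambda>f. \<kappa> f = k) F. log_house f) \<le> 16 * real n ^ 2 * ln (real n + 1) / real N"
    proof (cases "M = {#}")
      case True
      then show ?thesis unfolding M_def[symmetric] by simp
    next
      case False
      then obtain f0 where f0: "f0 \<in># M" by blast
      define s where "s = max (spread I) (spread J)"
      have IJ: "I \<subseteq> {0..n}" "I \<noteq> {}" "J \<subseteq> {0..n}" "J \<noteq> {}" "reciprocal_pair I J \<or> I \<inter> J = {}" "s > 0"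
        using gM[OF f0] by (auto simp: good_def s_def)
      note cz = common_zeros_count[OF IJ(1-5) IJ(6)[unfolded s_def] N, folded s_def]
      have sub: "M \<subseteq># factors" unfolding M_def F_def by (meson multiset_filter_subset subset_mset.order_trans)
      have z0: "0 \<notin> common_zeros I J" by (simp add: common_zeros_def)
      have rts: "z \<in> common_zeros I J" if "f \<in># M" "poly (cpoly f) z = 0" for f z
        using gM[OF that(1)] that(2) unfolding good_def by auto
      have deg: "(\<Sum>f\<in>#M. real (degree f)) \<le> real n * real (card (common_zeros I J))"
        by (rule sum_degrees_le_zeros[OF sub cz(1) z0 rts])
      have ln0: "ln (real n + 1) \<ge> 0" by simp
      define H where "H = (\<Sum>f\<in>#M. log_house f)"
      have "H * real s = (\<Sum>f\<in>#M. log_house f * real s)"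
        unfolding H_def by (rule sum_mset_distrib_right)
      also have "\<dots> \<le> (\<Sum>f\<in>#M. real n * ln (real n + 1) * real (degree f))"
        by (rule sum_mset_le_sum_mset) (use gM in \<open>auto simp: good_def s_def\<close>)
      also have "\<dots> = real n * ln (real n + 1) * (\<Sum>f\<in>#M. real (degree f))"
        by (rule sum_mset_distrib_left[symmetric])
      also have "\<dots> \<le> real n * ln (real n + 1) * (real n * real (card (common_zeros I J)))"
        using deg ln0 by (intro mult_left_mono) auto
      finally have "(H * real s) * real N \<le> (real n * ln (real n + 1) * (real n * real (card (common_zeros I J)))) * real N"
        by (intro mult_right_mono) auto
      also have "\<dots> = real n ^ 2 * ln (real n + 1) * (real (card (common_zeros I J)) * real N)"
        by (simp add: power2_eq_square mult_ac)
      also have "\<dots> \<le> real n ^ 2 * ln (real n + 1) * (16 * real s)"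
        using cz(2) ln0 by (intro mult_left_mono) auto
      finally have "(H * real N) * real s \<le> (16 * real n ^ 2 * ln (real n + 1)) * real s"
        by (simp add: mult_ac)
      then have "H * real N \<le> 16 * real n ^ 2 * ln (real n + 1)"
        using IJ(6) by (subst (asm) mult_le_cancel_right) auto
      then show ?thesis unfolding M_def[symmetric] H_def[symmetric] using N by (simp add: pos_le_divide_eq)
    qed
  qed
  also have "\<dots> = pair_constant / real N"
    by (simp only: sum_constant cardK pair_constant_def) (simp add: mult_ac)
  finally show ?thesis unfolding F_def .
qed

text \<open>Summed over the factors, those not dividing the reciprocal polynomial cost O(d ln d),
  since their degrees add up to at most d and their heights to at most ln (n + 1); the others cost p
  times their total height.\<close>

theorem root_of_unity_average:
  assumes p: "prime p" "p > n + 1" and N: "N \<ge> 1" "4 * N ^ Suc n \<le> L"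
  shows "\<bar>(\<Sum>t<p. ln (cmod (poly (cpoly Q) (circle_pt (real t / real p)))))
      - real p * (LINT x|unit_interval. ln (cmod (poly (cpoly Q) (circle_pt x))))\<bar>
     \<le> pair_constant * real p / real N + real d * ln (2 * ((real n + 1) * real d)) + (2 * real d + 2) * ln (real n + 1)"
proof -
  have p1: "p \<ge> 1" using p by linarith
  have lc: "lead_coeff (cpoly Q) = 1" using lead_Q by simp
  have jen: "(LINT x|unit_interval. ln (cmod (poly (cpoly Q) (circle_pt x)))) = log_house Q"
    unfolding log_house_def by (rule jensen(2)[OF lc])
  define A where "A = ln (2 * ((real n + 1) * real d))"
  have A0: "A \<ge> ln 2" unfolding A_def using d_pos by (subst ln_le_cancel_iff) (auto simp: mult_ge1_I)
  define PP where "PP = pair_constant / real N"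
  have PP: "(\<Sum>f\<in>#filter_mset (\<lambda>f. f dvd reflect_poly Q) factors. log_house f) \<le> PP"
    unfolding PP_def by (rule reciprocal_factors_log_house[OF N])
  have fac_root: "z ^ p \<noteq> 1" if "f \<in># factors" "poly (cpoly f) z = 0" for f z
    using no_root_of_unity[OF p factor_root[OF that]] .
  have split: "power_defect p Q = (\<Sum>f\<in>#factors. power_defect p f)"
    unfolding power_defect_def by (rule sum_over_factors)
  have split_h: "log_house Q = (\<Sum>f\<in>#factors. log_house f)"
    unfolding log_house_def by (rule sum_over_factors)
  have "power_defect p Q \<le> real (degree Q) * ln 2"
    by (rule power_defect_upper) (use no_root_of_unity[OF p] Q_nz in auto)
  also have "\<dots> \<le> real d * A" unfolding degree_Q using A0 by (intro mult_left_mono) auto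
  finally have up: "power_defect p Q \<le> real d * A" .
  have "(\<Sum>f\<in>#factors. - (real (degree f) * A) - (2 * real d + 2) * log_house f - real p * (if f dvd reflect_poly Q then log_house f else 0))
      \<le> (\<Sum>f\<in>#factors. power_defect p f)"
  proof (rule sum_mset_le_sum_mset)
    fix f assume f: "f \<in># factors"
    have A1: "A \<ge> 0" using A0 ln_ge_zero[of 2] by linarith
    show "- (real (degree f) * A) - (2 * real d + 2) * log_house f - real p * (if f dvd reflect_poly Q then log_house f else 0) \<le> power_defect p f"
    proof (cases "f dvd reflect_poly Q")
      case True
      have "power_defect p f \<ge> - real p * log_house f"
        by (rule power_defect_lower_prime[OF factorD(1,3,2)[OF f]]) (rule fac_root[OF f])
      moreover have "0 \<le> real (degree f) * A" "0 \<le> (2 * real d + 2) * log_house f" using A1 by auto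
      ultimately show ?thesis using True by (simp only: if_True)
    next
      case False
      then show ?thesis using power_defect_lower_coprime[OF f False p1] unfolding A_def by simp
    qed
  qed
  moreover have "(\<Sum>f\<in>#factors. - (real (degree f) * A) - (2 * real d + 2) * log_house f - real p * (if f dvd reflect_poly Q then log_house f else 0))
     = - (real d * A) - (2 * real d + 2) * log_house Q - real p * (\<Sum>f\<in>#filter_mset (\<lambda>f. f dvd reflect_poly Q) factors. log_house f)"
  proof -
    have "(\<Sum>f\<in>#M. - (real (degree f) * A) - (2 * real d + 2) * log_house f - real p * (if f dvd reflect_poly Q then log_house f else 0))
      = - ((\<Sum>f\<in>#M. real (degree f)) * A) - (2 * real d + 2) * (\<Sum>f\<in>#M. log_house f) - real p * (\<Sum>f\<in>#filter_mset (\<lambda>f. f dvd reflect_poly Q) M. log_house f)" for M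
      by (induction M) (auto simp: algebra_simps)
    from this[of factors] show ?thesis unfolding split_h sum_degrees .
  qed
  moreover have "real p * (\<Sum>f\<in>#filter_mset (\<lambda>f. f dvd reflect_poly Q) factors. log_house f) \<le> real p * PP"
    using PP by (intro mult_left_mono) auto
  moreover have "(2 * real d + 2) * log_house Q \<le> (2 * real d + 2) * ln (real n + 1)"
    using log_house_Q by (intro mult_left_mono) auto
  ultimately have low: "power_defect p Q \<ge> - (real d * A) - (2 * real d + 2) * ln (real n + 1) - real p * PP"
    unfolding split by linarith
  have "0 \<le> real p * PP" unfolding PP_def pair_constant_def by simp
  moreover have "0 \<le> (2 * real d + 2) * ln (real n + 1)" by simp
  ultimately have "\<bar>power_defect p Q\<bar> \<le> real p * PP + real d * A + (2 * real d + 2) * ln (real n + 1)"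
    using up low by linarith
  then show ?thesis
    unfolding jen root_of_unity_sum(2)[OF p] PP_def A_def by (simp add: mult_ac)
qed

end

section \<open>Lines and tori with the same moments\<close>

lemma char_integral:
  fixes k :: int
  shows "(LINT x|unit_interval. cis (2 * pi * (of_int k * x))) = (if k = 0 then 1 else 0)"
proof -
  have pos: "(LINT x|unit_interval. cis (2 * pi * (real m * x))) = 0" if "m > 0" for m :: nat
  proof -
    have "(LINT x|unit_interval. (\<lambda>z. z ^ m) (of_real 1 * circle_pt x)) = (0::complex) ^ m"
      by (rule holomorphic_mean_value(2)[where R = 2]) (auto intro!: holomorphic_intros)
    moreover have "circle_pt x ^ m = cis (2 * pi * (real m * x))" for x
      by (simp add: Complex.DeMoivre mult_ac)
    ultimately show ?thesis using that by (simp add: power_0_left)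
  qed
  consider "k = 0" | "k > 0" | "k < 0" by linarith
  then show ?thesis
  proof cases
    case 1
    then show ?thesis using prob_space.prob_space[OF prob_space_unit_interval] by simp
  next
    case 2
    then have "real (nat k) = of_int k" by simp
    then show ?thesis using pos[of "nat k"] 2 by simp
  next
    case 3
    then have nk: "real (nat (- k)) = - of_int k" by simp
    have "(LINT x|unit_interval. cis (2 * pi * (of_int k * x))) = (LINT x|unit_interval. cnj (cis (2 * pi * (real (nat (- k)) * x))))"
      unfolding nk by (simp add: cis_cnj)
    also have "\<dots> = cnj (LINT x|unit_interval. cis (2 * pi * (real (nat (- k)) * x)))" by simp
    also have "\<dots> = 0" using pos[of "nat (- k)"] 3 by simp
    finally show ?thesis using 3 by simp
  qed
qed

definition cube :: "nat \<Rightarrow> (nat \<Rightarrow> real) measure" where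
  "cube m = restrict_space (\<Pi>\<^sub>M i\<in>{1..m}. lborel) ({1..m} \<rightarrow>\<^sub>E {0..1})"

lemma cube_sets:
  fixes m :: nat
  shows "({1..m} \<rightarrow>\<^sub>E {0..1}) \<in> sets (\<Pi>\<^sub>M i\<in>{1..m}. (lborel :: real measure))"
  by (rule sets_PiM_I_finite) auto

lemma space_cube: "space (cube m) = ({1..m} \<rightarrow>\<^sub>E {0..1})"
  by (auto simp: cube_def space_restrict_space space_PiM)

lemma measurable_cube: "f \<in> borel_measurable (\<Pi>\<^sub>M i\<in>{1..m}. lborel) \<Longrightarrow> f \<in> borel_measurable (cube m)"
  unfolding cube_def by (rule measurable_restrict_space1)

lemma prob_space_cube: "prob_space (cube m)"
proof (rule prob_spaceI)
  interpret product_sigma_finite "\<lambda>_::nat. lborel :: real measure" ..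
  have "emeasure (cube m) (space (cube m)) = emeasure (\<Pi>\<^sub>M i\<in>{1..m}. (lborel :: real measure)) ({1..m} \<rightarrow>\<^sub>E {0..1})"
    unfolding space_cube unfolding cube_def by (rule emeasure_restrict_space) (use cube_sets in auto)
  also have "\<dots> = (\<Prod>i\<in>{1..m}. emeasure (lborel :: real measure) {0..1})"
    by (rule emeasure_PiM) auto
  also have "\<dots> = 1" by simp
  finally show "emeasure (cube m) (space (cube m)) = 1" .
qed

lemma cube_integral:
  fixes f :: "(nat \<Rightarrow> real) \<Rightarrow> 'b::{banach, second_countable_topology}"
  shows "(LINT x|cube m. f x) = (LINT x : ({1..m} \<rightarrow>\<^sub>E {0..1}) | (\<Pi>\<^sub>M i\<in>{1..m}. lborel). f x)"
  unfolding cube_def set_lebesgue_integral_def by (rule integral_restrict_space) (use cube_sets in auto)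

lemma cube_char_integral:
  fixes a :: "nat \<Rightarrow> int"
  shows "(LINT x|cube m. cis (2 * pi * (\<Sum>i=1..m. of_int (a i) * x i))) = (if \<forall>i\<in>{1..m}. a i = 0 then 1 else 0)"
proof -
  interpret product_sigma_finite "\<lambda>_::nat. lborel :: real measure" ..
  define g :: "nat \<Rightarrow> real \<Rightarrow> complex" where "g = (\<lambda>i x. indicat_real {0..1} x *\<^sub>R cis (2 * pi * (of_int (a i) * x)))"
  have int: "integrable lborel (g i)" for i
  proof -
    have "set_integrable lborel {0..1} (\<lambda>x. cis (2 * pi * (of_int (a i) * x)))"
      by (intro borel_integrable_atLeastAtMost' continuous_intros)
    then show ?thesis by (simp add: set_integrable_def g_def)
  qed
  have gi: "(LINT x|lborel. g i x) = (if a i = 0 then 1 else 0)" for i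
  proof -
    have "(LINT x|lborel. g i x) = (LINT x|unit_interval. cis (2 * pi * (of_int (a i) * x)))"
      unfolding g_def by (rule integral_restrict_space[symmetric]) auto
    then show ?thesis by (simp add: char_integral)
  qed
  have cis_sum: "cis (\<Sum>i\<in>S. h i) = (\<Prod>i\<in>S. cis (h i))" if "finite S" for h :: "nat \<Rightarrow> real" and S
    using that by (induction S rule: finite_induct) (auto simp: cis_mult[symmetric])
  have "(LINT x|cube m. cis (2 * pi * (\<Sum>i=1..m. of_int (a i) * x i)))
     = (LINT x|(\<Pi>\<^sub>M i\<in>{1..m}. lborel). (\<Prod>i\<in>{1..m}. g i (x i)))"
    unfolding cube_integral set_lebesgue_integral_def
  proof (rule Bochner_Integration.integral_cong[OF refl])
    fix x assume x: "x \<in> space (\<Pi>\<^sub>M i\<in>{1..m}. (lborel :: real measure))"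
    have c: "cis (2 * pi * (\<Sum>i=1..m. of_int (a i) * x i)) = (\<Prod>i\<in>{1..m}. cis (2 * pi * (of_int (a i) * x i)))"
      unfolding sum_distrib_left by (rule cis_sum) simp
    show "indicat_real ({1..m} \<rightarrow>\<^sub>E {0..1}) x *\<^sub>R cis (2 * pi * (\<Sum>i=1..m. of_int (a i) * x i)) = (\<Prod>i\<in>{1..m}. g i (x i))"
    proof (cases "x \<in> {1..m} \<rightarrow>\<^sub>E {0..1}")
      case True
      then have "g i (x i) = cis (2 * pi * (of_int (a i) * x i))" if "i \<in> {1..m}" for i
        using that by (auto simp: g_def PiE_def Pi_def)
      then show ?thesis using True c by simp
    next
      case False
      then obtain i where "i \<in> {1..m}" "x i \<notin> {0..1}" using x by (auto simp: space_PiM PiE_def Pi_def)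
      then have "(\<Prod>i\<in>{1..m}. g i (x i)) = 0" by (intro prod_zero) (auto simp: g_def intro!: bexI[of _ i])
      then show ?thesis using False by simp
    qed
  qed
  also have "\<dots> = (\<Prod>i\<in>{1..m}. (LINT x|lborel. g i x))"
    by (rule product_integral_prod) (use int in auto)
  also have "\<dots> = (if \<forall>i\<in>{1..m}. a i = 0 then 1 else 0)"
    unfolding gi by (auto simp: prod_zero_iff)
  finally show ?thesis .
qed

definition phase_char :: "nat \<Rightarrow> (nat \<Rightarrow> 'a \<Rightarrow> real) \<Rightarrow> (nat \<Rightarrow> int) \<Rightarrow> 'a \<Rightarrow> complex" where
  "phase_char n \<phi> w x = cis (2 * pi * (\<Sum>j=1..n. of_int (w j) * \<phi> j x))"

text \<open>A common form for both sides of the comparison: with \<open>line_phase\<close> it is Q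
  on the circle up to a unimodular factor, with \<open>torus_phase\<close> the Laurent polynomial of
  the matrix on the torus.\<close>

definition phase_sum :: "nat \<Rightarrow> (nat \<Rightarrow> 'a \<Rightarrow> real) \<Rightarrow> 'a \<Rightarrow> complex" where
  "phase_sum n \<phi> x = 1 + (\<Sum>j=1..n. cis (2 * pi * \<phi> j x))"

text \<open>Pairs of functions obtained from the same Laurent polynomial of total degree at most \<open>r\<close> by substituting
  two families of phases.\<close>

inductive matched :: "nat \<Rightarrow> (nat \<Rightarrow> 'a \<Rightarrow> real) \<Rightarrow> (nat \<Rightarrow> 'b \<Rightarrow> real) \<Rightarrow> nat \<Rightarrow> ('a \<Rightarrow> complex) \<Rightarrow> ('b \<Rightarrow> complex) \<Rightarrow> bool"
  for n \<phi> \<psi> where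
  matched_char: "(\<Sum>j=1..n. \<bar>w j\<bar>) \<le> int r \<Longrightarrow> matched n \<phi> \<psi> r (\<lambda>x. c * phase_char n \<phi> w x) (\<lambda>y. c * phase_char n \<psi> w y)"
| matched_add: "matched n \<phi> \<psi> r F G \<Longrightarrow> matched n \<phi> \<psi> r F' G' \<Longrightarrow> matched n \<phi> \<psi> r (\<lambda>x. F x + F' x) (\<lambda>y. G y + G' y)"

lemma phase_char_mult: "phase_char n \<phi> w x * phase_char n \<phi> w' x = phase_char n \<phi> (\<lambda>j. w j + w' j) x"
  by (simp add: phase_char_def cis_mult algebra_simps sum.distrib)

lemma matched_mult:
  assumes "matched n \<phi> \<psi> r F G" "matched n \<phi> \<psi> r' F' G'"
  shows "matched n \<phi> \<psi> (r + r') (\<lambda>x. F x * F' x) (\<lambda>y. G y * G' y)"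
  using assms
proof (induction rule: matched.induct)
  case (matched_char w r c)
  from matched_char(2,1) show ?case
  proof (induction rule: matched.induct)
    case (matched_char w' r' c')
    have "(\<Sum>j=1..n. \<bar>w j + w' j\<bar>) \<le> (\<Sum>j=1..n. \<bar>w j\<bar> + \<bar>w' j\<bar>)" by (intro sum_mono abs_triangle_ineq)
    also have "\<dots> \<le> int (r + r')" using matched_char by (simp add: sum.distrib)
    finally have "matched n \<phi> \<psi> (r + r') (\<lambda>x. (c * c') * phase_char n \<phi> (\<lambda>j. w j + w' j) x) (\<lambda>y. (c * c') * phase_char n \<psi> (\<lambda>j. w j + w' j) y)"
      by (rule matched.matched_char)
    then show ?case by (simp add: phase_char_mult[symmetric] mult_ac)
  next
    case (matched_add r' F G F' G')
    then show ?case using matched.matched_add by (fastforce simp: distrib_left)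
  qed
next
  case (matched_add r F G F'' G'')
  then show ?case using matched.matched_add by (fastforce simp: distrib_right)
qed

lemma matched_const: "matched n \<phi> \<psi> r (\<lambda>_. c) (\<lambda>_. c)"
  using matched_char[of "\<lambda>_. 0" n r \<phi> \<psi> c] by (simp add: phase_char_def)

lemma matched_sum:
  assumes "finite S" "\<And>j. j \<in> S \<Longrightarrow> matched n \<phi> \<psi> r (F j) (G j)"
  shows "matched n \<phi> \<psi> r (\<lambda>x. \<Sum>j\<in>S. F j x) (\<lambda>y. \<Sum>j\<in>S. G j y)"
  using assms by (induction S rule: finite_induct) (auto intro: matched_const matched_add)

lemma matched_phase_sum:
  "matched n \<phi> \<psi> 1 (phase_sum n \<phi>) (phase_sum n \<psi>)"
  "matched n \<phi> \<psi> 1 (\<lambda>x. cnj (phase_sum n \<phi> x)) (\<lambda>y. cnj (phase_sum n \<psi> y))"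
proof -
  have one: "matched n \<phi> \<psi> 1 (\<lambda>x. cis (2 * pi * (of_int s * \<phi> j x))) (\<lambda>y. cis (2 * pi * (of_int s * \<psi> j y)))"
    if j: "j \<in> {1..n}" and s: "\<bar>s\<bar> = 1" for j and s :: int
  proof -
    define w where "w = (\<lambda>i. if i = j then s else 0)"
    have "(\<Sum>i=1..n. \<bar>w i\<bar>) = (\<Sum>i\<in>{1..n}. if i = j then 1 else 0)"
      by (intro sum.cong refl) (simp add: w_def s)
    also have "\<dots> = 1" using j by simp
    finally have "matched n \<phi> \<psi> 1 (\<lambda>x. 1 * phase_char n \<phi> w x) (\<lambda>y. 1 * phase_char n \<psi> w y)"
      by (intro matched_char) simp
    moreover have ps: "(\<Sum>i=1..n. of_int (w i) * \<rho> i) = of_int s * \<rho> j" for \<rho> :: "nat \<Rightarrow> real"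
    proof -
      have "(\<Sum>i=1..n. of_int (w i) * \<rho> i) = (\<Sum>i\<in>{1..n}. if i = j then of_int s * \<rho> j else 0)"
        by (intro sum.cong refl) (simp add: w_def)
      then show ?thesis using j by simp
    qed
    ultimately show ?thesis by (simp add: phase_char_def ps)
  qed
  have "matched n \<phi> \<psi> 1 (\<lambda>x. 1 + (\<Sum>j=1..n. cis (2 * pi * (of_int 1 * \<phi> j x)))) (\<lambda>y. 1 + (\<Sum>j=1..n. cis (2 * pi * (of_int 1 * \<psi> j y))))"
    by (intro matched_add matched_const matched_sum one) auto
  then show "matched n \<phi> \<psi> 1 (phase_sum n \<phi>) (phase_sum n \<psi>)" by (simp add: phase_sum_def[abs_def])
  have "matched n \<phi> \<psi> 1 (\<lambda>x. 1 + (\<Sum>j=1..n. cis (2 * pi * (of_int (-1) * \<phi> j x)))) (\<lambda>y. 1 + (\<Sum>j=1..n. cis (2 * pi * (of_int (-1) * \<psi> j y))))"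
    by (intro matched_add matched_const matched_sum one) auto
  then show "matched n \<phi> \<psi> 1 (\<lambda>x. cnj (phase_sum n \<phi> x)) (\<lambda>y. cnj (phase_sum n \<psi> y))"
    by (simp add: phase_sum_def[abs_def] cis_cnj)
qed

text \<open>The square makes it a Laurent polynomial in the exponentials of the phases, and the
  denominator puts it into [0, 1], as the logarithmic series requires.\<close>

definition norm_ratio :: "nat \<Rightarrow> (nat \<Rightarrow> 'a \<Rightarrow> real) \<Rightarrow> 'a \<Rightarrow> real" where
  "norm_ratio n \<phi> x = (cmod (phase_sum n \<phi> x))\<^sup>2 / (real n + 1)\<^sup>2"

lemma matched_moment:
  "matched n \<phi> \<psi> (2 * k) (\<lambda>x. of_real ((1 - norm_ratio n \<phi> x) ^ k)) (\<lambda>y. of_real ((1 - norm_ratio n \<psi> y) ^ k))"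
proof -
  define c :: complex where "c = - 1 / of_real ((real n + 1)\<^sup>2)"
  have eq: "of_real (1 - norm_ratio n \<rho> x) = 1 + c * (phase_sum n \<rho> x * cnj (phase_sum n \<rho> x))" for \<rho> :: "nat \<Rightarrow> 'c \<Rightarrow> real" and x
    unfolding norm_ratio_def c_def complex_norm_square[symmetric] by simp
  have "matched n \<phi> \<psi> (0 + (1 + 1)) (\<lambda>x. c * (phase_sum n \<phi> x * cnj (phase_sum n \<phi> x))) (\<lambda>y. c * (phase_sum n \<psi> y * cnj (phase_sum n \<psi> y)))"
    by (intro matched_mult matched_const matched_phase_sum)
  then have "matched n \<phi> \<psi> 2 (\<lambda>x. 1 + c * (phase_sum n \<phi> x * cnj (phase_sum n \<phi> x))) (\<lambda>y. 1 + c * (phase_sum n \<psi> y * cnj (phase_sum n \<psi> y)))"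
    by (intro matched_add matched_const) (simp add: numeral_2_eq_2)
  then have base: "matched n \<phi> \<psi> 2 (\<lambda>x. of_real (1 - norm_ratio n \<phi> x)) (\<lambda>y. of_real (1 - norm_ratio n \<psi> y))"
    unfolding eq .
  show ?thesis
  proof (induction k)
    case 0
    then show ?case by (simp add: matched_const)
  next
    case (Suc k)
    from matched_mult[OF base Suc] show ?case by simp
  qed
qed

lemma norm_ratio_range: "0 \<le> norm_ratio n \<phi> x" "norm_ratio n \<phi> x \<le> 1"
proof -
  show "0 \<le> norm_ratio n \<phi> x" by (simp add: norm_ratio_def)
  have "cmod (phase_sum n \<phi> x) \<le> cmod 1 + (\<Sum>j=1..n. cmod (cis (2 * pi * \<phi> j x)))"
    unfolding phase_sum_def by (intro order_trans[OF norm_triangle_ineq] add_mono order_refl norm_sum)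
  then have "cmod (phase_sum n \<phi> x) \<le> real n + 1" by simp
  then have "(cmod (phase_sum n \<phi> x))\<^sup>2 \<le> (real n + 1)\<^sup>2" by (intro power_mono) auto
  then show "norm_ratio n \<phi> x \<le> 1" by (simp add: norm_ratio_def)
qed

lemma phase_char_integrable:
  assumes M: "prob_space M" and meas: "\<And>j. j \<in> {1..n} \<Longrightarrow> \<phi> j \<in> borel_measurable M"
  shows "integrable M (\<lambda>x. c * phase_char n \<phi> w x)"
proof -
  interpret prob_space M by (rule M)
  have "(\<lambda>x. \<Sum>j=1..n. of_int (w j) * \<phi> j x) \<in> borel_measurable M"
    by (intro borel_measurable_sum borel_measurable_times meas) auto
  moreover have "cis \<in> borel_measurable borel" by (intro borel_measurable_continuous_onI continuous_intros)
  ultimately have "(\<lambda>x. c * phase_char n \<phi> w x) \<in> borel_measurable M"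
    unfolding phase_char_def by measurable
  then show ?thesis by (intro integrable_const_bound[of _ "cmod c"]) (auto simp: phase_char_def norm_mult)
qed

lemma matched_integral:
  assumes M: "prob_space M" "\<And>j. j \<in> {1..n} \<Longrightarrow> \<phi> j \<in> borel_measurable M"
    and M': "prob_space M'" "\<And>j. j \<in> {1..n} \<Longrightarrow> \<psi> j \<in> borel_measurable M'"
    and eq: "\<And>w. (\<Sum>j=1..n. \<bar>w j\<bar>) \<le> int R \<Longrightarrow> (LINT x|M. phase_char n \<phi> w x) = (LINT y|M'. phase_char n \<psi> w y)"
    and F: "matched n \<phi> \<psi> r F G" "r \<le> R"
  shows "integrable M F \<and> integrable M' G \<and> (LINT x|M. F x) = (LINT y|M'. G y)"
  using F
proof (induction rule: matched.induct)
  case (matched_char w r c)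
  then have "(\<Sum>j=1..n. \<bar>w j\<bar>) \<le> int R" by linarith
  then show ?case using eq phase_char_integrable[OF M] phase_char_integrable[OF M'] by simp
qed (auto simp: Bochner_Integration.integral_add)

lemma moment_eq:
  assumes "prob_space M" "\<And>j. j \<in> {1..n} \<Longrightarrow> \<phi> j \<in> borel_measurable M"
    and "prob_space M'" "\<And>j. j \<in> {1..n} \<Longrightarrow> \<psi> j \<in> borel_measurable M'"
    and "\<And>w. (\<Sum>j=1..n. \<bar>w j\<bar>) \<le> int (2 * k) \<Longrightarrow> (LINT x|M. phase_char n \<phi> w x) = (LINT y|M'. phase_char n \<psi> w y)"
  shows "(LINT x|M. (1 - norm_ratio n \<phi> x) ^ k) = (LINT y|M'. (1 - norm_ratio n \<psi> y) ^ k)"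
proof -
  have "(LINT x|M. complex_of_real ((1 - norm_ratio n \<phi> x) ^ k)) = (LINT y|M'. complex_of_real ((1 - norm_ratio n \<psi> y) ^ k))"
    using matched_integral[OF assms matched_moment order_refl] by blast
  then show ?thesis by (simp only: integral_complex_of_real of_real_eq_iff)
qed

definition line_phase :: "(nat \<Rightarrow> int) \<Rightarrow> nat \<Rightarrow> real \<Rightarrow> real" where
  "line_phase b j x = of_int (b j) * x"

definition torus_phase :: "nat \<Rightarrow> (nat \<Rightarrow> nat \<Rightarrow> int) \<Rightarrow> nat \<Rightarrow> (nat \<Rightarrow> real) \<Rightarrow> real" where
  "torus_phase m A j x = (\<Sum>i=1..m. of_int (A i j) * x i)"

lemma measurable_line_phase: "line_phase b j \<in> borel_measurable unit_interval"
  unfolding line_phase_def by (intro measurable_unit_interval) simp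

lemma measurable_torus_phase: "torus_phase m A j \<in> borel_measurable (cube m)"
  unfolding torus_phase_def
proof (intro measurable_cube borel_measurable_sum borel_measurable_times)
  fix i assume "i \<in> {1..m}"
  then show "(\<lambda>x. x i) \<in> borel_measurable (\<Pi>\<^sub>M i\<in>{1..m}. (lborel::real measure))"
    using measurable_component_singleton[of i "{1..m}" "\<lambda>_. lborel :: real measure"] by simp
qed simp

lemma line_char_integral:
  "(LINT x|unit_interval. phase_char n (line_phase b) w x) = (if Defs.scalar_prod n w b = 0 then 1 else 0)"
proof -
  have "phase_char n (line_phase b) w x = cis (2 * pi * (of_int (Defs.scalar_prod n w b) * x))" for x
  proof -
    have "(\<Sum>j=1..n. of_int (w j) * line_phase b j x) = of_int (Defs.scalar_prod n w b) * x"
      by (simp add: line_phase_def Defs.scalar_prod_def sum_distrib_right mult.assoc)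
    then show ?thesis by (simp only: phase_char_def)
  qed
  then show ?thesis by (simp add: char_integral)
qed

lemma torus_char_integral:
  "(LINT x|cube m. phase_char n (torus_phase m A) w x) = (if \<forall>i\<in>{1..m}. Defs.scalar_prod n w (A i) = 0 then 1 else 0)"
proof -
  have "(\<Sum>j=1..n. of_int (w j) * torus_phase m A j x) = (\<Sum>i=1..m. of_int (Defs.scalar_prod n w (A i)) * x i)" for x
  proof -
    have "(\<Sum>j=1..n. of_int (w j) * torus_phase m A j x) = (\<Sum>j=1..n. \<Sum>i=1..m. of_int (w j * A i j) * x i)"
      by (simp add: torus_phase_def sum_distrib_left mult_ac)
    also have "\<dots> = (\<Sum>i=1..m. \<Sum>j=1..n. of_int (w j * A i j) * x i)" by (rule sum.swap)
    finally show ?thesis by (simp add: Defs.scalar_prod_def sum_distrib_right)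
  qed
  then show ?thesis by (simp only: phase_char_def cube_char_integral)
qed

lemma phase_sum_line:
  assumes b0: "b 0 = 0" and c: "\<And>j. j \<in> {0..n} \<Longrightarrow> c \<le> b j"
  shows "cmod (phase_sum n (line_phase b) x) = cmod (poly (\<Sum>j\<in>{0..n}. monom 1 (nat (b j - c))) (circle_pt x))"
proof -
  have "phase_sum n (line_phase b) x = (\<Sum>j\<in>{0..n}. cis (2 * pi * (of_int (b j) * x)))"
    by (simp add: phase_sum_def line_phase_def b0 sum.atLeast_Suc_atMost)
  also have "\<dots> = (\<Sum>j\<in>{0..n}. cis (2 * pi * (of_int c * x)) * circle_pt x ^ nat (b j - c))"
  proof (rule sum.cong[OF refl])
    fix j assume "j \<in> {0..n}"
    then have r: "real (nat (b j - c)) = of_int (b j) - of_int c" using c by simp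
    show "cis (2 * pi * (of_int (b j) * x)) = cis (2 * pi * (of_int c * x)) * circle_pt x ^ nat (b j - c)"
      unfolding Complex.DeMoivre cis_mult r by (rule arg_cong[where f = cis]) (simp add: algebra_simps)
  qed
  also have "\<dots> = cis (2 * pi * (of_int c * x)) * poly (\<Sum>j\<in>{0..n}. monom 1 (nat (b j - c))) (circle_pt x)"
    by (simp add: poly_sum poly_monom sum_distrib_left)
  finally show ?thesis by (simp add: norm_mult)
qed

lemma power_le_powr_neg:
  fixes x a :: real
  assumes x: "0 < x" "x \<le> 1" and a: "0 < a" "a \<le> 1" and k: "k \<ge> (1::nat)"
  shows "(1 - x) ^ k \<le> real k powr (- a) * x powr (- a)"
proof -
  define t where "t = real k * x"
  have t: "t > 0" using x k by (simp add: t_def)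
  have "1 - x \<le> exp (- x)" using exp_ge_add_one_self[of "- x"] by simp
  then have "(1 - x) ^ k \<le> exp (- x) ^ k" using x by (intro power_mono) auto
  also have "\<dots> = exp (- t)" by (simp add: t_def exp_of_nat_mult[symmetric])
  also have "\<dots> \<le> t powr (- a)"
  proof -
    have "t powr a \<le> exp t"
    proof (cases "t \<le> 1")
      case True
      then have "t powr a \<le> 1" using t a by (simp add: powr_le1)
      then show ?thesis using t one_le_exp_iff[of t] by linarith
    next
      case False
      then have "t powr a \<le> t powr 1" using a by (intro powr_mono) auto
      also have "t powr 1 = t" using t by simp
      finally show ?thesis using exp_ge_add_one_self[of t] by linarith
    qed
    then have "exp (- t) \<le> inverse (t powr a)" using t by (simp add: exp_minus le_imp_inverse_le)
    then show ?thesis by (simp add: powr_minus)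
  qed
  also have "\<dots> = real k powr (- a) * x powr (- a)" unfolding t_def using x by (subst powr_mult) auto
  finally show ?thesis .
qed

text \<open>The exponent 1/(4n) for a squared modulus corresponds to the negative moment of order
  1/(2n) of a polynomial with n + 1 terms. The inequality (1 - y)^k <= (k y)^(-a) turns that moment
  into decay in k, uniformly in b.\<close>

lemma line_moment_bound:
  assumes n: "n \<ge> 1"
  shows "\<exists>B>0. \<forall>b k. b 0 = 0 \<longrightarrow> inj_on b {0..n} \<longrightarrow> k \<ge> (1::nat) \<longrightarrow>
    (LINT x|unit_interval. (1 - norm_ratio n (line_phase b) x) ^ k) \<le> B * real k powr (- (1 / (4 * real n)))"
proof -
  define a where "a = 1 / (4 * real n)"
  have a: "0 < a" "a \<le> 1" using n by (auto simp: a_def)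
  have n': "Suc (n - 1) = n" using n by simp
  obtain C where C: "C > 0" "\<And>F. fewnomial n F \<Longrightarrow>
     (\<integral>\<^sup>+x. ennreal (cmod (poly F (circle_pt x)) powr (- 1 / (2 * real n))) \<partial>unit_interval) \<le> ennreal C"
    using fewnomial_negative_moment[of "n - 1", unfolded n'] by blast
  define B where "B = (real n + 1) powr (2 * a) * C"
  show ?thesis
  proof (intro exI[of _ B] conjI allI impI)
    show "B > 0" using C by (simp add: B_def)
    fix b :: "nat \<Rightarrow> int" and k :: nat assume b0: "b 0 = 0" and inj: "inj_on b {0..n}" and k: "k \<ge> 1"
    define c where "c = Min (b ` {0..n})"
    define e where "e = (\<lambda>j. nat (b j - c))"
    have c: "c \<le> b j" if "j \<in> {0..n}" for j unfolding c_def using that by (intro Min_le) auto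
    have inje: "inj_on e {0..n}"
    proof (rule inj_onI)
      fix i j assume ij: "i \<in> {0..n}" "j \<in> {0..n}" "e i = e j"
      then have "b i = b j" using c[OF ij(1)] c[OF ij(2)] by (simp add: e_def eq_nat_nat_iff)
      then show "i = j" using inj ij by (auto dest: inj_onD)
    qed
    define F :: "complex poly" where "F = (\<Sum>j\<in>{0..n}. monom 1 (e j))"
    have coeffF: "coeff F i = (if i \<in> e ` {0..n} then 1 else 0)" for i
    proof -
      have "coeff F i = (\<Sum>j\<in>{0..n}. if e j = i then 1 else 0)" by (simp add: F_def coeff_sum)
      also have "\<dots> = of_nat (card {j \<in> {0..n}. e j = i})" by (simp flip: sum.inter_filter)
      also have "\<dots> = (if i \<in> e ` {0..n} then 1 else 0)"
      proof (cases "i \<in> e ` {0..n}")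
        case True
        then obtain j where j: "j \<in> {0..n}" "e j = i" by auto
        then have "{j \<in> {0..n}. e j = i} = {j}" using inje by (auto dest: inj_onD)
        then show ?thesis using True by simp
      next
        case False
        then have "{j \<in> {0..n}. e j = i} = {}" by auto
        then show ?thesis using False by (simp only: card.empty of_nat_0 if_False)
      qed
      finally show ?thesis .
    qed
    have supp: "{i. coeff F i \<noteq> 0} = e ` {0..n}" using coeffF by auto
    have F0: "F \<noteq> 0" using supp by auto
    then have "lead_coeff F = 1" using coeffF[of "degree F"] by (metis leading_coeff_0_iff)
    then have few: "fewnomial n F" using supp card_image_le[of "{0..n}" e] by (simp add: fewnomial_def)
    have nr: "norm_ratio n (line_phase b) x = (cmod (poly F (circle_pt x)))\<^sup>2 / (real n + 1)\<^sup>2" for x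
      unfolding norm_ratio_def F_def e_def using phase_sum_line[of b n c, OF b0 c] by simp
    have AE: "AE x in unit_interval. ennreal ((1 - norm_ratio n (line_phase b) x) ^ k)
        \<le> ennreal (real k powr (- a) * (real n + 1) powr (2 * a)) * ennreal (cmod (poly F (circle_pt x)) powr (- 1 / (2 * real n)))"
      using AE_poly_circle_nonzero[OF F0]
    proof eventually_elim
      case (elim x)
      define u where "u = cmod (poly F (circle_pt x))"
      have u: "u > 0" using elim by (simp add: u_def)
      define y where "y = norm_ratio n (line_phase b) x"
      have yu: "y = (u / (real n + 1)) powr 2" using u unfolding y_def nr u_def[symmetric] by (simp add: power_divide powr_numeral)
      have y: "0 < y" "y \<le> 1" using u norm_ratio_range[of n "line_phase b" x] by (auto simp: y_def nr u_def)
      have "(1 - y) ^ k \<le> real k powr (- a) * y powr (- a)" by (rule power_le_powr_neg[OF y a k])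
      also have "y powr (- a) = (u / (real n + 1)) powr (- (2 * a))" unfolding yu by (simp add: powr_powr)
      also have "\<dots> = (real n + 1) powr (2 * a) * u powr (- (2 * a))"
      proof -
        have "(u / (real n + 1)) powr (- (2 * a)) = u powr (- (2 * a)) / (real n + 1) powr (- (2 * a))"
          by (rule powr_divide)
        also have "(real n + 1) powr (- (2 * a)) = inverse ((real n + 1) powr (2 * a))" by (rule powr_minus)
        finally show ?thesis by (simp add: divide_inverse mult.commute)
      qed
      also have "- (2 * a) = - 1 / (2 * real n)" by (simp add: a_def)
      finally have "(1 - y) ^ k \<le> real k powr (- a) * (real n + 1) powr (2 * a) * u powr (- 1 / (2 * real n))" by (simp add: mult.assoc)
      then show ?case unfolding y_def u_def by (simp add: ennreal_leI flip: ennreal_mult)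
    qed
    have meas: "(\<lambda>x. norm_ratio n (line_phase b) x) \<in> borel_measurable unit_interval"
      unfolding nr by measurable
    have "ennreal (LINT x|unit_interval. (1 - norm_ratio n (line_phase b) x) ^ k)
       = (\<integral>\<^sup>+x. ennreal ((1 - norm_ratio n (line_phase b) x) ^ k) \<partial>unit_interval)"
    proof (rule nn_integral_eq_integral[symmetric])
      show "integrable unit_interval (\<lambda>x. (1 - norm_ratio n (line_phase b) x) ^ k)"
        using meas norm_ratio_range[of n "line_phase b"]
        by (intro finite_measure.integrable_const_bound[of _ _ 1] prob_space.finite_measure prob_space_unit_interval)
           (auto simp: abs_le_iff power_le_one intro!: AE_I2 power_le_one)
      show "AE x in unit_interval. 0 \<le> (1 - norm_ratio n (line_phase b) x) ^ k"
        using norm_ratio_range[of n "line_phase b"] by (intro AE_I2 zero_le_power) simp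
    qed
    also have "\<dots> \<le> (\<integral>\<^sup>+x. ennreal (real k powr (- a) * (real n + 1) powr (2 * a)) * ennreal (cmod (poly F (circle_pt x)) powr (- 1 / (2 * real n))) \<partial>unit_interval)"
      by (rule nn_integral_mono_AE[OF AE])
    also have "\<dots> = ennreal (real k powr (- a) * (real n + 1) powr (2 * a)) * (\<integral>\<^sup>+x. ennreal (cmod (poly F (circle_pt x)) powr (- 1 / (2 * real n))) \<partial>unit_interval)"
      by (rule nn_integral_cmult) measurable
    also have "\<dots> \<le> ennreal (real k powr (- a) * (real n + 1) powr (2 * a)) * ennreal C"
      by (intro mult_left_mono C(2) few) simp
    also have "\<dots> = ennreal (B * real k powr (- a))" using C(1) by (simp add: B_def mult_ac flip: ennreal_mult)
    finally show "(LINT x|unit_interval. (1 - norm_ratio n (line_phase b) x) ^ k) \<le> B * real k powr (- (1 / (4 * real n)))"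
      using C(1) by (subst (asm) ennreal_le_iff) (auto simp: B_def a_def)
  qed
qed

text \<open>Take for b the combination of the A i with coefficients T^i, where the integer T avoids
  the roots of the finitely many nonzero polynomials that encode the pairings with bounded w.
  Through such a line the torus inherits the moment bounds known for lines.\<close>

lemma generic_line:
  fixes A :: "nat \<Rightarrow> nat \<Rightarrow> int"
  assumes A: "\<And>i. i \<in> {1..m} \<Longrightarrow> A i \<in> int_vecs n"
  shows "\<exists>b. b 0 = 0 \<and> (\<forall>w. (\<Sum>j=1..n. \<bar>w j\<bar>) \<le> int R \<longrightarrow>
     (Defs.scalar_prod n w b = 0 \<longleftrightarrow> (\<forall>i\<in>{1..m}. Defs.scalar_prod n w (A i) = 0)))"
proof -
  define W where "W = {w. \<forall>j. (j \<in> {1..n} \<longrightarrow> w j \<in> {- int R..int R}) \<and> (j \<notin> {1..n} \<longrightarrow> w j = (0::int))}"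
  have finW: "finite W" unfolding W_def by (rule finite_set_of_finite_funs) auto
  define P where "P = (\<lambda>w. \<Sum>i=1..m. monom (Defs.scalar_prod n w (A i)) i)"
  define bad where "bad = (\<Union>w\<in>{w \<in> W. P w \<noteq> 0}. {T. poly (P w) T = 0})"
  have "finite bad" unfolding bad_def using finW by (auto intro!: poly_roots_finite)
  then obtain T where T: "T \<notin> bad" using ex_new_if_finite[of bad] infinite_UNIV_int by blast
  define b where "b = (\<lambda>j. \<Sum>i=1..m. A i j * T ^ i)"
  have Pc: "coeff (P w) i = Defs.scalar_prod n w (A i)" if "i \<in> {1..m}" for w i
    using that by (simp add: P_def coeff_sum)
  have wb: "Defs.scalar_prod n w b = poly (P w) T" for w
  proof -
    have "Defs.scalar_prod n w b = (\<Sum>j=1..n. \<Sum>i=1..m. w j * A i j * T ^ i)"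
      by (simp add: Defs.scalar_prod_def b_def sum_distrib_left mult.assoc)
    also have "\<dots> = (\<Sum>i=1..m. \<Sum>j=1..n. w j * A i j * T ^ i)" by (rule sum.swap)
    also have "\<dots> = poly (P w) T" by (simp add: P_def poly_sum poly_monom Defs.scalar_prod_def sum_distrib_right)
    finally show ?thesis .
  qed
  have "Defs.scalar_prod n w b = 0 \<longleftrightarrow> (\<forall>i\<in>{1..m}. Defs.scalar_prod n w (A i) = 0)" if w: "(\<Sum>j=1..n. \<bar>w j\<bar>) \<le> int R" for w
  proof
    define w' where "w' = (\<lambda>j. if j \<in> {1..n} then w j else 0)"
    have sp: "Defs.scalar_prod n w' x = Defs.scalar_prod n w x" for x
      unfolding Defs.scalar_prod_def by (intro sum.cong refl) (simp add: w'_def)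
    have wR: "- int R \<le> w j \<and> w j \<le> int R" if "j \<in> {1..n}" for j
      using order_trans[OF member_le_sum[of j "{1..n}" "\<lambda>j. \<bar>w j\<bar>"] w] that by (simp add: abs_le_iff)
    then have w'W: "w' \<in> W" unfolding W_def w'_def by auto
    assume "Defs.scalar_prod n w b = 0"
    then have "poly (P w') T = 0" using wb[of w'] sp by simp
    then have "P w' = 0" using T w'W unfolding bad_def by blast
    then show "\<forall>i\<in>{1..m}. Defs.scalar_prod n w (A i) = 0" using Pc[of _ w'] sp by simp
  next
    assume "\<forall>i\<in>{1..m}. Defs.scalar_prod n w (A i) = 0"
    then show "Defs.scalar_prod n w b = 0" unfolding wb P_def by simp
  qed
  moreover have "b 0 = 0" unfolding b_def using A by (intro sum.neutral) (auto simp: int_vecs_def)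
  ultimately show ?thesis by blast
qed

lemma matrix_laurent_poly_phase:
  "matrix_laurent_poly m n A (\<lambda>i. exp (2 * of_real pi * \<i> * of_real (x i))) = phase_sum n (torus_phase m A) x"
proof -
  have e: "exp (2 * of_real pi * \<i> * of_real y) = cis (2 * pi * y)" for y :: real
    by (simp add: cis_conv_exp mult_ac)
  have cis_sum: "cis (\<Sum>i\<in>S. h i) = (\<Prod>i\<in>S. cis (h i))" if "finite S" for h :: "nat \<Rightarrow> real" and S
    using that by (induction S rule: finite_induct) (auto simp: cis_mult[symmetric])
  have "cis (2 * pi * y) powi k = cis (2 * pi * (of_int k * y))" for y :: real and k :: int
    by (simp add: cis_power_int mult_ac)
  then have "(\<Prod>i=1..m. cis (2 * pi * x i) powi A i j) = cis (2 * pi * torus_phase m A j x)" for j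
    unfolding torus_phase_def sum_distrib_left by (subst cis_sum) auto
  then show ?thesis unfolding matrix_laurent_poly_def phase_sum_def e by simp
qed

lemma ln_norm_ratio:
  "cmod (phase_sum n \<phi> x) > 0 \<Longrightarrow> ln (cmod (phase_sum n \<phi> x)) = ln (norm_ratio n \<phi> x) / 2 + ln (real n + 1)"
  by (simp add: norm_ratio_def ln_div ln_realpow)

text \<open>Moments of order up to N agree exactly, since they involve only characters of weight at
  most 2 N; the later ones are bounded on both sides. On the torus each single moment equals that of
  a generic line, to which \<open>line_moment_bound\<close> applies. The factor 1/2 from the square
  lets the two tails add up to B / a.\<close>

theorem line_torus_log_integral:
  assumes n: "n \<ge> 1"
  shows "\<exists>K>0. \<forall>b m A N. b 0 = 0 \<longrightarrow> inj_on b {0..n} \<longrightarrow> (\<forall>i\<in>{1..m}. A i \<in> int_vecs n) \<longrightarrow>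
     N \<ge> (1::nat) \<longrightarrow>
     (\<forall>w. (\<Sum>j=1..n. \<bar>w j\<bar>) \<le> int (2 * N) \<longrightarrow> (Defs.scalar_prod n w b = 0 \<longleftrightarrow> (\<forall>i\<in>{1..m}. Defs.scalar_prod n w (A i) = 0))) \<longrightarrow>
     \<bar>(LINT x|unit_interval. ln (cmod (phase_sum n (line_phase b) x))) - log_mahler m (matrix_laurent_poly m n A)\<bar>
      \<le> K * real N powr (- (1 / (4 * real n)))"
proof -
  define a where "a = 1 / (4 * real n)"
  have a: "a > 0" using n by (simp add: a_def)
  obtain B where B: "B > 0" "\<And>b k. b 0 = 0 \<Longrightarrow> inj_on b {0..n} \<Longrightarrow> k \<ge> 1 \<Longrightarrow>
    (LINT x|unit_interval. (1 - norm_ratio n (line_phase b) x) ^ k) \<le> B * real k powr (- a)"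
    using line_moment_bound[OF n] unfolding a_def by blast
  show ?thesis
  proof (intro exI[of _ "B / a"] conjI allI impI)
    show "B / a > 0" using B a by simp
    fix b :: "nat \<Rightarrow> int" and m N :: nat and A :: "nat \<Rightarrow> nat \<Rightarrow> int"
    assume b0: "b 0 = 0" and inj: "inj_on b {0..n}" and A: "\<forall>i\<in>{1..m}. A i \<in> int_vecs n" and N: "N \<ge> 1"
      and rel: "\<forall>w. (\<Sum>j=1..n. \<bar>w j\<bar>) \<le> int (2 * N) \<longrightarrow> (Defs.scalar_prod n w b = 0 \<longleftrightarrow> (\<forall>i\<in>{1..m}. Defs.scalar_prod n w (A i) = 0))"
    note U = prob_space_unit_interval and T = prob_space_cube[of m]
    have mom_eq: "(LINT x|unit_interval. (1 - norm_ratio n (line_phase b') x) ^ k) = (LINT x|cube m. (1 - norm_ratio n (torus_phase m A) x) ^ k)"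
      if "\<And>w. (\<Sum>j=1..n. \<bar>w j\<bar>) \<le> int (2 * k) \<Longrightarrow> (Defs.scalar_prod n w b' = 0 \<longleftrightarrow> (\<forall>i\<in>{1..m}. Defs.scalar_prod n w (A i) = 0))" for b' k
      by (rule moment_eq[OF U measurable_line_phase T measurable_torus_phase])
         (simp add: line_char_integral torus_char_integral that)
    have torus_bound: "(LINT x|cube m. (1 - norm_ratio n (torus_phase m A) x) ^ k) \<le> B * real k powr (- a)" if k: "k \<ge> 1" for k
    proof -
      obtain b' where b': "b' 0 = 0" "\<And>w. (\<Sum>j=1..n. \<bar>w j\<bar>) \<le> int (2 * k) \<Longrightarrow> (Defs.scalar_prod n w b' = 0 \<longleftrightarrow> (\<forall>i\<in>{1..m}. Defs.scalar_prod n w (A i) = 0))"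
        using generic_line[of m A n "2 * k"] A by blast
      \<comment> \<open>A coincidence b' i = b' j is a relation of weight at most 2; it passes
        through A to b, where it contradicts injectivity.\<close>
      have "inj_on b' {0..n}"
      proof (rule inj_onI, rule ccontr)
        fix i j assume ij: "i \<in> {0..n}" "j \<in> {0..n}" "b' i = b' j" "i \<noteq> j"
        define w where "w = (\<lambda>l. (if l = i then 1 else 0) - (if l = j then 1 else (0::int)))"
        have sp: "Defs.scalar_prod n w \<beta> = \<beta> i - \<beta> j" if "\<beta> 0 = 0" for \<beta> :: "nat \<Rightarrow> int"
        proof -
          have "Defs.scalar_prod n w \<beta> = (\<Sum>l=1..n. (if l = i then \<beta> l else 0) - (if l = j then \<beta> l else 0))"
            unfolding Defs.scalar_prod_def by (intro sum.cong refl) (simp add: w_def)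
          also have "\<dots> = (\<Sum>l=1..n. (if l = i then \<beta> l else 0)) - (\<Sum>l=1..n. (if l = j then \<beta> l else 0))"
            by (rule sum_subtractf)
          also have "\<dots> = \<beta> i - \<beta> j" using ij that by (auto simp: sum.delta not_less_eq_eq)
          finally show ?thesis .
        qed
        have "(\<Sum>l=1..n. \<bar>w l\<bar>) \<le> (\<Sum>l=1..n. (if l = i then 1 else 0) + (if l = j then 1 else 0))"
          by (intro sum_mono) (simp add: w_def)
        also have "\<dots> \<le> 2" by (simp add: sum.distrib sum.delta)
        finally have w2: "(\<Sum>l=1..n. \<bar>w l\<bar>) \<le> 2" .
        have "Defs.scalar_prod n w b' = 0" using sp[of b', OF b'(1)] ij(3) by simp
        then have "\<forall>i\<in>{1..m}. Defs.scalar_prod n w (A i) = 0" using b'(2)[of w] w2 k by simp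
        then have "Defs.scalar_prod n w b = 0" using rel w2 N by simp
        then have "b i = b j" using sp[of b, OF b0] by simp
        then show False using inj ij by (auto dest: inj_onD)
      qed
      from B(2)[OF b'(1) this k] mom_eq[OF b'(2)] show ?thesis by simp
    qed
    have psm: "norm_ratio n \<phi> \<in> borel_measurable M" if "\<And>j. j \<in> {1..n} \<Longrightarrow> \<phi> j \<in> borel_measurable M" for \<phi> :: "nat \<Rightarrow> 'q \<Rightarrow> real" and M
    proof -
      have "cis \<in> borel_measurable borel" by (intro borel_measurable_continuous_onI continuous_intros)
      then have "phase_sum n \<phi> \<in> borel_measurable M"
        unfolding phase_sum_def using that by (intro borel_measurable_add borel_measurable_sum measurable_const) simp_all
      then show ?thesis unfolding norm_ratio_def by simp
    qed
    note lineS = log_integral_moments[OF U psm[OF measurable_line_phase] conjI[OF norm_ratio_range] a less_imp_le[OF B(1)] B(2)[OF b0 inj] N]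
    note torusS = log_integral_moments[OF T psm[OF measurable_torus_phase] conjI[OF norm_ratio_range] a less_imp_le[OF B(1)] torus_bound N]
    define E where "E = (\<Sum>k=1..N. (LINT x|cube m. (1 - norm_ratio n (torus_phase m A) x) ^ k) / real k)"
    have E_line: "(\<Sum>k=1..N. (LINT x|unit_interval. (1 - norm_ratio n (line_phase b) x) ^ k) / real k) = E"
      unfolding E_def
    proof (rule sum.cong[OF refl])
      fix k assume "k \<in> {1..N}"
      then have "(LINT x|unit_interval. (1 - norm_ratio n (line_phase b) x) ^ k) = (LINT x|cube m. (1 - norm_ratio n (torus_phase m A) x) ^ k)"
        by (intro mom_eq) (use rel in auto)
      then show "(LINT x|unit_interval. (1 - norm_ratio n (line_phase b) x) ^ k) / real k = (LINT x|cube m. (1 - norm_ratio n (torus_phase m A) x) ^ k) / real k" by simp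
    qed
    have conv: "(LINT x|M. ln (cmod (phase_sum n \<phi> x))) = (LINT x|M. ln (norm_ratio n \<phi> x)) / 2 + ln (real n + 1)"
      if M: "prob_space M" and pos: "AE x in M. norm_ratio n \<phi> x > 0" and int: "integrable M (\<lambda>x. ln (norm_ratio n \<phi> x))"
        and meas: "\<And>j. j \<in> {1..n} \<Longrightarrow> \<phi> j \<in> borel_measurable M"
      for M :: "'q measure" and \<phi>
    proof -
      interpret prob_space M by (rule M)
      have "cis \<in> borel_measurable borel" by (intro borel_measurable_continuous_onI continuous_intros)
      then have pm: "phase_sum n \<phi> \<in> borel_measurable M"
        unfolding phase_sum_def using meas by (intro borel_measurable_add borel_measurable_sum measurable_const) simp_all
      have "(LINT x|M. ln (cmod (phase_sum n \<phi> x))) = (LINT x|M. ln (norm_ratio n \<phi> x) / 2 + ln (real n + 1))"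
      proof (rule integral_cong_AE)
        show "AE x in M. ln (cmod (phase_sum n \<phi> x)) = ln (norm_ratio n \<phi> x) / 2 + ln (real n + 1)"
          using pos by eventually_elim (rule ln_norm_ratio, auto simp: norm_ratio_def)
      qed (use pm int in auto)
      also have "\<dots> = (LINT x|M. ln (norm_ratio n \<phi> x)) / 2 + ln (real n + 1)"
        using int by (simp add: Bochner_Integration.integral_add prob_space)
      finally show ?thesis .
    qed
    have line: "(LINT x|unit_interval. ln (cmod (phase_sum n (line_phase b) x))) = (LINT x|unit_interval. ln (norm_ratio n (line_phase b) x)) / 2 + ln (real n + 1)"
      by (rule conv[OF U lineS(1,2) measurable_line_phase])
    have "log_mahler m (matrix_laurent_poly m n A) = (LINT x|cube m. ln (cmod (phase_sum n (torus_phase m A) x)))"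
      unfolding log_mahler_def cube_integral matrix_laurent_poly_phase ..
    also have "\<dots> = (LINT x|cube m. ln (norm_ratio n (torus_phase m A) x)) / 2 + ln (real n + 1)"
      by (rule conv[OF T torusS(1,2) measurable_torus_phase])
    finally have torus: "log_mahler m (matrix_laurent_poly m n A) = (LINT x|cube m. ln (norm_ratio n (torus_phase m A) x)) / 2 + ln (real n + 1)" .
    show "\<bar>(LINT x|unit_interval. ln (cmod (phase_sum n (line_phase b) x))) - log_mahler m (matrix_laurent_poly m n A)\<bar>
      \<le> B / a * real N powr (- (1 / (4 * real n)))"
      using lineS(3) torusS(3) unfolding E_line E_def[symmetric] line torus a_def[symmetric] by linarith
  qed
qed

section \<open>Places of number fields\<close>

lemma number_field_basis:
  assumes "number_field K"
  obtains B where "finite B" "rat_vs.span B = K" "card B = field_degree K"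
proof -
  obtain B0 where B0: "finite B0" "rat_vs.span B0 = K" using assms unfolding number_field_def by blast
  obtain B where B: "B \<subseteq> K" "rat_vs.independent B" "K \<subseteq> rat_vs.span B" "card B = rat_vs.dim K"
    using rat_vs.basis_exists[of K] by blast
  have "finite B" using rat_vs.independent_span_bound[OF B0(1) B(2)] B(1) B0(2) by simp
  moreover have "rat_vs.span B = K"
    using B(1,3) B0(2) rat_vs.span_minimal[OF B(1)] rat_vs.subspace_span[of B0] by auto
  ultimately show ?thesis using that B(4) unfolding field_degree_def by blast
qed

lemma number_field_subspace: "number_field K \<Longrightarrow> rat_vs.subspace K"
  using number_field_basis rat_vs.subspace_span by metis

lemma number_field_scale: "number_field K \<Longrightarrow> x \<in> K \<Longrightarrow> of_rat q * x \<in> K"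
  using rat_vs.subspace_scale[OF number_field_subspace, of K x q] by (simp add: rat_scale_def)

lemma number_field_closed:
  assumes "number_field K"
  shows "1 \<in> K" "0 \<in> K" "x \<in> K \<Longrightarrow> y \<in> K \<Longrightarrow> x - y \<in> K" "x \<in> K \<Longrightarrow> y \<in> K \<Longrightarrow> x + y \<in> K"
    "x \<in> K \<Longrightarrow> y \<in> K \<Longrightarrow> x * y \<in> K" "of_rat q \<in> K" "of_int i \<in> K" "of_nat m \<in> K" "x \<in> K \<Longrightarrow> x ^ m \<in> K"
    "(\<And>i. i \<in> I \<Longrightarrow> f i \<in> K) \<Longrightarrow> sum f I \<in> K"
proof -
  show one: "1 \<in> K" and "x \<in> K \<Longrightarrow> y \<in> K \<Longrightarrow> x - y \<in> K" and mult: "\<And>x y. x \<in> K \<Longrightarrow> y \<in> K \<Longrightarrow> x * y \<in> K"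
    using assms unfolding number_field_def by blast+
  show "0 \<in> K" "x \<in> K \<Longrightarrow> y \<in> K \<Longrightarrow> x + y \<in> K" "(\<And>i. i \<in> I \<Longrightarrow> f i \<in> K) \<Longrightarrow> sum f I \<in> K"
    using number_field_subspace[OF assms] rat_vs.subspace_0 rat_vs.subspace_add rat_vs.subspace_sum by blast+
  show rat: "of_rat q \<in> K" for q using number_field_scale[OF assms one, of q] by simp
  show "of_int i \<in> K" using rat[of "of_int i"] by simp
  show "of_nat m \<in> K" using rat[of "of_nat m"] by simp
  show "x \<in> K \<Longrightarrow> x ^ m \<in> K" by (induction m) (auto simp: one mult)
qed

text \<open>B is a basis of the intersection of all number fields containing the \<alpha> i. It is
  determined before any K is given and lies in each admissible K, which makes the later constants
  uniform in K.\<close>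

lemma number_field_common_module:
  fixes \<alpha> :: "nat \<Rightarrow> 'k::field_char_0"
  assumes K0: "number_field K0" "\<forall>i\<in>{1..n}. \<alpha> i \<in> K0"
  obtains B where "finite B" "rat_vs.independent B" "B \<noteq> {}"
    "\<And>i b. i \<in> {1..n} \<Longrightarrow> b \<in> B \<Longrightarrow> \<alpha> i * b \<in> rat_vs.span B"
    "\<And>K. number_field K \<Longrightarrow> \<forall>i\<in>{1..n}. \<alpha> i \<in> K \<Longrightarrow> B \<subseteq> K \<and> card B \<le> field_degree K"
proof -
  define F where "F = {K. number_field K \<and> (\<forall>i\<in>{1..n}. \<alpha> i \<in> K)}"
  define K1 where "K1 = \<Inter> F"
  have sub: "rat_vs.subspace K1"
    unfolding K1_def by (rule rat_vs.subspace_Inter) (auto simp: F_def number_field_subspace)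
  obtain B where B: "B \<subseteq> K1" "rat_vs.independent B" "K1 \<subseteq> rat_vs.span B" "card B = rat_vs.dim K1"
    by (rule rat_vs.basis_exists)
  have span: "rat_vs.span B = K1" using B(1,3) rat_vs.span_minimal[OF B(1) sub] by simp
  have fam: "B \<subseteq> K \<and> finite B \<and> card B \<le> field_degree K" if K: "K \<in> F" for K
  proof -
    have "B \<subseteq> K" using B(1) K unfolding K1_def by blast
    moreover obtain B' where B': "finite B'" "rat_vs.span B' = K" "card B' = field_degree K"
      using number_field_basis K unfolding F_def by blast
    ultimately show ?thesis using rat_vs.independent_span_bound[OF B'(1) B(2)] by simp
  qed
  have K0F: "K0 \<in> F" using K0 by (simp add: F_def)
  show ?thesis
  proof (rule that[of B])
    show "finite B" "rat_vs.independent B" using fam[OF K0F] B(2) by auto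
    show "B \<noteq> {}"
    proof
      assume "B = {}"
      then have "K1 = {0}" using span by simp
      moreover have "1 \<in> K1" unfolding K1_def F_def using number_field_closed(1) by blast
      ultimately show False by simp
    qed
    show "\<alpha> i * b \<in> rat_vs.span B" if "i \<in> {1..n}" "b \<in> B" for i b
      unfolding span using that B(1) number_field_closed(5) unfolding K1_def F_def by blast
    show "B \<subseteq> K \<and> card B \<le> field_degree K" if "number_field K" "\<forall>i\<in>{1..n}. \<alpha> i \<in> K" for K
      using fam[of K] that by (simp add: F_def)
  qed
qed

lemma rat_common_denominator:
  fixes r :: "'a \<Rightarrow> rat"
  assumes "finite A"
  obtains E :: int where "E > 0" "\<And>x. x \<in> A \<Longrightarrow> \<exists>m. of_int E * r x = of_int m"
proof -
  have "\<exists>E>0. \<forall>x\<in>A. \<exists>m. of_int E * r x = of_int m"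
    using assms
  proof induction
    case empty
    show ?case by (intro exI[of _ 1]) simp
  next
    case (insert a A)
    then obtain E where E: "E > 0" "\<forall>x\<in>A. \<exists>m. of_int E * r x = of_int m" by blast
    obtain u d where ud: "quotient_of (r a) = (u, d)" by fastforce
    have d: "d > 0" "r a = of_int u / of_int d" using quotient_of_denom_pos[OF ud] quotient_of_div[OF ud] by auto
    have "\<exists>m. of_int (d * E) * r x = of_int m" if "x \<in> insert a A" for x
    proof (cases "x = a")
      case True
      then have "of_int (d * E) * r x = of_int (E * u)" using d by simp
      then show ?thesis by blast
    next
      case False
      then obtain m where "of_int E * r x = of_int m" using E(2) \<open>x \<in> insert a A\<close> by blast
      then have "of_int (d * E) * r x = of_int (d * m)" by (simp add: mult.assoc)
      then show ?thesis by blast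
    qed
    moreover have "d * E > 0" using d E by simp
    ultimately show ?case by blast
  qed
  then show ?thesis using that by blast
qed

lemma det_abs_le:
  fixes N :: "int mat"
  assumes N: "N \<in> carrier_mat D D" and b: "\<And>i j. i < D \<Longrightarrow> j < D \<Longrightarrow> \<bar>N $$ (i, j)\<bar> \<le> M"
  shows "\<bar>det N\<bar> \<le> fact D * M ^ D"
proof -
  have "\<bar>det N\<bar> \<le> (\<Sum>p | p permutes {0..<D}. \<bar>signof p * (\<Prod>i = 0..<D. N $$ (i, p i))\<bar>)"
    unfolding det_def'[OF N] by (rule sum_abs)
  also have "\<dots> \<le> (\<Sum>p | p permutes {0..<D}. M ^ D)"
  proof (rule sum_mono)
    fix p assume "p \<in> {p. p permutes {0..<D}}"
    then have p: "p i < D" if "i < D" for i using that permutes_in_image[of p "{0..<D}" i] by auto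
    have "\<bar>signof p * (\<Prod>i = 0..<D. N $$ (i, p i))\<bar> = (\<Prod>i = 0..<D. \<bar>N $$ (i, p i)\<bar>)"
      by (simp add: abs_mult abs_prod sign_def)
    also have "\<dots> \<le> (\<Prod>i = 0..<D. M)" by (intro prod_mono) (auto intro!: b p)
    finally show "\<bar>signof p * (\<Prod>i = 0..<D. N $$ (i, p i))\<bar> \<le> M ^ D" by simp
  qed
  also have "\<dots> = fact D * M ^ D" by (simp add: card_permutations)
  finally show ?thesis .
qed

lemma padic_abs_of_int:
  assumes "prime p"
  shows "padic_abs p (of_int k) \<le> 1" "padic_abs p (of_int k) < 1 \<longleftrightarrow> int p dvd k"
proof -
  have p: "real p > 1" using prime_gt_1_nat[OF assms] by simp
  have nu: "\<not> is_unit (int p)" using assms prime_gt_1_nat[OF assms] by simp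
  have eq: "padic_abs p (of_int k) = 1 / real p ^ multiplicity (int p) k" if "k \<noteq> 0"
    using that p by (simp add: padic_abs_def quotient_of_int power_int_minus divide_inverse)
  show "padic_abs p (of_int k) \<le> 1"
    using p by (cases "k = 0") (auto simp: eq, simp add: padic_abs_def)
  show "padic_abs p (of_int k) < 1 \<longleftrightarrow> int p dvd k"
  proof (cases "k = 0")
    case True
    then show ?thesis by (simp add: padic_abs_def)
  next
    case False
    have "1 / real p ^ m < 1 \<longleftrightarrow> m > 0" for m
      using p one_less_power[OF p, of m] by (cases "m = 0") (auto simp: divide_less_eq)
    moreover have "multiplicity (int p) k > 0 \<longleftrightarrow> int p dvd k"
      using False nu by (simp add: multiplicity_gt_zero_iff)
    ultimately show ?thesis by (simp add: eq[OF False])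
  qed
qed

context
  fixes p :: nat and K :: "'k::field_char_0 set" and v :: "'k \<Rightarrow> real"
  assumes p: "prime p" and K: "number_field K" and v: "place_above p K v"
begin

lemma place_props:
  "x \<in> K \<Longrightarrow> v x \<ge> 0" "x \<in> K \<Longrightarrow> v x = 0 \<longleftrightarrow> x = 0"
  "x \<in> K \<Longrightarrow> y \<in> K \<Longrightarrow> v (x * y) = v x * v y" "x \<in> K \<Longrightarrow> y \<in> K \<Longrightarrow> v (x + y) \<le> v x + v y"
  using v unfolding place_above_def absolute_value_on_def by blast+

lemma place_int: "v (of_int k) \<le> 1" "v (of_int k) < 1 \<longleftrightarrow> int p dvd k"
proof -
  have "v (of_int k) = padic_abs p (of_int k)" using v unfolding place_above_def by (metis of_rat_of_int_eq)
  then show "v (of_int k) \<le> 1" "v (of_int k) < 1 \<longleftrightarrow> int p dvd k" using padic_abs_of_int[OF p] by simp_all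
qed

lemma place_power: "x \<in> K \<Longrightarrow> v (x ^ m) = v x ^ m"
proof (induction m)
  case 0
  have "v 1 = v 1 * v 1" using place_props(3)[of 1 1] number_field_closed(1)[OF K] by simp
  moreover have "v 1 \<noteq> 0" using place_props(2)[of 1] number_field_closed(1)[OF K] by simp
  ultimately show ?case by simp
next
  case (Suc m)
  then show ?case using place_props(3)[of x "x ^ m"] number_field_closed(9)[OF K] by simp
qed

lemma place_sum: "(\<And>i. i \<in> I \<Longrightarrow> f i \<in> K) \<Longrightarrow> v (sum f I) \<le> (\<Sum>i\<in>I. v (f i))"
proof (induction I rule: infinite_finite_induct)
  case (insert i I)
  have "v (sum f (insert i I)) = v (f i + sum f I)" using insert(1,2) by simp
  also have "\<dots> \<le> v (f i) + v (sum f I)" using insert by (intro place_props(4) number_field_closed(10)[OF K]) auto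
  also have "\<dots> \<le> v (f i) + (\<Sum>i\<in>I. v (f i))" using insert by simp
  finally show ?case using insert by simp
qed (use place_props(2)[of 0] number_field_closed(2)[OF K] in auto)

text \<open>The definition of a place provides only the triangle inequality. Since integers have
  absolute value at most 1, the binomial expansion of (x + y)^m gives r^m <= m + 1 for r = v (x + y)
  / s, which is impossible for r > 1. Taking s midway between M and v (x + y) keeps the denominator
  positive when M = 0.\<close>

lemma place_ultrametric:
  assumes x: "x \<in> K" and y: "y \<in> K" and M: "v x \<le> M" "v y \<le> M"
  shows "v (x + y) \<le> M"
proof (rule ccontr)
  assume nle: "\<not> v (x + y) \<le> M"
  define s where "s = (M + v (x + y)) / 2"
  have M0: "M \<ge> 0" using place_props(1)[OF x] M by simp
  have s: "s > 0" "M \<le> s" "s < v (x + y)" using nle M0 unfolding s_def by auto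
  define r where "r = v (x + y) / s"
  have r: "r > 1" using s by (simp add: r_def)
  have bound: "r ^ m \<le> real m + 1" for m
  proof -
    have "v (x + y) ^ m = v ((x + y) ^ m)" by (rule place_power[symmetric]) (rule number_field_closed(4)[OF K x y])
    also have "(x + y) ^ m = (\<Sum>i\<le>m. of_nat (m choose i) * x ^ i * y ^ (m - i))" by (rule binomial_ring)
    also have "v \<dots> \<le> (\<Sum>i\<le>m. v (of_nat (m choose i) * x ^ i * y ^ (m - i)))"
      by (rule place_sum) (intro number_field_closed[OF K] x y)
    also have "\<dots> \<le> (\<Sum>i\<le>m. s ^ m)"
    proof (rule sum_mono)
      fix i assume i: "i \<in> {..m}"
      have "v (of_nat (m choose i) * x ^ i * y ^ (m - i)) = v (of_int (int (m choose i))) * (v x ^ i * v y ^ (m - i))"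
        using number_field_closed[OF K] x y by (simp add: place_props(3) place_power)
      also have "\<dots> \<le> 1 * (s ^ i * s ^ (m - i))"
        using place_int(1)[of "int (m choose i)"] place_props(1) x y s M number_field_closed[OF K]
        by (intro mult_mono power_mono) auto
      also have "\<dots> = s ^ m" using i by (simp flip: power_add)
      finally show "v (of_nat (m choose i) * x ^ i * y ^ (m - i)) \<le> s ^ m" .
    qed
    also have "\<dots> = (real m + 1) * s ^ m" by (simp add: add.commute)
    finally show ?thesis using s by (simp add: r_def power_divide divide_le_eq)
  qed
  obtain m :: nat where m: "2 < real m * (r - 1)\<^sup>2" using reals_Archimedean3[of "(r - 1)\<^sup>2"] r by auto
  \<comment> \<open>Bernoulli's bound for r^m, squared, grows quadratically in m, against the bound
    2 m + 1 for r^(2 m).\<close>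
  have "(1 + real m * (r - 1)) ^ 2 \<le> (r ^ m) ^ 2"
    using Bernoulli_inequality[of "r - 1" m] r by (intro power_mono) auto
  also have "\<dots> \<le> real (m * 2) + 1" using bound[of "m * 2"] by (simp add: power_mult)
  finally have "(1 + real m * (r - 1))\<^sup>2 \<le> real (m * 2) + 1" .
  moreover have "(1 + real m * (r - 1))\<^sup>2 = 1 + 2 * (real m * (r - 1)) + real m * (real m * (r - 1)\<^sup>2)"
    by (simp add: power2_eq_square algebra_simps)
  moreover have "0 \<le> real m * (r - 1)" using r by simp
  ultimately have "real m * (real m * (r - 1)\<^sup>2) \<le> real m * 2" by simp
  moreover have "m > 0" using m by (cases m) auto
  ultimately show False using m by simp
qed

lemma place_ultrametric_sum:
  "M \<ge> 0 \<Longrightarrow> (\<And>i. i \<in> I \<Longrightarrow> f i \<in> K \<and> v (f i) \<le> M) \<Longrightarrow> v (sum f I) \<le> M"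
proof (induction I rule: infinite_finite_induct)
  case (insert i I)
  have "v (f i + sum f I) \<le> M" using insert by (intro place_ultrametric number_field_closed(10)[OF K]) auto
  then show ?case using insert by simp
qed (use place_props(2)[of 0] number_field_closed(2)[OF K] in auto)

lemma place_relation_approx:
  fixes \<alpha> :: "nat \<Rightarrow> 'k" and a w :: "nat \<Rightarrow> int"
  assumes \<alpha>: "\<forall>i\<in>{1..n}. \<alpha> i \<in> K" and a: "\<forall>i\<in>{1..n}. v (of_int (a i) - \<alpha> i) < 1"
  shows "v ((\<Sum>i=1..n. of_int (w i) * \<alpha> i) - of_int (\<Sum>i=1..n. w i * a i)) < 1"
proof -
  \<comment> \<open>A maximum over finitely many indices stays strictly below 1; 0 is inserted so
    that the set is nonempty when n = 0.\<close>
  define M where "M = Max (insert 0 ((\<lambda>i. v (of_int (a i) - \<alpha> i)) ` {1..n}))"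
  have M: "0 \<le> M" "M < 1" "\<And>i. i \<in> {1..n} \<Longrightarrow> v (of_int (a i) - \<alpha> i) \<le> M"
    using a unfolding M_def by (simp, simp, intro Max_ge) auto
  have "(\<Sum>i=1..n. of_int (w i) * \<alpha> i) - of_int (\<Sum>i=1..n. w i * a i) = (\<Sum>i=1..n. of_int (- w i) * (of_int (a i) - \<alpha> i))"
    by (simp add: of_int_sum sum_subtractf[symmetric] algebra_simps)
  also have "v \<dots> \<le> M"
  proof (rule place_ultrametric_sum[OF M(1)])
    fix i assume i: "i \<in> {1..n}"
    have mem: "of_int (- w i) \<in> K" "of_int (a i) - \<alpha> i \<in> K"
      using \<alpha> i number_field_closed(3,7)[OF K] by blast+
    have "v (of_int (- w i) * (of_int (a i) - \<alpha> i)) = v (of_int (- w i)) * v (of_int (a i) - \<alpha> i)"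
      by (rule place_props(3)[OF mem])
    also have "\<dots> \<le> 1 * M" using place_int(1)[of "- w i"] M i place_props(1)[OF mem(2)] by (intro mult_mono) auto
    finally show "of_int (- w i) * (of_int (a i) - \<alpha> i) \<in> K \<and> v (of_int (- w i) * (of_int (a i) - \<alpha> i)) \<le> M"
      using number_field_closed(5)[OF K mem] by simp
  qed
  finally show ?thesis using M by simp
qed

text \<open>A relation among the \<alpha> i turns into an integer of absolute value below 1, and
  such integers are the multiples of p.\<close>

lemma congruence_of_relation:
  fixes \<alpha> :: "nat \<Rightarrow> 'k" and a w :: "nat \<Rightarrow> int"
  assumes "\<forall>i\<in>{1..n}. \<alpha> i \<in> K" "\<forall>i\<in>{1..n}. v (of_int (a i) - \<alpha> i) < 1"
    and "(\<Sum>i=1..n. of_int (w i) * \<alpha> i) = 0"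
  shows "int p dvd (\<Sum>i=1..n. w i * a i)"
proof -
  have "v (of_int (- (\<Sum>i=1..n. w i * a i))) < 1"
    using place_relation_approx[OF assms(1,2), of w] assms(3) by simp
  then show ?thesis unfolding place_int(2) by simp
qed

text \<open>The vector b is an eigenvector of N for \<gamma>. Multiplying by the adjugate gives det
  N * b = \<gamma> * adj(N) b; at an index k where v (b k) is largest this shows v (det N) <= v
  \<gamma> < 1.\<close>

lemma det_multiplication_divisible:
  fixes b :: "nat \<Rightarrow> 'k" and N :: "int mat"
  assumes N: "N \<in> carrier_mat D D" and D: "D > 0"
    and b: "\<And>k. k < D \<Longrightarrow> b k \<in> K \<and> b k \<noteq> 0"
    and eig: "\<And>k. k < D \<Longrightarrow> (\<Sum>l<D. of_int (N $$ (k, l)) * b l) = \<gamma> * b k"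
    and \<gamma>: "\<gamma> \<in> K" "v \<gamma> < 1"
  shows "int p dvd det N"
proof -
  obtain k where k: "k < D" "\<And>l. l < D \<Longrightarrow> v (b l) \<le> v (b k)"
  proof -
    have "Max ((\<lambda>k. v (b k)) ` {..<D}) \<in> (\<lambda>k. v (b k)) ` {..<D}" using D by (intro Max_in) auto
    then obtain k where "k < D" "Max ((\<lambda>k. v (b k)) ` {..<D}) = v (b k)" by auto
    then show ?thesis using that[of k] by (metis Max_ge finite_imageI finite_lessThan imageI lessThan_iff)
  qed
  have adj: "adj_mat N \<in> carrier_mat D D" "adj_mat N * N = det N \<cdot>\<^sub>m 1\<^sub>m D" using adj_mat[OF N] by auto
  have ent: "(\<Sum>l<D. adj_mat N $$ (k, l) * N $$ (l, j)) = (if k = j then det N else 0)" if "j < D" for j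
  proof -
    have "(adj_mat N * N) $$ (k, j) = (\<Sum>l<D. adj_mat N $$ (k, l) * N $$ (l, j))"
      using that k adj(1) N by (simp add: times_mat_def Matrix.scalar_prod_def lessThan_atLeast0)
    then show ?thesis unfolding adj(2) using that k by (cases "k = j") simp_all
  qed
  have "of_int (det N) * b k = (\<Sum>j<D. (if k = j then of_int (det N) * b j else 0))" using k by simp
  also have "\<dots> = (\<Sum>j<D. of_int (\<Sum>l<D. adj_mat N $$ (k, l) * N $$ (l, j)) * b j)"
    by (intro sum.cong refl) (simp add: ent)
  also have "\<dots> = (\<Sum>l<D. \<Sum>j<D. of_int (adj_mat N $$ (k, l)) * (of_int (N $$ (l, j)) * b j))"
    unfolding of_int_sum sum_distrib_right by (subst sum.swap) (simp add: mult.assoc)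
  also have "\<dots> = (\<Sum>l<D. of_int (adj_mat N $$ (k, l)) * (\<gamma> * b l))"
    unfolding sum_distrib_left[symmetric] by (intro sum.cong refl) (simp add: eig)
  finally have eq: "of_int (det N) * b k = (\<Sum>l<D. of_int (adj_mat N $$ (k, l)) * (\<gamma> * b l))" .
  have bk: "v (b k) > 0" using place_props(1,2)[of "b k"] b[OF k(1)] by force
  have "v (of_int (det N)) * v (b k) = v (of_int (det N) * b k)"
    using place_props(3)[of "of_int (det N)" "b k"] number_field_closed(7)[OF K] b[OF k(1)] by simp
  also have "\<dots> \<le> v \<gamma> * v (b k)"
    unfolding eq
  proof (rule place_ultrametric_sum)
    show "0 \<le> v \<gamma> * v (b k)" using place_props(1) \<gamma> b k by simp
    fix l assume "l \<in> {..<D}"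
    then have l: "l < D" by simp
    have mem: "of_int (adj_mat N $$ (k, l)) \<in> K" "\<gamma> * b l \<in> K" using number_field_closed(5,7)[OF K] \<gamma> b[OF l] by auto
    have "v (of_int (adj_mat N $$ (k, l)) * (\<gamma> * b l)) = v (of_int (adj_mat N $$ (k, l))) * (v \<gamma> * v (b l))"
      using place_props(3) mem \<gamma> b[OF l] by simp
    also have "\<dots> \<le> 1 * (v \<gamma> * v (b k))"
      using place_int(1) place_props(1) \<gamma> b[OF l] k(2)[OF l] by (intro mult_mono) auto
    finally show "of_int (adj_mat N $$ (k, l)) * (\<gamma> * b l) \<in> K \<and> v (of_int (adj_mat N $$ (k, l)) * (\<gamma> * b l)) \<le> v \<gamma> * v (b k)"
      using number_field_closed(5)[OF K mem] by simp
  qed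
  finally have "v (of_int (det N)) \<le> v \<gamma>" using bk by simp
  then show ?thesis using \<gamma> place_int(2) by force
qed

end

text \<open>Let g be the linear form and E a common denominator. Multiplication by E g has an
  integer matrix on B whose entries are at most a constant times the weight of w. Its determinant is
  nonzero because g is, and divisible by p because v g < 1; so p is at most its absolute value,
  which is of the order of the D-th power of the weight.\<close>

lemma congruence_bound:
  fixes \<alpha> :: "nat \<Rightarrow> 'k::field_char_0"
  assumes K0: "number_field K0" "\<forall>i\<in>{1..n}. \<alpha> i \<in> K0"
  obtains D :: nat and C :: real where "D > 0" "C > 0"
    "\<And>K. number_field K \<Longrightarrow> \<forall>i\<in>{1..n}. \<alpha> i \<in> K \<Longrightarrow> D \<le> field_degree K"
    "\<And>K p v a w. number_field K \<Longrightarrow> \<forall>i\<in>{1..n}. \<alpha> i \<in> K \<Longrightarrow> prime p \<Longrightarrow> place_above p K v \<Longrightarrow>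
       \<forall>i\<in>{1..n}. v (of_int (a i) - \<alpha> i) < 1 \<Longrightarrow> int p dvd (\<Sum>i=1..n. w i * a i) \<Longrightarrow>
       (\<Sum>i=1..n. of_int (w i) * \<alpha> i) \<noteq> 0 \<Longrightarrow> real p \<le> C * real_of_int (\<Sum>i=1..n. \<bar>w i\<bar>) ^ D"
proof -
  obtain B where B: "finite B" "rat_vs.independent B" "B \<noteq> {}"
    "\<And>i b. i \<in> {1..n} \<Longrightarrow> b \<in> B \<Longrightarrow> \<alpha> i * b \<in> rat_vs.span B"
    "\<And>K. number_field K \<Longrightarrow> \<forall>i\<in>{1..n}. \<alpha> i \<in> K \<Longrightarrow> B \<subseteq> K \<and> card B \<le> field_degree K"
    using number_field_common_module[OF K0] by blast
  define D where "D = card B"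
  have D: "D > 0" using B(1,3) by (simp add: D_def card_gt_0_iff)
  obtain b where b: "bij_betw b {..<D} B"
    using ex_bij_betw_nat_finite[OF B(1)] unfolding D_def lessThan_atLeast0 by blast
  have bB: "b k \<in> B" if "k < D" for k using b that by (auto simp: bij_betw_def)
  have reindex: "(\<Sum>l<D. g (b l)) = sum g B" for g :: "'k \<Rightarrow> 'k" by (rule sum.reindex_bij_betw[OF b])
  have "\<exists>r. \<alpha> i * b k = (\<Sum>l<D. of_rat (r l) * b l)" if "i \<in> {1..n}" "k < D" for i k
  proof -
    have "\<alpha> i * b k \<in> rat_vs.span B" using B(4)[OF that(1) bB[OF that(2)]] .
    then obtain u where "\<alpha> i * b k = (\<Sum>x\<in>B. rat_scale (u x) x)"
      unfolding rat_vs.span_finite[OF B(1)] by blast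
    then show ?thesis using reindex[of "\<lambda>x. rat_scale (u x) x"] unfolding rat_scale_def
      by (intro exI[of _ "\<lambda>l. u (b l)"]) simp
  qed
  then have "\<forall>i k. \<exists>r. i \<in> {1..n} \<longrightarrow> k < D \<longrightarrow> \<alpha> i * b k = (\<Sum>l<D. of_rat (r l) * b l)" by blast
  then obtain r where r: "\<And>i k. i \<in> {1..n} \<Longrightarrow> k < D \<Longrightarrow> \<alpha> i * b k = (\<Sum>l<D. of_rat (r i k l) * b l)"
    by metis
  obtain E :: int where E: "E > 0" "\<And>x. x \<in> {1..n} \<times> {..<D} \<times> {..<D} \<Longrightarrow> \<exists>m. of_int E * (case x of (i, k, l) \<Rightarrow> r i k l) = of_int m"
    using rat_common_denominator[of "{1..n} \<times> {..<D} \<times> {..<D}" "\<lambda>(i, k, l). r i k l"] by blast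
  define m where "m = (\<lambda>i k l. \<lfloor>of_int E * r i k l\<rfloor>)"
  have m: "of_int (m i k l) = of_int E * r i k l" if "i \<in> {1..n}" "k < D" "l < D" for i k l
    using E(2)[of "(i, k, l)"] that unfolding m_def by fastforce
  have mult: "of_int E * \<alpha> i * b k = (\<Sum>l<D. of_int (m i k l) * b l)" if "i \<in> {1..n}" "k < D" for i k
  proof -
    have "of_int E * \<alpha> i * b k = (\<Sum>l<D. of_int E * (of_rat (r i k l) * b l))"
      using r[OF that] by (simp add: sum_distrib_left mult.assoc)
    also have "\<dots> = (\<Sum>l<D. of_int (m i k l) * b l)"
    proof (intro sum.cong refl)
      fix l assume "l \<in> {..<D}"
      then have "(of_rat (of_int (m i k l)) :: 'k) = of_rat (of_int E * r i k l)" using m that by simp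
      then show "of_int E * (of_rat (r i k l) * b l) = of_int (m i k l) * b l" by (simp add: of_rat_mult mult.assoc)
    qed
    finally show ?thesis .
  qed
  define Mx where "Mx = 1 + (\<Sum>i=1..n. \<Sum>k<D. \<Sum>l<D. \<bar>m i k l\<bar>)"
  have Mx: "\<bar>m i k l\<bar> \<le> Mx" if "i \<in> {1..n}" "k < D" "l < D" for i k l
  proof -
    have "\<bar>m i k l\<bar> \<le> (\<Sum>l<D. \<bar>m i k l\<bar>)" using that by (intro member_le_sum[of l _ "\<lambda>l. \<bar>m i k l\<bar>"]) auto
    also have "\<dots> \<le> (\<Sum>k<D. \<Sum>l<D. \<bar>m i k l\<bar>)"
      using that by (intro member_le_sum[of k _ "\<lambda>k. \<Sum>l<D. \<bar>m i k l\<bar>"]) (auto intro: sum_nonneg)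
    also have "\<dots> \<le> (\<Sum>i=1..n. \<Sum>k<D. \<Sum>l<D. \<bar>m i k l\<bar>)"
      using that by (intro member_le_sum[of i _ "\<lambda>i. \<Sum>k<D. \<Sum>l<D. \<bar>m i k l\<bar>"]) (auto intro: sum_nonneg)
    finally show ?thesis by (simp add: Mx_def)
  qed
  have Mx0: "Mx > 0" unfolding Mx_def by (simp add: add_pos_nonneg sum_nonneg)
  define C where "C = fact D * real_of_int Mx ^ D"
  have C: "C > 0" using Mx0 by (simp add: C_def)
  show ?thesis
  proof (rule that[OF D C])
    show "D \<le> field_degree K" if "number_field K" "\<forall>i\<in>{1..n}. \<alpha> i \<in> K" for K
      using B(5)[OF that] by (simp add: D_def)
    fix K p v a and w :: "nat \<Rightarrow> int"
    assume K: "number_field K" and \<alpha>K: "\<forall>i\<in>{1..n}. \<alpha> i \<in> K" and p: "prime p" and v: "place_above p K v"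
      and a: "\<forall>i\<in>{1..n}. v (of_int (a i) - \<alpha> i) < 1" and dvd: "int p dvd (\<Sum>i=1..n. w i * a i)"
      and nz: "(\<Sum>i=1..n. of_int (w i) * \<alpha> i) \<noteq> 0"
    define g where "g = (\<Sum>i=1..n. of_int (w i) * \<alpha> i)"
    define \<gamma> where "\<gamma> = of_int E * g"
    define N where "N = mat D D (\<lambda>(k, l). \<Sum>i=1..n. w i * m i k l)"
    have N: "N \<in> carrier_mat D D" by (simp add: N_def)
    have gK: "g \<in> K" unfolding g_def using \<alpha>K by (intro number_field_closed[OF K]) auto
    have \<gamma>K: "\<gamma> \<in> K" unfolding \<gamma>_def by (intro number_field_closed[OF K] gK)
    have "v (g - of_int (\<Sum>i=1..n. w i * a i)) < 1"
      unfolding g_def by (rule place_relation_approx[OF p K v \<alpha>K a])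
    moreover have "v (of_int (\<Sum>i=1..n. w i * a i)) < 1" using place_int(2)[OF p K v] dvd by blast
    ultimately have "v (g - of_int (\<Sum>i=1..n. w i * a i) + of_int (\<Sum>i=1..n. w i * a i))
        \<le> max (v (g - of_int (\<Sum>i=1..n. w i * a i))) (v (of_int (\<Sum>i=1..n. w i * a i)))"
      by (intro place_ultrametric[OF p K v] number_field_closed(3,7)[OF K] gK) auto
    then have vg: "v g < 1"
      using \<open>v (g - of_int (\<Sum>i=1..n. w i * a i)) < 1\<close> \<open>v (of_int (\<Sum>i=1..n. w i * a i)) < 1\<close> by simp
    have "v \<gamma> = v (of_int E) * v g"
      unfolding \<gamma>_def by (intro place_props(3)[OF p K v] number_field_closed(7)[OF K] gK)
    also have "\<dots> \<le> 1 * v g" using place_int(1)[OF p K v] place_props(1)[OF p K v gK] by (intro mult_right_mono)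
    finally have v\<gamma>: "v \<gamma> < 1" using vg by simp
    have eig: "(\<Sum>l<D. of_int (N $$ (k, l)) * b l) = \<gamma> * b k" if "k < D" for k
    proof -
      have "(\<Sum>l<D. of_int (N $$ (k, l)) * b l) = (\<Sum>l<D. \<Sum>i=1..n. of_int (w i) * (of_int (m i k l) * b l))"
        using that by (intro sum.cong refl) (simp add: N_def sum_distrib_right mult.assoc)
      also have "\<dots> = (\<Sum>i=1..n. \<Sum>l<D. of_int (w i) * (of_int (m i k l) * b l))" by (rule sum.swap)
      also have "\<dots> = (\<Sum>i=1..n. of_int (w i) * (of_int E * \<alpha> i * b k))"
        by (intro sum.cong refl) (simp add: mult that sum_distrib_left)
      also have "\<dots> = \<gamma> * b k" by (simp add: \<gamma>_def g_def sum_distrib_left sum_distrib_right algebra_simps)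
      finally show ?thesis .
    qed
    have bK: "b k \<in> K \<and> b k \<noteq> 0" if "k < D" for k
      using bB[OF that] B(5)[OF K \<alpha>K] rat_vs.dependent_zero[of B] B(2) by auto
    have dvd': "int p dvd det N" by (rule det_multiplication_divisible[OF p K v N D bK eig \<gamma>K v\<gamma>])
    have "det N \<noteq> 0"
    proof
      assume "det N = 0"
      then have "det N\<^sup>T = 0" using det_transpose[OF N] by simp
      then obtain x where x: "x \<in> carrier_vec D" "x \<noteq> 0\<^sub>v D" "N\<^sup>T *\<^sub>v x = 0\<^sub>v D"
        using det_0_iff_vec_prod_zero[of "N\<^sup>T" D] N by auto
      have col: "(\<Sum>k<D. x $ k * N $$ (k, l)) = 0" if "l < D" for l
      proof -
        have "(N\<^sup>T *\<^sub>v x) $ l = (\<Sum>k<D. N $$ (k, l) * x $ k)"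
          using that x(1) N by (simp add: Matrix.scalar_prod_def lessThan_atLeast0)
        then show ?thesis using x(3) that by (simp add: mult.commute)
      qed
      have "\<gamma> * (\<Sum>k<D. of_int (x $ k) * b k) = (\<Sum>k<D. \<Sum>l<D. of_int (x $ k) * (of_int (N $$ (k, l)) * b l))"
        unfolding sum_distrib_left by (intro sum.cong refl) (simp add: eig sum_distrib_left[symmetric] mult.left_commute)
      also have "\<dots> = (\<Sum>l<D. of_int (\<Sum>k<D. x $ k * N $$ (k, l)) * b l)"
        by (subst sum.swap) (simp add: sum_distrib_right mult.assoc)
      also have "\<dots> = 0" by (simp add: col)
      finally have zero: "(\<Sum>k<D. of_int (x $ k) * b k) = 0" using nz E(1) by (simp add: \<gamma>_def g_def)
      define u where "u = (\<lambda>y. of_int (x $ the_inv_into {..<D} b y) :: rat)"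
      have ub: "u (b k) = of_int (x $ k)" if "k < D" for k
        using the_inv_into_f_f[of b "{..<D}" k] b that by (simp add: u_def bij_betw_def)
      have "(\<Sum>y\<in>B. rat_scale (u y) y) = (\<Sum>k<D. of_int (x $ k) * b k)"
        unfolding reindex[symmetric] by (intro sum.cong refl) (simp add: ub rat_scale_def)
      then have "u y = 0" if "y \<in> B" for y
        using zero B(2) that unfolding rat_vs.dependent_finite[OF B(1)] by auto
      then have "x $ k = 0" if "k < D" for k using ub[OF that] bB[OF that] by simp
      then show False using x(1,2) by auto
    qed
    then have "int p \<le> \<bar>det N\<bar>" using dvd_imp_le_int[of "det N" "int p"] dvd' by simp
    also have "\<bar>det N\<bar> \<le> fact D * (Mx * (\<Sum>i=1..n. \<bar>w i\<bar>)) ^ D"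
    proof (rule det_abs_le[OF N])
      fix k l assume kl: "k < D" "l < D"
      have "\<bar>N $$ (k, l)\<bar> \<le> (\<Sum>i=1..n. \<bar>w i * m i k l\<bar>)" using kl by (simp add: N_def sum_abs)
      also have "\<dots> \<le> (\<Sum>i=1..n. Mx * \<bar>w i\<bar>)"
        using Mx kl by (intro sum_mono) (auto simp: abs_mult mult.commute[of Mx] intro!: mult_left_mono)
      finally show "\<bar>N $$ (k, l)\<bar> \<le> Mx * (\<Sum>i=1..n. \<bar>w i\<bar>)" by (simp add: sum_distrib_left)
    qed
    finally have "real_of_int (int p) \<le> real_of_int (fact D * (Mx * (\<Sum>i=1..n. \<bar>w i\<bar>)) ^ D)"
      by (rule of_int_le_iff[THEN iffD2])
    then show "real p \<le> C * real_of_int (\<Sum>i=1..n. \<bar>w i\<bar>) ^ D"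
      by (simp add: C_def power_mult_distrib mult.assoc)
  qed
qed

section \<open>Lattices and relations modulo a prime\<close>

definition int_subgroup :: "(nat \<Rightarrow> int) set \<Rightarrow> bool" where
  "int_subgroup L \<longleftrightarrow> (\<lambda>_. 0) \<in> L \<and> (\<forall>a\<in>L. \<forall>b\<in>L. (\<lambda>j. a j - b j) \<in> L)"

lemma int_subgroup_diff: "int_subgroup L \<Longrightarrow> a \<in> L \<Longrightarrow> b \<in> L \<Longrightarrow> (\<lambda>j. a j - b j) \<in> L"
  unfolding int_subgroup_def by blast

lemma int_subgroup_scale:
  assumes L: "int_subgroup L" and a: "a \<in> L"
  shows "(\<lambda>j. k * a j) \<in> L"
proof (induction k rule: int_induct[where k = 0])
  case base
  show ?case using L unfolding int_subgroup_def by simp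
next
  case (step1 i)
  have "(\<lambda>j. 0 - a j) \<in> L" using int_subgroup_diff[OF L _ a, of "\<lambda>_. 0"] L unfolding int_subgroup_def by simp
  from int_subgroup_diff[OF L step1(2) this] show ?case by (simp add: algebra_simps)
next
  case (step2 i)
  from int_subgroup_diff[OF L step2(2) a] show ?case by (simp add: algebra_simps)
qed

lemma int_comb_Suc: "int_comb (Suc m) A c = (\<lambda>j. int_comb m A c j + c (Suc m) * A (Suc m) j)"
  by (simp add: int_comb_def)

lemma int_comb_cong: "(\<And>i. i \<in> {1..m} \<Longrightarrow> A i = A' i \<and> c i = c' i) \<Longrightarrow> int_comb m A c = int_comb m A' c'"
  unfolding int_comb_def by (intro ext sum.cong refl) simp

lemma int_vecs_Suc: "c \<in> int_vecs (Suc m) \<Longrightarrow> c (Suc m) = 0 \<Longrightarrow> c \<in> int_vecs m"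
  unfolding int_vecs_def mem_Collect_eq atLeastAtMostSuc_conv[of 1 m, simplified]
  by (intro allI impI, rename_tac j, case_tac "j = Suc m") auto

text \<open>Euclidean division on the last coordinate: a vector whose last coordinate is the least
  positive one completes a basis of the sublattice where that coordinate vanishes.\<close>

lemma lattice_basis_exists:
  "L \<subseteq> int_vecs n \<Longrightarrow> int_subgroup L \<Longrightarrow> \<exists>m A. lattice_basis m A L"
proof (induction n arbitrary: L)
  case 0
  have "L \<subseteq> {\<lambda>_. 0}" using 0 unfolding int_vecs_def by auto
  then have "lattice_basis 0 A L" for A
    unfolding lattice_basis_def int_comb_def int_vecs_def by auto
  then show ?case by blast
next
  case (Suc n)
  note L = Suc.prems(2)
  define L0 where "L0 = {x \<in> L. x (Suc n) = 0}"
  have "L0 \<subseteq> int_vecs n" using Suc.prems(1) int_vecs_Suc unfolding L0_def by blast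
  moreover have "int_subgroup L0" using L unfolding int_subgroup_def L0_def by simp
  ultimately obtain m A where mA: "lattice_basis m A L0" using Suc.IH by blast
  show ?case
  proof (cases "L0 = L")
    case True
    then show ?thesis using mA by blast
  next
    case False
    define P where "P = (\<lambda>g::nat. g > 0 \<and> (\<exists>x\<in>L. x (Suc n) = int g))"
    obtain y where y: "y \<in> L" "y (Suc n) \<noteq> 0" using False unfolding L0_def by blast
    have "P (nat \<bar>y (Suc n)\<bar>)"
    proof (cases "y (Suc n) > 0")
      case True
      then show ?thesis using y unfolding P_def by (auto intro!: bexI[of _ y])
    next
      case False
      then show ?thesis using y int_subgroup_scale[OF L y(1), of "- 1"] unfolding P_def
        by (auto intro!: bexI[of _ "\<lambda>j. - 1 * y j"])
    qed
    then have P: "P (LEAST g. P g)" by (rule LeastI)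
    define g where "g = (LEAST g. P g)"
    obtain x0 where x0: "x0 \<in> L" "x0 (Suc n) = int g" and g: "g > 0" using P unfolding P_def g_def by blast
    have red: "(\<lambda>j. x j - (x (Suc n) div int g) * x0 j) \<in> L0" if x: "x \<in> L" for x
    proof -
      define z where "z = (\<lambda>j. x j - (x (Suc n) div int g) * x0 j)"
      have z: "z \<in> L" unfolding z_def by (rule int_subgroup_diff[OF L x int_subgroup_scale[OF L x0(1)]])
      have "z (Suc n) = x (Suc n) mod int g" by (simp add: z_def x0(2) minus_div_mult_eq_mod)
      then have r: "0 \<le> z (Suc n)" "z (Suc n) < int g" using g by simp_all
      have "z (Suc n) = 0"
      proof (rule ccontr)
        assume "z (Suc n) \<noteq> 0"
        then have "P (nat (z (Suc n)))" using r z unfolding P_def by auto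
        then have "g \<le> nat (z (Suc n))" unfolding g_def by (rule Least_le)
        then show False using r by linarith
      qed
      then show ?thesis using z unfolding L0_def z_def by simp
    qed
    define A' where "A' = A(Suc m := x0)"
    have comb: "int_comb (Suc m) A' c = (\<lambda>j. int_comb m A c j + c (Suc m) * x0 j)" for c
      using int_comb_cong[of m A' A c c] by (simp add: int_comb_Suc A'_def)
    have "lattice_basis (Suc m) A' L"
      unfolding lattice_basis_def
    proof (intro conjI ballI impI subsetI)
      show "A' i \<in> L" if "i \<in> {1..Suc m}" for i
        using that mA x0(1) unfolding lattice_basis_def A'_def L0_def by (cases "i = Suc m") auto
    next
      fix x assume x: "x \<in> L"
      obtain c where c: "c \<in> int_vecs m" "(\<lambda>j. x j - (x (Suc n) div int g) * x0 j) = int_comb m A c"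
        using red[OF x] mA unfolding lattice_basis_def by blast
      define c' where "c' = c(Suc m := x (Suc n) div int g)"
      have "int_comb m A c' = int_comb m A c" by (rule int_comb_cong) (simp add: c'_def)
      then have "int_comb (Suc m) A' c' = x" unfolding comb by (simp add: c(2)[symmetric] c'_def)
      moreover have "c' \<in> int_vecs (Suc m)" using c(1) unfolding c'_def int_vecs_def by auto
      ultimately show "x \<in> int_comb (Suc m) A' ` int_vecs (Suc m)" by blast
    next
      fix c assume c: "c \<in> int_vecs (Suc m)" "int_comb (Suc m) A' c = (\<lambda>_. 0)"
      have "A i (Suc n) = 0" if "i \<in> {1..m}" for i using mA that unfolding lattice_basis_def L0_def by blast
      then have "int_comb m A c (Suc n) = 0" unfolding int_comb_def by simp
      then have "c (Suc m) * int g = 0" using fun_cong[OF c(2), of "Suc n"] unfolding comb x0(2)[symmetric] by simp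
      then have c0: "c (Suc m) = 0" using g by simp
      then have "int_comb m A c = (\<lambda>_. 0)" using c(2) unfolding comb by simp
      then show "c = (\<lambda>_. 0)" using mA int_vecs_Suc[OF c(1) c0] unfolding lattice_basis_def by blast
    qed
    then show ?thesis by blast
  qed
qed

lemma lattice_basis_orthogonal:
  assumes "lattice_basis m A L" "\<And>i. i \<in> {1..m} \<Longrightarrow> Defs.scalar_prod n w (A i) = 0" "x \<in> L"
  shows "Defs.scalar_prod n w x = 0"
proof -
  obtain c where "x = int_comb m A c" using assms(1,3) unfolding lattice_basis_def by blast
  then have "Defs.scalar_prod n w x = (\<Sum>j=1..n. \<Sum>i=1..m. c i * (w j * A i j))"
    unfolding Defs.scalar_prod_def int_comb_def by (simp add: sum_distrib_left mult.left_commute)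
  also have "\<dots> = (\<Sum>i=1..m. c i * Defs.scalar_prod n w (A i))"
    unfolding Defs.scalar_prod_def by (subst sum.swap) (simp add: sum_distrib_left)
  finally show ?thesis using assms(2) by simp
qed

lemma relation_lattice_subgroup: "relation_lattice n \<alpha> \<subseteq> int_vecs n" "int_subgroup (relation_lattice n \<alpha>)"
  unfolding relation_lattice_def int_subgroup_def int_vecs_def by (auto simp: algebra_simps sum_subtractf)

lemma Omega_subgroup: "Omega n \<alpha> \<subseteq> int_vecs n" "int_subgroup (Omega n \<alpha>)"
  unfolding Omega_def perp_def int_subgroup_def int_vecs_def Defs.scalar_prod_def by (auto simp: algebra_simps sum_subtractf)

lemma lattice_mahler_basis:
  assumes "L \<subseteq> int_vecs n" "int_subgroup L"
  obtains A where "lattice_basis (lattice_rank L) A L"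
    "lattice_mahler n' L = log_mahler (lattice_rank L) (matrix_laurent_poly (lattice_rank L) n' A)"
proof -
  have "\<exists>A. lattice_basis (lattice_rank L) A L"
    unfolding lattice_rank_def by (rule LeastI_ex) (rule lattice_basis_exists[OF assms])
  then have "lattice_basis (lattice_rank L) (SOME A. lattice_basis (lattice_rank L) A L) L" by (rule someI_ex)
  then show ?thesis by (rule that) (simp add: lattice_mahler_def Let_def)
qed

text \<open>For n = 2 no four indices are distinct, and irrationality comes from the rank instead: a
  rational relation between \<alpha> 1 and \<alpha> 2 makes \<Omega> orthogonal to a nonzero vector
  of the plane, so any two of its elements are dependent.\<close>

lemma rank_two_irrational:
  fixes \<alpha> :: "nat \<Rightarrow> 'k::field_char_0"
  assumes rank: "lattice_rank (Omega 2 \<alpha>) \<ge> 2" and nz: "\<alpha> 1 \<noteq> 0" "\<alpha> 2 \<noteq> 0"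
    and uv: "of_int u * \<alpha> 1 = of_int v * \<alpha> 2"
  shows "u = 0 \<and> v = 0"
proof (rule ccontr)
  assume "\<not> (u = 0 \<and> v = 0)"
  then have v: "v \<noteq> 0" using uv nz by auto
  obtain A where A: "lattice_basis (lattice_rank (Omega 2 \<alpha>)) A (Omega 2 \<alpha>)"
    by (rule lattice_mahler_basis[OF Omega_subgroup])
  define m where "m = lattice_rank (Omega 2 \<alpha>)"
  have m: "m \<ge> 2" using rank by (simp add: m_def)
  define w where "w = (\<lambda>j::nat. if j = 1 then u else if j = 2 then - v else (0::int))"
  have s2: "(\<Sum>j=1..2. h j) = h 1 + h (2::nat)" for h :: "nat \<Rightarrow> 'b::comm_monoid_add"
    by (simp add: numeral_2_eq_2)
  have w: "w \<in> relation_lattice 2 \<alpha>"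
  proof -
    have "(\<Sum>j=1..2. of_int (w j) * \<alpha> j) = 0" unfolding s2 using uv by (simp add: w_def)
    then show ?thesis unfolding relation_lattice_def int_vecs_def by (auto simp: w_def)
  qed
  have A1: "A i 1 * u = A i 2 * v" "\<And>j. j \<notin> {1..2} \<Longrightarrow> A i j = 0" if "i \<in> {1..2}" for i
  proof -
    have "A i \<in> Omega 2 \<alpha>" using A that m unfolding lattice_basis_def m_def by auto
    then have "Defs.scalar_prod 2 (A i) w = 0" "A i \<in> int_vecs 2" using w unfolding Omega_def perp_def by auto
    then show "A i 1 * u = A i 2 * v" "\<And>j. j \<notin> {1..2} \<Longrightarrow> A i j = 0"
      unfolding Defs.scalar_prod_def s2 int_vecs_def by (auto simp: w_def)
  qed
  have indep: "c = (\<lambda>_. 0)" if "c \<in> int_vecs m" "int_comb m A c = (\<lambda>_. 0)" for c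
    using A that unfolding lattice_basis_def m_def by blast
  have comb2: "int_comb m A c = (\<lambda>j. c 1 * A 1 j + c 2 * A 2 j)" if "\<And>i. i \<notin> {1..2} \<Longrightarrow> c i = 0" for c
  proof
    fix j
    have "(\<Sum>i=1..m. c i * A i j) = (\<Sum>i=1..2. c i * A i j)"
      using m that by (intro sum.mono_neutral_right) auto
    then show "int_comb m A c j = c 1 * A 1 j + c 2 * A 2 j" unfolding int_comb_def s2 .
  qed
  \<comment> \<open>This combination kills the first coordinate and then, as v is nonzero, the
    second. Independence forces A 1 1 = 0, hence A 1 = 0, which contradicts independence once
    more.\<close>
  define c where "c = (\<lambda>i::nat. if i = 1 then A 2 1 else if i = 2 then - A 1 1 else (0::int))"
  have ci: "c i = 0" if "i \<notin> {1..2}" for i using that by (auto simp: c_def)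
  have "c 1 * A 1 j + c 2 * A 2 j = 0" for j
  proof (cases "j \<in> {1..2}")
    case True
    show ?thesis
    proof (cases "j = 1")
      case True
      then show ?thesis by (simp add: c_def)
    next
      case False
      then have j: "j = 2" using True by auto
      have "(c 1 * A 1 2 + c 2 * A 2 2) * v = A 2 1 * (A 1 2 * v) - A 1 1 * (A 2 2 * v)"
        by (simp add: c_def algebra_simps)
      also have "\<dots> = A 2 1 * (A 1 1 * u) - A 1 1 * (A 2 1 * u)" using A1(1)[of 1] A1(1)[of 2] by simp
      also have "\<dots> = 0" by simp
      finally show ?thesis using v j by simp
    qed
  next
    case False
    then show ?thesis using A1(2)[of 1 j] A1(2)[of 2 j] by simp
  qed
  then have "int_comb m A c = (\<lambda>_. 0)" using comb2[OF ci] by simp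
  moreover have "c \<in> int_vecs m" using ci m unfolding int_vecs_def by auto
  ultimately have "c = (\<lambda>_. 0)" using indep by blast
  then have "c 2 = 0" by simp
  then have "A 1 1 = 0" by (simp add: c_def)
  then have A0: "A 1 j = 0" for j
    using A1(1)[of 1] A1(2)[of 1 j] v by (cases "j = 1"; cases "j = 2") auto
  define c1 where "c1 = (\<lambda>i::nat. if i = 1 then 1 else (0::int))"
  have c1i: "c1 i = 0" if "i \<notin> {1..2}" for i using that by (auto simp: c1_def)
  have "int_comb m A c1 = (\<lambda>j. c1 1 * A 1 j + c1 2 * A 2 j)" by (rule comb2[OF c1i])
  also have "\<dots> = (\<lambda>_. 0)" by (simp only: A0) (simp add: c1_def)
  finally have "int_comb m A c1 = (\<lambda>_. 0)" .
  moreover have "c1 \<in> int_vecs m" using m unfolding int_vecs_def c1_def by auto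
  ultimately have "c1 = (\<lambda>_. 0)" using indep by blast
  then have "c1 1 = 0" by simp
  then show False by (simp add: c1_def)
qed

text \<open>The coefficients of a relation between two differences. Pairings run over {1..n} only
  and lose the entry at 0, which is harmless because \<alpha> and b vanish there.\<close>

definition pair_vec :: "int \<Rightarrow> nat \<Rightarrow> nat \<Rightarrow> int \<Rightarrow> nat \<Rightarrow> nat \<Rightarrow> nat \<Rightarrow> int" where
  "pair_vec u i j v k l x = u * (of_bool (x = i) - of_bool (x = j)) - v * (of_bool (x = k) - of_bool (x = l))"

lemma pair_vec_sum:
  fixes \<beta> :: "nat \<Rightarrow> 'a::comm_ring_1"
  assumes \<beta>: "\<beta> 0 = 0" and m: "i \<in> {0..n}" "j \<in> {0..n}" "k \<in> {0..n}" "l \<in> {0..n}"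
  shows "(\<Sum>x=1..n. of_int (pair_vec u i j v k l x) * \<beta> x) = of_int u * (\<beta> i - \<beta> j) - of_int v * (\<beta> k - \<beta> l)"
proof -
  have d: "(\<Sum>x\<in>{0..n}. of_bool (x = y) * \<beta> x) = \<beta> y" if "y \<in> {0..n}" for y
    using that by (simp add: of_bool_def if_distrib[where f = "\<lambda>c. c * _"] sum.delta cong: if_cong)
  have "(\<Sum>x=1..n. of_int (pair_vec u i j v k l x) * \<beta> x) = (\<Sum>x\<in>{0..n}. of_int (pair_vec u i j v k l x) * \<beta> x)"
    by (simp add: sum.atLeast_Suc_atMost \<beta>)
  also have "\<dots> = of_int u * ((\<Sum>x\<in>{0..n}. of_bool (x = i) * \<beta> x) - (\<Sum>x\<in>{0..n}. of_bool (x = j) * \<beta> x))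
      - of_int v * ((\<Sum>x\<in>{0..n}. of_bool (x = k) * \<beta> x) - (\<Sum>x\<in>{0..n}. of_bool (x = l) * \<beta> x))"
    unfolding sum_subtractf[symmetric] sum_distrib_left by (intro sum.cong refl) (simp add: pair_vec_def algebra_simps)
  also have "\<dots> = of_int u * (\<beta> i - \<beta> j) - of_int v * (\<beta> k - \<beta> l)" by (simp only: d m)
  finally show ?thesis .
qed

lemma pair_vec_norm: "(\<Sum>x=1..n. \<bar>pair_vec u i j v k l x\<bar>) \<le> 2 * (\<bar>u\<bar> + \<bar>v\<bar>)"
proof -
  have d: "(\<Sum>x=1..n. if x = y then c else 0) \<le> c" if "c \<ge> 0" for y :: nat and c :: int
    using that by (simp add: sum.delta)
  have "(\<Sum>x=1..n. \<bar>pair_vec u i j v k l x\<bar>) \<le> (\<Sum>x=1..n. (if x = i then \<bar>u\<bar> else 0) + (if x = j then \<bar>u\<bar> else 0)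
      + ((if x = k then \<bar>v\<bar> else 0) + (if x = l then \<bar>v\<bar> else 0)))"
    by (intro sum_mono) (auto simp: pair_vec_def)
  also have "\<dots> \<le> 2 * (\<bar>u\<bar> + \<bar>v\<bar>)"
    unfolding sum.distrib using d[of "\<bar>u\<bar>" i] d[of "\<bar>u\<bar>" j] d[of "\<bar>v\<bar>" k] d[of "\<bar>v\<bar>" l] by simp
  finally show ?thesis .
qed

section \<open>Exponents modulo p and the estimate with free parameters\<close>

lemma root_sum_phase: "root_sum n p a t = phase_sum n (line_phase a) (real t / real p)"
proof -
  have "exp (2 * complex_of_real pi * \<i> / of_nat p) powi k = cis (2 * pi * (of_int k / real p))" for k
  proof -
    have "exp (2 * complex_of_real pi * \<i> / of_nat p) = cis (2 * pi / real p)"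
      by (simp add: cis_conv_exp mult_ac)
    then show ?thesis by (simp add: cis_power_int mult_ac)
  qed
  then show ?thesis unfolding root_sum_def phase_sum_def line_phase_def by (simp add: mult_ac)
qed

text \<open>The multiples of p in the exponents contribute whole turns, so evaluating b at t amounts
  to evaluating a at q t.\<close>

lemma root_sum_multiple:
  assumes p: "p > 0" and b: "\<And>j. j \<in> {1..n} \<Longrightarrow> b j = int q * a j - int p * P j"
  shows "root_sum n p b t = root_sum n p a (q * t mod p)"
proof -
  have "cis (2 * pi * line_phase b j (real t / real p)) = cis (2 * pi * line_phase a j (real (q * t mod p) / real p))"
    if j: "j \<in> {1..n}" for j
  proof -
    define s where "s = int (q * t div p) * a j - int t * P j"
    have "real q * real t = real p * real (q * t div p) + real (q * t mod p)"
      unfolding of_nat_mult[symmetric] of_nat_add[symmetric] by simp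
    then have qt: "real q * real t / real p = real (q * t div p) + real (q * t mod p) / real p"
      using p by (simp add: add_divide_distrib)
    have "line_phase b j (real t / real p) = of_int (a j) * (real q * real t / real p) - of_int (P j) * real t"
      using p by (simp add: line_phase_def b[OF j] divide_simps) (simp add: algebra_simps)
    also have "\<dots> = line_phase a j (real (q * t mod p) / real p) + of_int s"
      unfolding qt by (simp add: line_phase_def s_def algebra_simps)
    finally have "line_phase b j (real t / real p) = line_phase a j (real (q * t mod p) / real p) + of_int s" .
    then have "cis (2 * pi * line_phase b j (real t / real p))
        = cis (2 * pi * line_phase a j (real (q * t mod p) / real p)) * cis (2 * pi * of_int s)"
      by (simp add: distrib_left flip: cis_mult)
    then show ?thesis by simp
  qed
  then show ?thesis unfolding root_sum_phase phase_sum_def by simp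
qed

lemma mult_mod_permutes_residues:
  fixes p q :: nat
  assumes p: "prime p" and q: "0 < q" "q < p"
  shows "inj_on (\<lambda>t. q * t mod p) {1..p - 1}" "(\<lambda>t. q * t mod p) ` {1..p - 1} = {1..p - 1}"
proof -
  have cop: "coprime q p" using p q by (metis coprime_commute nat_dvd_not_less prime_imp_coprime)
  show inj: "inj_on (\<lambda>t. q * t mod p) {1..p - 1}"
  proof (rule inj_onI)
    fix s t assume st: "s \<in> {1..p - 1}" "t \<in> {1..p - 1}" "q * s mod p = q * t mod p"
    have "[s = t] (mod p)" using st(3) cong_mult_lcancel_nat[OF cop, of s t] by (simp add: cong_def)
    moreover have "s < p" "t < p" using st(1,2) q by auto
    ultimately show "s = t" by (rule cong_less_modulus_unique_nat)
  qed
  have "q * t mod p \<in> {1..p - 1}" if "t \<in> {1..p - 1}" for t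
  proof -
    have "t < p" "0 < t" using that q by auto
    then have "\<not> p dvd t" by (simp add: nat_dvd_not_less)
    then have "\<not> p dvd q * t" using p q by (simp add: prime_dvd_mult_iff nat_dvd_not_less)
    then have "q * t mod p > 0" by (simp add: dvd_eq_mod_eq_0)
    moreover have "q * t mod p < p" using q by simp
    ultimately show ?thesis by simp
  qed
  then show "(\<lambda>t. q * t mod p) ` {1..p - 1} = {1..p - 1}" by (intro endo_inj_surj inj) auto
qed

text \<open>The parameters are left free: R is the weight up to which relations modulo p lift to
  \<alpha>, N1 the quality of the Dirichlet reduction of a, N2 controls the factors of small height,
  and N cuts the logarithmic series. The assumptions \<open>cong\<close> and \<open>small\<close>
  are all that is kept of the place, and \<open>line\<close> is the comparison with the torus, with
  error \<eta>.\<close>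

lemma exponential_sum_estimate:
  fixes \<alpha> :: "nat \<Rightarrow> 'k::field_char_0" and a :: "nat \<Rightarrow> int" and n p R N1 N2 N m1 :: nat
  assumes n: "n \<ge> 2" and rank: "lattice_rank (Omega n \<alpha>) \<ge> 2" and \<alpha>0: "\<alpha> 0 = 0" and inj: "inj_on \<alpha> {0..n}"
    and ratio: "\<forall>i\<in>{0..n}. \<forall>j\<in>{0..n}. \<forall>k\<in>{0..n}. \<forall>l\<in>{0..n}.
       distinct [i, j, k, l] \<longrightarrow> (\<alpha> i - \<alpha> j) / (\<alpha> k - \<alpha> l) \<notin> \<rat>"
    and p: "prime p" "p > n + 1"
    and cong: "\<And>w. (\<Sum>i=1..n. of_int (w i) * \<alpha> i) = 0 \<Longrightarrow> int p dvd (\<Sum>i=1..n. w i * a i)"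
    and small: "\<And>w. (\<Sum>i=1..n. \<bar>w i\<bar>) \<le> int R \<Longrightarrow> int p dvd (\<Sum>i=1..n. w i * a i) \<Longrightarrow>
       (\<Sum>i=1..n. of_int (w i) * \<alpha> i) = 0"
    and \<Lambda>: "lattice_basis m1 \<Lambda> (relation_lattice n \<alpha>)"
    and N1: "(\<Sum>i=1..m1. \<Sum>j=1..n. \<bar>\<Lambda> i j\<bar>) < int N1" "N1 ^ Suc n < p"
    and N2: "N2 \<ge> 1" "16 * N2 ^ Suc n \<le> R" and N: "N \<ge> 1" "2 * N \<le> R"
    and line: "\<And>b m A. b 0 = 0 \<Longrightarrow> inj_on b {0..n} \<Longrightarrow> \<forall>i\<in>{1..m}. A i \<in> int_vecs n \<Longrightarrow>
       \<forall>w. (\<Sum>j=1..n. \<bar>w j\<bar>) \<le> int (2 * N) \<longrightarrow>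
         (Defs.scalar_prod n w b = 0 \<longleftrightarrow> (\<forall>i\<in>{1..m}. Defs.scalar_prod n w (A i) = 0)) \<Longrightarrow>
       \<bar>(LINT x|unit_interval. ln (cmod (phase_sum n (line_phase b) x))) - log_mahler m (matrix_laurent_poly m n A)\<bar> \<le> \<eta>"
  shows "\<forall>t\<in>{1..p-1}. root_sum n p a t \<noteq> 0"
    "\<bar>1 / (real p - 1) * (\<Sum>t=1..p-1. ln (cmod (root_sum n p a t))) - lattice_mahler n (Omega n \<alpha>)\<bar>
      \<le> 32 * real n ^ 2 * ln (real n + 1) * 4 ^ Suc n / real N2 + 28 * ln (4 * (real n + 1) * real p) / real N1 + \<eta>"
proof -
  have p0: "p > 0" "p \<ge> 4" using p(2) n by auto
  have H0: "0 \<le> (\<Sum>i=1..m1. \<Sum>j=1..n. \<bar>\<Lambda> i j\<bar>)" by (intro sum_nonneg) simp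
  then have N1p: "N1 > 0" using N1(1) by simp
  obtain qi P where qi: "0 < qi" "qi \<le> int (N1 ^ Suc n)"
    "\<And>i. i < Suc n \<Longrightarrow> \<bar>of_int qi * (of_int (a i) / real p) - of_int (P i)\<bar> < 1 / N1"
    using Dirichlet_approx_simult[OF N1p, of "Suc n" "\<lambda>i. of_int (a i) / real p"] by blast
  define q where "q = nat qi"
  have q: "0 < q" "q < p" "int q = qi" using qi(1,2) N1(2) unfolding q_def by linarith+
  define b where "b = (\<lambda>j. if j \<in> {1..n} then int q * a j - int p * P j else 0)"
  have b0: "b 0 = 0" by (simp add: b_def)
  have bv: "b \<in> int_vecs n" by (simp add: b_def int_vecs_def)
  have b_le: "\<bar>real_of_int (b j)\<bar> \<le> real p / real N1" for j
  proof (cases "j \<in> {1..n}")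
    case True
    have "real_of_int (b j) = real p * (of_int qi * (of_int (a j) / real p) - of_int (P j))"
      using True p0 by (simp add: b_def q(3)[symmetric] right_diff_distrib)
    then have "\<bar>real_of_int (b j)\<bar> = real p * \<bar>of_int qi * (of_int (a j) / real p) - of_int (P j)\<bar>"
      by (simp add: abs_mult)
    also have "\<dots> \<le> real p * (1 / N1)" using qi(3)[of j] True by (intro mult_left_mono) auto
    finally show ?thesis by simp
  next
    case False
    then have "b j = 0" unfolding b_def by (rule if_not_P)
    then show ?thesis by simp
  qed
  have sb: "Defs.scalar_prod n w b = int q * (\<Sum>j=1..n. w j * a j) - int p * (\<Sum>j=1..n. w j * P j)" for w
    unfolding Defs.scalar_prod_def sum_distrib_left sum_subtractf[symmetric]
    by (intro sum.cong refl) (simp add: b_def algebra_simps)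
  have ndvd: "\<not> int p dvd int q" using q(1,2) by (simp add: nat_dvd_not_less)
  have dvd: "int p dvd Defs.scalar_prod n w b \<longleftrightarrow> int p dvd (\<Sum>j=1..n. w j * a j)" for w
  proof -
    have "int p dvd Defs.scalar_prod n w b \<longleftrightarrow> int p dvd int q * (\<Sum>j=1..n. w j * a j)"
      unfolding sb by (rule dvd_diff_left_iff) simp
    then show ?thesis using p(1) ndvd by (simp add: prime_dvd_mult_iff)
  qed
  have rel_small: "(\<Sum>i=1..n. of_int (w i) * \<alpha> i) = 0"
    if "(\<Sum>i=1..n. \<bar>w i\<bar>) \<le> int R" "Defs.scalar_prod n w b = 0" for w
    using small[OF that(1)] dvd[of w] that(2) by simp
  have comm: "Defs.scalar_prod n x y = Defs.scalar_prod n y x" for x y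
    unfolding Defs.scalar_prod_def by (simp add: mult.commute)
  \<comment> \<open>The pairing of b with each basis relation is divisible by p and, by the choice
    of N1, smaller than p in absolute value. So b lies in \<Omega> exactly, not just modulo
    p.\<close>
  have b\<Omega>: "b \<in> Omega n \<alpha>"
  proof -
    have "Defs.scalar_prod n b (\<Lambda> i) = 0" if i: "i \<in> {1..m1}" for i
    proof (rule ccontr)
      assume nz: "Defs.scalar_prod n b (\<Lambda> i) \<noteq> 0"
      have "\<Lambda> i \<in> relation_lattice n \<alpha>" using \<Lambda> i unfolding lattice_basis_def by blast
      then have "int p dvd (\<Sum>j=1..n. \<Lambda> i j * a j)" by (intro cong) (simp add: relation_lattice_def)
      then have "int p dvd Defs.scalar_prod n b (\<Lambda> i)" using dvd[of "\<Lambda> i"] comm by simp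
      then have "int p \<le> \<bar>Defs.scalar_prod n b (\<Lambda> i)\<bar>" using dvd_imp_le_int[OF nz, of "int p"] by simp
      then have "real p \<le> \<bar>real_of_int (Defs.scalar_prod n b (\<Lambda> i))\<bar>" by linarith
      also have "\<dots> \<le> (\<Sum>j=1..n. \<bar>real_of_int (b j) * real_of_int (\<Lambda> i j)\<bar>)"
        unfolding Defs.scalar_prod_def of_int_sum of_int_mult by (rule sum_abs)
      also have "\<dots> \<le> (\<Sum>j=1..n. real p / real N1 * real_of_int \<bar>\<Lambda> i j\<bar>)"
        unfolding abs_mult of_int_abs by (intro sum_mono mult_right_mono b_le) simp
      also have "\<dots> = real p / real N1 * real_of_int (\<Sum>j=1..n. \<bar>\<Lambda> i j\<bar>)" by (simp add: sum_distrib_left)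
      also have "\<dots> < real p / real N1 * real N1"
      proof (rule mult_strict_left_mono)
        have "(\<Sum>j=1..n. \<bar>\<Lambda> i j\<bar>) \<le> (\<Sum>i=1..m1. \<Sum>j=1..n. \<bar>\<Lambda> i j\<bar>)"
          using i by (intro member_le_sum[of i _ "\<lambda>i. \<Sum>j=1..n. \<bar>\<Lambda> i j\<bar>"]) (auto intro: sum_nonneg)
        then show "real_of_int (\<Sum>j=1..n. \<bar>\<Lambda> i j\<bar>) < real N1" using N1(1) by linarith
      qed (use p0 N1p in simp)
      finally show False using N1p by simp
    qed
    then have "Defs.scalar_prod n b l = 0" if "l \<in> relation_lattice n \<alpha>" for l
      using lattice_basis_orthogonal[OF \<Lambda> _ that, of n b] by blast
    then show ?thesis using bv unfolding Omega_def perp_def by blast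
  qed
  define m where "m = lattice_rank (Omega n \<alpha>)"
  obtain A where A: "lattice_basis m A (Omega n \<alpha>)"
    "lattice_mahler n (Omega n \<alpha>) = log_mahler m (matrix_laurent_poly m n A)"
    unfolding m_def by (rule lattice_mahler_basis[OF Omega_subgroup])
  have A\<Omega>: "A i \<in> Omega n \<alpha>" if "i \<in> {1..m}" for i using A(1) that unfolding lattice_basis_def by blast
  have equiv: "Defs.scalar_prod n w b = 0 \<longleftrightarrow> (\<forall>i\<in>{1..m}. Defs.scalar_prod n w (A i) = 0)"
    if w: "(\<Sum>j=1..n. \<bar>w j\<bar>) \<le> int (2 * N)" for w
  proof
    assume w0: "Defs.scalar_prod n w b = 0"
    have "(\<Sum>j=1..n. \<bar>w j\<bar>) \<le> int R" using w N(2) by linarith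
    then have rel: "(\<Sum>i=1..n. of_int (w i) * \<alpha> i) = 0" using rel_small w0 by blast
    define w' where "w' = (\<lambda>j. if j \<in> {1..n} then w j else 0)"
    have "(\<Sum>i=1..n. of_int (w' i) * \<alpha> i) = (\<Sum>i=1..n. of_int (w i) * \<alpha> i)"
      by (intro sum.cong refl) (simp add: w'_def)
    then have "w' \<in> relation_lattice n \<alpha>" unfolding relation_lattice_def int_vecs_def using rel by (simp add: w'_def)
    then have "Defs.scalar_prod n (A i) w' = 0" if "i \<in> {1..m}" for i
      using A\<Omega>[OF that] unfolding Omega_def perp_def by blast
    moreover have "Defs.scalar_prod n (A i) w' = Defs.scalar_prod n w (A i)" for i
      unfolding Defs.scalar_prod_def by (intro sum.cong refl) (simp add: w'_def)
    ultimately show "\<forall>i\<in>{1..m}. Defs.scalar_prod n w (A i) = 0" by simp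
  next
    assume "\<forall>i\<in>{1..m}. Defs.scalar_prod n w (A i) = 0"
    then show "Defs.scalar_prod n w b = 0" by (intro lattice_basis_orthogonal[OF A(1) _ b\<Omega>]) blast
  qed
  have quad: "of_int u * (\<alpha> i - \<alpha> j) = of_int v * (\<alpha> k - \<alpha> l)"
    if ijkl: "i \<in> {0..n}" "j \<in> {0..n}" "k \<in> {0..n}" "l \<in> {0..n}" and uv: "2 * (\<bar>u\<bar> + \<bar>v\<bar>) \<le> int R"
      and eq: "u * (b i - b j) = v * (b k - b l)" for u v i j k l
  proof -
    have "Defs.scalar_prod n (pair_vec u i j v k l) b = 0"
      using pair_vec_sum[where \<beta> = b and u = u and v = v, OF b0 ijkl] eq by (simp add: Defs.scalar_prod_def)
    moreover have "(\<Sum>x=1..n. \<bar>pair_vec u i j v k l x\<bar>) \<le> int R"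
      using pair_vec_norm uv by (rule order_trans)
    ultimately have "(\<Sum>x=1..n. of_int (pair_vec u i j v k l x) * \<alpha> x) = 0" by (intro rel_small)
    then show ?thesis using pair_vec_sum[where \<beta> = \<alpha> and u = u and v = v, OF \<alpha>0 ijkl] by simp
  qed
  have \<alpha>_ne: "\<alpha> i \<noteq> \<alpha> j" if "i \<in> {0..n}" "j \<in> {0..n}" "i \<noteq> j" for i j using inj that by (auto dest: inj_onD)
  have binj: "inj_on b {0..n}"
  proof (rule inj_onI, rule ccontr)
    fix i j assume ij: "i \<in> {0..n}" "j \<in> {0..n}" "b i = b j" "i \<noteq> j"
    have "of_int 1 * (\<alpha> i - \<alpha> j) = of_int 0 * (\<alpha> 0 - \<alpha> 0)" using ij N by (intro quad) auto
    then show False using \<alpha>_ne[OF ij(1,2,4)] by simp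
  qed
  define c where "c = Min (b ` {0..n})"
  define e where "e = (\<lambda>j. nat (b j - c))"
  define d where "d = Max (e ` {0..n})"
  have c_le: "c \<le> b j" if "j \<in> {0..n}" for j unfolding c_def using that by simp
  have e_int: "int (e j) = b j - c" if "j \<in> {0..n}" for j using c_le[OF that] by (simp add: e_def)
  \<comment> \<open>A relation between two differences with coefficients up to L has weight at most
    4 L <= R by \<open>pair_vec_norm\<close>, so it lifts from b to \<alpha>.\<close>
  define L where "L = 4 * N2 ^ Suc n"
  have L: "4 * L \<le> R" using N2(2) by (simp add: L_def)
  have LR: "2 * (\<bar>u\<bar> + \<bar>v\<bar>) \<le> int R" if "\<bar>u\<bar> \<le> int L" "\<bar>v\<bar> \<le> int L" for u v :: int
    using that of_nat_mono[OF L, where 'a = int] by simp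
  have dist: "u = 0 \<and> v = 0"
    if ijkl: "i \<in> {0..n}" "j \<in> {0..n}" "k \<in> {0..n}" "l \<in> {0..n}" "distinct [i, j, k, l]"
      and uv: "\<bar>u\<bar> \<le> int L" "\<bar>v\<bar> \<le> int L" and eq: "u * (int (e i) - int (e j)) = v * (int (e k) - int (e l))" for u v i j k l
  proof -
    have kl: "\<alpha> k - \<alpha> l \<noteq> 0" "\<alpha> i - \<alpha> j \<noteq> 0" using \<alpha>_ne ijkl by auto
    have q0: "of_int u * (\<alpha> i - \<alpha> j) = of_int v * (\<alpha> k - \<alpha> l)"
      using eq ijkl by (intro quad LR uv) (simp_all add: e_int)
    have "u = 0"
    proof (rule ccontr)
      assume u: "u \<noteq> 0"
      then have "(\<alpha> i - \<alpha> j) / (\<alpha> k - \<alpha> l) = of_int v / of_int u" using q0 kl by (simp add: field_simps)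
      also have "\<dots> \<in> \<rat>" by simp
      finally show False using ratio ijkl by blast
    qed
    then show ?thesis using q0 kl by simp
  qed
  interpret sparse_setup n d L e
  proof
    show "n \<ge> 2" by (rule n)
    show "inj_on e {0..n}"
    proof (rule inj_onI)
      fix i j assume "i \<in> {0..n}" "j \<in> {0..n}" "e i = e j"
      then have "b i = b j" using e_int[of i] e_int[of j] by simp
      then show "i = j" using binj \<open>i \<in> {0..n}\<close> \<open>j \<in> {0..n}\<close> by (auto dest: inj_onD)
    qed
    show "e j \<le> d" if "j \<in> {0..n}" for j unfolding d_def using that by simp
    have "d \<in> e ` {0..n}" unfolding d_def by (intro Max_in) auto
    then show "\<exists>j\<in>{0..n}. e j = d" by auto
    have "c \<in> b ` {0..n}" unfolding c_def by (intro Min_in) auto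
    then show "\<exists>j\<in>{0..n}. e j = 0" unfolding e_def by auto
    show "u = 0 \<and> v = 0"
      if "i \<in> {0..n}" "j \<in> {0..n}" "k \<in> {0..n}" "l \<in> {0..n}" "distinct [i, j, k, l]"
        "\<bar>u\<bar> \<le> int L" "\<bar>v\<bar> \<le> int L" "u * (int (e i) - int (e j)) = v * (int (e k) - int (e l))" for i j k l u v
      by (rule dist[OF that])
    show "\<exists>i\<in>{0..n}. \<exists>j\<in>{0..n}. \<exists>k\<in>{0..n}. \<exists>l\<in>{0..n}. i \<noteq> j \<and>
      (\<forall>u v. \<bar>u\<bar> \<le> int L \<longrightarrow> \<bar>v\<bar> \<le> int L \<longrightarrow>
        u * (int (e i) - int (e j)) = v * (int (e k) - int (e l)) \<longrightarrow> u = 0 \<and> v = 0)"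
    \<comment> \<open>The witness for \<open>rel2\<close>: two differences sharing the index 0 if n
      = 2, two differences of distinct indices otherwise.\<close>
    proof (cases "n = 2")
      case True
      have nz: "\<alpha> 1 \<noteq> 0" "\<alpha> 2 \<noteq> 0" using \<alpha>_ne[of 1 0] \<alpha>_ne[of 2 0] n \<alpha>0 by auto
      have "u = 0 \<and> v = 0" if uv: "\<bar>u\<bar> \<le> int L" "\<bar>v\<bar> \<le> int L"
        and eq: "u * (int (e 1) - int (e 0)) = v * (int (e 2) - int (e 0))" for u v
      proof -
        have "of_int u * (\<alpha> 1 - \<alpha> 0) = of_int v * (\<alpha> 2 - \<alpha> 0)"
          using eq n by (intro quad LR uv) (simp_all add: e_int)
        then show ?thesis using rank_two_irrational[of \<alpha> u v] rank nz \<alpha>0 True by simp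
      qed
      then have wit: "1 \<noteq> (0::nat) \<and> (\<forall>u v. \<bar>u\<bar> \<le> int L \<longrightarrow> \<bar>v\<bar> \<le> int L \<longrightarrow>
          u * (int (e 1) - int (e 0)) = v * (int (e 2) - int (e 0)) \<longrightarrow> u = 0 \<and> v = 0)"
        by (intro conjI[OF one_neq_zero] allI impI)
      show ?thesis
        by (rule bexI[of _ 1], rule bexI[of _ 0], rule bexI[of _ 2], rule bexI[of _ 0], rule wit) (use n in simp_all)
    next
      case False
      then have "n \<ge> 3" using n by simp
      then have mem: "0 \<in> {0..n}" "1 \<in> {0..n}" "2 \<in> {0..n}" "3 \<in> {0..n}" "distinct [0, 1, 2, 3::nat]" by auto
      have wit: "0 \<noteq> (1::nat) \<and> (\<forall>u v. \<bar>u\<bar> \<le> int L \<longrightarrow> \<bar>v\<bar> \<le> int L \<longrightarrow>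
          u * (int (e 0) - int (e 1)) = v * (int (e 2) - int (e 3)) \<longrightarrow> u = 0 \<and> v = 0)"
        by (intro conjI[OF zero_neq_one] allI impI dist[OF mem])
      show ?thesis
        by (rule bexI[of _ 0], rule bexI[of _ 1], rule bexI[of _ 2], rule bexI[of _ 3], rule wit) (use mem in simp_all)
    qed
  qed
  have Qeq: "cmod (phase_sum n (line_phase b) x) = cmod (poly (cpoly Q) (circle_pt x))" for x
  proof -
    have "cmod (phase_sum n (line_phase b) x) = cmod (poly (\<Sum>j\<in>{0..n}. monom 1 (nat (b j - c))) (circle_pt x))"
      by (rule phase_sum_line[of b n c x, OF b0 c_le])
    also have "\<dots> = cmod (\<Sum>j\<in>{0..n}. circle_pt x ^ e j)" by (simp add: poly_sum poly_monom e_def)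
    finally show ?thesis unfolding poly_Q .
  qed
  have Qroot: "cmod (root_sum n p b t) = cmod (poly (cpoly Q) (circle_pt (real t / real p)))" for t
    unfolding root_sum_phase by (rule Qeq)
  have perm: "root_sum n p b t = root_sum n p a (q * t mod p)" for t
    by (rule root_sum_multiple[OF p0(1), where P = P]) (simp add: b_def)
  note res = mult_mod_permutes_residues[OF p(1) q(1,2)]
  show nz: "\<forall>t\<in>{1..p-1}. root_sum n p a t \<noteq> 0"
  proof
    fix t assume "t \<in> {1..p-1}"
    then obtain s where "t = q * s mod p" using res(2) by blast
    then have "cmod (root_sum n p a t) = cmod (poly (cpoly Q) (circle_pt (real s / real p)))" using perm Qroot by simp
    then show "root_sum n p a t \<noteq> 0" using root_of_unity_sum(1)[OF p] by auto
  qed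
  define S where "S = (\<Sum>t<p. ln (cmod (poly (cpoly Q) (circle_pt (real t / real p)))))"
  define J where "J = (LINT x|unit_interval. ln (cmod (poly (cpoly Q) (circle_pt x))))"
  define S' where "S' = (\<Sum>t=1..p-1. ln (cmod (root_sum n p a t)))"
  define \<mu> where "\<mu> = lattice_mahler n (Omega n \<alpha>)"
  have "S' = (\<Sum>t\<in>(\<lambda>t. q * t mod p) ` {1..p-1}. ln (cmod (root_sum n p a t)))" unfolding S'_def res(2) ..
  also have "\<dots> = (\<Sum>t=1..p-1. ln (cmod (poly (cpoly Q) (circle_pt (real t / real p)))))"
    unfolding sum.reindex[OF res(1)] by (simp add: perm[symmetric] Qroot)
  finally have S'Q: "S' = (\<Sum>t=1..p-1. ln (cmod (poly (cpoly Q) (circle_pt (real t / real p)))))" .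
  \<comment> \<open>The term at t = 0 is ln (n + 1); it belongs to the sum over all p-th roots of
    unity but not to the sum being estimated.\<close>
  have "{..<p} = insert 0 {1..p-1}" using p0 by auto
  then have "S = ln (cmod (poly (cpoly Q) (circle_pt (real 0 / real p)))) + S'" unfolding S_def S'Q by simp
  moreover have "cmod (poly (cpoly Q) (circle_pt (real 0 / real p))) = real n + 1"
  proof -
    have "root_sum n p b 0 = of_nat (Suc n)" by (simp add: root_sum_def)
    then have "cmod (root_sum n p b 0) = real (Suc n)" by (simp only: norm_of_nat)
    then show ?thesis using Qroot[of 0] by simp
  qed
  ultimately have S: "S = ln (real n + 1) + S'" by simp
  have lc: "lead_coeff (cpoly Q) = 1" using lead_Q by simp
  have J: "J = log_house Q" unfolding J_def log_house_def by (rule jensen(2)[OF lc])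
  have J_le: "J \<le> ln (real n + 1)" unfolding J by (rule log_house_Q)
  have J_ge: "0 \<le> J" unfolding J by (rule log_house_nonneg)
  have "\<forall>i\<in>{1..m}. A i \<in> int_vecs n" using A\<Omega> Omega_subgroup(1)[of n \<alpha>] by blast
  then have J\<mu>: "\<bar>J - \<mu>\<bar> \<le> \<eta>" using line[OF b0 binj, of m A] equiv unfolding J_def \<mu>_def A(2) Qeq by blast
  define G where "G = pair_constant / real N2"
  define U where "U = ln (4 * (real n + 1) * real p)"
  \<comment> \<open>This is where the reduction of a to b pays: terms of order d ln d become terms
    of order p ln p / N1.\<close>
  have d_le: "real d \<le> 2 * (real p / real N1)"
  proof -
    obtain j where j: "j \<in> {0..n}" "e j = d" using e_max by blast
    have "c \<in> b ` {0..n}" unfolding c_def by (intro Min_in) auto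
    then obtain i where i: "c = b i" by blast
    have "real d = real_of_int (b j - b i)" using e_int[OF j(1)] j(2) i by (metis of_int_of_nat_eq)
    then show ?thesis using b_le[of j] b_le[of i] by simp
  qed
  have dp: "real d \<le> 2 * real p"
  proof -
    have "real p / real N1 \<le> real p / 1" using N1p by (intro divide_left_mono) auto
    then show ?thesis using d_le by linarith
  qed
  have d1: "real d \<ge> 1" using d_pos by linarith
  have "0 < 2 * ((real n + 1) * real d)" using d1 by (simp add: zero_less_mult_iff)
  moreover have "2 * ((real n + 1) * real d) \<le> 4 * (real n + 1) * real p"
    using mult_left_mono[OF dp, of "2 * (real n + 1)"] by (simp add: algebra_simps)
  ultimately have T: "ln (2 * ((real n + 1) * real d)) \<le> U" unfolding U_def by (intro ln_mono) auto
  have lnU: "ln (real n + 1) \<le> U"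
  proof -
    have "1 * (real n + 1) \<le> (4 * real p) * (real n + 1)" using p0 by (intro mult_right_mono) auto
    then show ?thesis unfolding U_def by (intro ln_mono) (auto simp: mult_ac)
  qed
  have ln0: "0 \<le> ln (real n + 1)" by simp
  have "\<bar>S - real p * J\<bar> \<le> pair_constant * real p / real N2 + real d * ln (2 * ((real n + 1) * real d)) + (2 * real d + 2) * ln (real n + 1)"
    unfolding S_def J_def by (rule root_of_unity_average[OF p N2(1)]) (simp add: L_def)
  also have "\<dots> \<le> real p * G + real d * U + (2 * real d + 2) * U"
    using T lnU d1 by (intro add_mono mult_left_mono) (simp_all add: G_def mult.commute)
  finally have E: "\<bar>S - real p * J\<bar> \<le> real p * G + real d * U + (2 * real d + 2) * U" .
  have U0: "0 \<le> U" using ln0 lnU by linarith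
  have "2 * U \<le> 2 * (real d * U)" using mult_right_mono[OF d1 U0] by simp
  \<comment> \<open>The 7 collects all multiples of d U, including the term at t = 0. With d <= 2 p
    / N1 and p <= 2 (p - 1) it becomes 28 = 7 * 2 * 2.\<close>
  then have "\<bar>S' - (real p - 1) * J\<bar> \<le> real p * G + 7 * (real d * U)"
    using E S J_le J_ge lnU by (simp add: algebra_simps abs_le_iff)
  also have "\<dots> \<le> real p * G + 7 * (2 * (real p / real N1) * U)"
    using mult_right_mono[OF d_le U0] by simp
  also have "\<dots> = real p * (G + 14 * U / real N1)" by (simp add: field_simps)
  finally have E': "\<bar>S' - (real p - 1) * J\<bar> \<le> real p * (G + 14 * U / real N1)" .
  have GU: "0 \<le> G + 14 * U / real N1" using U0 by (simp add: G_def pair_constant_def)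
  have p2: "real p \<le> 2 * (real p - 1)" "real p - 1 > 0" using p0 by auto
  have "real p * (G + 14 * U / real N1) \<le> (2 * (real p - 1)) * (G + 14 * U / real N1)"
    using p2 GU by (intro mult_right_mono)
  also have "\<dots> = (real p - 1) * (2 * (G + 14 * U / real N1))" by (simp only: mult_ac)
  finally have E'': "\<bar>S' - (real p - 1) * J\<bar> \<le> (real p - 1) * (2 * (G + 14 * U / real N1))" by (rule order_trans[OF E'])
  have "S' / (real p - 1) - J = (S' - (real p - 1) * J) / (real p - 1)" using p2 by (simp add: field_simps)
  then have "\<bar>S' / (real p - 1) - J\<bar> = \<bar>S' - (real p - 1) * J\<bar> / (real p - 1)" using p2 by simp
  also have "\<dots> \<le> 2 * (G + 14 * U / real N1)" using E'' p2(2) by (simp add: pos_divide_le_eq mult.commute)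
  finally have "\<bar>S' / (real p - 1) - \<mu>\<bar> \<le> 2 * (G + 14 * U / real N1) + \<eta>" using J\<mu> by linarith
  also have "2 * (G + 14 * U / real N1) = 32 * real n ^ 2 * ln (real n + 1) * 4 ^ Suc n / real N2 + 28 * U / real N1"
    by (simp add: G_def pair_constant_def)
  finally show "\<bar>1 / (real p - 1) * (\<Sum>t=1..p-1. ln (cmod (root_sum n p a t))) - lattice_mahler n (Omega n \<alpha>)\<bar>
      \<le> 32 * real n ^ 2 * ln (real n + 1) * 4 ^ Suc n / real N2 + 28 * ln (4 * (real n + 1) * real p) / real N1 + \<eta>"
    unfolding S'_def[symmetric] \<mu>_def[symmetric] U_def[symmetric] by simp
qed

section \<open>Choice of the parameters and the final bound\<close>

lemma root_powr_power: "y \<ge> 0 \<Longrightarrow> k > 0 \<Longrightarrow> (y powr (1 / real k)) ^ k = y"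
  by (cases "y = 0") (simp_all add: powr_powr flip: powr_realpow)

lemma powr_ge_threshold:
  fixes x B q :: real
  assumes "B > 0" "q > 0" "x \<ge> B powr (1 / q)"
  shows "x powr q \<ge> B"
proof -
  have "B = (B powr (1 / q)) powr q" using assms by (simp add: powr_powr)
  also have "\<dots> \<le> x powr q" using assms by (intro powr_mono2) auto
  finally show ?thesis .
qed

lemma nat_floor_bounds:
  fixes y :: real
  assumes "y \<ge> 1"
  shows "real (nat \<lfloor>y\<rfloor>) \<le> y" "y / 2 \<le> real (nat \<lfloor>y\<rfloor>)" "1 \<le> nat \<lfloor>y\<rfloor>"
proof -
  have f: "1 \<le> \<lfloor>y\<rfloor>" using assms by simp
  then have "1 \<le> nat \<lfloor>y\<rfloor>" by linarith
  moreover have "real (nat \<lfloor>y\<rfloor>) = of_int \<lfloor>y\<rfloor>" "1 \<le> real_of_int \<lfloor>y\<rfloor>" using f by simp_all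
  moreover have "y < of_int \<lfloor>y\<rfloor> + 1" "of_int \<lfloor>y\<rfloor> \<le> y" by linarith+
  ultimately show "real (nat \<lfloor>y\<rfloor>) \<le> y" "y / 2 \<le> real (nat \<lfloor>y\<rfloor>)" "1 \<le> nat \<lfloor>y\<rfloor>" by linarith+
qed

text \<open>Up to constants, R is p^(1/D), N1 is p^(1/(n+1)), N2 is R^(1/(n+1)) and N is R / 2. The
  term with N decays with exponent exactly 1/(4 n D); the other exponents, 1/(D (n+1)) and, after
  absorbing the logarithm, 1/(4 n), are at least as large.\<close>

lemma parameter_choice:
  fixes n D :: nat and C0 A1 A3 :: real and H :: int
  assumes n: "n \<ge> 2" and D: "D > 0" and C0: "C0 > 0" and A: "A1 \<ge> 0" "A3 \<ge> 0"
  obtains C :: real and p0 :: nat where "C \<ge> 0"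
    "\<And>p. p \<ge> p0 \<Longrightarrow> p > n + 1 \<and> (\<exists>R N1 N2 N :: nat. C0 * real R ^ D < real p \<and> H < int N1 \<and> N1 ^ Suc n < p \<and>
       N2 \<ge> 1 \<and> 16 * N2 ^ Suc n \<le> R \<and> N \<ge> 1 \<and> 2 * N \<le> R \<and>
       A1 / real N2 + 28 * ln (4 * (real n + 1) * real p) / real N1 + A3 * real N powr (- (1 / (4 * real n)))
         \<le> C * real p powr (- (1 / (4 * real n * real D))))"
proof -
  define \<delta> where "\<delta> = 1 / (4 * real n * real D)"
  define \<rho> where "\<rho> = 1 / real D"
  define \<sigma> where "\<sigma> = 1 / (real n + 1)"
  \<comment> \<open>The surplus of 1/(n+1) over 1/(4 n), positive since 4 n > n + 1; its power of p
    absorbs the logarithm in the second error term.\<close>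
  define g where "g = \<sigma> - 1 / (4 * real n)"
  define r0 where "r0 = (1 / (2 * C0)) powr \<rho> / 2"
  define h where "h = real_of_int \<bar>H\<bar>"
  have h: "0 \<le> h" "real_of_int H \<le> h" by (simp_all add: h_def)
  define B1 where "B1 = 4 * (h + 1)"
  have n0: "real n \<ge> 2" using n by simp
  have D0: "real D \<ge> 1" using D by simp
  have pos: "\<delta> > 0" "\<rho> > 0" "\<sigma> > 0" "r0 > 0" using n0 D0 C0 by (simp_all add: \<delta>_def \<rho>_def \<sigma>_def r0_def)
  have g: "g > 0"
  proof -
    have "1 / (4 * real n) < 1 / (real n + 1)" using n0 by (intro divide_strict_left_mono) auto
    then show ?thesis by (simp add: g_def \<sigma>_def)
  qed
  have \<delta>\<rho>: "\<rho> * \<sigma> \<ge> \<delta>" "\<rho> * (1 / (4 * real n)) = \<delta>" "1 / (4 * real n) \<ge> \<delta>"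
  proof -
    have "1 / (4 * real n * real D) \<le> 1 / (real D * (real n + 1))"
      using n0 D0 by (intro divide_left_mono) (auto simp: mult.commute intro!: mult_right_mono)
    then show "\<rho> * \<sigma> \<ge> \<delta>" by (simp add: \<delta>_def \<rho>_def \<sigma>_def)
    show "\<rho> * (1 / (4 * real n)) = \<delta>" by (simp add: \<delta>_def \<rho>_def)
    have "1 / (4 * real n * real D) \<le> 1 / (4 * real n * 1)"
      using n0 D0 by (intro divide_left_mono mult_left_mono) auto
    then show "1 / (4 * real n) \<ge> \<delta>" by (simp add: \<delta>_def)
  qed
  define k1 where "k1 = A1 * (2 * (r0 / 16) powr (- \<sigma>))"
  define k2 where "k2 = 112 * ((4 * (real n + 1)) powr g / g)"
  define k3 where "k3 = A3 * (r0 / 4) powr (- (1 / (4 * real n)))"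
  have k: "k1 \<ge> 0" "k2 \<ge> 0" "k3 \<ge> 0" using A g by (simp_all add: k1_def k2_def k3_def)
  define T where "T = real n + 3 + B1 powr (1 / \<sigma>) + (16 / r0) powr (1 / \<rho>)"
  show ?thesis
  proof (rule that[of "k1 + k2 + k3" "nat \<lceil>T\<rceil>"])
    show "0 \<le> k1 + k2 + k3" using k by simp
    fix p assume "nat \<lceil>T\<rceil> \<le> p"
    then have pT: "real p \<ge> T" by linarith
    have T: "T \<ge> real n + 3" "T \<ge> B1 powr (1 / \<sigma>)" "T \<ge> (16 / r0) powr (1 / \<rho>)" by (simp_all add: T_def)
    define X where "X = real p"
    have X: "X > real n + 2" "X \<ge> 1" using pT T unfolding X_def by linarith+
    have B1: "X powr \<sigma> \<ge> B1" using pT T pos by (intro powr_ge_threshold) (auto simp: X_def B1_def add_nonneg_pos h)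
    have RX: "X powr \<rho> \<ge> 16 / r0" using pT T pos by (intro powr_ge_threshold) (auto simp: X_def)
    \<comment> \<open>The 2 in the denominator leaves C0 R^D at most p / 2, hence strictly below
      p.\<close>
    define y where "y = (X / (2 * C0)) powr \<rho>"
    have y: "y = 2 * r0 * X powr \<rho>" using powr_mult[of "1 / (2 * C0)" X \<rho>] by (simp add: y_def r0_def)
    have r0X: "r0 * X powr \<rho> \<ge> 16" using RX pos by (simp add: divide_le_eq mult.commute)
    define R where "R = nat \<lfloor>y\<rfloor>"
    have R: "real R \<le> y" "r0 * X powr \<rho> \<le> real R" "real R \<ge> 16"
      using nat_floor_bounds[of y] r0X y unfolding R_def by linarith+
    define N1 where "N1 = nat \<lfloor>X powr \<sigma> / 2\<rfloor>"
    have "X powr \<sigma> / 2 \<ge> 1" using B1 h unfolding B1_def by simp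
    note N1 = nat_floor_bounds[OF this, folded N1_def]
    define z where "z = (real R / 16) powr \<sigma>"
    define N2 where "N2 = nat \<lfloor>z\<rfloor>"
    have "z \<ge> 1" using R pos unfolding z_def by (intro ge_one_powr_ge_zero) auto
    note N2 = nat_floor_bounds[OF this, folded N2_def]
    define N where "N = R div 2"
    have N: "N \<ge> 1" "2 * N \<le> R" "real N \<ge> real R / 4" using R unfolding N_def by linarith+
    have c1: "C0 * real R ^ D < real p"
    proof -
      have "real R ^ D \<le> y ^ D" using R by (intro power_mono) auto
      also have "\<dots> = X / (2 * C0)" unfolding y_def \<rho>_def using X C0 D by (intro root_powr_power) auto
      finally have "C0 * real R ^ D \<le> C0 * (X / (2 * C0))" using C0 by (intro mult_left_mono) auto
      also have "\<dots> = X / 2" using C0 by simp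
      finally show ?thesis using X by (simp add: X_def)
    qed
    have sig: "(x powr \<sigma>) ^ Suc n = x" if "x \<ge> 0" for x
      using root_powr_power[of x "Suc n"] that by (simp add: \<sigma>_def add.commute)
    have c2: "N1 ^ Suc n < p"
    proof -
      have "real N1 ^ Suc n \<le> (X powr \<sigma> / 2) ^ Suc n" using N1 by (intro power_mono) auto
      also have "\<dots> = X / 2 ^ Suc n" using sig[of X] X by (simp add: power_divide)
      also have "\<dots> < X / 1" using X one_less_power[of "2::real" "Suc n"] by (intro divide_strict_left_mono) auto
      finally have "real (N1 ^ Suc n) < real p" by (simp add: X_def)
      then show ?thesis by (simp only: of_nat_less_iff)
    qed
    have c3: "16 * N2 ^ Suc n \<le> R"
    proof -
      have "real N2 ^ Suc n \<le> z ^ Suc n" using N2 by (intro power_mono) auto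
      also have "\<dots> = real R / 16" unfolding z_def by (rule sig) simp
      finally have "real (16 * N2 ^ Suc n) \<le> real R" by simp
      then show ?thesis by (simp only: of_nat_le_iff)
    qed
    have "h + 1 \<le> X powr \<sigma> / 4" using B1 unfolding B1_def by simp
    then have "real_of_int H < real N1" using N1(2) h by linarith
    then have c4: "H < int N1" by linarith
    have X\<delta>: "X powr (- q) \<le> X powr (- \<delta>)" if "q \<ge> \<delta>" for q using that X by (intro powr_mono) auto
    have t1: "A1 / real N2 \<le> k1 * X powr (- \<delta>)"
    proof -
      have "(r0 / 16) powr \<sigma> * X powr (\<rho> * \<sigma>) = (r0 * X powr \<rho> / 16) powr \<sigma>"
        using powr_mult[of "r0 / 16" "X powr \<rho>" \<sigma>] by (simp add: powr_powr)
      also have "\<dots> \<le> z" unfolding z_def using R pos by (intro powr_mono2) auto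
      finally have z_ge: "(r0 / 16) powr \<sigma> * X powr (\<rho> * \<sigma>) / 2 \<le> real N2" using N2(2) by linarith
      have "A1 / real N2 \<le> A1 / ((r0 / 16) powr \<sigma> * X powr (\<rho> * \<sigma>) / 2)"
        using z_ge A pos X N2 by (intro divide_left_mono) auto
      also have "\<dots> = k1 * X powr (- (\<rho> * \<sigma>))"
      proof -
        have "A1 / (u * w / 2) = A1 * (2 * inverse u) * inverse w" for u w :: real
          by (cases "u = 0"; cases "w = 0") (simp_all add: field_simps)
        then show ?thesis unfolding k1_def powr_minus .
      qed
      also have "\<dots> \<le> k1 * X powr (- \<delta>)" by (intro mult_left_mono X\<delta> \<delta>\<rho> k)
      finally show ?thesis .
    qed
    have t2: "28 * ln (4 * (real n + 1) * X) / real N1 \<le> k2 * X powr (- \<delta>)"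
    proof -
      have "1 \<le> 4 * (real n + 1) * X" using mult_mono[of 1 "4 * (real n + 1)" 1 X] X by simp
      then have "ln (4 * (real n + 1) * X) \<le> (4 * (real n + 1) * X) powr g / g" "0 \<le> ln (4 * (real n + 1) * X)"
        using ln_powr_bound g by auto
      moreover have "(4 * (real n + 1) * X) powr g = (4 * (real n + 1)) powr g * X powr g"
        by (rule powr_mult)
      ultimately have l: "28 * ln (4 * (real n + 1) * X) \<le> k2 / 4 * X powr g" "0 \<le> 28 * ln (4 * (real n + 1) * X)"
        by (simp_all add: k2_def)
      have "X powr \<sigma> / 4 \<le> real N1" using N1(2) by simp
      then have "28 * ln (4 * (real n + 1) * X) / real N1 \<le> k2 / 4 * X powr g / (X powr \<sigma> / 4)"
        using l X k by (intro frac_le) auto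
      also have "\<dots> = k2 * X powr (g - \<sigma>)" by (simp add: powr_diff)
      also have "g - \<sigma> = - (1 / (4 * real n))" by (simp add: g_def)
      also have "k2 * X powr (- (1 / (4 * real n))) \<le> k2 * X powr (- \<delta>)" by (intro mult_left_mono X\<delta> \<delta>\<rho> k)
      finally show ?thesis .
    qed
    have t3: "A3 * real N powr (- (1 / (4 * real n))) \<le> k3 * X powr (- \<delta>)"
    proof -
      have "real N powr (- (1 / (4 * real n))) \<le> (r0 / 4 * X powr \<rho>) powr (- (1 / (4 * real n)))"
        using N(3) R(2) pos X by (intro powr_mono2') auto
      also have "\<dots> = (r0 / 4) powr (- (1 / (4 * real n))) * X powr (- (\<rho> * (1 / (4 * real n))))"
        unfolding powr_mult powr_powr by simp
      also have "\<rho> * (1 / (4 * real n)) = \<delta>" by (rule \<delta>\<rho>)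
      finally have "A3 * real N powr (- (1 / (4 * real n))) \<le> A3 * ((r0 / 4) powr (- (1 / (4 * real n))) * X powr (- \<delta>))"
        by (rule mult_left_mono) (rule A)
      then show ?thesis by (simp add: k3_def mult.assoc)
    qed
    have "A1 / real N2 + 28 * ln (4 * (real n + 1) * X) / real N1 + A3 * real N powr (- (1 / (4 * real n)))
         \<le> (k1 + k2 + k3) * X powr (- \<delta>)"
      using add_mono[OF add_mono[OF t1 t2] t3] by (simp only: distrib_right)
    moreover have "p > n + 1" using X unfolding X_def by linarith
    ultimately show "p > n + 1 \<and> (\<exists>R N1 N2 N :: nat. C0 * real R ^ D < real p \<and> H < int N1 \<and> N1 ^ Suc n < p \<and>
       N2 \<ge> 1 \<and> 16 * N2 ^ Suc n \<le> R \<and> N \<ge> 1 \<and> 2 * N \<le> R \<and>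
       A1 / real N2 + 28 * ln (4 * (real n + 1) * real p) / real N1 + A3 * real N powr (- (1 / (4 * real n)))
         \<le> (k1 + k2 + k3) * real p powr (- (1 / (4 * real n * real D))))"
      using c1 c2 c3 c4 N(1,2) N2(3) unfolding X_def \<delta>_def by blast
  qed
qed

text \<open>C and p0 are chosen before K, p, v and a: this is how the dependence on the \<alpha> i
  and \<epsilon> alone is expressed.\<close>

theorem theorem9p1:
  fixes n :: nat and \<alpha> :: "nat \<Rightarrow> 'k::field_char_0" and \<epsilon> :: real
  assumes "n \<ge> 2"
    and "\<epsilon> > 0"
    and "lattice_rank (Omega n \<alpha>) \<ge> 2"
    and "\<alpha> 0 = 0"
    and "inj_on \<alpha> {0..n}"
    and "\<forall>i\<in>{0..n}. \<forall>j\<in>{0..n}. \<forall>k\<in>{0..n}. \<forall>l\<in>{0..n}.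
           distinct [i, j, k, l] \<longrightarrow> (\<alpha> i - \<alpha> j) / (\<alpha> k - \<alpha> l) \<notin> \<rat>"
  shows "\<exists>(C::real) (p0::nat).
           \<forall>(K::'k set) (p::nat) (v::'k \<Rightarrow> real) (a::nat \<Rightarrow> int).
             number_field K \<longrightarrow> (\<forall>i\<in>{1..n}. \<alpha> i \<in> K) \<longrightarrow>
             prime p \<longrightarrow> p \<ge> p0 \<longrightarrow> place_above p K v \<longrightarrow>
             (\<forall>i\<in>{1..n}. v (of_int (a i) - \<alpha> i) < 1) \<longrightarrow>
               (\<forall>t\<in>{1..p-1}. root_sum n p a t \<noteq> 0) \<and>
               \<bar>1 / (real p - 1) * (\<Sum>t=1..p-1. ln (cmod (root_sum n p a t)))
                  - lattice_mahler n (Omega n \<alpha>)\<bar>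
                 \<le> C * real p powr
                     (- 1 / (4 * real n * real (field_degree K) * real (ramification_index K v)) + \<epsilon>)"
proof (cases "\<exists>K0. number_field K0 \<and> (\<forall>i\<in>{1..n}. \<alpha> i \<in> K0)")
  \<comment> \<open>No number field contains all the \<alpha> i, so no K satisfies the
    premises.\<close>
  case False
  then show ?thesis by blast
next
  case True
  then obtain K0 where K0: "number_field K0" "\<forall>i\<in>{1..n}. \<alpha> i \<in> K0" by blast
  obtain D C0 where D: "D > 0" "C0 > 0"
    "\<And>K. number_field K \<Longrightarrow> \<forall>i\<in>{1..n}. \<alpha> i \<in> K \<Longrightarrow> D \<le> field_degree K"
    and bound: "\<And>K p v a w. number_field K \<Longrightarrow> \<forall>i\<in>{1..n}. \<alpha> i \<in> K \<Longrightarrow> prime p \<Longrightarrow> place_above p K v \<Longrightarrow>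
       \<forall>i\<in>{1..n}. v (of_int (a i) - \<alpha> i) < 1 \<Longrightarrow> int p dvd (\<Sum>i=1..n. w i * a i) \<Longrightarrow>
       (\<Sum>i=1..n. of_int (w i) * \<alpha> i) \<noteq> 0 \<Longrightarrow> real p \<le> C0 * real_of_int (\<Sum>i=1..n. \<bar>w i\<bar>) ^ D"
    by (rule congruence_bound[OF K0], rule that) (assumption | blast)+
  obtain m1 \<Lambda> where \<Lambda>: "lattice_basis m1 \<Lambda> (relation_lattice n \<alpha>)"
    using lattice_basis_exists[OF relation_lattice_subgroup] by blast
  have n1: "n \<ge> 1" using assms(1) by simp
  obtain A3 where A3: "A3 > 0"
    and line: "\<And>b m A N. b 0 = 0 \<Longrightarrow> inj_on b {0..n} \<Longrightarrow> \<forall>i\<in>{1..m}. A i \<in> int_vecs n \<Longrightarrow> N \<ge> 1 \<Longrightarrow>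
       \<forall>w. (\<Sum>j=1..n. \<bar>w j\<bar>) \<le> int (2 * N) \<longrightarrow>
         (Defs.scalar_prod n w b = 0 \<longleftrightarrow> (\<forall>i\<in>{1..m}. Defs.scalar_prod n w (A i) = 0)) \<Longrightarrow>
       \<bar>(LINT x|unit_interval. ln (cmod (phase_sum n (line_phase b) x))) - log_mahler m (matrix_laurent_poly m n A)\<bar>
         \<le> A3 * real N powr (- (1 / (4 * real n)))"
    using line_torus_log_integral[OF n1] by blast
  define A1 where "A1 = 32 * real n ^ 2 * ln (real n + 1) * 4 ^ Suc n"
  have A1: "A1 \<ge> 0" by (simp add: A1_def)
  obtain C p0 where C: "C \<ge> 0" and choice: "\<And>p. p \<ge> p0 \<Longrightarrow> p > n + 1 \<and>
     (\<exists>R N1 N2 N :: nat. C0 * real R ^ D < real p \<and> (\<Sum>i=1..m1. \<Sum>j=1..n. \<bar>\<Lambda> i j\<bar>) < int N1 \<and> N1 ^ Suc n < p \<and>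
       N2 \<ge> 1 \<and> 16 * N2 ^ Suc n \<le> R \<and> N \<ge> 1 \<and> 2 * N \<le> R \<and>
       A1 / real N2 + 28 * ln (4 * (real n + 1) * real p) / real N1 + A3 * real N powr (- (1 / (4 * real n)))
         \<le> C * real p powr (- (1 / (4 * real n * real D))))"
    by (rule parameter_choice[OF assms(1) D(1,2) A1 less_imp_le[OF A3],
        where H = "\<Sum>i=1..m1. \<Sum>j=1..n. \<bar>\<Lambda> i j\<bar>"], rule that) (assumption | blast)+
  show ?thesis
  proof (intro exI[of _ C] exI[of _ p0] allI impI)
    fix K :: "'k set" and p :: nat and v :: "'k \<Rightarrow> real" and a :: "nat \<Rightarrow> int"
    assume K: "number_field K" and \<alpha>K: "\<forall>i\<in>{1..n}. \<alpha> i \<in> K" and p: "prime p" and p0: "p \<ge> p0"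
      and v: "place_above p K v" and a: "\<forall>i\<in>{1..n}. v (of_int (a i) - \<alpha> i) < 1"
    obtain R N1 N2 N where par: "C0 * real R ^ D < real p" "(\<Sum>i=1..m1. \<Sum>j=1..n. \<bar>\<Lambda> i j\<bar>) < int N1" "N1 ^ Suc n < p"
       "N2 \<ge> 1" "16 * N2 ^ Suc n \<le> R" "N \<ge> 1" "2 * N \<le> R"
       and err: "A1 / real N2 + 28 * ln (4 * (real n + 1) * real p) / real N1 + A3 * real N powr (- (1 / (4 * real n)))
         \<le> C * real p powr (- (1 / (4 * real n * real D)))"
       and pn: "p > n + 1"
      using choice[OF p0] by blast
    have cong: "int p dvd (\<Sum>i=1..n. w i * a i)" if "(\<Sum>i=1..n. of_int (w i) * \<alpha> i) = 0" for w
      by (rule congruence_of_relation[OF p K v \<alpha>K a that])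
    have small: "(\<Sum>i=1..n. of_int (w i) * \<alpha> i) = 0"
      if w: "(\<Sum>i=1..n. \<bar>w i\<bar>) \<le> int R" "int p dvd (\<Sum>i=1..n. w i * a i)" for w
    proof (rule ccontr)
      assume "(\<Sum>i=1..n. of_int (w i) * \<alpha> i) \<noteq> 0"
      then have "real p \<le> C0 * real_of_int (\<Sum>i=1..n. \<bar>w i\<bar>) ^ D" by (rule bound[OF K \<alpha>K p v a w(2)])
      also have "\<dots> \<le> C0 * real R ^ D"
      proof (intro mult_left_mono power_mono)
        show "real_of_int (\<Sum>i=1..n. \<bar>w i\<bar>) \<le> real R" using w(1) by linarith
        have "0 \<le> (\<Sum>i=1..n. \<bar>w i\<bar>)" by (rule sum_nonneg) simp
        then show "0 \<le> real_of_int (\<Sum>i=1..n. \<bar>w i\<bar>)" by (simp only: of_int_0_le_iff)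
      qed (use D in simp)
      finally show False using par(1) by simp
    qed
    have nz: "\<forall>t\<in>{1..p-1}. root_sum n p a t \<noteq> 0"
      by (rule exponential_sum_estimate(1)[OF assms(1,3-6) p pn _ _ \<Lambda> par(2-7)])
        (erule cong, erule (1) small, rule line, assumption, assumption, assumption, rule par(6), assumption)
    have est: "\<bar>1 / (real p - 1) * (\<Sum>t=1..p-1. ln (cmod (root_sum n p a t))) - lattice_mahler n (Omega n \<alpha>)\<bar>
        \<le> 32 * real n ^ 2 * ln (real n + 1) * 4 ^ Suc n / real N2 + 28 * ln (4 * (real n + 1) * real p) / real N1
          + A3 * real N powr (- (1 / (4 * real n)))"
      by (rule exponential_sum_estimate(2)[OF assms(1,3-6) p pn _ _ \<Lambda> par(2-7)])
        (erule cong, erule (1) small, rule line, assumption, assumption, assumption, rule par(6), assumption)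
    have "\<bar>1 / (real p - 1) * (\<Sum>t=1..p-1. ln (cmod (root_sum n p a t))) - lattice_mahler n (Omega n \<alpha>)\<bar>
        \<le> C * real p powr (- (1 / (4 * real n * real D)))"
      using est err unfolding A1_def by linarith
    also have "\<dots> \<le> C * real p powr
        (- 1 / (4 * real n * real (field_degree K) * real (ramification_index K v)) + \<epsilon>)"
    proof (intro mult_left_mono C powr_mono)
      show "1 \<le> real p" using prime_gt_0_nat[OF p] by simp
      \<comment> \<open>D is at most [K:Q] and a nonzero ramification index is at least 1, so the
        exponent obtained is at least as strong as the one claimed.\<close>
      define E where "E = real (field_degree K) * real (ramification_index K v)"
      have "1 / (4 * real n * E) \<le> 1 / (4 * real n * real D)"
      proof (cases "ramification_index K v = 0")
        \<comment> \<open>\<open>card\<close> would be 0 on an infinite set of cosets; division by 0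
          gives 0, and the comparison of exponents holds in this case too.\<close>
        case True
        then show ?thesis by (simp add: E_def)
      next
        case False
        then have "real D * 1 \<le> E" unfolding E_def using D(3)[OF K \<alpha>K] by (intro mult_mono) auto
        then show ?thesis using D(1) n1 by (intro divide_left_mono mult_left_mono) auto
      qed
      then show "- (1 / (4 * real n * real D))
          \<le> - 1 / (4 * real n * real (field_degree K) * real (ramification_index K v)) + \<epsilon>"
        using assms(2) unfolding E_def by (simp add: mult.assoc)
    qed
    finally show "(\<forall>t\<in>{1..p-1}. root_sum n p a t \<noteq> 0) \<and>
         \<bar>1 / (real p - 1) * (\<Sum>t=1..p-1. ln (cmod (root_sum n p a t))) - lattice_mahler n (Omega n \<alpha>)\<bar>
           \<le> C * real p powr
               (- 1 / (4 * real n * real (field_degree K) * real (ramification_index K v)) + \<epsilon>)"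
      using nz by blast
  qed
qed

end
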